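(* Let $d\ge 1$, $T>0$, $0<s<1$, and let $a,b,c\in L^\infty(\mathbb R^d)$ be real-valued such that, for some constants $a_0,b_0,c_0$, \[ a(x)\ge a_0>0,\qquad b(x)\ge b_0>0,\qquad c(x)\ge c_0>0\qquad\text{for a.e. }x\in\mathbb R^d . \] Let $u_0\in H^1(\mathbb R^d)$ and consider the Cauchy problem \[ u_t-\nabla\cdot(a(x)\nabla u)+(-\Delta)^{s/2}\bigl(b(x)(-\Delta)^{s/2}u\bigr)+c(x)u=0\ \text{ in }(0,T)\times\mathbb R^d,\qquad u(0,x)=u_0(x). \] Then there exists a unique weak solution $u$ of this problem (in the sense defined in the context), and it satisfies \[ u\in L^\infty(0,T;H^1(\mathbb R^d))\cap C([0,T];L^2(\mathbb R^d)),\qquad u_t\in L^2\bigl(0,T;(H^1(\mathbb R^d))'\bigr). \] Moreover, for a.e. $t\in[0,T]$, \[ \|u(t)\|_{L^2(\mathbb R^d)}^2+\|\nabla u(t)\|_{L^2(\mathbb R^d)}^2+\|(-\Delta)^{s/2}u(t)\|_{L^2(\mathbb R^d)}^2\le C\,\|u_0\|_{H^1(\mathbb R^d)}^2, \] where \[ C:=2\Bigl(1+\frac1{a_0}+\frac1{b_0}\Bigr)\Bigl(1+\|a\|_{L^\infty(\mathbb R^d)}+\|b\|_{L^\infty(\mathbb R^d)}+\|c\|_{L^\infty(\mathbb R^d)}\Bigr). \]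
   Context: Functions $u$ are scalar (complex-valued in general). For $\sigma>0$, $(-\Delta)^{\sigma}$ is the Fourier multiplier $\widehat{(-\Delta)^{\sigma}u}(\xi)=|\xi|^{2\sigma}\hat u(\xi)$ with $\hat f(\xi)=\int_{\mathbb R^d}e^{-ix\cdot\xi}f(x)\,dx$; in particular $(-\Delta)^{s/2}$ has symbol $|\xi|^{s}$ and maps $H^1(\mathbb R^d)$ into $L^2(\mathbb R^d)$ for $0<s<1$. The norm on $H^1(\mathbb R^d)$ is $\|v\|_{H^1}^2=\|v\|_{L^2}^2+\|\nabla v\|_{L^2}^2$. Use the Gelfand triple $H^1(\mathbb R^d)\hookrightarrow L^2(\mathbb R^d)\simeq (L^2(\mathbb R^d))'\hookrightarrow (H^1(\mathbb R^d))'$; $\langle\cdot,\cdot\rangle$ is the duality pairing between $(H^1)'$ and $H^1$ extending the inner product $(f,g)_{L^2}=\int f\overline g\,dx$ (so it is conjugate-linear in the second argument). For $v,\varphi\in H^1(\mathbb R^d)$ set \[ B(v,\varphi):=\int_{\mathbb R^d} a\,\nabla v\cdot\overline{\nabla \varphi}\,dx+\int_{\mathbb R^d} b\,(-\Delta)^{s/2}v\,\overline{(-\Delta)^{s/2}\varphi}\,dx+\int_{\mathbb R^d} c\,v\,\overline{\varphi}\,dx . \] Weak solution: $u$ is a weak solution of the Cauchy problem if $u\in L^2(0,T;H^1(\mathbb R^d))$, $u_t\in L^2(0,T;(H^1(\mathbb R^d))')$, $u(0)=u_0$ in $L^2(\mathbb R^d)$ (which makes sense because such $u$ has a representative in $C([0,T];L^2(\mathbb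 R^d))$), and for a.e. $t\in(0,T)$ \[ \langle u_t(t),\varphi\rangle+B(u(t),\varphi)=0\qquad\text{for all }\varphi\in H^1(\mathbb R^d). \] *)

theory Defs
  imports "HOL-Analysis.Analysis" "HOL-Probability.Essential_Supremum"
begin

section \<open>The Hilbert space \<open>L\<^sup>2(\<real>\<^sup>d; \<complex>)\<close>\<close>

definition square_integrable :: "(real^'n \<Rightarrow> complex) \<Rightarrow> bool" where
  "square_integrable f \<longleftrightarrow>
     f \<in> borel_measurable lebesgue \<and> integrable lebesgue (\<lambda>x. (cmod (f x))\<^sup>2)"

lemma square_integrable_zero: "square_integrable (\<lambda>_. 0)"
  by (simp add: square_integrable_def)

lemma square_integrable_add:
  assumes "square_integrable f" "square_integrable g"
  shows "square_integrable (\<lambda>x. f x + g x)"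
proof -
  have [measurable]: "f \<in> borel_measurable lebesgue" "g \<in> borel_measurable lebesgue"
    using assms by (auto simp: square_integrable_def)
  have "integrable lebesgue (\<lambda>x. 2 * (cmod (f x))\<^sup>2 + 2 * (cmod (g x))\<^sup>2)"
    using assms by (auto simp: square_integrable_def)
  then have "integrable lebesgue (\<lambda>x. (cmod (f x + g x))\<^sup>2)"
  proof (rule Bochner_Integration.integrable_bound)
    show "AE x in lebesgue. norm ((cmod (f x + g x))\<^sup>2)
            \<le> norm (2 * (cmod (f x))\<^sup>2 + 2 * (cmod (g x))\<^sup>2)"
    proof (rule AE_I2)
      fix x
      have "(cmod (f x + g x))\<^sup>2 \<le> (cmod (f x) + cmod (g x))\<^sup>2"
        by (intro power_mono norm_triangle_ineq) auto
      also have "\<dots> \<le> 2 * (cmod (f x))\<^sup>2 + 2 * (cmod (g x))\<^sup>2"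
        using sum_squares_bound[of "cmod (f x)" "cmod (g x)"] by (simp add: power2_sum)
      finally show "norm ((cmod (f x + g x))\<^sup>2)
            \<le> norm (2 * (cmod (f x))\<^sup>2 + 2 * (cmod (g x))\<^sup>2)" by simp
    qed
  qed measurable
  then show ?thesis
    by (simp add: square_integrable_def)
qed

lemma square_integrable_mult:
  assumes "square_integrable f"
  shows "square_integrable (\<lambda>x. z * f x)"
  using assms by (auto simp: square_integrable_def norm_mult power_mult_distrib)

lemma integrable_mult_cnj:
  assumes "square_integrable f" "square_integrable g"
  shows "integrable lebesgue (\<lambda>x. f x * cnj (g x))"
proof -
  have m: "f \<in> borel_measurable lebesgue" "g \<in> borel_measurable lebesgue"
    using assms by (auto simp: square_integrable_def)
  have cnj_m: "(\<lambda>x. cnj (g x)) \<in> borel_measurable lebesgue"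
    by (rule borel_measurable_continuous_on[OF _ m(2)]) (intro continuous_intros)
  have "integrable lebesgue (\<lambda>x. (cmod (f x))\<^sup>2 + (cmod (g x))\<^sup>2)"
    using assms by (auto simp: square_integrable_def)
  then show ?thesis
  proof (rule Bochner_Integration.integrable_bound)
    show "(\<lambda>x. f x * cnj (g x)) \<in> borel_measurable lebesgue"
      using m(1) cnj_m by simp
    show "AE x in lebesgue. norm (f x * cnj (g x)) \<le> norm ((cmod (f x))\<^sup>2 + (cmod (g x))\<^sup>2)"
    proof (rule AE_I2)
      fix x
      have "2 * (cmod (f x) * cmod (g x)) \<le> (cmod (f x))\<^sup>2 + (cmod (g x))\<^sup>2"
        using sum_squares_bound[of "cmod (f x)" "cmod (g x)"] by simp
      moreover have "0 \<le> cmod (f x) * cmod (g x)" by simp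
      ultimately have "cmod (f x) * cmod (g x) \<le> (cmod (f x))\<^sup>2 + (cmod (g x))\<^sup>2"
        by linarith
      then show "norm (f x * cnj (g x)) \<le> norm ((cmod (f x))\<^sup>2 + (cmod (g x))\<^sup>2)"
        by (simp add: norm_mult)
    qed
  qed
qed

quotient_type 'n L2 = "real^('n::finite) \<Rightarrow> complex" / partial:
  "\<lambda>f g. square_integrable f \<and> square_integrable g \<and> (AE x in lebesgue. f x = g x)"
proof (rule part_equivpI)
  show "\<exists>f::real^'n \<Rightarrow> complex.
      square_integrable f \<and> square_integrable f \<and> (AE x in lebesgue. f x = f x)"
    using square_integrable_zero by auto
qed (auto intro!: sympI transpI elim: AE_mp)

lift_definition scaleC_L2 :: "complex \<Rightarrow> 'n::finite L2 \<Rightarrow> 'n L2" is "\<lambda>z f x. z * f x"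
  by (auto intro: square_integrable_mult)

lift_definition cinner_L2 :: "'n::finite L2 \<Rightarrow> 'n L2 \<Rightarrow> complex"
  is "\<lambda>f g. \<integral>x. f x * cnj (g x) \<partial>lebesgue"
  by (rule integral_cong_AE)
     (auto dest: integrable_mult_cnj intro: borel_measurable_integrable elim: AE_mp)

instantiation L2 :: (finite) real_inner
begin

lift_definition zero_L2 :: "'a L2" is "\<lambda>_. 0"
  by (simp add: square_integrable_zero)

lift_definition plus_L2 :: "'a L2 \<Rightarrow> 'a L2 \<Rightarrow> 'a L2" is "\<lambda>f g x. f x + g x"
  by (auto intro: square_integrable_add elim: AE_mp)

definition uminus_L2 :: "'a L2 \<Rightarrow> 'a L2" where "uminus_L2 f = scaleC_L2 (-1) f"

definition minus_L2 :: "'a L2 \<Rightarrow> 'a L2 \<Rightarrow> 'a L2" where "minus_L2 f g = f + (- g)"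

definition scaleR_L2 :: "real \<Rightarrow> 'a L2 \<Rightarrow> 'a L2" where
  "scaleR_L2 r f = scaleC_L2 (of_real r) f"

definition inner_L2 :: "'a L2 \<Rightarrow> 'a L2 \<Rightarrow> real" where "inner_L2 f g = Re (cinner_L2 f g)"

definition norm_L2 :: "'a L2 \<Rightarrow> real" where "norm_L2 f = sqrt (inner f f)"

definition sgn_L2 :: "'a L2 \<Rightarrow> 'a L2" where "sgn_L2 f = scaleR (inverse (norm f)) f"

definition dist_L2 :: "'a L2 \<Rightarrow> 'a L2 \<Rightarrow> real" where "dist_L2 f g = norm (f - g)"

definition uniformity_L2 :: "('a L2 \<times> 'a L2) filter" where
  "uniformity_L2 = (INF e\<in>{0<..}. principal {(f, g). dist f g < e})"

definition open_L2 :: "'a L2 set \<Rightarrow> bool" where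
  "open_L2 U \<longleftrightarrow> (\<forall>f\<in>U. eventually (\<lambda>(f', g). f' = f \<longrightarrow> g \<in> U) uniformity)"

instance
proof
  fix f g h :: "'a L2" and r q :: real
  show "f + g + h = f + (g + h)"
    by transfer (auto intro: square_integrable_add simp: add.assoc elim: AE_mp)
  show "f + g = g + f"
    by transfer (auto intro: square_integrable_add simp: add.commute elim: AE_mp)
  show "0 + f = f"
    by transfer auto
  show "- f + f = 0"
    unfolding uminus_L2_def by transfer (auto intro: square_integrable_add square_integrable_mult
        square_integrable_zero)
  show "f - g = f + - g"
    by (rule minus_L2_def)
  show "r *\<^sub>R (f + g) = r *\<^sub>R f + r *\<^sub>R g"
    unfolding scaleR_L2_def
    by transfer (auto intro!: square_integrable_add square_integrable_mult simp: distrib_left)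
  show "(r + q) *\<^sub>R f = r *\<^sub>R f + q *\<^sub>R f"
    unfolding scaleR_L2_def
    by transfer (auto intro!: square_integrable_add square_integrable_mult simp: distrib_right)
  show "r *\<^sub>R q *\<^sub>R f = (r * q) *\<^sub>R f"
    unfolding scaleR_L2_def
    by transfer (auto intro!: square_integrable_mult simp: mult.assoc)
  show "1 *\<^sub>R f = f"
    unfolding scaleR_L2_def by transfer auto
  show "sgn f = scaleR (inverse (norm f)) f"
    by (rule sgn_L2_def)
  show "dist f g = norm (f - g)"
    by (rule dist_L2_def)
  show "uniformity = (INF e\<in>{0<..}. principal {(f::'a L2, g). dist f g < e})"
    by (rule uniformity_L2_def)
  show "open U = (\<forall>f\<in>U. eventually (\<lambda>(f', g). f' = f \<longrightarrow> g \<in> U) uniformity)" for U :: "'a L2 set"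
    by (rule open_L2_def)
  show "inner f g = inner g f"
    unfolding inner_L2_def
  proof transfer
    fix f g :: "real^'a \<Rightarrow> complex"
    have "(\<integral>x. g x * cnj (f x) \<partial>lebesgue) = (\<integral>x. cnj (f x * cnj (g x)) \<partial>lebesgue)"
      by (simp add: mult.commute)
    also have "\<dots> = cnj (\<integral>x. f x * cnj (g x) \<partial>lebesgue)"
      by (rule Bochner_Integration.integral_cnj)
    finally show "Re (\<integral>x. f x * cnj (g x) \<partial>lebesgue) = Re (\<integral>x. g x * cnj (f x) \<partial>lebesgue)"
      by simp
  qed
  show "inner (f + g) h = inner f h + inner g h"
    unfolding inner_L2_def
    by transfer (auto dest: integrable_mult_cnj simp: distrib_right integrable_mult_cnj)
  show "inner (r *\<^sub>R f) g = r * inner f g"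
    unfolding inner_L2_def scaleR_L2_def
    by transfer (simp add: mult.assoc)
  have sq: "Re (\<integral>x. F x * cnj (F x) \<partial>lebesgue) = (\<integral>x. (cmod (F x))\<^sup>2 \<partial>lebesgue)"
    for F :: "real^'a \<Rightarrow> complex"
  proof -
    have "(\<integral>x. F x * cnj (F x) \<partial>lebesgue) = (\<integral>x. complex_of_real ((cmod (F x))\<^sup>2) \<partial>lebesgue)"
      by (simp only: complex_norm_square)
    then show ?thesis by (simp only: integral_complex_of_real Re_complex_of_real)
  qed
  show "0 \<le> inner f f"
    unfolding inner_L2_def by transfer (simp only: sq, simp)
  show "(inner f f = 0) = (f = 0)"
    unfolding inner_L2_def
  proof transfer
    fix F :: "real^'a \<Rightarrow> complex"
    assume "square_integrable F \<and> square_integrable F \<and> (AE x in lebesgue. F x = F x)"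
    then have F: "square_integrable F" by simp
    then have "integrable lebesgue (\<lambda>x. (cmod (F x))\<^sup>2)" by (simp add: square_integrable_def)
    then have "(\<integral>x. (cmod (F x))\<^sup>2 \<partial>lebesgue) = 0 \<longleftrightarrow> (AE x in lebesgue. (cmod (F x))\<^sup>2 = 0)"
      by (rule integral_nonneg_eq_0_iff_AE) simp
    then show "(Re (\<integral>x. F x * cnj (F x) \<partial>lebesgue) = 0) =
        (square_integrable F \<and> square_integrable (\<lambda>_::real^'a. 0) \<and> (AE x in lebesgue. F x = 0))"
      using F by (simp add: sq square_integrable_zero)
  qed
  show "norm f = sqrt (inner f f)"
    by (rule norm_L2_def)
qed

end

section \<open>The Sobolev space \<open>H\<^sup>1(\<real>\<^sup>d)\<close>\<close>

primrec Ck :: "nat \<Rightarrow> ('a::euclidean_space \<Rightarrow> real) \<Rightarrow> bool" where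
  "Ck 0 f \<longleftrightarrow> continuous_on UNIV f"
| "Ck (Suc k) f \<longleftrightarrow> (\<forall>x. f differentiable (at x)) \<and>
     (\<forall>i\<in>Basis. Ck k (\<lambda>x. frechet_derivative f (at x) i))"

definition test_function :: "'a::euclidean_space set \<Rightarrow> ('a \<Rightarrow> real) \<Rightarrow> bool" where
  "test_function \<Omega> \<phi> \<longleftrightarrow> (\<forall>k. Ck k \<phi>) \<and>
     compact (closure {x. \<phi> x \<noteq> 0}) \<and> closure {x. \<phi> x \<noteq> 0} \<subseteq> \<Omega>"

text \<open>Testing with real-valued \<open>\<phi>\<close> is the same as testing with complex-valued ones, by linearity.\<close>

definition is_weak_gradient :: "'n::finite L2 \<Rightarrow> ('n L2)^'n \<Rightarrow> bool" where
  "is_weak_gradient v g \<longleftrightarrow> (\<forall>i \<phi>. test_function UNIV \<phi> \<longrightarrow>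
     (\<integral>x. rep_L2 v x * of_real (frechet_derivative \<phi> (at x) (axis i 1)) \<partial>lebesgue)
       = - (\<integral>x. rep_L2 (g $ i) x * of_real (\<phi> x) \<partial>lebesgue))"

definition H1 :: "'n::finite L2 set" where
  "H1 = {v. \<exists>g. is_weak_gradient v g}"

text \<open>The norm of \<^term>\<open>weak_gradient v\<close> below is the norm of the type \<open>('n L2)^'n\<close>, that is, the
  square root of the sum of the squared \<open>L\<^sup>2\<close> norms of the partial derivatives.\<close>

definition weak_gradient :: "'n::finite L2 \<Rightarrow> ('n L2)^'n" where
  "weak_gradient v = (THE g. is_weak_gradient v g)"

definition H1_norm :: "'n::finite L2 \<Rightarrow> real" where
  "H1_norm v = sqrt ((norm v)\<^sup>2 + (norm (weak_gradient v))\<^sup>2)"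

text \<open>The space \<open>(H\<^sup>1)'\<close> of bounded antilinear functionals: the pairing is conjugate-linear in its
  second argument. Only the values of a functional on \<^term>\<open>H1\<close> matter.\<close>

definition H1_dual :: "('n::finite L2 \<Rightarrow> complex) set" where
  "H1_dual = {F. (\<forall>\<phi>\<in>H1. \<forall>\<psi>\<in>H1. F (\<phi> + \<psi>) = F \<phi> + F \<psi>) \<and>
                 (\<forall>z. \<forall>\<phi>\<in>H1. F (scaleC_L2 z \<phi>) = cnj z * F \<phi>) \<and>
                 (\<exists>K. \<forall>\<phi>\<in>H1. cmod (F \<phi>) \<le> K * H1_norm \<phi>)}"

definition H1_dual_norm :: "('n::finite L2 \<Rightarrow> complex) \<Rightarrow> real" where
  "H1_dual_norm F = (SUP \<phi>\<in>{\<phi>\<in>H1. H1_norm \<phi> \<le> 1}. cmod (F \<phi>))"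

section \<open>Fourier transform and fractional Laplacian\<close>

definition fourier :: "(real^'n \<Rightarrow> complex) \<Rightarrow> real^'n \<Rightarrow> complex" where
  "fourier f \<xi> = (\<integral>x. exp (- (\<i> * of_real (x \<bullet> \<xi>))) * f x \<partial>lebesgue)"

text \<open>The continuous extension of \<^const>\<open>fourier\<close> from \<open>L\<^sup>1 \<inter> L\<^sup>2\<close> to \<open>L\<^sup>2\<close>. By Plancherel,
  \<^term>\<open>square_integrable (fourier (F k))\<close> is automatic; it is listed because \<^const>\<open>abs_L2\<close> is
  meaningful only on square-integrable functions.\<close>

definition is_fourier_L2 :: "'n::finite L2 \<Rightarrow> 'n L2 \<Rightarrow> bool" where
  "is_fourier_L2 f g \<longleftrightarrow> (\<exists>F :: nat \<Rightarrow> real^'n \<Rightarrow> complex.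
     (\<forall>k. integrable lebesgue (F k) \<and> square_integrable (F k) \<and> square_integrable (fourier (F k))) \<and>
     (\<lambda>k. abs_L2 (F k)) \<longlonglongrightarrow> f \<and> (\<lambda>k. abs_L2 (fourier (F k))) \<longlonglongrightarrow> g)"

definition fourier_L2 :: "'n::finite L2 \<Rightarrow> 'n L2" where
  "fourier_L2 f = (THE g. is_fourier_L2 f g)"

text \<open>Meaningful for those \<open>v \<in> L\<^sup>2\<close> with \<open>(-\<Delta>)\<^sup>\<sigma> v \<in> L\<^sup>2\<close>; for \<open>0 < \<sigma> \<le> 1/2\<close> this includes \<open>H\<^sup>1\<close>.\<close>

definition frac_laplacian :: "real \<Rightarrow> 'n::finite L2 \<Rightarrow> 'n L2" where
  "frac_laplacian \<sigma> v = (THE w. AE \<xi> in lebesgue.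
     rep_L2 (fourier_L2 w) \<xi> = of_real (norm \<xi> powr (2 * \<sigma>)) * rep_L2 (fourier_L2 v) \<xi>)"

section \<open>Coefficients and the sesquilinear form\<close>

definition Linfty :: "(real^'n \<Rightarrow> real) set" where
  "Linfty = {a \<in> borel_measurable lebesgue. esssup lebesgue (\<lambda>x. ereal \<bar>a x\<bar>) < \<infinity>}"

definition Linfty_norm :: "(real^'n \<Rightarrow> real) \<Rightarrow> real" where
  "Linfty_norm a = real_of_ereal (esssup lebesgue (\<lambda>x. ereal \<bar>a x\<bar>))"

definition sesq_form :: "(real^'n \<Rightarrow> real) \<Rightarrow> (real^'n \<Rightarrow> real) \<Rightarrow> (real^'n \<Rightarrow> real) \<Rightarrow> real
    \<Rightarrow> 'n::finite L2 \<Rightarrow> 'n L2 \<Rightarrow> complex" where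
  "sesq_form a b c s v \<phi> =
     (\<integral>x. of_real (a x) *
        (\<Sum>i\<in>UNIV. rep_L2 (weak_gradient v $ i) x * cnj (rep_L2 (weak_gradient \<phi> $ i) x)) \<partial>lebesgue)
   + (\<integral>x. of_real (b x) * rep_L2 (frac_laplacian (s / 2) v) x
        * cnj (rep_L2 (frac_laplacian (s / 2) \<phi>) x) \<partial>lebesgue)
   + (\<integral>x. of_real (c x) * rep_L2 v x * cnj (rep_L2 \<phi> x) \<partial>lebesgue)"

section \<open>Bochner spaces over \<open>(0, T)\<close> and weak solutions\<close>

text \<open>Here \<open>X\<close> is a space of values with norm \<open>N\<close>; it is instantiated with \<^const>\<open>H1\<close> and
  \<^const>\<open>H1_dual\<close>, which are not types. As usual for classes modulo null sets, a function need only
  take its values in \<open>X\<close> almost everywhere.\<close>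

definition strongly_measurable ::
    "real \<Rightarrow> 'x::minus set \<Rightarrow> ('x \<Rightarrow> real) \<Rightarrow> (real \<Rightarrow> 'x) \<Rightarrow> bool" where
  "strongly_measurable T X N f \<longleftrightarrow>
     (AE t in lebesgue_on {0<..<T}. f t \<in> X) \<and>
     (\<exists>h. (\<forall>k::nat. simple_function (lebesgue_on {0<..<T}) (h k) \<and> (\<forall>t\<in>{0<..<T}. h k t \<in> X)) \<and>
          (AE t in lebesgue_on {0<..<T}. (\<lambda>k. N (h k t - f t)) \<longlonglongrightarrow> 0))"

definition bochner_L2 :: "real \<Rightarrow> 'x::minus set \<Rightarrow> ('x \<Rightarrow> real) \<Rightarrow> (real \<Rightarrow> 'x) set" where
  "bochner_L2 T X N = {f. strongly_measurable T X N f \<and>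
     integrable (lebesgue_on {0<..<T}) (\<lambda>t. (N (f t))\<^sup>2)}"

definition bochner_Linfty :: "real \<Rightarrow> 'x::minus set \<Rightarrow> ('x \<Rightarrow> real) \<Rightarrow> (real \<Rightarrow> 'x) set" where
  "bochner_Linfty T X N = {f. strongly_measurable T X N f \<and>
     (\<exists>K. AE t in lebesgue_on {0<..<T}. N (f t) \<le> K)}"

text \<open>The identity \<open>\<integral> u \<psi>' dt = - \<integral> u\<^sub>t \<psi> dt\<close> in \<open>(H\<^sup>1)'\<close> for all test functions \<open>\<psi>\<close>, evaluated at
  each \<open>\<phi> \<in> H\<^sup>1\<close>; \<open>u(t) \<in> L\<^sup>2\<close> acts on \<open>\<phi>\<close> through the \<open>L\<^sup>2\<close> inner product.\<close>

definition is_weak_time_derivative ::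
    "real \<Rightarrow> (real \<Rightarrow> 'n::finite L2) \<Rightarrow> (real \<Rightarrow> 'n L2 \<Rightarrow> complex) \<Rightarrow> bool" where
  "is_weak_time_derivative T u u' \<longleftrightarrow>
     (\<forall>\<psi>. test_function {0<..<T} \<psi> \<longrightarrow> (\<forall>\<phi>\<in>H1.
        (\<integral>t. cinner_L2 (u t) \<phi> * of_real (deriv \<psi> t) \<partial>lebesgue_on {0<..<T})
          = - (\<integral>t. u' t \<phi> * of_real (\<psi> t) \<partial>lebesgue_on {0<..<T})))"

text \<open>A weak solution \<open>u\<close> is determined only up to null sets of times, so the initial condition is
  imposed on its continuous representative \<open>w\<close>.\<close>

definition weak_solution :: "(real^'n \<Rightarrow> real) \<Rightarrow> (real^'n \<Rightarrow> real) \<Rightarrow> (real^'n \<Rightarrow> real) \<Rightarrow> real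
    \<Rightarrow> real \<Rightarrow> 'n::finite L2 \<Rightarrow> (real \<Rightarrow> 'n L2) \<Rightarrow> bool" where
  "weak_solution a b c s T u0 u \<longleftrightarrow>
     u \<in> bochner_L2 T H1 H1_norm \<and>
     (\<exists>w. continuous_on {0..T} w \<and> (AE t in lebesgue_on {0<..<T}. w t = u t) \<and> w 0 = u0) \<and>
     (\<exists>u' \<in> bochner_L2 T H1_dual H1_dual_norm.
        is_weak_time_derivative T u u' \<and>
        (AE t in lebesgue_on {0<..<T}. \<forall>\<phi>\<in>H1. u' t \<phi> + sesq_form a b c s (u t) \<phi> = 0))"

end

theory Submission
  imports Defs "HOL-Probability.Sinc_Integral" "HOL-Computational_Algebra.Polynomial"
begin

text \<open>
Let \<open>V = H\<^sup>1\<close> and let \<open>A\<close> and \<open>M\<close> be the bounded symmetric operators on \<open>V\<close> representing the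
form \<open>B\<close> and the \<open>L\<^sup>2\<close> inner product, so that the equation reads \<open>M u' + A u = 0\<close> in \<open>V\<close>. With
\<open>M + \<epsilon> A\<close> in place of \<open>M\<close> it is a linear differential equation with bounded coefficients, along
whose solutions both \<open>(A u, u)\<close> and \<open>((M + \<epsilon> A) u, u)\<close> decrease. For initial data \<open>A\<^sup>-\<^sup>1 M z\<close> the
solutions are Cauchy in \<open>V\<close> as \<open>\<epsilon> \<rightarrow> 0\<close>; such data are dense, and the energy bound \<open>(A u, u) \<le> (A u\<^sub>0, u\<^sub>0)\<close>
carries over to the limit for arbitrary data and yields the stated estimate. For uniqueness, the
difference of two solutions is integrated in time, which makes it an admissible test function.

The form is bounded on \<open>H\<^sup>1\<close> because \<open>|\<xi>|\<^sup>s \<le> 1 + |\<xi>|\<close> and the Fourier transform is an isometry taking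
weak gradients to multiplication by \<open>\<i>\<xi>\<close>. Plancherel's theorem is obtained from the span of the
indicators of boxes, where it reduces to \<open>\<integral> (1 - cos x) / x\<^sup>2 dx = \<pi>\<close>; the formula for gradients
follows by testing with smooth approximations of indicators of boxes averaged in one coordinate.
\<close>

section \<open>Symmetric evolution equations in Hilbert space\<close>

text \<open>\<open>L2\<close> and \<open>sobolev\<close> carry only real inner products; complex
  identities are recovered by testing with both \<phi> and \<i> \<phi>. On H1 the operator
  \<open>M\<close> is injective but has no bounded inverse, since the L2 norm does not control the
  gradient; adding \<epsilon> \<open>A\<close> makes it coercive and keeps it symmetric. A rate of
  convergence as \<epsilon> tends to 0 requires a velocity bound uniform in \<epsilon>, hence the
  special data. Boxes serve on the Fourier side because their transforms are explicit products of
  one-variable functions and because no nonzero L2 function is orthogonal to all of them.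
  Multiplication by one coordinate of \<xi> is unbounded; a box minus its unit translate is a
  derivative of the averaged box, which brings in the bounded multiplier 1 - exp(-\<i> t) instead, t
  being that coordinate. For uniqueness, the time derivative lives only in the dual of H1, whereas
  the time integral of a solution is differentiable in L2, so its squared norm can be differentiated
  directly. In \<open>C\<close> the second factor comes from bounding the initial energy by the sup
  norms, the terms 1/a0 and 1/b0 from dividing the energy by its lower bounds, and the 1 from the
  decay of the L2 norm.\<close>

lemma orthogonal_projection_exists:
  fixes S :: "'a::{real_inner, banach} set"
  assumes "closed S" "subspace S"
  shows "\<exists>y\<in>S. \<forall>z\<in>S. inner (x - y) z = 0"
proof -
  define D where "D = (INF z\<in>S. (norm (x - z))\<^sup>2)"
  have ne: "S \<noteq> {}" using assms(2) subspace_0 by blast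
  have bdd: "bdd_below ((\<lambda>z. (norm (x - z))\<^sup>2) ` S)" by (rule bdd_belowI2[of _ 0]) auto
  have D_le: "D \<le> (norm (x - z))\<^sup>2" if "z \<in> S" for z
    unfolding D_def by (rule cINF_lower[OF bdd that])
  have "\<exists>z\<in>S. (norm (x - z))\<^sup>2 < D + 1 / real (Suc n)" for n
  proof -
    have "D < D + 1 / real (Suc n)" by simp
    then show ?thesis
      unfolding D_def using cINF_less_iff[OF ne bdd] by blast
  qed
  then obtain y where yS: "\<And>n. y n \<in> S" and y: "\<And>n. (norm (x - y n))\<^sup>2 < D + 1 / real (Suc n)"
    by metis
  \<comment> \<open>Parallelogram identity for \<open>x - y n\<close> and \<open>x - y m\<close>:
    the midpoint of \<open>y n\<close> and \<open>y m\<close> lies in \<open>S\<close>, so the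
    squared norm of the sum is at least 4 \<open>D\<close>, which cancels the \<open>D\<close> terms
    on the right.\<close>
  have par: "(norm (y n - y m))\<^sup>2 \<le> 2 / real (Suc n) + 2 / real (Suc m)" for n m
  proof -
    have mid: "(1/2) *\<^sub>R (y n + y m) \<in> S"
      using assms(2) yS by (simp add: subspace_add subspace_scale)
    have eq: "x - (1/2) *\<^sub>R (y n + y m) = (1/2) *\<^sub>R ((x - y n) + (x - y m))"
      by (simp add: algebra_simps flip: scaleR_2)
    have "4 * D \<le> (norm ((x - y n) + (x - y m)))\<^sup>2"
      using D_le[OF mid] unfolding eq by (simp add: power_mult_distrib power2_eq_square)
    moreover have "(norm (y n - y m))\<^sup>2 + (norm ((x - y n) + (x - y m)))\<^sup>2
        = 2 * (norm (x - y n))\<^sup>2 + 2 * (norm (x - y m))\<^sup>2"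
      unfolding power2_norm_eq_inner by (simp add: algebra_simps inner_commute)
    ultimately show ?thesis using y[of n] y[of m] by simp
  qed
  have "Cauchy y"
  proof (rule metric_CauchyI)
    fix e :: real assume "e > 0"
    then obtain N where N: "1 / real (Suc N) < e\<^sup>2 / 4"
      using reals_Archimedean[of "e\<^sup>2 / 4"] by (auto simp: inverse_eq_divide)
    have "dist (y m) (y n) < e" if "m \<ge> N" "n \<ge> N" for m n
    proof -
      have "1 / real (Suc m) \<le> 1 / real (Suc N)" "1 / real (Suc n) \<le> 1 / real (Suc N)"
        using that by (auto intro!: divide_left_mono)
      then have "(norm (y m - y n))\<^sup>2 < e\<^sup>2"
        using par[of m n] N by simp
      then show ?thesis
        using \<open>e > 0\<close> by (simp add: dist_norm power_less_imp_less_base)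
    qed
    then show "\<exists>M. \<forall>m\<ge>M. \<forall>n\<ge>M. dist (y m) (y n) < e" by blast
  qed
  then obtain l where l: "y \<longlonglongrightarrow> l" using Cauchy_convergent_iff convergent_def by blast
  have lS: "l \<in> S" using closed_sequentially[OF assms(1)] yS l by blast
  have lim: "(\<lambda>n. (norm (x - y n))\<^sup>2) \<longlonglongrightarrow> (norm (x - l))\<^sup>2"
    by (intro tendsto_intros l)
  have "(\<lambda>n. D + 1 / real (Suc n)) \<longlonglongrightarrow> D + 0"
    using LIMSEQ_inverse_real_of_nat by (intro tendsto_intros) (simp add: inverse_eq_divide)
  then have lD: "(norm (x - l))\<^sup>2 \<le> D"
    using LIMSEQ_le[OF lim] y less_imp_le by (metis (no_types, lifting) add.right_neutral)
  have "inner (x - l) z = 0" if z: "z \<in> S" for z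
  proof (rule ccontr)
    assume nz: "inner (x - l) z \<noteq> 0"
    then have zz: "inner z z > 0" by auto
    \<comment> \<open>The value of t that minimises the distance from \<open>x\<close> to l + t z;
      unless \<open>inner (x - l) z\<close> vanishes, moving \<open>l\<close> by it would beat the
      minimum \<open>D\<close>.\<close>
    define t where "t = inner (x - l) z / inner z z"
    have "l + t *\<^sub>R z \<in> S" using lS z assms(2) by (simp add: subspace_add subspace_scale)
    then have "(norm (x - l))\<^sup>2 \<le> (norm (x - (l + t *\<^sub>R z)))\<^sup>2" using D_le[of "l + t *\<^sub>R z"] lD by linarith
    also have "x - (l + t *\<^sub>R z) = (x - l) - t *\<^sub>R z" by simp
    also have "(norm ((x - l) - t *\<^sub>R z))\<^sup>2 = (norm (x - l))\<^sup>2 - 2 * t * inner (x - l) z + t * t * inner z z"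
      unfolding power2_norm_eq_inner by (simp add: inner_diff_left inner_diff_right inner_commute algebra_simps)
    also have "\<dots> = (norm (x - l))\<^sup>2 - (inner (x - l) z)\<^sup>2 / inner z z"
      using zz by (simp add: t_def field_simps power2_eq_square)
    finally show False using nz zz by (simp add: field_simps)
  qed
  then show ?thesis using lS by blast
qed

lemma subspace_closure:
  fixes S :: "'a::real_normed_vector set"
  assumes "subspace S"
  shows "subspace (closure S)"
proof (rule subspaceI)
  show "0 \<in> closure S" using subspace_0[OF assms] closure_subset by blast
  show "x + y \<in> closure S" if x: "x \<in> closure S" and y: "y \<in> closure S" for x y
  proof -
    obtain f where f: "\<And>n. f n \<in> S" "f \<longlonglongrightarrow> x" using x unfolding closure_sequential by blast
    obtain g where g: "\<And>n. g n \<in> S" "g \<longlonglongrightarrow> y" using y unfolding closure_sequential by blast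
    have "(\<lambda>n. f n + g n) \<longlonglongrightarrow> x + y" "\<And>n. f n + g n \<in> S"
      using f g assms by (auto intro: tendsto_add subspace_add)
    then show ?thesis unfolding closure_sequential by (intro exI[of _ "\<lambda>n. f n + g n"]) blast
  qed
  show "c *\<^sub>R x \<in> closure S" if x: "x \<in> closure S" for c x
  proof -
    obtain f where f: "\<And>n. f n \<in> S" "f \<longlonglongrightarrow> x" using x unfolding closure_sequential by blast
    have "(\<lambda>n. c *\<^sub>R f n) \<longlonglongrightarrow> c *\<^sub>R x" "\<And>n. c *\<^sub>R f n \<in> S"
      using f assms by (auto intro: tendsto_scaleR subspace_scale)
    then show ?thesis unfolding closure_sequential by (intro exI[of _ "\<lambda>n. c *\<^sub>R f n"]) blast
  qed
qed

text \<open>The residual of the orthogonal projection is orthogonal to \<open>S\<close>. Ranges of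
  coercive operators, the density of special initial data, and totality and surjectivity of the
  Fourier transform are all obtained in this form.\<close>

lemma closed_subspace_eq_UNIV:
  fixes S :: "'a::{real_inner, banach} set"
  assumes "closed S" "subspace S" "\<And>x. (\<And>z. z \<in> S \<Longrightarrow> inner x z = 0) \<Longrightarrow> x = 0"
  shows "S = UNIV"
proof -
  have "x \<in> S" for x
  proof -
    obtain y where "y \<in> S" "\<And>z. z \<in> S \<Longrightarrow> inner (x - y) z = 0"
      using orthogonal_projection_exists[OF assms(1,2), of x] by blast
    then show ?thesis using assms(3)[of "x - y"] by simp
  qed
  then show ?thesis by blast
qed

lemma riesz_representation:
  fixes f :: "'a::{real_inner, banach} \<Rightarrow> real"
  assumes "bounded_linear f"
  shows "\<exists>y. \<forall>x. f x = inner y x"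
proof (cases "\<forall>x. f x = 0")
  case True
  then show ?thesis by (intro exI[of _ 0]) simp
next
  case False
  then obtain x0 where x0: "f x0 \<noteq> 0" by blast
  interpret f: bounded_linear f by fact
  have "closed {x. f x = 0}"
    by (intro closed_Collect_eq continuous_on_const linear_continuous_on assms)
  moreover have "subspace {x. f x = 0}"
    by (auto simp: subspace_def f.add f.scaleR f.zero)
  ultimately obtain p where p: "f p = 0" "\<And>z. f z = 0 \<Longrightarrow> inner (x0 - p) z = 0"
    using orthogonal_projection_exists[of "{x. f x = 0}" x0] by blast
  \<comment> \<open>\<open>e\<close> spans the orthogonal complement of the kernel of
    \<open>f\<close>: every \<open>x\<close> differs from a multiple of \<open>e\<close> by an
    element of the kernel, which fixes the representing vector up to normalisation.\<close>
  define e where "e = x0 - p"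
  have fe: "f e = f x0" by (simp add: e_def f.diff p)
  then have ee: "inner e e \<noteq> 0" using x0 f.zero by auto
  have "f x = inner ((f e / inner e e) *\<^sub>R e) x" for x
  proof -
    have "inner e (x - (f x / f e) *\<^sub>R e) = 0"
      unfolding e_def using p(2) fe x0 by (simp add: e_def[symmetric] f.diff f.scaleR)
    then have "inner e x = f x / f e * inner e e" by (simp add: inner_diff_right)
    then show ?thesis using ee fe x0 by simp
  qed
  then show ?thesis by blast
qed

section \<open>Coercive operators: the Lax-Milgram theorem\<close>

lemma coercive_norm_le:
  fixes A :: "'a::real_inner \<Rightarrow> 'a"
  assumes "\<alpha> > 0" "\<And>x. \<alpha> * (norm x)\<^sup>2 \<le> inner (A x) x"
  shows "\<alpha> * norm x \<le> norm (A x)"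
proof (cases "x = 0")
  case False
  have "\<alpha> * norm x * norm x \<le> norm (A x) * norm x"
    using assms(2)[of x] norm_cauchy_schwarz[of "A x" x] by (simp add: power2_eq_square mult.assoc)
  then show ?thesis using False by simp
qed auto

text \<open>The lower bound on \<open>norm (A x)\<close> gives injectivity and, by completeness, a
  closed range. A vector orthogonal to the range is in particular orthogonal to its own image, so
  coercivity forces it to be 0.\<close>

lemma coercive_bij:
  fixes A :: "'a::{real_inner, banach} \<Rightarrow> 'a"
  assumes "bounded_linear A" "\<alpha> > 0" "\<And>x. \<alpha> * (norm x)\<^sup>2 \<le> inner (A x) x"
  shows "bij A"
proof -
  interpret A: bounded_linear A by fact
  have le: "\<alpha> * norm x \<le> norm (A x)" for x using coercive_norm_le assms(2,3) by blast
  have "inj A"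
  proof (rule injI)
    fix x y assume "A x = A y"
    then have "A (x - y) = 0" by (simp add: A.diff)
    then show "x = y" using le[of "x - y"] assms(2) by (simp add: mult_le_0_iff)
  qed
  moreover have "range A = UNIV"
  proof (rule closed_subspace_eq_UNIV)
    show "closed (range A)"
      using complete_isometric_image[OF assms(2) subspace_UNIV assms(1)] le complete_UNIV
      by (auto simp: mult.commute complete_eq_closed)
    show "subspace (range A)"
      by (intro linear_subspace_image A.linear subspace_UNIV)
    fix x assume "\<And>z. z \<in> range A \<Longrightarrow> inner x z = 0"
    then have "inner (A x) x = 0" by (metis inner_commute rangeI)
    then show "x = 0" using assms(2) assms(3)[of x] by (simp add: mult_le_0_iff)
  qed
  ultimately show ?thesis by (simp add: bij_def)
qed

lemma coercive_inv_bounded_linear: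
  fixes A :: "'a::{real_inner, banach} \<Rightarrow> 'a"
  assumes "bounded_linear A" "\<alpha> > 0" "\<And>x. \<alpha> * (norm x)\<^sup>2 \<le> inner (A x) x"
  shows "bounded_linear (inv A)"
proof -
  interpret A: bounded_linear A by fact
  have bij: "bij A" using coercive_bij assms by blast
  have s: "A (inv A y) = y" for y using bij by (simp add: bij_is_surj surj_f_inv_f)
  have i: "inv A (A y) = y" for y using bij by (simp add: bij_is_inj)
  show ?thesis
  proof (rule bounded_linear_intro[where K = "1 / \<alpha>"])
    show "inv A (x + y) = inv A x + inv A y" for x y
      by (metis A.add s i)
    show "inv A (r *\<^sub>R x) = r *\<^sub>R inv A x" for r x
      by (metis A.scaleR s i)
    show "norm (inv A x) \<le> norm x * (1 / \<alpha>)" for x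
      using coercive_norm_le[OF assms(2,3), of "inv A x"] assms(2) by (simp add: s field_simps)
  qed
qed

section \<open>Linear differential equations with a bounded operator\<close>

lemma linear_ode_exists:
  fixes S :: "'a::banach \<Rightarrow> 'a"
  assumes "bounded_linear S"
  shows "\<exists>u. u 0 = x \<and> (\<forall>t. (u has_vector_derivative S (u t)) (at t))"
proof -
  interpret S: bounded_linear S by fact
  obtain K where K: "K > 0" "\<And>x. norm (S x) \<le> norm x * K" using S.pos_bounded by blast
  define p where "p n = (S ^^ n) x" for n
  have np: "norm (p n) \<le> K ^ n * norm x" for n
  proof (induction n)
    case (Suc n)
    have "norm (p (Suc n)) \<le> norm (p n) * K" using K(2)[of "p n"] by (simp add: p_def)
    also have "\<dots> \<le> K ^ n * norm x * K" using Suc K(1) by (intro mult_right_mono) auto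
    finally show ?case by (simp add: mult_ac)
  qed (simp add: p_def)
  \<comment> \<open>The terms of the exponential series exp(t S) x.\<close>
  define f where "f n t = (t ^ n / fact n) *\<^sub>R p n" for n and t :: real
  define u where "u t = (\<Sum>n. f n t)" for t
  \<comment> \<open>The termwise derivatives. The index shift makes the first n + 1 terms of
    \<open>g\<close> sum to \<open>S\<close> applied to the first n terms of \<open>f\<close>, so
    uniform convergence of the derivatives follows from that of the series itself.\<close>
  define g where "g n t = (case n of 0 \<Rightarrow> 0 | Suc m \<Rightarrow> S (f m t))" for n t
  have nf: "norm (f n t) \<le> (R * K) ^ n / fact n * norm x" if "\<bar>t\<bar> \<le> R" for n t R
  proof -
    have "norm (f n t) = \<bar>t\<bar> ^ n / fact n * norm (p n)" by (simp add: f_def power_abs)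
    also have "\<dots> \<le> R ^ n / fact n * (K ^ n * norm x)"
      using that np by (intro mult_mono divide_right_mono power_mono) auto
    finally show ?thesis by (simp add: power_mult_distrib mult_ac)
  qed
  have sumK: "summable (\<lambda>n. (R * K) ^ n / fact n * norm x)" for R :: real
  proof (rule summable_mult2)
    have "(\<lambda>n. (R * K) ^ n / fact n) = (\<lambda>n. inverse (fact n) * (R * K) ^ n)"
      by (simp only: divide_inverse mult.commute)
    then show "summable (\<lambda>n. (R * K) ^ n / fact n)"
      using summable_exp[of "R * K"] by simp
  qed
  have sf: "summable (\<lambda>n. f n t)" for t
    by (rule summable_comparison_test'[OF sumK[of "\<bar>t\<bar>"]]) (use nf[of t "\<bar>t\<bar>"] in auto)
  have df: "(f n has_vector_derivative g n t) (at t within X)" for n t X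
  proof (cases n)
    case 0
    then show ?thesis by (simp add: f_def[abs_def] g_def)
  next
    case (Suc m)
    have d: "((\<lambda>t. t ^ Suc m / fact (Suc m)) has_real_derivative t ^ m / fact m) (at t within X)"
    proof -
      have "((\<lambda>t. t ^ Suc m / fact (Suc m)) has_real_derivative
          real (Suc m) * t ^ m / fact (Suc m)) (at t within X)"
        using DERIV_cdivide[OF DERIV_pow[of "Suc m" t X], of "fact (Suc m)"] by (simp del: fact_Suc)
      moreover have "real (Suc m) * t ^ m / fact (Suc m) = t ^ m / fact m"
        by (simp add: fact_Suc del: of_nat_Suc)
      ultimately show ?thesis by (simp del: fact_Suc)
    qed
    have "S (f m t) = (t ^ m / fact m) *\<^sub>R p (Suc m)" by (simp add: f_def S.scaleR p_def)
    then show ?thesis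
      using has_vector_derivative_scaleR[OF d has_vector_derivative_const[of "p (Suc m)"]] Suc
      by (simp add: f_def[abs_def] g_def)
  qed
  have unif: "uniform_limit {-R..R} (\<lambda>n t. \<Sum>i<n. f i t) u sequentially" for R
    unfolding u_def by (rule Weierstrass_m_test[OF _ sumK[of R]]) (use nf in auto)
  have sg: "(\<Sum>i<Suc n. g i t) = S (\<Sum>i<n. f i t)" for n t
    by (subst sum.lessThan_Suc_shift) (simp add: g_def S.sum)
  have "(u has_vector_derivative S (u t)) (at t)" for t
  proof -
    \<comment> \<open>The series converges uniformly on bounded intervals only; this interval
      contains \<open>t\<close> in its interior, so a derivative within it is a derivative at
      \<open>t\<close>.\<close>
    define R where "R = \<bar>t\<bar> + 1"
    have tR: "t \<in> {-R<..<R}" by (auto simp: R_def)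
    have un: "uniform_limit {-R..R} (\<lambda>n t. \<Sum>i<n. g i t) (\<lambda>t. S (u t)) sequentially"
    proof -
      have "uniform_limit {-R..R} (\<lambda>n t. S (\<Sum>i<n. f i t)) (\<lambda>t. S (u t)) sequentially"
        by (rule bounded_linear.uniform_limit[OF assms unif])
      then have "uniform_limit {-R..R} (\<lambda>n t. \<Sum>i<Suc n. g i t) (\<lambda>t. S (u t)) sequentially"
        by (simp only: sg)
      then show ?thesis
        unfolding uniform_limit_iff by (simp only: eventually_sequentially_Suc[of "\<lambda>n. \<forall>x\<in>{-R..R}. dist (\<Sum>i<n. g i x) (S (u x)) < _"])
    qed
    have "\<exists>v. \<forall>r\<in>{-R..R}. (\<lambda>n. f n r) sums v r \<and> (v has_derivative (\<lambda>h. h *\<^sub>R S (u r))) (at r within {-R..R})"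
    proof (rule has_derivative_series[where f' = "\<lambda>n t h. h *\<^sub>R g n t"])
      show "(f n has_derivative (\<lambda>h. h *\<^sub>R g n r)) (at r within {-R..R})" for n r
        using df by (simp add: has_vector_derivative_def)
      show "(\<lambda>n. f n t) sums u t" using sf by (simp add: u_def summable_sums)
      show "t \<in> {-R..R}" using tR by auto
      fix e :: real assume "e > 0"
      from uniform_limitD[OF un this]
      show "\<forall>\<^sub>F n in sequentially. \<forall>r\<in>{-R..R}. \<forall>h. norm ((\<Sum>i<n. h *\<^sub>R g i r) - h *\<^sub>R S (u r)) \<le> e * norm h"
      proof (rule eventually_mono, intro ballI allI)
        fix n r h assume *: "\<forall>x\<in>{-R..R}. dist (\<Sum>i<n. g i x) (S (u x)) < e" "r \<in> {-R..R}"
        have "norm ((\<Sum>i<n. h *\<^sub>R g i r) - h *\<^sub>R S (u r)) = \<bar>h\<bar> * dist (\<Sum>i<n. g i r) (S (u r))"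
          by (simp add: dist_norm flip: scaleR_sum_right scaleR_diff_right)
        also have "\<dots> \<le> \<bar>h\<bar> * e" using * by (intro mult_left_mono) (auto intro: less_imp_le)
        finally show "norm ((\<Sum>i<n. h *\<^sub>R g i r) - h *\<^sub>R S (u r)) \<le> e * norm h" by (simp add: mult.commute)
      qed
    qed auto
    then obtain v where v: "\<And>r. r \<in> {-R..R} \<Longrightarrow> (\<lambda>n. f n r) sums v r"
      "\<And>r. r \<in> {-R..R} \<Longrightarrow> (v has_vector_derivative S (u r)) (at r within {-R..R})"
      unfolding has_vector_derivative_def by blast
    have uv: "u r = v r" if "r \<in> {-R<..<R}" for r
      using v(1)[of r] that by (simp add: u_def sums_unique[symmetric])
    have "(v has_vector_derivative S (u t)) (at t)"
      using v(2)[of t] tR by (simp add: at_within_Icc_at)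
    then show ?thesis
      by (rule has_vector_derivative_transform_within_open[of _ _ _ "{-R<..<R}"]) (use tR uv in auto)
  qed
  moreover have "u 0 = x"
  proof -
    have "(\<lambda>n. f n 0) = (\<lambda>n. if n = 0 then x else 0)" by (auto simp: f_def p_def fun_eq_iff)
    then show ?thesis using sums_unique[OF sums_single[of 0 "\<lambda>_. x"]] by (simp add: u_def)
  qed
  ultimately show ?thesis by blast
qed

section \<open>The regularised equation in an abstract Hilbert space\<close>

locale symmetric_evolution =
  fixes M A :: "'v::{real_inner, banach} \<Rightarrow> 'v" and \<alpha> :: real
  assumes M_bounded: "bounded_linear M"
    and M_sym: "inner (M x) y = inner x (M y)"
    and M_nonneg: "0 \<le> inner (M x) x"
    and M_definite: "inner (M x) x = 0 \<Longrightarrow> x = 0"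
    and A_bounded: "bounded_linear A"
    and A_sym: "inner (A x) y = inner x (A y)"
    and \<alpha>_pos: "\<alpha> > 0"
    and A_coercive: "\<alpha> * (norm x)\<^sup>2 \<le> inner (A x) x"
begin

sublocale M: bounded_linear M by (rule M_bounded)
sublocale A: bounded_linear A by (rule A_bounded)

text \<open>In the application \<open>e\<close> is the energy B(v, v) and \<open>m\<close> the
  squared L2 norm. \<open>M\<close> is only assumed positive definite, so \<open>m\<close> gives no
  control of the norm of the space, while \<open>e\<close> does.\<close>

definition e :: "'v \<Rightarrow> real" where "e x = inner (A x) x"
definition m :: "'v \<Rightarrow> real" where "m x = inner (M x) x"
definition N :: "real \<Rightarrow> 'v \<Rightarrow> 'v" where "N \<epsilon> x = M x + \<epsilon> *\<^sub>R A x"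
definition S :: "real \<Rightarrow> 'v \<Rightarrow> 'v" where "S \<epsilon> x = inv (N \<epsilon>) (A x)"
text \<open>The equation \<open>N \<epsilon>\<close> u' = - \<open>A\<close> u solved for u'. It is
  posed on the whole real line, where the exponential series solves it, so no one-sided derivatives
  occur before the limit.\<close>

definition sol :: "real \<Rightarrow> (real \<Rightarrow> 'v) \<Rightarrow> bool" where
  "sol \<epsilon> u \<longleftrightarrow> (\<forall>t. (u has_vector_derivative - S \<epsilon> (u t)) (at t))"

lemma e_nonneg: "0 \<le> e x"
  using A_coercive[of x] \<alpha>_pos unfolding e_def by (smt (verit) mult_nonneg_nonneg zero_le_power2)

lemma e_le_norm: "\<exists>K>0. \<forall>x. e x \<le> K * (norm x)\<^sup>2"
proof -
  obtain K where K: "K > 0" "\<And>x. norm (A x) \<le> norm x * K" using A.pos_bounded by blast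
  have "e x \<le> K * (norm x)\<^sup>2" for x
  proof -
    have "e x \<le> norm (A x) * norm x" unfolding e_def by (rule norm_cauchy_schwarz)
    also have "\<dots> \<le> norm x * K * norm x" using K(2) by (rule mult_right_mono) simp
    finally show ?thesis by (simp add: power2_eq_square mult_ac)
  qed
  then show ?thesis using K(1) by blast
qed

lemma e_minus: "e (- x) = e x" by (simp add: e_def A.neg)

lemma e_parallelogram: "e (x + y) + e (x - y) = 2 * e x + 2 * e y"
  unfolding e_def by (simp add: A.add A.diff inner_add_left inner_add_right inner_diff_left inner_diff_right)

lemma e_diff_le: "e (x - y) \<le> 2 * e x + 2 * e y"
  using e_parallelogram[of x y] e_nonneg[of "x + y"] by linarith

lemma e_add_le: "e (x + y) \<le> 2 * e x + 2 * e y"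
  using e_parallelogram[of x y] e_nonneg[of "x - y"] by linarith

text \<open>Cauchy-Schwarz for the energy form in its additive shape, read off from the
  nonnegativity of \<open>e (x + y)\<close> and \<open>e (x - y)\<close>.\<close>

lemma A_inner_le: "2 * \<bar>inner (A x) y\<bar> \<le> e x + e y"
proof -
  have "inner (A y) x = inner (A x) y" using A_sym[of y x] by (simp add: inner_commute)
  then have "e (x + y) = e x + 2 * inner (A x) y + e y" "e (x - y) = e x - 2 * inner (A x) y + e y"
    unfolding e_def by (simp_all add: A.add A.diff inner_add_left inner_add_right inner_diff_left inner_diff_right)
  then show ?thesis using e_nonneg[of "x + y"] e_nonneg[of "x - y"] by linarith
qed

lemma N_bounded: "bounded_linear (N \<epsilon>)"
  unfolding N_def[abs_def] by (intro bounded_linear_add M_bounded bounded_linear_scaleR_right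
      bounded_linear_compose[OF bounded_linear_scaleR_right A_bounded])

lemma N_coercive: assumes "\<epsilon> > 0" shows "(\<epsilon> * \<alpha>) * (norm x)\<^sup>2 \<le> inner (N \<epsilon> x) x"
proof -
  have "\<epsilon> * (\<alpha> * (norm x)\<^sup>2) \<le> \<epsilon> * inner (A x) x"
    using A_coercive assms by (intro mult_left_mono) auto
  then show ?thesis using M_nonneg[of x] by (simp add: N_def inner_add_left mult.assoc)
qed

lemma N_S: assumes "\<epsilon> > 0" shows "N \<epsilon> (S \<epsilon> x) = A x"
proof -
  have "bij (N \<epsilon>)"
    using coercive_bij[OF N_bounded _ N_coercive[OF assms]] assms \<alpha>_pos by simp
  then show ?thesis by (simp add: S_def bij_is_surj surj_f_inv_f)
qed

lemma S_bounded: assumes "\<epsilon> > 0" shows "bounded_linear (S \<epsilon>)"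
  unfolding S_def[abs_def]
  using coercive_inv_bounded_linear[OF N_bounded _ N_coercive[OF assms]] assms \<alpha>_pos
  by (intro bounded_linear_compose[OF _ A_bounded]) simp

lemma sol_exists: assumes "\<epsilon> > 0" shows "\<exists>u. sol \<epsilon> u \<and> u 0 = x"
  using linear_ode_exists[OF bounded_linear_minus[OF S_bounded[OF assms]], of x] unfolding sol_def by blast

text \<open>The equation is linear and autonomous, so the velocity solves it again; the decay of
  energy can then be applied to the velocity.\<close>

lemma sol_S: assumes "\<epsilon> > 0" "sol \<epsilon> u" shows "sol \<epsilon> (\<lambda>t. - S \<epsilon> (u t))"
  using bounded_linear.has_vector_derivative[OF bounded_linear_minus[OF S_bounded[OF assms(1)]]] assms(2)
  unfolding sol_def by blast

lemma sol_diff: assumes "\<epsilon> > 0" "sol \<epsilon> u" "sol \<epsilon> v" shows "sol \<epsilon> (\<lambda>t. u t - v t)"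
proof -
  interpret S: bounded_linear "S \<epsilon>" by (rule S_bounded[OF assms(1)])
  show ?thesis
    unfolding sol_def
  proof
    fix t
    have "((\<lambda>t. u t - v t) has_vector_derivative (- S \<epsilon> (u t)) - (- S \<epsilon> (v t))) (at t)"
      using assms unfolding sol_def by (intro has_vector_derivative_diff) auto
    then show "((\<lambda>t. u t - v t) has_vector_derivative - S \<epsilon> (u t - v t)) (at t)"
      by (simp add: S.diff)
  qed
qed

lemma quadratic_form_deriv:
  assumes "bounded_linear L" "\<And>x y. inner (L x) y = inner x (L y)"
    and "(u has_vector_derivative u') (at t)"
  shows "((\<lambda>t. inner (L (u t)) (u t)) has_real_derivative 2 * inner (L (u t)) u') (at t)"
proof -
  have "((\<lambda>t. inner (L (u t)) (u t)) has_vector_derivative inner (L (u t)) u' + inner (L u') (u t)) (at t)"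
    using bounded_bilinear.has_vector_derivative[OF bounded_bilinear_inner
        bounded_linear.has_vector_derivative[OF assms(1,3)] assms(3)] .
  moreover have "inner (L u') (u t) = inner (L (u t)) u'"
    using assms(2)[of u' "u t"] by (simp add: inner_commute)
  ultimately show ?thesis by (simp add: has_real_derivative_iff_has_vector_derivative)
qed

text \<open>With w = u', the derivative of \<open>e\<close> along u is 2 (\<open>A\<close> u, w) = -
  2 (\<open>N \<epsilon>\<close> w, w), which is not positive.\<close>

lemma sol_energy:
  assumes "\<epsilon> > 0" "sol \<epsilon> u" "s \<le> t" shows "e (u t) \<le> e (u s)"
proof (rule DERIV_nonpos_imp_nonincreasing[OF assms(3)])
  fix r
  let ?w = "- S \<epsilon> (u r)"
  interpret S: bounded_linear "S \<epsilon>" by (rule S_bounded[OF assms(1)])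
  have "A (u r) = - N \<epsilon> ?w"
    using N_S[OF assms(1), of "u r"] by (simp add: N_def M.neg A.neg algebra_simps)
  then have "inner (A (u r)) ?w = - inner (N \<epsilon> ?w) ?w" by simp
  then have "2 * inner (A (u r)) ?w \<le> 0"
    using N_coercive[OF assms(1), of ?w] assms(1) \<alpha>_pos
    by (smt (verit) mult_nonneg_nonneg zero_le_power2 mult_pos_pos)
  moreover have "((\<lambda>t. e (u t)) has_real_derivative 2 * inner (A (u r)) ?w) (at r)"
    unfolding e_def using assms(2) by (intro quadratic_form_deriv A_bounded A_sym) (simp add: sol_def)
  ultimately show "\<exists>y. ((\<lambda>t. e (u t)) has_real_derivative y) (at r) \<and> y \<le> 0" by blast
qed

text \<open>The quantity is (\<open>N \<epsilon>\<close> u, u); by symmetry its derivative is 2 (u,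
  \<open>N \<epsilon>\<close> u') = - 2 \<open>e\<close> u.\<close>

lemma sol_mass:
  assumes "\<epsilon> > 0" "sol \<epsilon> u" "s \<le> t" shows "m (u t) + \<epsilon> * e (u t) \<le> m (u s) + \<epsilon> * e (u s)"
proof (rule DERIV_nonpos_imp_nonincreasing[OF assms(3)])
  fix r
  let ?w = "- S \<epsilon> (u r)"
  interpret N: bounded_linear "N \<epsilon>" by (rule N_bounded)
  have u: "(u has_vector_derivative ?w) (at r)" using assms(2) by (simp add: sol_def)
  have "inner (M (u r)) ?w + \<epsilon> * inner (A (u r)) ?w = inner (u r) (N \<epsilon> ?w)"
    by (simp only: N_def inner_add_right inner_scaleR_right M_sym A_sym)
  also have "\<dots> = - inner (u r) (A (u r))"
    using N_S[OF assms(1), of "u r"] by (simp add: N.neg)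
  also have "\<dots> \<le> 0" using e_nonneg[of "u r"] by (simp add: e_def inner_commute)
  finally have "2 * inner (M (u r)) ?w + \<epsilon> * (2 * inner (A (u r)) ?w) \<le> 0" by linarith
  moreover have "((\<lambda>t. m (u t) + \<epsilon> * e (u t)) has_real_derivative
      2 * inner (M (u r)) ?w + \<epsilon> * (2 * inner (A (u r)) ?w)) (at r)"
    unfolding e_def m_def
    by (intro DERIV_add DERIV_cmult quadratic_form_deriv A_bounded A_sym M_bounded M_sym u)
  ultimately show "\<exists>y. ((\<lambda>t. m (u t) + \<epsilon> * e (u t)) has_real_derivative y) (at r) \<and> y \<le> 0" by blast
qed

text \<open>For initial data \<open>A\<^sup>-\<^sup>1 M z\<close> the initial velocity \<open>y\<close> satisfies \<open>N \<epsilon> (y + z) = \<epsilon> A z\<close>,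
  which bounds it independently of \<open>\<epsilon>\<close>.\<close>

lemma sol_velocity_bound:
  assumes "\<epsilon> > 0" "sol \<epsilon> u" "A (u 0) = M z" "0 \<le> t"
  shows "e (S \<epsilon> (u t)) \<le> 4 * e z"
proof -
  interpret N: bounded_linear "N \<epsilon>" by (rule N_bounded)
  define y where "y = - S \<epsilon> (u 0)"
  have "N \<epsilon> (y + z) = \<epsilon> *\<^sub>R A z"
    using N_S[OF assms(1), of "u 0"] assms(3) unfolding y_def N.add N.neg by (simp add: N_def)
  then have "m (y + z) + \<epsilon> * e (y + z) = \<epsilon> * inner (A z) (y + z)"
    by (simp add: m_def e_def N_def flip: inner_add_left inner_scaleR_left)
  moreover have "0 \<le> m (y + z)" by (simp add: m_def M_nonneg)
  ultimately have "\<epsilon> * e (y + z) \<le> \<epsilon> * inner (A z) (y + z)" by linarith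
  then have "e (y + z) \<le> inner (A z) (y + z)" using assms(1) by simp
  then have "e (y + z) \<le> e z" using A_inner_le[of z "y + z"] by linarith
  then have "e y \<le> 4 * e z" using e_diff_le[of "y + z" z] by simp
  moreover have "e (- S \<epsilon> (u t)) \<le> e y"
    unfolding y_def by (rule sol_energy[OF assms(1) sol_S[OF assms(1,2)] assms(4)])
  ultimately show ?thesis by (simp add: e_minus)
qed

text \<open>Let p and q be the two velocities. Subtracting the equations and pairing with p - q
  gives - m(p - q), which has the good sign, plus the two error terms \<epsilon> \<open>A\<close> p
  and \<delta> \<open>A\<close> q. These are small because the velocities are bounded in energy
  independently of \<epsilon> and \<delta>.\<close>

lemma sol_compare:
  assumes "\<epsilon> > 0" "sol \<epsilon> u" "\<delta> > 0" "sol \<delta> v" "u 0 = v 0" "A (u 0) = M z" "0 \<le> t"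
  shows "e (u t - v t) \<le> 20 * (\<epsilon> + \<delta>) * e z * t"
proof -
  have "e (u t - v t) - 20 * (\<epsilon> + \<delta>) * e z * t \<le> e (u 0 - v 0) - 20 * (\<epsilon> + \<delta>) * e z * 0"
  proof (rule DERIV_nonpos_imp_nonincreasing[OF assms(7)])
    fix r :: real assume r: "0 \<le> r" "r \<le> t"
    define p q where "p = - S \<epsilon> (u r)" and "q = - S \<delta> (v r)"
    have "(u has_vector_derivative p) (at r)" "(v has_vector_derivative q) (at r)"
      using assms unfolding sol_def p_def q_def by blast+
    then have d: "((\<lambda>t. u t - v t) has_vector_derivative p - q) (at r)"
      by (rule has_vector_derivative_diff)
    have "e p \<le> 4 * e z" "e q \<le> 4 * e z"
      using sol_velocity_bound[OF assms(1,2,6) r(1)] sol_velocity_bound[OF assms(3,4) _ r(1)] assms(5,6)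
      unfolding p_def q_def e_minus by auto
    moreover from this have "e (p - q) \<le> 16 * e z" using e_diff_le[of p q] by linarith
    \<comment> \<open>10 = (4 + 16) / 2 by \<open>A_inner_le\<close>; the factor 2 in the derivative
      of the energy turns this into the 20 of the claim.\<close>
    ultimately have pq: "\<bar>inner (A p) (p - q)\<bar> \<le> 10 * e z" "\<bar>inner (A q) (p - q)\<bar> \<le> 10 * e z"
      using A_inner_le[of p "p - q"] A_inner_le[of q "p - q"] by linarith+
    have "A (u r) = - (M p + \<epsilon> *\<^sub>R A p)"
      using N_S[OF assms(1), of "u r"] by (simp add: N_def p_def M.neg A.neg add.commute)
    moreover have "A (v r) = - (M q + \<delta> *\<^sub>R A q)"
      using N_S[OF assms(3), of "v r"] by (simp add: N_def q_def M.neg A.neg add.commute)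
    ultimately have "A (u r - v r) = - M (p - q) - \<epsilon> *\<^sub>R A p + \<delta> *\<^sub>R A q"
      by (simp add: A.diff M.diff)
    then have "inner (A (u r - v r)) (p - q) = - m (p - q) - \<epsilon> * inner (A p) (p - q) + \<delta> * inner (A q) (p - q)"
      by (simp only: m_def inner_add_left inner_diff_left inner_minus_left inner_scaleR_left)
    moreover have "0 \<le> m (p - q)" by (simp add: m_def M_nonneg)
    moreover have "- \<epsilon> * inner (A p) (p - q) \<le> \<epsilon> * (10 * e z)"
      using mult_left_mono[of "- inner (A p) (p - q)" "10 * e z" \<epsilon>] pq(1) assms(1) by auto
    moreover have "\<delta> * inner (A q) (p - q) \<le> \<delta> * (10 * e z)"
      using mult_left_mono[of "inner (A q) (p - q)" "10 * e z" \<delta>] pq(2) assms(3) by auto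
    ultimately have "2 * inner (A (u r - v r)) (p - q) - 20 * (\<epsilon> + \<delta>) * e z \<le> 0"
      by (simp add: algebra_simps)
    moreover have "((\<lambda>t. e (u t - v t) - 20 * (\<epsilon> + \<delta>) * e z * t) has_real_derivative
        2 * inner (A (u r - v r)) (p - q) - 20 * (\<epsilon> + \<delta>) * e z) (at r)"
    proof (rule DERIV_diff)
      show "((\<lambda>t. e (u t - v t)) has_real_derivative 2 * inner (A (u r - v r)) (p - q)) (at r)"
        unfolding e_def by (rule quadratic_form_deriv[OF A_bounded A_sym d])
      show "((\<lambda>t. 20 * (\<epsilon> + \<delta>) * e z * t) has_real_derivative 20 * (\<epsilon> + \<delta>) * e z) (at r)"
        using DERIV_cmult_Id by blast
    qed
    ultimately show "\<exists>y. ((\<lambda>t. e (u t - v t) - 20 * (\<epsilon> + \<delta>) * e z * t) has_real_derivative y) (at r) \<and> y \<le> 0"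
      by blast
  qed
  then show ?thesis using assms(5) by (simp add: e_def A.zero)
qed

text \<open>If x is orthogonal to every inv A (M z), symmetry moves both operators onto x and gives
  M (inv A x) = 0; definiteness of \<open>M\<close> then yields x = 0. So such data form a dense
  subspace.\<close>

lemma dense_data: assumes "d > 0" shows "\<exists>y z. A y = M z \<and> norm (x - y) < d"
proof -
  have bij: "bij A" using coercive_bij[OF A_bounded \<alpha>_pos A_coercive] .
  define B where "B = inv A"
  have BB: "bounded_linear B" unfolding B_def using coercive_inv_bounded_linear[OF A_bounded \<alpha>_pos A_coercive] .
  have AB: "A (B y) = y" for y using bij by (simp add: B_def bij_is_surj surj_f_inv_f)
  let ?R = "closure (range (\<lambda>z. B (M z)))"
  have "?R = UNIV"
  proof (rule closed_subspace_eq_UNIV)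
    show "subspace ?R"
      by (intro subspace_closure linear_subspace_image bounded_linear.linear[OF bounded_linear_compose[OF BB M_bounded]] subspace_UNIV)
    fix x assume *: "\<And>z. z \<in> ?R \<Longrightarrow> inner x z = 0"
    have "inner (M (B x)) z = 0" for z
    proof -
      have "inner x (B (M z)) = 0" using * closure_subset by blast
      also have "inner x (B (M z)) = inner (A (B x)) (B (M z))" by (simp add: AB)
      also have "\<dots> = inner (B x) (M z)" using A_sym[of "B x" "B (M z)"] by (simp add: AB)
      finally show ?thesis by (simp add: M_sym)
    qed
    then have "B x = 0" using M_definite by blast
    then show "x = 0" using AB[of x] by (simp add: A.zero)
  qed auto
  then have "x \<in> ?R" by blast
  then obtain z where "dist (B (M z)) x < d" using assms unfolding closure_approachable by blast
  then show ?thesis using AB by (metis dist_norm norm_minus_commute)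
qed

text \<open>The approximations converge uniformly in the norm of the space, but their velocities are
  not controlled for general data. The equation therefore survives as a derivative of the scalar
  functions (M u, \<phi>), which is exactly what the weak formulation asks for.\<close>

theorem evolution_exists:
  assumes T: "0 \<le> T"
  shows "\<exists>u. u 0 = x \<and> continuous_on {0..T} u \<and>
    (\<forall>\<phi>. \<forall>t\<in>{0..T}. ((\<lambda>t. inner (M (u t)) \<phi>) has_real_derivative - inner (A (u t)) \<phi>) (at t within {0..T})) \<and>
    (\<forall>t\<in>{0..T}. inner (A (u t)) (u t) \<le> inner (A x) x \<and> inner (M (u t)) (u t) \<le> inner (M x) x)"
proof -
  define \<epsilon> where "\<epsilon> n = inverse (real (Suc n))" for n
  have \<epsilon>: "\<epsilon> n > 0" for n by (simp add: \<epsilon>_def)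
  have \<epsilon>0: "\<epsilon> \<longlonglongrightarrow> 0" unfolding \<epsilon>_def[abs_def] by (rule LIMSEQ_inverse_real_of_nat)
  have "\<exists>U. \<forall>n. sol (\<epsilon> n) (U n) \<and> U n 0 = x" for x
    using sol_exists[OF \<epsilon>] by (intro choice allI)
  then obtain U where U: "\<And>x n. sol (\<epsilon> n) (U x n)" "\<And>x n. U x n 0 = x" by metis
  obtain K where K: "K > 0" "\<And>x. e x \<le> K * (norm x)\<^sup>2" using e_le_norm by blast
  have "uniformly_Cauchy_on {0..T} (U x)"
  proof (rule uniformly_Cauchy_onI)
    fix \<eta> :: real assume \<eta>: "\<eta> > 0"
    \<comment> \<open>The energy threshold that forces a distance below \<eta>. Approximating the
      datum costs 6 c/16 and comparing two regularisations costs 4 c/8; together they stay below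
      c.\<close>
    define c where "c = \<alpha> * \<eta>\<^sup>2"
    have c: "c > 0" using \<eta> \<alpha>_pos by (simp add: c_def)
    obtain y z where yz: "A y = M z" and "norm (x - y) < sqrt (c / (16 * K))"
      using dense_data[of "sqrt (c / (16 * K))" x] c K(1) by auto
    then have "(norm (x - y))\<^sup>2 < (sqrt (c / (16 * K)))\<^sup>2" by (intro power_strict_mono) auto
    then have "K * (norm (x - y))\<^sup>2 < c / 16" using c K(1) by (simp add: field_simps)
    then have exy: "e (x - y) < c / 16" using K(2)[of "x - y"] by linarith
    have "(\<lambda>n. 40 * \<epsilon> n * e z * T) \<longlonglongrightarrow> 40 * 0 * e z * T" by (intro tendsto_intros \<epsilon>0)
    then have "\<forall>\<^sub>F n in sequentially. 40 * \<epsilon> n * e z * T < c / 8"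
      using c by (intro order_tendstoD) auto
    then obtain n0 where n0: "\<And>n. n \<ge> n0 \<Longrightarrow> 40 * \<epsilon> n * e z * T < c / 8"
      by (auto simp: eventually_sequentially)
    have "dist (U x n t) (U x k t) < \<eta>" if "t \<in> {0..T}" "n \<ge> n0" "k \<ge> n0" for n k t
    proof -
      have t: "0 \<le> t" "t \<le> T" using that by auto
      \<comment> \<open>The difference of two solutions with the same \<epsilon> solves the same
        equation, so the error of replacing x by the special datum y does not grow in time,
        uniformly in \<epsilon>.\<close>
      have *: "e (U x j t - U y j t) \<le> e (x - y)" for j
        using sol_energy[OF \<epsilon> sol_diff[OF \<epsilon> U(1) U(1)] t(1)] U(2) by metis
      have **: "e (U y n t - U y k t) \<le> 20 * (\<epsilon> n + \<epsilon> k) * e z * t"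
        by (rule sol_compare[OF \<epsilon> U(1) \<epsilon> U(1)]) (use t yz U(2) in auto)
      also have "\<dots> \<le> 20 * (\<epsilon> n + \<epsilon> k) * e z * T"
        using t e_nonneg \<epsilon> by (intro mult_left_mono mult_nonneg_nonneg add_nonneg_nonneg less_imp_le[OF \<epsilon>]) auto
      also have "\<dots> = (40 * \<epsilon> n * e z * T + 40 * \<epsilon> k * e z * T) / 2" by (simp add: algebra_simps)
      also have "\<dots> < c / 8" using n0[OF that(2)] n0[OF that(3)] by simp
      finally have b: "e (U y n t - U y k t) < c / 8" .
      define p q r where "p = U x n t - U y n t" and "q = U y n t - U y k t" and "r = U y k t - U x k t"
      have "e r = e (U x k t - U y k t)" using e_minus[of r] by (simp add: r_def)
      then have "e (p + q + r) \<le> 4 * e (x - y) + 4 * e q + 2 * e (x - y)"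
        using e_add_le[of "p + q" r] e_add_le[of p q] *[of n] *[of k] unfolding p_def by linarith
      also have "\<dots> < c" using b exy c unfolding q_def by linarith
      also have "p + q + r = U x n t - U x k t" by (simp add: p_def q_def r_def)
      finally have "\<alpha> * (norm (U x n t - U x k t))\<^sup>2 < \<alpha> * \<eta>\<^sup>2"
        using A_coercive[of "U x n t - U x k t"] unfolding e_def c_def by linarith
      then have "(norm (U x n t - U x k t))\<^sup>2 < \<eta>\<^sup>2"
        using \<alpha>_pos by simp
      then show ?thesis using \<eta> by (simp add: dist_norm power_less_imp_less_base)
    qed
    then show "\<exists>n0. \<forall>t\<in>{0..T}. \<forall>n\<ge>n0. \<forall>k\<ge>n0. dist (U x n t) (U x k t) < \<eta>" by blast
  qed
  then obtain u where u: "uniform_limit {0..T} (U x) u sequentially"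
    using Cauchy_uniformly_convergent uniformly_convergent_on_def by blast
  have pt: "(\<lambda>n. U x n t) \<longlonglongrightarrow> u t" if "t \<in> {0..T}" for t
    by (rule tendsto_uniform_limitI[OF u that])
  have contU: "continuous_on {0..T} (U x n)" for n
    using U(1)[of n x] unfolding sol_def by (meson continuous_at_imp_continuous_on has_vector_derivative_continuous)
  have "continuous_on {0..T} u"
    by (rule uniform_limit_theorem[OF _ u]) (use contU in auto)
  moreover have "u 0 = x"
    using LIMSEQ_unique[OF pt[of 0]] U(2) T by simp
  moreover have "inner (A (u t)) (u t) \<le> inner (A x) x" if "t \<in> {0..T}" for t
  proof -
    have "(\<lambda>n. inner (A (U x n t)) (U x n t)) \<longlonglongrightarrow> inner (A (u t)) (u t)"
      by (intro tendsto_intros A.tendsto pt that)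
    moreover have "inner (A (U x n t)) (U x n t) \<le> inner (A x) x" for n
      using sol_energy[OF \<epsilon> U(1)[of n x], of 0 t] that U(2) by (simp add: e_def)
    ultimately show ?thesis by (intro LIMSEQ_le_const2) auto
  qed
  moreover have "inner (M (u t)) (u t) \<le> inner (M x) x" if "t \<in> {0..T}" for t
  proof -
    have "(\<lambda>n. inner (M (U x n t)) (U x n t)) \<longlonglongrightarrow> inner (M (u t)) (u t)"
      by (intro tendsto_intros M.tendsto pt that)
    moreover have "(\<lambda>n. inner (M x) x + \<epsilon> n * e x) \<longlonglongrightarrow> inner (M x) x + 0 * e x"
      by (intro tendsto_intros \<epsilon>0)
    moreover have "inner (M (U x n t)) (U x n t) \<le> inner (M x) x + \<epsilon> n * e x" for n
    proof -
      have "0 \<le> \<epsilon> n * e (U x n t)" using \<epsilon>[of n] e_nonneg by simp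
      then show ?thesis
        using sol_mass[OF \<epsilon> U(1)[of n x], of 0 t] that U(2) by (simp add: m_def)
    qed
    ultimately show ?thesis by (intro LIMSEQ_le) auto
  qed
  moreover have "((\<lambda>t. inner (M (u t)) \<phi>) has_real_derivative - inner (A (u t)) \<phi>) (at t within {0..T})"
    if t: "t \<in> {0..T}" for \<phi> t
  proof -
    \<comment> \<open>Pairing \<open>N (\<epsilon> n)\<close>, rather than \<open>M\<close>, with
      \<phi> makes the derivative exactly - (A u, \<phi>) for each n. These derivatives converge
      uniformly, and the extra \<epsilon> \<open>A\<close> term disappears in the limit of
      \<open>f\<close> itself.\<close>
    define f where "f n t = inner (N (\<epsilon> n) (U x n t)) \<phi>" for n t
    have df: "(f n has_vector_derivative - inner (A (U x n t)) \<phi>) (at t within {0..T})" for n t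
    proof -
      have "(U x n has_vector_derivative - S (\<epsilon> n) (U x n t)) (at t within {0..T})"
        using U(1)[of n x] unfolding sol_def by (meson has_vector_derivative_at_within)
      from bounded_linear.has_vector_derivative[OF
          bounded_linear_compose[OF bounded_linear_inner_left[of \<phi>] N_bounded[of "\<epsilon> n"]] this]
      show ?thesis
        using N_S[OF \<epsilon>, of n "U x n t"]
        unfolding f_def[abs_def] by (simp add: bounded_linear.linear[OF N_bounded, THEN linear_neg])
    qed
    have un: "uniform_limit {0..T} (\<lambda>n t. inner (A (U x n t)) \<phi>) (\<lambda>t. inner (A (u t)) \<phi>) sequentially"
      by (rule bounded_linear.uniform_limit[OF bounded_linear_compose[OF bounded_linear_inner_left[of \<phi>] A_bounded] u])
    have lim: "(\<lambda>n. f n t) \<longlonglongrightarrow> inner (M (u t)) \<phi>" if "t \<in> {0..T}" for t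
    proof -
      have "(\<lambda>n. inner (M (U x n t) + \<epsilon> n *\<^sub>R A (U x n t)) \<phi>) \<longlonglongrightarrow> inner (M (u t) + 0 *\<^sub>R A (u t)) \<phi>"
        by (intro tendsto_intros M.tendsto A.tendsto pt that \<epsilon>0)
      then show ?thesis by (simp add: f_def N_def)
    qed
    have "\<exists>g. \<forall>t\<in>{0..T}. (\<lambda>n. f n t) \<longlonglongrightarrow> g t \<and>
      (g has_derivative (\<lambda>h. h *\<^sub>R (- inner (A (u t)) \<phi>))) (at t within {0..T})"
    proof (rule has_derivative_sequence[where f' = "\<lambda>n t h. h *\<^sub>R (- inner (A (U x n t)) \<phi>)"])
      show "(f n has_derivative (\<lambda>h. h *\<^sub>R (- inner (A (U x n t)) \<phi>))) (at t within {0..T})" for n t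
        using df by (simp add: has_vector_derivative_def)
      fix \<eta> :: real assume "\<eta> > 0"
      from uniform_limitD[OF un this]
      show "\<forall>\<^sub>F n in sequentially. \<forall>t\<in>{0..T}. \<forall>h. norm (h *\<^sub>R (- inner (A (U x n t)) \<phi>) - h *\<^sub>R (- inner (A (u t)) \<phi>)) \<le> \<eta> * norm h"
      proof (rule eventually_mono, intro ballI allI)
        fix n t h assume *: "\<forall>t\<in>{0..T}. dist (inner (A (U x n t)) \<phi>) (inner (A (u t)) \<phi>) < \<eta>" "t \<in> {0..T}"
        have "norm (h *\<^sub>R (- inner (A (U x n t)) \<phi>) - h *\<^sub>R (- inner (A (u t)) \<phi>))
            = \<bar>h\<bar> * \<bar>inner (A (U x n t)) \<phi> - inner (A (u t)) \<phi>\<bar>"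
          unfolding scaleR_diff_right[symmetric] by (simp add: abs_mult abs_minus_commute)
        also have "\<dots> \<le> \<bar>h\<bar> * \<eta>" using * by (intro mult_left_mono) (auto simp: dist_real_def intro: less_imp_le)
        finally show "norm (h *\<^sub>R (- inner (A (U x n t)) \<phi>) - h *\<^sub>R (- inner (A (u t)) \<phi>)) \<le> \<eta> * norm h"
          by (simp add: mult.commute)
      qed
    qed (use t lim in auto)
    then obtain g where g: "\<And>t. t \<in> {0..T} \<Longrightarrow> (\<lambda>n. f n t) \<longlonglongrightarrow> g t"
      "\<And>t. t \<in> {0..T} \<Longrightarrow> (g has_vector_derivative - inner (A (u t)) \<phi>) (at t within {0..T})"
      unfolding has_vector_derivative_def by blast
    have gM: "g t = inner (M (u t)) \<phi>" if "t \<in> {0..T}" for t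
      using LIMSEQ_unique[OF g(1) lim] that by blast
    show ?thesis
      unfolding has_real_derivative_iff_has_vector_derivative
      by (rule has_vector_derivative_transform[OF t _ g(2)[OF t]]) (use gM in auto)
  qed
  ultimately show ?thesis by (intro exI[of _ u]) auto
qed

end

section \<open>The Hilbert space of square integrable functions\<close>

lemma square_integrable_rep_L2: "square_integrable (rep_L2 f)"
  using Quotient3_rep_reflp[OF Quotient3_L2, of f] by simp

lemma abs_rep_L2 [simp]: "abs_L2 (rep_L2 f) = f"
  by (rule Quotient3_abs_rep[OF Quotient3_L2])

lemma rep_abs_L2: "square_integrable F \<Longrightarrow> AE x in lebesgue. rep_L2 (abs_L2 F) x = F x"
  using Quotient3_rep_abs[OF Quotient3_L2, of F] by simp

lemma L2_eq_iff: "f = g \<longleftrightarrow> (AE x in lebesgue. rep_L2 f x = rep_L2 g x)"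
  using Quotient3_rel_rep[OF Quotient3_L2, of f g] square_integrable_rep_L2 by auto

lemma measurable_rep_L2 [measurable]: "rep_L2 f \<in> borel_measurable lebesgue"
  using square_integrable_rep_L2[of f] by (simp add: square_integrable_def)

lemma abs_L2_zero: "abs_L2 (\<lambda>_. 0) = 0"
  by (simp add: zero_L2_def)

lemma rep_L2_zero: "AE x in lebesgue. rep_L2 0 x = 0"
  using rep_abs_L2[OF square_integrable_zero] by (simp add: abs_L2_zero)

lemma abs_L2_add:
  "square_integrable F \<Longrightarrow> square_integrable G \<Longrightarrow> abs_L2 (\<lambda>x. F x + G x) = abs_L2 F + abs_L2 G"
  by (rule plus_L2.abs_eq[symmetric]) auto

lemma abs_L2_scaleC:
  "square_integrable F \<Longrightarrow> abs_L2 (\<lambda>x. z * F x) = scaleC_L2 z (abs_L2 F)"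
  by (rule scaleC_L2.abs_eq[symmetric]) auto

lemma rep_L2_add: "AE x in lebesgue. rep_L2 (f + g) x = rep_L2 f x + rep_L2 g x"
  using rep_abs_L2[OF square_integrable_add[OF square_integrable_rep_L2[of f] square_integrable_rep_L2[of g]]]
  by (simp add: abs_L2_add square_integrable_rep_L2)

lemma rep_L2_scaleC: "AE x in lebesgue. rep_L2 (scaleC_L2 z f) x = z * rep_L2 f x"
  using rep_abs_L2[OF square_integrable_mult[OF square_integrable_rep_L2[of f], of z]]
  by (simp add: abs_L2_scaleC square_integrable_rep_L2)

lemma uminus_L2_scaleC: "- f = scaleC_L2 (-1) (f :: 'n::finite L2)"
  by (simp add: uminus_L2_def)

lemma rep_L2_diff: "AE x in lebesgue. rep_L2 (f - g) x = rep_L2 f x - rep_L2 g x"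
  using rep_L2_add[of f "scaleC_L2 (-1) g"] rep_L2_scaleC[of "-1" g]
  unfolding minus_L2_def uminus_L2_scaleC by eventually_elim simp

lemma rep_L2_scaleR: "AE x in lebesgue. rep_L2 (r *\<^sub>R f) x = of_real r * rep_L2 f x"
  unfolding scaleR_L2_def by (rule rep_L2_scaleC)

lemma square_integrable_diff:
  "square_integrable F \<Longrightarrow> square_integrable G \<Longrightarrow> square_integrable (\<lambda>x. F x - G x)"
  using square_integrable_add[OF _ square_integrable_mult[of G "-1"], of F] by simp

lemma abs_L2_diff:
  assumes "square_integrable F" "square_integrable G"
  shows "abs_L2 (\<lambda>x. F x - G x) = abs_L2 F - abs_L2 G"
  using abs_L2_add[OF assms(1) square_integrable_mult[OF assms(2), of "-1"]] abs_L2_scaleC[OF assms(2), of "-1"]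
  by (simp add: minus_L2_def uminus_L2_scaleC)

lemma cinner_L2_abs:
  "square_integrable F \<Longrightarrow> square_integrable G \<Longrightarrow>
    cinner_L2 (abs_L2 F) (abs_L2 G) = (\<integral>x. F x * cnj (G x) \<partial>lebesgue)"
  by (rule cinner_L2.abs_eq) auto

lemma cinner_L2_rep: "cinner_L2 f g = (\<integral>x. rep_L2 f x * cnj (rep_L2 g x) \<partial>lebesgue)"
  using cinner_L2_abs[OF square_integrable_rep_L2[of f] square_integrable_rep_L2[of g]] by simp

lemma integrable_rep_L2_cnj: "integrable lebesgue (\<lambda>x. rep_L2 f x * cnj (rep_L2 g x))"
  by (intro integrable_mult_cnj square_integrable_rep_L2)

lemma cnj_measurable [measurable]:
  "f \<in> borel_measurable M \<Longrightarrow> (\<lambda>x. cnj (f x)) \<in> borel_measurable M"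
  by (rule borel_measurable_continuous_on[of cnj]) (intro continuous_intros)

lemma cinner_L2_add_left: "cinner_L2 (f + g) h = cinner_L2 f h + cinner_L2 g h"
proof -
  have "cinner_L2 (f + g) h = (\<integral>x. rep_L2 f x * cnj (rep_L2 h x) + rep_L2 g x * cnj (rep_L2 h x) \<partial>lebesgue)"
    unfolding cinner_L2_rep
    by (rule integral_cong_AE) (use rep_L2_add[of f g] in \<open>auto simp: distrib_right\<close>)
  then show ?thesis
    by (simp add: cinner_L2_rep integrable_rep_L2_cnj)
qed

lemma cinner_L2_scaleC_left: "cinner_L2 (scaleC_L2 z f) g = z * cinner_L2 f g"
proof -
  have "cinner_L2 (scaleC_L2 z f) g = (\<integral>x. z * (rep_L2 f x * cnj (rep_L2 g x)) \<partial>lebesgue)"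
    unfolding cinner_L2_rep
    by (rule integral_cong_AE) (use rep_L2_scaleC[of z f] in \<open>auto simp: mult.assoc\<close>)
  then show ?thesis by (simp add: cinner_L2_rep)
qed

lemma cinner_L2_commute: "cinner_L2 f g = cnj (cinner_L2 g f)"
  unfolding cinner_L2_rep Bochner_Integration.integral_cnj[symmetric] by (simp add: mult.commute)

lemma cinner_L2_add_right: "cinner_L2 f (g + h) = cinner_L2 f g + cinner_L2 f h"
  by (metis cinner_L2_add_left cinner_L2_commute complex_cnj_add)

lemma cinner_L2_scaleC_right: "cinner_L2 f (scaleC_L2 z g) = cnj z * cinner_L2 f g"
  by (metis cinner_L2_scaleC_left cinner_L2_commute complex_cnj_mult)

lemma cinner_L2_scaleR_left: "cinner_L2 (r *\<^sub>R f) g = of_real r * cinner_L2 f g"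
  by (simp add: scaleR_L2_def cinner_L2_scaleC_left)

lemma cinner_L2_diff_left: "cinner_L2 (f - g) h = cinner_L2 f h - cinner_L2 g h"
  unfolding minus_L2_def uminus_L2_scaleC by (simp add: cinner_L2_add_left cinner_L2_scaleC_left)

lemma Re_cinner_L2: "Re (cinner_L2 f g) = inner f g"
  by (simp add: inner_L2_def)

lemma Im_cinner_L2: "Im (cinner_L2 f g) = inner f (scaleC_L2 \<i> g)"
  by (simp add: inner_L2_def cinner_L2_scaleC_right)

text \<open>The bridge between the real Hilbert space structure and the complex pairing: continuity
  and isometry statements are shown for the real inner product and transferred by inserting \<i>
  g.\<close>

lemma cinner_L2_eq: "cinner_L2 f g = Complex (inner f g) (inner f (scaleC_L2 \<i> g))"
  by (simp add: complex_eq_iff Re_cinner_L2 Im_cinner_L2)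

lemma cinner_L2_self: "cinner_L2 f f = of_real ((norm f)\<^sup>2)"
  using arg_cong[OF cinner_L2_commute[of f f], of Im]
  by (simp add: complex_eq_iff Re_cinner_L2 power2_norm_eq_inner)

lemma norm_L2_sq: "(norm f)\<^sup>2 = (\<integral>x. (cmod (rep_L2 f x))\<^sup>2 \<partial>lebesgue)"
proof -
  have "of_real ((norm f)\<^sup>2) = (\<integral>x. complex_of_real ((cmod (rep_L2 f x))\<^sup>2) \<partial>lebesgue)"
    unfolding cinner_L2_self[symmetric] cinner_L2_rep by (simp only: complex_norm_square)
  then show ?thesis by (simp only: integral_complex_of_real of_real_eq_iff)
qed

lemma integrable_norm_sq_rep_L2: "integrable lebesgue (\<lambda>x. (cmod (rep_L2 f x))\<^sup>2)"
  using square_integrable_rep_L2[of f] by (simp add: square_integrable_def)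

lemma nn_integral_rep_L2: "(\<integral>\<^sup>+x. ennreal ((cmod (rep_L2 f x))\<^sup>2) \<partial>lebesgue) = ennreal ((norm f)\<^sup>2)"
  unfolding norm_L2_sq by (rule nn_integral_eq_integral[OF integrable_norm_sq_rep_L2]) simp

lemma norm_abs_L2:
  assumes "square_integrable F"
  shows "(norm (abs_L2 F))\<^sup>2 = (\<integral>x. (cmod (F x))\<^sup>2 \<partial>lebesgue)"
proof -
  have [measurable]: "F \<in> borel_measurable lebesgue" using assms by (simp add: square_integrable_def)
  show ?thesis
    unfolding norm_L2_sq by (rule integral_cong_AE) (use rep_abs_L2[OF assms] in auto)
qed

lemma scaleC_scaleC_L2: "scaleC_L2 z (scaleC_L2 w f) = scaleC_L2 (z * w) f"
  unfolding L2_eq_iff using rep_L2_scaleC[of z "scaleC_L2 w f"] rep_L2_scaleC[of w f] rep_L2_scaleC[of "z * w" f]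
  by eventually_elim simp

lemma scaleC_L2_add: "scaleC_L2 z (f + g) = scaleC_L2 z f + scaleC_L2 z g"
  unfolding L2_eq_iff
  using rep_L2_scaleC[of z "f + g"] rep_L2_scaleC[of z f] rep_L2_scaleC[of z g] rep_L2_add[of f g]
    rep_L2_add[of "scaleC_L2 z f" "scaleC_L2 z g"]
  by eventually_elim (simp add: distrib_left)

lemma norm_scaleC_L2: "norm (scaleC_L2 z f) = cmod z * norm f"
proof -
  have "complex_of_real ((norm (scaleC_L2 z f))\<^sup>2) = of_real ((cmod z * norm f)\<^sup>2)"
    unfolding cinner_L2_self[symmetric] cinner_L2_scaleC_left cinner_L2_scaleC_right
    by (simp add: cinner_L2_self power_mult_distrib mult.assoc[symmetric] complex_norm_square del: of_real_power)
  then have "(norm (scaleC_L2 z f))\<^sup>2 = (cmod z * norm f)\<^sup>2" by (simp only: of_real_eq_iff)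
  then show ?thesis by (simp add: power2_eq_iff_nonneg)
qed

lemma tendsto_cinner_L2:
  assumes "(f \<longlongrightarrow> l) F" "(g \<longlongrightarrow> k) F"
  shows "((\<lambda>x. cinner_L2 (f x) (g x)) \<longlongrightarrow> cinner_L2 l k) F"
proof -
  have "((\<lambda>x. scaleC_L2 \<i> (g x)) \<longlongrightarrow> scaleC_L2 \<i> k) F"
  proof -
    have "norm (scaleC_L2 \<i> (g x) - scaleC_L2 \<i> k) = norm (g x - k)" for x
      using scaleC_L2_add[of \<i> "g x" "- k"]
      by (simp add: minus_L2_def norm_scaleC_L2 uminus_L2_scaleC scaleC_scaleC_L2)
         (metis diff_conv_add_uminus minus_L2_def norm_scaleC_L2 norm_ii mult_1 scaleC_L2_add scaleC_scaleC_L2 uminus_L2_scaleC mult.commute)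
    then show ?thesis using assms(2) by (simp add: tendsto_iff dist_norm)
  qed
  then show ?thesis
    unfolding cinner_L2_eq Complex_eq using assms by (intro tendsto_intros)
qed

section \<open>Completeness of L2 and separation by boxes\<close>

instance L2 :: (finite) banach
proof
  fix X :: "nat \<Rightarrow> 'a L2"
  assume X: "Cauchy X"
  have "\<exists>N. \<forall>m\<ge>N. \<forall>n\<ge>N. norm (X m - X n) < 1 / 4 ^ k" for k
    using CauchyD[OF X, of "1 / 4 ^ k"] by simp
  then obtain N where N: "\<And>k m n. m \<ge> N k \<Longrightarrow> n \<ge> N k \<Longrightarrow> norm (X m - X n) < 1 / 4 ^ k"
    by metis
  \<comment> \<open>The sum dominates \<open>N k\<close> and the summand k makes \<open>r\<close>
    strictly increasing, so one formula yields a subsequence whose increments are below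
    4^-k.\<close>
  define r where "r k = (\<Sum>i\<le>k. N i) + k" for k
  have r: "strict_mono r" by (rule strict_monoI_Suc) (simp add: r_def)
  have rN: "N k \<le> r k" for k
    unfolding r_def by (simp add: member_le_sum trans_le_add1)
  have rk: "norm (X (r m) - X (r k)) < 1 / 4 ^ k" if "m \<ge> k" for m k
    by (rule N) (use that rN[of k] strict_mono_leD[OF r that] in auto)
  define F where "F k = rep_L2 (X (r k))" for k
  have [measurable]: "F k \<in> borel_measurable lebesgue" for k by (simp add: F_def)
  have nF: "(\<integral>\<^sup>+x. ennreal ((cmod (F m x - F k x))\<^sup>2) \<partial>lebesgue) = ennreal ((norm (X (r m) - X (r k)))\<^sup>2)" for m k
    unfolding nn_integral_rep_L2[symmetric]
    by (rule nn_integral_cong_AE) (use rep_L2_diff[of "X (r m)" "X (r k)"] in \<open>auto simp: F_def\<close>)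
  \<comment> \<open>The weight 4^k is affordable because the squared increments integrate to at most
    16^-k. Finiteness of the weighted sum at x makes the increments at x eventually at most 2^-k,
    hence summable.\<close>
  have "AE x in lebesgue. (\<Sum>k. ennreal (4 ^ k * (cmod (F (Suc k) x - F k x))\<^sup>2)) \<noteq> \<infinity>"
  proof (rule nn_integral_noteq_infinite)
    have "(\<integral>\<^sup>+x. (\<Sum>k. ennreal (4 ^ k * (cmod (F (Suc k) x - F k x))\<^sup>2)) \<partial>lebesgue)
        = (\<Sum>k. \<integral>\<^sup>+x. ennreal (4 ^ k * (cmod (F (Suc k) x - F k x))\<^sup>2) \<partial>lebesgue)"
      by (rule nn_integral_suminf) measurable
    also have "\<dots> \<le> (\<Sum>k. ennreal ((1/4) ^ k))"
    proof (rule suminf_le)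
      fix k
      have "(\<integral>\<^sup>+x. ennreal (4 ^ k * (cmod (F (Suc k) x - F k x))\<^sup>2) \<partial>lebesgue)
          = ennreal (4 ^ k) * (\<integral>\<^sup>+x. ennreal ((cmod (F (Suc k) x - F k x))\<^sup>2) \<partial>lebesgue)"
        by (subst nn_integral_cmult[symmetric]) (auto simp: ennreal_mult)
      also have "\<dots> = ennreal (4 ^ k * (norm (X (r (Suc k)) - X (r k)))\<^sup>2)"
        by (simp add: nF ennreal_mult)
      also have "\<dots> \<le> ennreal ((1/4) ^ k)"
      proof (rule ennreal_leI)
        have "(norm (X (r (Suc k)) - X (r k)))\<^sup>2 \<le> (1 / 4 ^ k)\<^sup>2"
          using rk[of k "Suc k"] by (intro power_mono) auto
        then have "4 ^ k * (norm (X (r (Suc k)) - X (r k)))\<^sup>2 \<le> 4 ^ k * (1 / 4 ^ k)\<^sup>2"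
          by (intro mult_left_mono) auto
        then show "4 ^ k * (norm (X (r (Suc k)) - X (r k)))\<^sup>2 \<le> (1/4) ^ k"
          by (simp add: power2_eq_square power_one_over)
      qed
      finally show "(\<integral>\<^sup>+x. ennreal (4 ^ k * (cmod (F (Suc k) x - F k x))\<^sup>2) \<partial>lebesgue) \<le> ennreal ((1/4) ^ k)" .
    qed auto
    also have "\<dots> = ennreal (\<Sum>k. (1/4) ^ k)"
      by (rule suminf_ennreal2) (auto intro: summable_geometric)
    finally show "(\<integral>\<^sup>+x. (\<Sum>k. ennreal (4 ^ k * (cmod (F (Suc k) x - F k x))\<^sup>2)) \<partial>lebesgue) \<noteq> \<infinity>"
      using ennreal_less_top leD by (metis infinity_ennreal_def top.not_eq_extremum)
  qed measurable
  then have conv: "AE x in lebesgue. convergent (\<lambda>k. F k x)"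
  proof eventually_elim
    case (elim x)
    have "summable (\<lambda>k. 4 ^ k * (cmod (F (Suc k) x - F k x))\<^sup>2)"
      using elim by (intro summable_suminf_not_top) auto
    then have "(\<lambda>k. 4 ^ k * (cmod (F (Suc k) x - F k x))\<^sup>2) \<longlonglongrightarrow> 0" by (rule summable_LIMSEQ_zero)
    then have "\<forall>\<^sub>F k in sequentially. 4 ^ k * (cmod (F (Suc k) x - F k x))\<^sup>2 < 1"
      by (rule order_tendstoD) simp
    then have "\<forall>\<^sub>F k in sequentially. norm (F (Suc k) x - F k x) \<le> (1/2) ^ k"
    proof eventually_elim
      case (elim k)
      have "(cmod (F (Suc k) x - F k x))\<^sup>2 \<le> ((1/2) ^ k)\<^sup>2"
        using elim by (simp add: power_one_over field_simps)
          (simp add: power2_eq_square mult.assoc flip: power_mult_distrib)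
      then show ?case by (rule power2_le_imp_le) simp
    qed
    then have "summable (\<lambda>k. F (Suc k) x - F k x)"
      by (rule summable_comparison_test_ev) (auto intro: summable_geometric)
    then have "convergent (\<lambda>n. (\<Sum>k<n. F (Suc k) x - F k x) + F 0 x)"
      unfolding summable_iff_convergent by (intro convergent_add convergent_const)
    then show "convergent (\<lambda>k. F k x)"
      unfolding sum_lessThan_telescope[of "\<lambda>k. F k x"] by simp
  qed
  define G where "G x = lim (\<lambda>k. F k x)" for x
  have [measurable]: "G \<in> borel_measurable lebesgue"
    unfolding G_def[abs_def] by (rule borel_measurable_lim_metric) measurable
  have FG: "AE x in lebesgue. (\<lambda>k. F k x) \<longlonglongrightarrow> G x"
    using conv by eventually_elim (simp add: G_def convergent_LIMSEQ_iff)
  \<comment> \<open>Fatou's lemma with the first index tending to infinity; it shows at once that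
    the pointwise limit is square integrable and that it is the limit in norm.\<close>
  have fatou: "(\<integral>\<^sup>+x. ennreal ((cmod (G x - F k x))\<^sup>2) \<partial>lebesgue) \<le> ennreal ((1 / 4 ^ k)\<^sup>2)" for k
  proof -
    have "(\<integral>\<^sup>+x. ennreal ((cmod (G x - F k x))\<^sup>2) \<partial>lebesgue)
        = (\<integral>\<^sup>+x. liminf (\<lambda>m. ennreal ((cmod (F m x - F k x))\<^sup>2)) \<partial>lebesgue)"
    proof (rule nn_integral_cong_AE)
      show "AE x in lebesgue. ennreal ((cmod (G x - F k x))\<^sup>2) = liminf (\<lambda>m. ennreal ((cmod (F m x - F k x))\<^sup>2))"
        using FG
      proof eventually_elim
        case (elim x)
        have "(\<lambda>m. ennreal ((cmod (F m x - F k x))\<^sup>2)) \<longlonglongrightarrow> ennreal ((cmod (G x - F k x))\<^sup>2)"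
          by (intro tendsto_intros elim)
        then show ?case by (intro lim_imp_Liminf[symmetric]) auto
      qed
    qed
    also have "\<dots> \<le> liminf (\<lambda>m. \<integral>\<^sup>+x. ennreal ((cmod (F m x - F k x))\<^sup>2) \<partial>lebesgue)"
      by (rule nn_integral_liminf) measurable
    also have "\<dots> \<le> ennreal ((1 / 4 ^ k)\<^sup>2)"
    proof (rule Liminf_le)
      show "\<forall>\<^sub>F m in sequentially. (\<integral>\<^sup>+x. ennreal ((cmod (F m x - F k x))\<^sup>2) \<partial>lebesgue) \<le> ennreal ((1 / 4 ^ k)\<^sup>2)"
        using eventually_ge_at_top[of k]
      proof eventually_elim
        case (elim m)
        then show ?case
          unfolding nF using rk[of k m] by (intro ennreal_leI power_mono) auto
      qed
    qed simp
    finally show ?thesis .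
  qed
  have sqd: "square_integrable (\<lambda>x. G x - F k x)" for k
    unfolding square_integrable_def
  proof
    show "integrable lebesgue (\<lambda>x. (cmod (G x - F k x))\<^sup>2)"
      by (rule integrableI_bounded) (use fatou[of k] in \<open>auto intro: le_less_trans\<close>)
  qed measurable
  have sqG: "square_integrable G"
    using square_integrable_add[OF sqd[of 0] square_integrable_rep_L2[of "X (r 0)"]] by (simp add: F_def)
  have "norm (X (r k) - abs_L2 G) \<le> 1 / 4 ^ k" for k
  proof -
    have "ennreal ((norm (abs_L2 (\<lambda>x. G x - F k x)))\<^sup>2) \<le> ennreal ((1 / 4 ^ k)\<^sup>2)"
      unfolding norm_abs_L2[OF sqd] using fatou[of k] sqd[of k]
      by (subst nn_integral_eq_integral[symmetric]) (auto simp: square_integrable_def)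
    then have "(norm (abs_L2 (\<lambda>x. G x - F k x)))\<^sup>2 \<le> (1 / 4 ^ k)\<^sup>2" by simp
    then have "norm (abs_L2 (\<lambda>x. G x - F k x)) \<le> 1 / 4 ^ k" by (rule power2_le_imp_le) simp
    moreover have "abs_L2 (\<lambda>x. G x - F k x) = abs_L2 G - X (r k)"
      using abs_L2_diff[OF sqG square_integrable_rep_L2[of "X (r k)"]] by (simp add: F_def)
    ultimately show ?thesis by (simp add: norm_minus_commute)
  qed
  moreover have "(\<lambda>k. 1 / 4 ^ k :: real) \<longlonglongrightarrow> 0"
    using LIMSEQ_power_zero[of "1/4 :: real"] by (simp add: power_one_over)
  ultimately have "(\<lambda>k. X (r k) - abs_L2 G) \<longlonglongrightarrow> 0"
    using Lim_null_comparison[of "\<lambda>k. X (r k) - abs_L2 G" "\<lambda>k. 1 / 4 ^ k"] by (simp only: eventually_True)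
  then have "(X \<circ> r) \<longlonglongrightarrow> abs_L2 G" by (simp add: LIM_zero_iff comp_def)
  then show "convergent X"
    using Cauchy_converges_subseq[OF X r] by (auto simp: convergent_def)
qed

text \<open>The positive and the negative part of \<open>g\<close> are densities of two measures
  that agree on all boxes. Boxes are stable under intersection, generate the Borel sets and have
  finite mass, so the measures and hence the two parts coincide.\<close>

lemma AE_zero_if_box_integrals_zero_real:
  fixes g :: "'a::euclidean_space \<Rightarrow> real"
  assumes g: "\<And>a b. integrable lebesgue (\<lambda>x. indicator (box a b) x * g x)"
    and zero: "\<And>a b. (\<integral>x. indicator (box a b) x * g x \<partial>lebesgue) = 0"
    and gm: "g \<in> borel_measurable lebesgue"
  shows "AE x in lebesgue. g x = 0"
proof -
  \<comment> \<open>The uniqueness theorem for measures works on the Borel sets, so \<open>g\<close>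
    is first replaced by a Borel function equal to it almost everywhere.\<close>
  obtain h where h [measurable]: "h \<in> borel_measurable borel" and gh: "AE x in lborel. g x = h x"
    using completion_ex_borel_measurable_real[OF gm] by auto
  have [measurable]: "h \<in> borel_measurable lebesgue" using h by (auto intro: measurable_completion)
  have gh': "AE x in lebesgue. g x = h x" using gh by (rule AE_completion)
  have hi: "integrable lborel (\<lambda>x. indicator (box a b) x * h x)" for a b
  proof -
    have "integrable lebesgue (\<lambda>x. indicator (box a b) x * h x)"
      by (rule integrable_cong_AE_imp[OF g[of a b]])
        (use gh' in \<open>auto intro!: borel_measurable_times borel_measurable_indicator\<close>)
    then show ?thesis by (subst (asm) integrable_completion) auto
  qed
  have hz: "(\<integral>x. indicator (box a b) x * h x \<partial>lborel) = 0" for a b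
  proof -
    have "(\<integral>x. indicator (box a b) x * h x \<partial>lebesgue) = (\<integral>x. indicator (box a b) x * g x \<partial>lebesgue)"
      by (rule integral_cong_AE)
        (use gh' gm in \<open>auto intro!: borel_measurable_times borel_measurable_indicator\<close>)
    then show ?thesis by (subst (asm) integral_completion) (auto simp: zero)
  qed
  \<comment> \<open>\<open>ennreal\<close> sends negative numbers to 0, so these densities are the
    positive and the negative part of \<open>h\<close>.\<close>
  define P Q where "P = density lborel (\<lambda>x. ennreal (h x))" and "Q = density lborel (\<lambda>x. ennreal (- h x))"
  have P: "emeasure P (box a b) = (\<integral>\<^sup>+x. ennreal (indicator (box a b) x * h x) \<partial>lborel)" for a b
    unfolding P_def by (subst emeasure_density) (auto intro!: nn_integral_cong split: split_indicator)
  have Q: "emeasure Q (box a b) = (\<integral>\<^sup>+x. ennreal (- (indicator (box a b) x * h x)) \<partial>lborel)" for a b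
    unfolding Q_def by (subst emeasure_density) (auto intro!: nn_integral_cong split: split_indicator)
  have fin: "emeasure P (box a b) \<noteq> \<infinity>" "emeasure Q (box a b) \<noteq> \<infinity>" for a b
    using hi[of a b] unfolding P Q real_integrable_def by auto
  have "P = Q"
  proof (rule measure_eqI_generator_eq)
    let ?E = "range (\<lambda>(a, b). box a b::'a set)"
    show "Int_stable ?E" by (auto simp: Int_stable_def box_Int_box)
    show "?E \<subseteq> Pow UNIV" "sets P = sigma_sets UNIV ?E" "sets Q = sigma_sets UNIV ?E"
      by (simp_all add: borel_eq_box P_def Q_def)
    let ?A = "\<lambda>n::nat. box (- (real n *\<^sub>R One)) (real n *\<^sub>R One) :: 'a set"
    show "range ?A \<subseteq> ?E" "(\<Union>i. ?A i) = UNIV" unfolding UN_box_eq_UNIV by auto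
    show "emeasure P (?A i) \<noteq> \<infinity>" for i by (rule fin)
    show "emeasure P X = emeasure Q X" if XE: "X \<in> ?E" for X
    proof -
      obtain a b where X: "X = box a b" using XE by auto
      have "enn2real (emeasure P X) = enn2real (emeasure Q X)"
        using hz[of a b] real_lebesgue_integral_def[OF hi[of a b]] unfolding X P Q by simp
      then show ?thesis
        using fin unfolding X by (metis ennreal_enn2real infinity_ennreal_def top.not_eq_extremum)
    qed
  qed
  then have "AE x in lborel. ennreal (h x) = ennreal (- h x)"
    unfolding P_def Q_def by (intro sigma_finite_measure.density_unique[OF sigma_finite_lborel]) auto
  then have "AE x in lborel. g x = 0"
    using gh
  proof eventually_elim
    case (elim x)
    then show ?case by (cases "0 \<le> h x") (auto simp: ennreal_neg ennreal_eq_0_iff)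
  qed
  then show ?thesis by (rule AE_completion)
qed

lemma AE_zero_if_box_integrals_zero:
  fixes g :: "'a::euclidean_space \<Rightarrow> complex"
  assumes g: "\<And>a b. integrable lebesgue (\<lambda>x. indicator (box a b) x * g x)"
    and zero: "\<And>a b. (\<integral>x. indicator (box a b) x * g x \<partial>lebesgue) = 0"
    and gm [measurable]: "g \<in> borel_measurable lebesgue"
  shows "AE x in lebesgue. g x = 0"
proof -
  have *: "Re (indicator S x * w) = indicator S x * Re w" "Im (indicator S x * w) = indicator S x * Im w" for S :: "'a set" and x w
    by (auto split: split_indicator)
  have "AE x in lebesgue. Re (g x) = 0"
    by (rule AE_zero_if_box_integrals_zero_real)
      (use integrable_Re[OF g, unfolded *] integral_Re[OF g, unfolded *] zero in auto)
  moreover have "AE x in lebesgue. Im (g x) = 0"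
    by (rule AE_zero_if_box_integrals_zero_real)
      (use integrable_Im[OF g, unfolded *] integral_Im[OF g, unfolded *] zero in auto)
  ultimately show ?thesis by eventually_elim (simp add: complex_eq_iff)
qed

lemma square_integrable_indicator_box: "square_integrable (indicator (box a b))"
proof -
  have "(\<lambda>x. (cmod (indicator (box a b) x))\<^sup>2) = indicat_real (box a b)"
    by (auto simp: fun_eq_iff split: split_indicator)
  then show ?thesis
    using lmeasurable_box[of a b] by (auto simp: square_integrable_def fmeasurable_def intro!: borel_measurable_indicator integrable_real_indicator)
qed

lemma integrable_indicator_box_mult:
  assumes "square_integrable g"
  shows "integrable lebesgue (\<lambda>x. indicator (box a b) x * g x)"
proof -
  have "square_integrable (\<lambda>x. cnj (g x))" using assms by (auto simp: square_integrable_def)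
  from integrable_mult_cnj[OF square_integrable_indicator_box this] show ?thesis by simp
qed

lemma L2_zero_if_orthogonal_to_boxes:
  assumes "\<And>a b. cinner_L2 f (abs_L2 (indicator (box a b))) = 0"
  shows "f = 0"
proof -
  have "(\<integral>x. indicator (box a b) x * rep_L2 f x \<partial>lebesgue) = 0" for a b
  proof -
    have "(\<integral>x. rep_L2 f x * cnj (indicator (box a b) x) \<partial>lebesgue) = 0"
      using assms[of a b] cinner_L2_abs[OF square_integrable_rep_L2[of f] square_integrable_indicator_box]
      by simp
    moreover have "rep_L2 f x * cnj (indicator (box a b) x) = indicator (box a b) x * rep_L2 f x" for x
      by (auto split: split_indicator)
    ultimately show ?thesis by simp
  qed
  then have "AE x in lebesgue. rep_L2 f x = 0"
    by (intro AE_zero_if_box_integrals_zero integrable_indicator_box_mult square_integrable_rep_L2) auto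
  then show ?thesis
    unfolding L2_eq_iff using rep_L2_zero by eventually_elim simp
qed

section \<open>Fourier transforms of intervals\<close>

text \<open>The function (1 - cos x) / x^2 with its removable singularity at 0 filled in by 1/2;
  writing it through \<open>sinc\<close> makes it continuous everywhere.\<close>

definition sinc_sq :: "real \<Rightarrow> real" where "sinc_sq x = (sinc (x / 2))\<^sup>2 / 2"

lemma isCont_sinc_sq: "isCont sinc_sq x"
  unfolding sinc_sq_def[abs_def]
  by (intro continuous_intros isCont_o2[of x "\<lambda>x. x / 2" sinc] isCont_sinc) simp_all

lemma sinc_sq_measurable [measurable]: "sinc_sq \<in> borel_measurable borel"
  by (intro borel_measurable_continuous_onI continuous_at_imp_continuous_on ballI isCont_sinc_sq)

lemma sinc_sq_eq: "x \<noteq> 0 \<Longrightarrow> sinc_sq x = (1 - cos x) / x\<^sup>2"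
  using cos_double_sin[of "x / 2"] by (simp add: sinc_sq_def field_simps power2_eq_square)

lemma has_bochner_integral_sinc_sq: "has_bochner_integral lborel sinc_sq pi"
proof -
  \<comment> \<open>Integration by parts in closed form: Si x - (1 - cos x) / x is an antiderivative
    of \<open>sinc_sq\<close>, and its limit at infinity is that of Si, namely pi / 2.\<close>
  define P where "P x = Si x - x * sinc_sq x" for x
  have xs: "x * sinc_sq x = (1 - cos x) / x" for x
    by (cases "x = 0") (simp_all add: sinc_sq_eq power2_eq_square)
  have "(P has_real_derivative sinc_sq x) (at x)" for x
  proof (cases "x = 0")
    case True
    have "((\<lambda>x. x * sinc_sq x) has_real_derivative sinc_sq 0) (at 0)"
      \<comment> \<open>Caratheodory's criterion at 0: x times a continuous function has there the
        value of that function as derivative. Subtracted from Si' = 1 it leaves 1 - 1/2 =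
        \<open>sinc_sq\<close> 0.\<close>
      unfolding CARAT_DERIV by (intro exI[of _ sinc_sq]) (simp add: isCont_sinc_sq)
    from DERIV_diff[OF DERIV_Si[of 0] this] show ?thesis
      by (simp add: P_def[abs_def] True sinc_sq_def)
  next
    case False
    have "((\<lambda>x. (1 - cos x) / x) has_real_derivative (sin x * x - (1 - cos x)) / x\<^sup>2) (at x)"
      using False by (auto intro!: derivative_eq_intros simp: power2_eq_square)
    from DERIV_diff[OF DERIV_Si[of x] this] show ?thesis
      using False by (simp add: P_def[abs_def] xs sinc_sq_eq field_simps power2_eq_square)
  qed
  moreover have "(P \<longlongrightarrow> pi / 2 - 0) at_top"
    unfolding P_def[abs_def]
  proof (intro tendsto_diff Si_at_top)
    have "((\<lambda>x. 2 / x :: real) \<longlongrightarrow> 0) at_top"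
      by (intro tendsto_divide_0[OF tendsto_const] filterlim_at_top_imp_at_infinity filterlim_ident)
    then show "((\<lambda>x. x * sinc_sq x) \<longlongrightarrow> 0) at_top"
    proof (rule Lim_null_comparison[rotated])
      show "\<forall>\<^sub>F x in at_top. norm (x * sinc_sq x) \<le> 2 / x"
        using eventually_gt_at_top[of 0]
      proof eventually_elim
        case (elim x)
        have "0 \<le> 1 - cos x" "1 - cos x \<le> 2" using cos_ge_minus_one[of x] by auto
        then show ?case using elim by (simp add: xs divide_right_mono)
      qed
    qed
  qed
  ultimately have "(\<integral>\<^sup>+x. ennreal (sinc_sq x) * indicator {0..} x \<partial>lborel) = pi / 2 - P 0"
    by (intro nn_integral_FTC_atLeast) (auto simp: sinc_sq_def)
  moreover have "P 0 = 0" by (simp add: P_def Si_def zero_ereal_def)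
  ultimately have pos: "(\<integral>\<^sup>+x. ennreal (sinc_sq x) * indicator {0..} x \<partial>lborel) = ennreal (pi / 2)" by simp
  have "(\<integral>\<^sup>+x. ennreal (sinc_sq x) * indicator {..0} x \<partial>lborel)
      = ennreal \<bar>-1\<bar> * (\<integral>\<^sup>+x. ennreal (sinc_sq (0 + -1 * x)) * indicator {..0} (0 + -1 * x) \<partial>lborel)"
    by (rule nn_integral_real_affine) auto
  also have "\<dots> = (\<integral>\<^sup>+x. ennreal (sinc_sq x) * indicator {0..} x \<partial>lborel)"
    by (auto intro!: nn_integral_cong simp: sinc_sq_def split: split_indicator)
  finally have neg: "(\<integral>\<^sup>+x. ennreal (sinc_sq x) * indicator {..0} x \<partial>lborel) = ennreal (pi / 2)"
    using pos by simp
  have "(\<integral>\<^sup>+x. ennreal (sinc_sq x) \<partial>lborel)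
      = (\<integral>\<^sup>+x. ennreal (sinc_sq x) * indicator {0..} x + ennreal (sinc_sq x) * indicator {..0} x \<partial>lborel)"
    using AE_lborel_singleton[of "0::real"]
    by (intro nn_integral_cong_AE) (auto split: split_indicator)
  also have "\<dots> = ennreal pi"
    by (subst nn_integral_add) (auto simp: pos neg simp flip: ennreal_plus)
  finally show ?thesis
    by (intro has_bochner_integral_nn_integral) (auto simp: sinc_sq_def)
qed

text \<open>The function t^2 \<open>sinc_sq\<close> (t \<xi>), except at \<xi> = 0 where division by
  zero gives 0; identities between the two hold almost everywhere.\<close>

definition cosine_kernel :: "real \<Rightarrow> real \<Rightarrow> real" where
  "cosine_kernel t \<xi> = (1 - cos (t * \<xi>)) / \<xi>\<^sup>2"

lemma has_bochner_integral_cosine_kernel: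
  "has_bochner_integral lborel (cosine_kernel t) (pi * \<bar>t\<bar>)"
proof (cases "t = 0")
  case True
  then show ?thesis by (simp add: cosine_kernel_def[abs_def] has_bochner_integral_zero)
next
  case False
  have "has_bochner_integral lborel (\<lambda>x. sinc_sq (0 + t * x)) (pi /\<^sub>R \<bar>t\<bar>)"
    using lborel_has_bochner_integral_real_affine_iff[OF False, of sinc_sq pi 0] has_bochner_integral_sinc_sq
    by blast
  then have "has_bochner_integral lborel (\<lambda>x. t\<^sup>2 * sinc_sq (0 + t * x)) (t\<^sup>2 * (pi /\<^sub>R \<bar>t\<bar>))"
    by (rule has_bochner_integral_mult_right)
  moreover have "t\<^sup>2 * (pi /\<^sub>R \<bar>t\<bar>) = pi * \<bar>t\<bar>"
    using False by (simp add: field_simps power2_eq_square flip: abs_mult)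
  moreover have "has_bochner_integral lborel (\<lambda>x. t\<^sup>2 * sinc_sq (0 + t * x)) x
      \<longleftrightarrow> has_bochner_integral lborel (cosine_kernel t) x" for x
    using AE_lborel_singleton[of "0::real"] False
    by (intro has_bochner_integral_cong_AE)
       (auto simp: cosine_kernel_def[abs_def] sinc_sq_eq power_mult_distrib field_simps)
  ultimately show ?thesis by metis
qed

definition fourier_interval :: "real \<Rightarrow> real \<Rightarrow> real \<Rightarrow> complex" where
  "fourier_interval a b \<xi> = (\<integral>x. exp (- (\<i> * of_real (x * \<xi>))) * indicator {a<..<b} x \<partial>lborel)"

lemma fourier_interval_measurable [measurable]: "fourier_interval a b \<in> borel_measurable borel"
  unfolding fourier_interval_def[abs_def] by measurable

lemma fourier_interval_empty: "\<not> a \<le> b \<Longrightarrow> fourier_interval a b \<xi> = 0"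
  by (simp add: fourier_interval_def)

lemma imaginary_mult_imaginary: "\<i> * (z * \<i>) = - z" "\<i> * z * (\<i> * w) = - (z * w)"
proof -
  have "\<i> * (z * \<i>) = (\<i> * \<i>) * z" "\<i> * z * (\<i> * w) = (\<i> * \<i>) * (z * w)"
    by (simp_all only: mult_ac)
  then show "\<i> * (z * \<i>) = - z" "\<i> * z * (\<i> * w) = - (z * w)" by simp_all
qed

lemma fourier_interval_eq:
  assumes "a \<le> b" "\<xi> \<noteq> 0"
  shows "fourier_interval a b \<xi> = (cis (- (a * \<xi>)) - cis (- (b * \<xi>))) / (\<i> * of_real \<xi>)"
proof -
  let ?F = "\<lambda>z. exp (- (\<i> * (z * of_real \<xi>))) / (- (\<i> * of_real \<xi>))"
  have "(?F has_field_derivative exp (- (\<i> * (z * of_real \<xi>)))) (at z)" for z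
    using assms(2) by (auto intro!: derivative_eq_intros simp: imaginary_mult_imaginary)
  then have "((\<lambda>x. ?F (of_real x)) has_vector_derivative exp (- (\<i> * (of_real x * of_real \<xi>)))) (at x within {a..b})" for x
    by (rule has_vector_derivative_real_field)
  moreover have "continuous_on {a..b} (\<lambda>x. exp (- (\<i> * (of_real x * of_real \<xi>))))"
    by (intro continuous_intros)
  ultimately have "(\<integral>x. indicator {a..b} x *\<^sub>R exp (- (\<i> * (of_real x * of_real \<xi>))) \<partial>lborel)
      = ?F (of_real b) - ?F (of_real a)"
    using assms(1) by (intro integral_FTC_Icc) auto
  moreover have "fourier_interval a b \<xi> = (\<integral>x. indicator {a..b} x *\<^sub>R exp (- (\<i> * (of_real x * of_real \<xi>))) \<partial>lborel)"
    unfolding fourier_interval_def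
  proof (rule integral_cong_AE)
    show "AE x in lborel. exp (- (\<i> * of_real (x * \<xi>))) * indicator {a<..<b} x =
        indicator {a..b} x *\<^sub>R exp (- (\<i> * (of_real x * of_real \<xi>)))"
      using AE_lborel_singleton[of a] AE_lborel_singleton[of b]
      by eventually_elim (auto split: split_indicator)
  qed measurable
  moreover have "?F (of_real b) - ?F (of_real a) = (cis (- (a * \<xi>)) - cis (- (b * \<xi>))) / (\<i> * of_real \<xi>)"
    using assms(2) by (simp add: cis_conv_exp field_simps)
  ultimately show ?thesis by simp
qed

text \<open>Expanding the product gives four exponentials over \<xi>^2 with signs adding up to 0.
  The constants 1 in the four kernels therefore cancel, and a quotient singular term by term becomes
  a combination of integrable kernels.\<close>

lemma Re_fourier_interval_mult_cnj:
  assumes "a \<le> b" "c \<le> d" "\<xi> \<noteq> 0"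
  shows "Re (fourier_interval a b \<xi> * cnj (fourier_interval c d \<xi>))
    = cosine_kernel (d - a) \<xi> + cosine_kernel (c - b) \<xi> - cosine_kernel (c - a) \<xi> - cosine_kernel (d - b) \<xi>"
proof -
  have "fourier_interval a b \<xi> * cnj (fourier_interval c d \<xi>)
      = ((cis (- (a * \<xi>)) - cis (- (b * \<xi>))) * (cis (c * \<xi>) - cis (d * \<xi>))) / of_real (\<xi>\<^sup>2)"
    using assms by (simp add: fourier_interval_eq cis_cnj power2_eq_square imaginary_mult_imaginary)
  also have "(cis (- (a * \<xi>)) - cis (- (b * \<xi>))) * (cis (c * \<xi>) - cis (d * \<xi>))
      = cis ((c - a) * \<xi>) - cis ((d - a) * \<xi>) - cis ((c - b) * \<xi>) + cis ((d - b) * \<xi>)"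
    by (simp add: algebra_simps cis_mult)
  finally have "Re (fourier_interval a b \<xi> * cnj (fourier_interval c d \<xi>))
      = Re (cis ((c - a) * \<xi>) - cis ((d - a) * \<xi>) - cis ((c - b) * \<xi>) + cis ((d - b) * \<xi>)) / \<xi>\<^sup>2"
    by (simp only: Re_divide_of_real)
  then show ?thesis
    by (simp only: cosine_kernel_def plus_complex.sel minus_complex.sel cis.sel diff_divide_distrib add_divide_distrib)
qed

lemma fourier_interval_square_integrable: "integrable lborel (\<lambda>\<xi>. (cmod (fourier_interval a b \<xi>))\<^sup>2)"
proof (cases "a \<le> b")
  case True
  let ?k = "\<lambda>\<xi>. cosine_kernel (b - a) \<xi> + cosine_kernel (a - b) \<xi> - cosine_kernel (a - a) \<xi> - cosine_kernel (b - b) \<xi>"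
  have k: "integrable lborel ?k"
    using has_bochner_integral_cosine_kernel by (intro Bochner_Integration.integrable_diff Bochner_Integration.integrable_add) (auto simp: has_bochner_integral_iff)
  show ?thesis
  proof (rule integrable_cong_AE_imp[OF k])
    show "AE \<xi> in lborel. ?k \<xi> = (cmod (fourier_interval a b \<xi>))\<^sup>2"
      using AE_lborel_singleton[of "0::real"]
    proof eventually_elim
      case (elim \<xi>)
      have "Re (fourier_interval a b \<xi> * cnj (fourier_interval a b \<xi>)) = (cmod (fourier_interval a b \<xi>))\<^sup>2"
        by (simp only: complex_norm_square[symmetric] Re_complex_of_real)
      then show ?case using Re_fourier_interval_mult_cnj[OF True True elim] by simp
    qed
  qed measurable
qed (simp add: fourier_interval_empty)

lemma integrable_mult_cnj_general:
  fixes f g :: "'b \<Rightarrow> complex"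
  assumes [measurable]: "f \<in> borel_measurable M" "g \<in> borel_measurable M"
    and "integrable M (\<lambda>x. (cmod (f x))\<^sup>2)" "integrable M (\<lambda>x. (cmod (g x))\<^sup>2)"
  shows "integrable M (\<lambda>x. f x * cnj (g x))"
proof (rule Bochner_Integration.integrable_bound)
  show "integrable M (\<lambda>x. (cmod (f x))\<^sup>2 + (cmod (g x))\<^sup>2)" using assms(3,4) by simp
  show "AE x in M. norm (f x * cnj (g x)) \<le> norm ((cmod (f x))\<^sup>2 + (cmod (g x))\<^sup>2)"
  proof (rule AE_I2)
    fix x
    have "0 \<le> cmod (f x) * cmod (g x)" by simp
    then have "cmod (f x) * cmod (g x) \<le> (cmod (f x))\<^sup>2 + (cmod (g x))\<^sup>2"
      using sum_squares_bound[of "cmod (f x)" "cmod (g x)"] by linarith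
    then show "norm (f x * cnj (g x)) \<le> norm ((cmod (f x))\<^sup>2 + (cmod (g x))\<^sup>2)"
      by (simp add: norm_mult)
  qed
qed measurable

text \<open>The imaginary part vanishes because replacing \<xi> by - \<xi> conjugates the integrand.
  The real part is pi times |d - a| + |c - b| - |c - a| - |d - b|, and this combination is twice the
  length of the overlap of the intervals.\<close>

lemma fourier_interval_inner:
  "integrable lborel (\<lambda>\<xi>. fourier_interval a b \<xi> * cnj (fourier_interval c d \<xi>))"
  "(\<integral>\<xi>. fourier_interval a b \<xi> * cnj (fourier_interval c d \<xi>) \<partial>lborel)
     = of_real (2 * pi) * (\<integral>x. indicator {a<..<b} x * indicator {c<..<d} x \<partial>lborel)" (is "?lhs = _")
proof -
  show int: "integrable lborel (\<lambda>\<xi>. fourier_interval a b \<xi> * cnj (fourier_interval c d \<xi>))"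
    by (intro integrable_mult_cnj_general fourier_interval_square_integrable) measurable
  show "?lhs = of_real (2 * pi) * (\<integral>x. indicator {a<..<b} x * indicator {c<..<d} x \<partial>lborel)"
  proof (cases "a \<le> b \<and> c \<le> d")
    case True
    then have ab: "a \<le> b" "c \<le> d" by auto
    have sym: "fourier_interval p q (- \<xi>) = cnj (fourier_interval p q \<xi>)" for p q \<xi>
      unfolding fourier_interval_def Bochner_Integration.integral_cnj[symmetric]
      by (rule Bochner_Integration.integral_cong[OF refl]) (auto simp: exp_cnj split: split_indicator)
    have "?lhs = \<bar>-1\<bar> *\<^sub>R (\<integral>\<xi>. fourier_interval a b (0 + -1 * \<xi>) * cnj (fourier_interval c d (0 + -1 * \<xi>)) \<partial>lborel)"
      by (rule lborel_integral_real_affine) simp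
    also have "\<dots> = cnj ?lhs"
      unfolding Bochner_Integration.integral_cnj[symmetric] by (simp add: sym mult.commute)
    finally have im: "Im ?lhs = 0" by (metis Reals_cnj_iff complex_is_Real_iff)
    let ?k = "\<lambda>\<xi>. cosine_kernel (d - a) \<xi> + cosine_kernel (c - b) \<xi> - cosine_kernel (c - a) \<xi> - cosine_kernel (d - b) \<xi>"
    have "has_bochner_integral lborel ?k (pi * \<bar>d - a\<bar> + pi * \<bar>c - b\<bar> - pi * \<bar>c - a\<bar> - pi * \<bar>d - b\<bar>)"
      by (intro has_bochner_integral_add has_bochner_integral_diff has_bochner_integral_cosine_kernel)
    then have k: "?k \<in> borel_measurable lborel"
      "(\<integral>\<xi>. ?k \<xi> \<partial>lborel) = pi * \<bar>d - a\<bar> + pi * \<bar>c - b\<bar> - pi * \<bar>c - a\<bar> - pi * \<bar>d - b\<bar>"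
      unfolding has_bochner_integral_iff by auto
    have "Re ?lhs = (\<integral>\<xi>. Re (fourier_interval a b \<xi> * cnj (fourier_interval c d \<xi>)) \<partial>lborel)"
      by (rule integral_Re[OF int, symmetric])
    also have "\<dots> = (\<integral>\<xi>. ?k \<xi> \<partial>lborel)"
    proof (rule integral_cong_AE)
      show "AE \<xi> in lborel. Re (fourier_interval a b \<xi> * cnj (fourier_interval c d \<xi>)) = ?k \<xi>"
        using AE_lborel_singleton[of "0::real"] by eventually_elim (rule Re_fourier_interval_mult_cnj[OF ab])
    qed (use k in auto)
    also have "\<dots> = 2 * pi * max 0 (min b d - max a c)"
    proof -
      have "\<bar>d - a\<bar> + \<bar>c - b\<bar> - \<bar>c - a\<bar> - \<bar>d - b\<bar> = 2 * max 0 (min b d - max a c)"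
        using ab by (auto simp: max_def min_def abs_if)
      moreover have "pi * \<bar>d - a\<bar> + pi * \<bar>c - b\<bar> - pi * \<bar>c - a\<bar> - pi * \<bar>d - b\<bar>
          = pi * (\<bar>d - a\<bar> + \<bar>c - b\<bar> - \<bar>c - a\<bar> - \<bar>d - b\<bar>)"
        by (simp only: right_diff_distrib distrib_left)
      ultimately show ?thesis unfolding k by (simp only: mult_ac)
    qed
    finally have re: "Re ?lhs = 2 * pi * max 0 (min b d - max a c)" .
    have len: "(\<integral>x. complex_of_real (indicator {q<..<r} x) \<partial>lborel) = of_real (max 0 (r - q))" for q r :: real
      by (cases "q \<le> r") simp_all
    have "(\<integral>x. indicator {a<..<b} x * indicator {c<..<d} x \<partial>lborel) = (\<integral>x. complex_of_real (indicator {max a c<..<min b d} x) \<partial>lborel)"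
      by (rule Bochner_Integration.integral_cong[OF refl]) (auto split: split_indicator)
    also have "\<dots> = of_real (max 0 (min b d - max a c))"
      by (rule len)
    finally have "of_real (2 * pi) * (\<integral>x. indicator {a<..<b} x * indicator {c<..<d} x \<partial>lborel)
        = complex_of_real (2 * pi * max 0 (min b d - max a c))" by (simp only: of_real_mult)
    then show ?thesis using re im by (simp only: complex_eq_iff Re_complex_of_real Im_complex_of_real simp_thms)
  qed (auto simp: fourier_interval_empty)
qed

lemma lborel_prod:
  fixes f :: "'a::euclidean_space \<Rightarrow> real \<Rightarrow> complex"
  assumes "\<And>b. b \<in> Basis \<Longrightarrow> integrable lborel (f b)"
  shows "integrable lborel (\<lambda>x. \<Prod>b\<in>Basis. f b (x \<bullet> b))" (is "?I")
    and "(\<integral>x. (\<Prod>b\<in>Basis. f b (x \<bullet> b)) \<partial>lborel) = (\<Prod>b\<in>Basis. \<integral>x. f b x \<partial>lborel)" (is "?E")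
proof -
  interpret product_sigma_finite "\<lambda>_::'a. lborel :: real measure"
    by (simp add: product_sigma_finite_def sigma_finite_lborel)
  have [measurable]: "f b \<in> borel_measurable borel" if "b \<in> Basis" for b
    using borel_measurable_integrable[OF assms[OF that]] by simp
  have m: "(\<lambda>x. \<Prod>b\<in>Basis. f b (x \<bullet> b)) \<in> borel_measurable borel"
  proof (rule borel_measurable_prod)
    fix b :: 'a assume b: "b \<in> Basis"
    have "(\<lambda>x::'a. x \<bullet> b) \<in> borel_measurable borel" by simp
    then show "(\<lambda>x. f b (x \<bullet> b)) \<in> borel_measurable borel"
      by (rule measurable_compose) (use b in measurable)
  qed
  have T: "(\<lambda>f. \<Sum>b\<in>Basis. f b *\<^sub>R b) \<in> (\<Pi>\<^sub>M b\<in>(Basis::'a set). lborel) \<rightarrow>\<^sub>M borel"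
    by measurable
  have eq: "(\<Prod>b\<in>Basis. f b ((\<Sum>c\<in>Basis. g c *\<^sub>R c) \<bullet> b)) = (\<Prod>b\<in>Basis. f b (g b))" for g
    by (intro prod.cong refl) simp
  show ?I
    by (subst lborel_eq, subst integrable_distr_eq[OF T m])
       (simp only: eq, intro product_integrable_prod assms finite_Basis)
  show ?E
    by (subst lborel_eq, subst integral_distr[OF T m])
       (simp only: eq, intro product_integral_prod assms finite_Basis)
qed

section \<open>The Plancherel theorem\<close>

text \<open>\<open>fourier\<close> integrates against the completed measure, so Fubini is applied to
  the product of \<open>lebesgue\<close> with itself.\<close>

lemma sigma_finite_lebesgue: "sigma_finite_measure (lebesgue :: 'a::euclidean_space measure)"
proof -
  obtain A :: "'a set set" where A: "countable A" "A \<subseteq> sets lborel" "\<Union>A = space lborel" "\<forall>a\<in>A. emeasure lborel a \<noteq> \<infinity>"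
    using sigma_finite_measure.sigma_finite_countable[OF sigma_finite_lborel] by blast
  have "emeasure lebesgue a \<noteq> \<infinity>" if "a \<in> A" for a
  proof -
    have "emeasure (completion lborel) a = emeasure lborel a"
      using A(2) that by (auto simp: emeasure_completion main_part_sets)
    then show ?thesis using A(4) that by simp
  qed
  then show ?thesis
    by (intro sigma_finite_measure.intro exI[of _ A]) (use A in \<open>auto intro: sets_completionI_sets\<close>)
qed

lemma lebesgue_measurable_of_borel: "f \<in> borel_measurable borel \<Longrightarrow> f \<in> borel_measurable lebesgue"
  by (intro measurable_completion) simp

lemma integrable_exp_indicator:
  "integrable lborel (\<lambda>x. exp (- (\<i> * of_real (x * t))) * indicator {a<..<b::real} x)"
proof (rule Bochner_Integration.integrable_bound)
  show "integrable lborel (indicat_real {a<..<b})"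
    by (cases "a \<le> b") (auto simp: integrable_indicator_iff)
qed (auto simp: norm_mult split: split_indicator)

lemma indicator_box_eq_prod:
  fixes x :: "'a::euclidean_space"
  shows "(indicator (box a b) x :: complex) = (\<Prod>j\<in>Basis. indicator {a \<bullet> j<..<b \<bullet> j} (x \<bullet> j))"
proof (cases "x \<in> box a b")
  case True
  then show ?thesis by (simp add: mem_box)
next
  case False
  then obtain j where "j \<in> Basis" "x \<bullet> j \<notin> {a \<bullet> j<..<b \<bullet> j}" by (auto simp: mem_box)
  then have "(\<Prod>j\<in>Basis. indicator {a \<bullet> j<..<b \<bullet> j} (x \<bullet> j) :: complex) = 0"
    by (intro prod_zero bexI[of _ j]) auto
  then show ?thesis using False by simp
qed

lemma fourier_indicator_box:
  "fourier (indicator (box a b)) \<xi> = (\<Prod>j\<in>Basis. fourier_interval (a \<bullet> j) (b \<bullet> j) (\<xi> \<bullet> j))"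
proof -
  have eq: "exp (- (\<i> * of_real (x \<bullet> \<xi>))) * indicator (box a b) x
      = (\<Prod>j\<in>Basis. exp (- (\<i> * of_real ((x \<bullet> j) * (\<xi> \<bullet> j)))) * indicator {a \<bullet> j<..<b \<bullet> j} (x \<bullet> j))" for x
  proof -
    have "- (\<i> * complex_of_real (x \<bullet> \<xi>)) = (\<Sum>j\<in>Basis. - (\<i> * of_real ((x \<bullet> j) * (\<xi> \<bullet> j))))"
      by (simp add: euclidean_inner[of x \<xi>] sum_distrib_left sum_negf)
    then have "exp (- (\<i> * complex_of_real (x \<bullet> \<xi>))) = (\<Prod>j\<in>Basis. exp (- (\<i> * of_real ((x \<bullet> j) * (\<xi> \<bullet> j)))))"
      by (simp add: exp_sum)
    then show ?thesis by (simp add: indicator_box_eq_prod prod.distrib)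
  qed
  have "fourier (indicator (box a b)) \<xi> = (\<integral>x. exp (- (\<i> * of_real (x \<bullet> \<xi>))) * indicator (box a b) x \<partial>lborel)"
    unfolding fourier_def by (intro integral_completion) measurable
  then show ?thesis
    unfolding eq lborel_prod(2)[OF integrable_exp_indicator] by (simp add: fourier_interval_def)
qed

lemma fourier_box_measurable [measurable]: "fourier (indicator (box a b)) \<in> borel_measurable borel"
proof -
  have "(\<lambda>\<xi>. \<Prod>j\<in>Basis. fourier_interval (a \<bullet> j) (b \<bullet> j) (\<xi> \<bullet> j)) \<in> borel_measurable borel"
    by measurable
  then show ?thesis by (simp add: fourier_indicator_box[abs_def])
qed

text \<open>Both integrands factor over the coordinates, and the one-dimensional identity
  contributes a factor 2 pi for each of them.\<close>

lemma fourier_box_inner: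
  fixes a b c d :: "real^'n"
  shows "integrable lebesgue (\<lambda>\<xi>. fourier (indicator (box a b)) \<xi> * cnj (fourier (indicator (box c d)) \<xi>))"
    and "(\<integral>\<xi>. fourier (indicator (box a b)) \<xi> * cnj (fourier (indicator (box c d)) \<xi>) \<partial>lebesgue)
      = of_real ((2 * pi) ^ CARD('n)) * (\<integral>x. indicator (box a b) x * cnj (indicator (box c d) x) \<partial>lebesgue)"
proof -
  let ?f = "\<lambda>j t. fourier_interval (a \<bullet> j) (b \<bullet> j) t * cnj (fourier_interval (c \<bullet> j) (d \<bullet> j) t)"
  let ?g = "\<lambda>j t. indicator {a \<bullet> j<..<b \<bullet> j} t * indicator {c \<bullet> j<..<d \<bullet> j} t :: complex"
  have eq: "fourier (indicator (box a b)) \<xi> * cnj (fourier (indicator (box c d)) \<xi>) = (\<Prod>j\<in>Basis. ?f j (\<xi> \<bullet> j))" for \<xi>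
    by (simp add: fourier_indicator_box prod.distrib)
  have eq2: "indicator (box a b) x * cnj (indicator (box c d) x) = (\<Prod>j\<in>Basis. ?g j (x \<bullet> j))" for x
  proof -
    have "cnj (indicator (box c d) x) = indicator (box c d) x" by (auto split: split_indicator)
    then show ?thesis by (simp add: indicator_box_eq_prod prod.distrib)
  qed
  have fi: "integrable lborel (?f j)" for j by (rule fourier_interval_inner)
  have gi: "integrable lborel (?g j)" for j
    using integrable_exp_indicator[of 0 "max (a \<bullet> j) (c \<bullet> j)" "min (b \<bullet> j) (d \<bullet> j)"]
    by (rule Bochner_Integration.integrable_cong[THEN iffD1, rotated 2]) (auto split: split_indicator)
  show "integrable lebesgue (\<lambda>\<xi>. fourier (indicator (box a b)) \<xi> * cnj (fourier (indicator (box c d)) \<xi>))"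
    by (subst integrable_completion) (use lborel_prod(1)[of ?f, OF fi] in \<open>simp_all add: eq\<close>)
  have "(\<integral>\<xi>. fourier (indicator (box a b)) \<xi> * cnj (fourier (indicator (box c d)) \<xi>) \<partial>lebesgue)
      = (\<Prod>j\<in>Basis. \<integral>t. ?f j t \<partial>lborel)"
    by (subst integral_completion) (use lborel_prod(2)[of ?f, OF fi] in \<open>simp_all add: eq\<close>)
  also have "\<dots> = (\<Prod>j\<in>(Basis::(real^'n) set). of_real (2 * pi) * (\<integral>t. ?g j t \<partial>lborel))"
    by (simp only: fourier_interval_inner(2))
  also have "\<dots> = of_real ((2 * pi) ^ CARD('n)) * (\<Prod>j\<in>Basis. \<integral>t. ?g j t \<partial>lborel)"
    by (simp add: prod.distrib)
  also have "(\<Prod>j\<in>Basis. \<integral>t. ?g j t \<partial>lborel) = (\<integral>x. indicator (box a b) x * cnj (indicator (box c d) x) \<partial>lebesgue)"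
    by (subst integral_completion) (use lborel_prod(2)[of ?g, OF gi] in \<open>simp_all add: eq2\<close>)
  finally show "(\<integral>\<xi>. fourier (indicator (box a b)) \<xi> * cnj (fourier (indicator (box c d)) \<xi>) \<partial>lebesgue)
      = of_real ((2 * pi) ^ CARD('n)) * (\<integral>x. indicator (box a b) x * cnj (indicator (box c d) x) \<partial>lebesgue)" .
qed

lemma square_integrable_fourier_box: "square_integrable (fourier (indicator (box a b)))"
proof -
  have "integrable lebesgue (\<lambda>\<xi>. Re (fourier (indicator (box a b)) \<xi> * cnj (fourier (indicator (box a b)) \<xi>)))"
    by (intro integrable_Re fourier_box_inner)
  then show ?thesis
    by (simp add: square_integrable_def lebesgue_measurable_of_borel complex_norm_square[symmetric] del: of_real_power times_complex.sel)
qed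

lemma integrable_indicator_box: "integrable lebesgue (indicator (box a b) :: 'a::euclidean_space \<Rightarrow> complex)"
proof -
  have "integrable lebesgue (\<lambda>x. complex_of_real (indicat_real (box a b) x))"
    using lmeasurable_box[of a b] by (intro integrable_of_real) (auto simp: fmeasurable_def intro!: integrable_real_indicator)
  then show ?thesis by (simp add: of_real_indicator)
qed

lemma integrable_fourier_integrand:
  fixes F :: "real^'n \<Rightarrow> complex"
  assumes "integrable lebesgue F"
  shows "integrable lebesgue (\<lambda>x. exp (- (\<i> * of_real (x \<bullet> \<xi>))) * F x)"
proof (rule Bochner_Integration.integrable_bound[OF assms])
  have [measurable]: "F \<in> borel_measurable lebesgue" using assms by auto
  have "(\<lambda>x::real^'n. exp (- (\<i> * of_real (x \<bullet> \<xi>)))) \<in> borel_measurable lebesgue"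
    by (rule lebesgue_measurable_of_borel) measurable
  then show "(\<lambda>x. exp (- (\<i> * of_real (x \<bullet> \<xi>))) * F x) \<in> borel_measurable lebesgue" by measurable
qed (simp add: norm_mult)

text \<open>Fubini for an integrand dominated by |F(x)| |G(\<xi>)|. With G the indicator of a box
  the right-hand side is continuous in F for the L2 norm, so such pairings determine the extension
  to L2.\<close>

lemma fourier_multiplication_formula:
  fixes F G :: "real^'n \<Rightarrow> complex"
  assumes F: "integrable lebesgue F" and G: "integrable lebesgue G"
  shows "(\<integral>\<xi>. fourier F \<xi> * G \<xi> \<partial>lebesgue) = (\<integral>x. F x * fourier G x \<partial>lebesgue)"
proof -
  interpret sigma_finite_measure "lebesgue :: (real^'n) measure" by (rule sigma_finite_lebesgue)
  interpret pair_sigma_finite "lebesgue :: (real^'n) measure" "lebesgue :: (real^'n) measure" ..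
  have [measurable]: "F \<in> borel_measurable lebesgue" "G \<in> borel_measurable lebesgue"
    using assms by auto
  have [measurable]: "(\<lambda>x. x) \<in> (lebesgue :: (real^'n) measure) \<rightarrow>\<^sub>M borel"
    by (rule lebesgue_measurable_of_borel) simp
  let ?h = "\<lambda>x \<xi>. exp (- (\<i> * of_real (x \<bullet> \<xi>))) * F x * G \<xi>"
  have m: "(\<lambda>p. ?h (fst p) (snd p)) \<in> borel_measurable (lebesgue \<Otimes>\<^sub>M lebesgue)"
  proof -
    have "(\<lambda>p. fst p :: real^'n) \<in> borel_measurable (lebesgue \<Otimes>\<^sub>M (lebesgue :: (real^'n) measure))"
      "(\<lambda>p. snd p :: real^'n) \<in> borel_measurable ((lebesgue :: (real^'n) measure) \<Otimes>\<^sub>M lebesgue)"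
      by measurable
    then have "(\<lambda>p. fst p \<bullet> snd p :: real) \<in> borel_measurable ((lebesgue :: (real^'n) measure) \<Otimes>\<^sub>M (lebesgue :: (real^'n) measure))"
      by (rule borel_measurable_inner)
    then show ?thesis by measurable
  qed
  have int: "integrable (lebesgue \<Otimes>\<^sub>M lebesgue) (\<lambda>(x, \<xi>). ?h x \<xi>)"
  proof (rule Fubini_integrable)
    show "(\<lambda>(x, \<xi>). ?h x \<xi>) \<in> borel_measurable (lebesgue \<Otimes>\<^sub>M lebesgue)"
      using m by (simp add: split_beta)
    have "integrable lebesgue (\<lambda>x. cmod (F x) * (\<integral>\<xi>. cmod (G \<xi>) \<partial>lebesgue))"
      using F by (intro integrable_mult_left integrable_norm) auto
    then show "integrable lebesgue (\<lambda>x. \<integral>\<xi>. norm (case (x, \<xi>) of (x, \<xi>) \<Rightarrow> ?h x \<xi>) \<partial>lebesgue)"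
      by (simp add: norm_mult)
    have "integrable lebesgue (\<lambda>\<xi>. ?h x \<xi>)" for x
      using integrable_mult_right[OF integrable_fourier_integrand[OF G, of x], of "F x"]
      by (simp add: mult_ac inner_commute)
    then show "AE x in lebesgue. integrable lebesgue (\<lambda>\<xi>. case (x, \<xi>) of (x, \<xi>) \<Rightarrow> ?h x \<xi>)" by simp
  qed
  have "(\<integral>\<xi>. fourier F \<xi> * G \<xi> \<partial>lebesgue) = (\<integral>\<xi>. (\<integral>x. ?h x \<xi> \<partial>lebesgue) \<partial>lebesgue)"
    by (simp add: fourier_def)
  also have "\<dots> = (\<integral>x. (\<integral>\<xi>. ?h x \<xi> \<partial>lebesgue) \<partial>lebesgue)"
    by (rule Fubini_integral[OF int])
  also have "\<dots> = (\<integral>x. F x * fourier G x \<partial>lebesgue)"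
  proof (rule Bochner_Integration.integral_cong[OF refl])
    fix x
    have "(\<integral>\<xi>. ?h x \<xi> \<partial>lebesgue) = (\<integral>\<xi>. F x * (exp (- (\<i> * of_real (\<xi> \<bullet> x))) * G \<xi>) \<partial>lebesgue)"
      by (simp add: mult_ac inner_commute)
    then show "(\<integral>\<xi>. ?h x \<xi> \<partial>lebesgue) = F x * fourier G x" by (simp add: fourier_def)
  qed
  finally show ?thesis .
qed

lemma fourier_add:
  assumes "integrable lebesgue F" "integrable lebesgue G"
  shows "fourier (\<lambda>x. F x + G x) \<xi> = fourier F \<xi> + fourier G \<xi>"
  unfolding fourier_def using assms by (simp add: distrib_left integrable_fourier_integrand)

lemma fourier_mult: "fourier (\<lambda>x. z * F x) \<xi> = z * fourier F \<xi>"
  unfolding fourier_def by (simp add: mult.left_commute[of _ z])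

text \<open>Testing \<^const>\<open>is_fourier_L2\<close> against box indicators turns it into a relation to the fixed
  elements \<open>box_dual\<close>, which makes uniqueness, linearity and surjectivity simple.\<close>

abbreviation box_L2 :: "real^'n \<Rightarrow> real^'n \<Rightarrow> 'n::finite L2" where
  "box_L2 a b \<equiv> abs_L2 (indicator (box a b))"

definition box_dual :: "real^'n \<Rightarrow> real^'n \<Rightarrow> 'n::finite L2" where
  "box_dual a b = abs_L2 (\<lambda>x. cnj (fourier (indicator (box a b)) x))"

lemma square_integrable_cnj: "square_integrable f \<Longrightarrow> square_integrable (\<lambda>x. cnj (f x))"
  by (auto simp: square_integrable_def)

lemma cnj_indicator: "cnj (indicator S x) = indicator S x"
  by (auto split: split_indicator)

lemma is_fourier_L2_box:
  assumes "is_fourier_L2 f g"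
  shows "cinner_L2 g (box_L2 a b) = cinner_L2 f (box_dual a b)"
proof -
  obtain F where F: "\<And>k. integrable lebesgue (F k)" "\<And>k. square_integrable (F k)" "\<And>k. square_integrable (fourier (F k))"
    and lim: "(\<lambda>k. abs_L2 (F k)) \<longlonglongrightarrow> f" "(\<lambda>k. abs_L2 (fourier (F k))) \<longlonglongrightarrow> g"
    using assms unfolding is_fourier_L2_def by blast
  have eq: "cinner_L2 (abs_L2 (fourier (F k))) (box_L2 a b) = cinner_L2 (abs_L2 (F k)) (box_dual a b)" for k
    unfolding box_dual_def cinner_L2_abs[OF F(3) square_integrable_indicator_box]
      cinner_L2_abs[OF F(2) square_integrable_cnj[OF square_integrable_fourier_box]]
    using fourier_multiplication_formula[OF F(1) integrable_indicator_box] by (simp add: cnj_indicator)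
  have "(\<lambda>k. cinner_L2 (abs_L2 (fourier (F k))) (box_L2 a b)) \<longlonglongrightarrow> cinner_L2 g (box_L2 a b)"
    by (intro tendsto_cinner_L2 lim tendsto_const)
  moreover have "(\<lambda>k. cinner_L2 (abs_L2 (F k)) (box_dual a b)) \<longlonglongrightarrow> cinner_L2 f (box_dual a b)"
    by (intro tendsto_cinner_L2 lim tendsto_const)
  ultimately show ?thesis unfolding eq by (rule LIMSEQ_unique)
qed

lemma L2_eqI_boxes:
  assumes "\<And>a b. cinner_L2 f (box_L2 a b) = cinner_L2 g (box_L2 a b)"
  shows "f = g"
  using L2_zero_if_orthogonal_to_boxes[of "f - g"] assms by (simp add: cinner_L2_diff_left)

section \<open>The graph of the Fourier transform, generated by boxes\<close>

lemma closed_subspace_span_closure: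
  fixes G K :: "'a::real_normed_vector set"
  assumes "G \<subseteq> K" "closed K" "subspace K"
  shows "closure (span G) \<subseteq> K"
  by (intro closure_minimal span_minimal assms)

text \<open>\<open>span\<close> is the real span, so the complex factor \<open>z\<close> is built
  into the generators.\<close>

definition box_pairs :: "('n::finite L2 \<times> 'n L2) set" where
  "box_pairs = {(abs_L2 (\<lambda>x. z * indicator (box a b) x), abs_L2 (\<lambda>x. z * fourier (indicator (box a b)) x)) | z a b. True}"

definition fourier_graph :: "('n::finite L2 \<times> 'n L2) set" where
  "fourier_graph = closure (span box_pairs)"

text \<open>Members of the span come from genuine integrable functions with square integrable
  transform, a class closed under real linear combinations. A sequence in the span converging to
  \<open>p\<close> is then precisely the approximating sequence that \<open>is_fourier_L2\<close>
  asks for.\<close>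

lemma fourier_graph_is_fourier:
  fixes p :: "'n::finite L2 \<times> 'n L2"
  assumes "p \<in> fourier_graph"
  shows "is_fourier_L2 (fst p) (snd p)"
proof -
  let ?P = "\<lambda>(p :: 'n L2 \<times> 'n L2) F. integrable lebesgue F \<and> square_integrable F \<and> square_integrable (fourier F) \<and>
    p = (abs_L2 F, abs_L2 (fourier F))"
  have "\<exists>F. ?P p F" if "p \<in> span box_pairs" for p
    using that
  proof (induction rule: span_induct)
    case base
    show ?case
    proof (rule subspaceI)
      show "0 \<in> {p. \<exists>F. ?P p F}"
      proof -
        have "fourier (\<lambda>_::real^'n. 0) = (\<lambda>_. 0)" by (simp add: fourier_def fun_eq_iff)
        then show ?thesis
          by (auto intro!: exI[of _ "\<lambda>_. 0"] simp: square_integrable_zero abs_L2_zero zero_prod_def)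
      qed
      show "p + q \<in> {p. \<exists>F. ?P p F}" if pq: "p \<in> {p. \<exists>F. ?P p F}" "q \<in> {p. \<exists>F. ?P p F}" for p q
      proof -
        obtain F G where F: "?P p F" and G: "?P q G" using pq by blast
        have eq: "fourier (\<lambda>x. F x + G x) = (\<lambda>\<xi>. fourier F \<xi> + fourier G \<xi>)"
          using F G by (intro ext fourier_add) blast+
        have "square_integrable (\<lambda>x. F x + G x)" "integrable lebesgue (\<lambda>x. F x + G x)"
          "square_integrable (\<lambda>\<xi>. fourier F \<xi> + fourier G \<xi>)"
          using F G by (blast intro: square_integrable_add Bochner_Integration.integrable_add)+
        moreover have "p + q = (abs_L2 (\<lambda>x. F x + G x), abs_L2 (\<lambda>\<xi>. fourier F \<xi> + fourier G \<xi>))"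
          using F G abs_L2_add[of F G] abs_L2_add[of "fourier F" "fourier G"] by (metis add_Pair)
        ultimately have "?P (p + q) (\<lambda>x. F x + G x)"
          unfolding eq by blast
        then show ?thesis by blast
      qed
      show "r *\<^sub>R p \<in> {p. \<exists>F. ?P p F}" if p: "p \<in> {p. \<exists>F. ?P p F}" for r p
      proof -
        obtain F where F: "?P p F" using p by blast
        have eq: "fourier (\<lambda>x. of_real r * F x) = (\<lambda>\<xi>. of_real r * fourier F \<xi>)"
          by (intro ext fourier_mult)
        have "square_integrable (\<lambda>x. of_real r * F x)" "integrable lebesgue (\<lambda>x. of_real r * F x)"
          "square_integrable (\<lambda>\<xi>. of_real r * fourier F \<xi>)"
          using F by (blast intro: square_integrable_mult integrable_mult_right)+
        moreover have "r *\<^sub>R p = (abs_L2 (\<lambda>x. of_real r * F x), abs_L2 (\<lambda>\<xi>. of_real r * fourier F \<xi>))"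
          using F abs_L2_scaleC[of F "of_real r"] abs_L2_scaleC[of "fourier F" "of_real r"]
          by (metis scaleR_Pair scaleR_L2_def)
        ultimately have "?P (r *\<^sub>R p) (\<lambda>x. of_real r * F x)"
          unfolding eq by blast
        then show ?thesis by blast
      qed
    qed
  next
    case (step p)
    then obtain z a b where p: "p = (abs_L2 (\<lambda>x. z * indicator (box a b) x), abs_L2 (\<lambda>x. z * fourier (indicator (box a b)) x))"
      unfolding box_pairs_def by blast
    have "fourier (\<lambda>x. z * indicator (box a b) x) = (\<lambda>x. z * fourier (indicator (box a b)) x)"
      by (simp add: fourier_mult fun_eq_iff)
    then have "?P p (\<lambda>x. z * indicator (box a b) x)"
      unfolding p by (simp add: square_integrable_mult square_integrable_indicator_box
          square_integrable_fourier_box integrable_indicator_box)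
    then show ?case by blast
  qed
  moreover obtain q where q: "\<And>k. q k \<in> span box_pairs" "q \<longlonglongrightarrow> p"
    using assms unfolding fourier_graph_def closure_sequential by blast
  ultimately have "\<forall>k. \<exists>F. ?P (q k) F" by blast
  then obtain F where F: "\<And>k. ?P (q k) (F k)" by metis
  have "(\<lambda>k. fst (q k)) \<longlonglongrightarrow> fst p" "(\<lambda>k. snd (q k)) \<longlonglongrightarrow> snd p"
    using q(2) by (intro tendsto_fst tendsto_snd; simp)+
  moreover have "fst (q k) = abs_L2 (F k)" "snd (q k) = abs_L2 (fourier (F k))" for k
    using F[of k] by auto
  ultimately have "(\<lambda>k. abs_L2 (F k)) \<longlonglongrightarrow> fst p" "(\<lambda>k. abs_L2 (fourier (F k))) \<longlonglongrightarrow> snd p"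
    by simp_all
  then show ?thesis
    unfolding is_fourier_L2_def using F by blast
qed

lemma fourier_graph_subspace: "subspace (fourier_graph :: ('n::finite L2 \<times> 'n L2) set)"
  unfolding fourier_graph_def by (intro subspace_closure subspace_span)

lemma box_pairs_isometry:
  fixes p q :: "'n::finite L2 \<times> 'n L2"
  assumes "p \<in> box_pairs" "q \<in> box_pairs"
  shows "inner (snd p) (snd q) = (2 * pi) ^ CARD('n) * inner (fst p) (fst q)"
proof -
  obtain z a b where p: "p = (abs_L2 (\<lambda>x. z * indicator (box a b) x), abs_L2 (\<lambda>x. z * fourier (indicator (box a b)) x))"
    using assms(1) unfolding box_pairs_def by blast
  obtain w c d where q: "q = (abs_L2 (\<lambda>x. w * indicator (box c d) x), abs_L2 (\<lambda>x. w * fourier (indicator (box c d)) x))"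
    using assms(2) unfolding box_pairs_def by blast
  let ?I = "\<integral>x. indicator (box a b) x * cnj (indicator (box c d) x) \<partial>lebesgue"
  have "cinner_L2 (fst p) (fst q) = cnj w * (z * ?I)"
    unfolding p q fst_conv abs_L2_scaleC[OF square_integrable_indicator_box]
      cinner_L2_scaleC_left cinner_L2_scaleC_right
      cinner_L2_abs[OF square_integrable_indicator_box square_integrable_indicator_box] ..
  moreover have "cinner_L2 (snd p) (snd q) = cnj w * (z * (of_real ((2 * pi) ^ CARD('n)) * ?I))"
    unfolding p q snd_conv abs_L2_scaleC[OF square_integrable_fourier_box]
      cinner_L2_scaleC_left cinner_L2_scaleC_right
      cinner_L2_abs[OF square_integrable_fourier_box square_integrable_fourier_box] fourier_box_inner(2) ..
  ultimately have "cinner_L2 (snd p) (snd q) = of_real ((2 * pi) ^ CARD('n)) * cinner_L2 (fst p) (fst q)"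
    by (simp only: mult_ac)
  then show ?thesis
    unfolding inner_L2_def by (simp only: Re_complex_of_real times_complex.sel Im_complex_of_real mult_zero_left diff_zero)
qed

text \<open>With one argument fixed, the identity cuts out a closed subspace in the other. It is
  extended from the generators to the graph first in one argument and then in the other.\<close>

lemma fourier_graph_isometry:
  fixes p q :: "'n::finite L2 \<times> 'n L2"
  assumes "p \<in> fourier_graph" "q \<in> fourier_graph"
  shows "inner (snd p) (snd q) = (2 * pi) ^ CARD('n) * inner (fst p) (fst q)"
proof -
  let ?K = "\<lambda>q :: 'n L2 \<times> 'n L2. {p. inner (snd p) (snd q) = (2 * pi) ^ CARD('n) * inner (fst p) (fst q)}"
  have cl: "closed (?K q)" for q
    by (intro closed_Collect_eq continuous_intros)
  have sub: "subspace (?K q)" for q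
    by (auto simp: subspace_def inner_add_left distrib_left)
  have sym: "p \<in> ?K q \<longleftrightarrow> q \<in> ?K p" for p q by (simp add: inner_commute)
  have 1: "fourier_graph \<subseteq> ?K q" if "q \<in> box_pairs" for q
    unfolding fourier_graph_def
    by (rule closed_subspace_span_closure[OF _ cl sub]) (use box_pairs_isometry that in blast)
  have "fourier_graph \<subseteq> ?K p"
    unfolding fourier_graph_def
    by (rule closed_subspace_span_closure[OF _ cl sub]) (use 1 assms(1) sym in blast)
  then show ?thesis using assms(2) by (auto simp: inner_commute)
qed

text \<open>By the isometry the norm of a pair is a fixed multiple of the norm of its first
  component. Projecting the closed graph to that component therefore has complete image, and this
  image contains all complex multiples of boxes.\<close>

lemma fourier_graph_total: "\<exists>g. (f, g) \<in> (fourier_graph :: ('n::finite L2 \<times> 'n L2) set)"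
proof -
  let ?G = "fourier_graph :: ('n::finite L2 \<times> 'n L2) set"
  define C where "C = (2 * pi) ^ CARD('n)"
  have C: "C > 0" by (simp add: C_def)
  define e where "e = 1 / sqrt (1 + C)"
  have bound: "e * norm p \<le> norm (fst p)" if "p \<in> ?G" for p
  proof -
    have "(norm (snd p))\<^sup>2 = C * (norm (fst p))\<^sup>2"
      using fourier_graph_isometry[OF that that] by (simp add: power2_norm_eq_inner C_def)
    then have "(norm p)\<^sup>2 = (1 + C) * (norm (fst p))\<^sup>2"
      using C by (cases p) (simp add: norm_Pair distrib_right)
    then have "norm p = sqrt (1 + C) * norm (fst p)"
      using C by (metis abs_norm_cancel real_sqrt_abs real_sqrt_mult)
    then show ?thesis using C by (simp add: e_def)
  qed
  have "complete (fst ` ?G)"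
  proof (rule complete_isometric_image[where e = e])
    show "complete ?G" unfolding fourier_graph_def complete_eq_closed by simp
  qed (use C bound in \<open>auto simp: e_def fourier_graph_subspace bounded_linear_fst\<close>)
  then have "fst ` ?G = UNIV"
  proof (intro closed_subspace_eq_UNIV)
    show "subspace (fst ` ?G)"
      by (intro linear_subspace_image fourier_graph_subspace bounded_linear.linear bounded_linear_fst)
    fix x :: "'n L2" assume x: "\<And>z. z \<in> fst ` ?G \<Longrightarrow> inner x z = 0"
    have "inner x (scaleC_L2 z (box_L2 a b)) = 0" for z a b
    proof (rule x)
      have "(abs_L2 (\<lambda>x. z * indicator (box a b) x), abs_L2 (\<lambda>x. z * fourier (indicator (box a b)) x)) \<in> ?G"
        unfolding fourier_graph_def
        by (rule subsetD[OF closure_subset], rule span_base) (auto simp: box_pairs_def)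
      then show "scaleC_L2 z (box_L2 a b) \<in> fst ` ?G"
        by (force simp: abs_L2_scaleC[OF square_integrable_indicator_box])
    qed
    from this[of 1] this[of \<i>] have "cinner_L2 x (box_L2 a b) = 0" for a b
      by (simp add: complex_eq_iff Re_cinner_L2 Im_cinner_L2) (simp add: inner_L2_def cinner_L2_scaleC_right)
    then show "x = 0" by (rule L2_zero_if_orthogonal_to_boxes)
  qed (simp add: complete_eq_closed)
  then show ?thesis by (metis UNIV_I fst_conv imageE surj_pair)
qed

section \<open>Linearity, isometry and surjectivity of the transform on L2\<close>

lemma is_fourier_L2_unique: "is_fourier_L2 f g \<Longrightarrow> is_fourier_L2 f h \<Longrightarrow> g = h"
  by (rule L2_eqI_boxes) (simp add: is_fourier_L2_box)

lemma fourier_L2_eqI: "is_fourier_L2 f g \<Longrightarrow> fourier_L2 f = g"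
  unfolding fourier_L2_def using is_fourier_L2_unique by blast

lemma fourier_L2_graph: "(f, fourier_L2 f) \<in> fourier_graph"
  using fourier_graph_total[of f] fourier_graph_is_fourier fourier_L2_eqI by fastforce

lemma is_fourier_fourier_L2: "is_fourier_L2 f (fourier_L2 f)"
  using fourier_graph_is_fourier[OF fourier_L2_graph] by simp

lemma fourier_L2_box: "cinner_L2 (fourier_L2 f) (box_L2 a b) = cinner_L2 f (box_dual a b)"
  by (rule is_fourier_L2_box[OF is_fourier_fourier_L2])

lemma fourier_L2_abs:
  "integrable lebesgue F \<Longrightarrow> square_integrable F \<Longrightarrow> square_integrable (fourier F) \<Longrightarrow>
    fourier_L2 (abs_L2 F) = abs_L2 (fourier F)"
  by (rule fourier_L2_eqI) (auto simp: is_fourier_L2_def intro!: exI[of _ "\<lambda>_. F"])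

lemma fourier_L2_add: "fourier_L2 (f + g) = fourier_L2 f + fourier_L2 g"
  by (rule L2_eqI_boxes) (simp add: fourier_L2_box cinner_L2_add_left)

lemma fourier_L2_scaleC: "fourier_L2 (scaleC_L2 z f) = scaleC_L2 z (fourier_L2 f)"
  by (rule L2_eqI_boxes) (simp add: fourier_L2_box cinner_L2_scaleC_left)

lemma fourier_L2_scaleR: "fourier_L2 (r *\<^sub>R f) = r *\<^sub>R fourier_L2 f"
  by (simp add: scaleR_L2_def fourier_L2_scaleC)

lemma fourier_L2_diff: "fourier_L2 (f - g) = fourier_L2 f - fourier_L2 g"
  by (rule L2_eqI_boxes) (simp add: fourier_L2_box cinner_L2_diff_left)

lemma cinner_fourier_L2:
  fixes f g :: "'n::finite L2"
  shows "cinner_L2 (fourier_L2 f) (fourier_L2 g) = of_real ((2 * pi) ^ CARD('n)) * cinner_L2 f g"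
proof -
  have *: "inner (fourier_L2 f) (fourier_L2 g) = (2 * pi) ^ CARD('n) * inner f g" for f g :: "'n L2"
    using fourier_graph_isometry[OF fourier_L2_graph fourier_L2_graph, of f g] by simp
  show ?thesis
    unfolding cinner_L2_eq fourier_L2_scaleC[symmetric] * by (simp add: complex_eq_iff)
qed

lemma norm_fourier_L2:
  fixes f :: "'n::finite L2"
  shows "(norm (fourier_L2 f))\<^sup>2 = (2 * pi) ^ CARD('n) * (norm f)\<^sup>2"
  using fourier_graph_isometry[OF fourier_L2_graph fourier_L2_graph, of f f]
  by (simp add: power2_norm_eq_inner)

lemma fourier_L2_eq_0: "fourier_L2 f = 0 \<Longrightarrow> f = 0"
  using norm_fourier_L2[of f] by simp

lemma bounded_linear_fourier_L2: "bounded_linear (fourier_L2 :: 'n::finite L2 \<Rightarrow> 'n L2)"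
proof (rule bounded_linear_intro[where K = "sqrt ((2 * pi) ^ CARD('n))"])
  show "norm (fourier_L2 f) \<le> norm f * sqrt ((2 * pi) ^ CARD('n))" for f :: "'n L2"
    by (rule power2_le_imp_le) (simp_all add: norm_fourier_L2 power_mult_distrib mult.commute)
qed (simp_all add: fourier_L2_add fourier_L2_scaleR)

text \<open>Up to complex conjugation the adjoint of the transform is the transform itself. If g is
  orthogonal to the range, the transform of its conjugate pairs to 0 with every box, and injectivity
  gives g = 0.\<close>

lemma surj_fourier_L2: "range (fourier_L2 :: 'n::finite L2 \<Rightarrow> 'n L2) = UNIV"
proof (rule closed_subspace_eq_UNIV)
  let ?F = "fourier_L2 :: 'n L2 \<Rightarrow> 'n L2"
  have "complete (range ?F)"
  proof (rule complete_isometric_image[where e = "sqrt ((2 * pi) ^ CARD('n))"])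
    have "sqrt ((2 * pi) ^ CARD('n)) * norm f = norm (?F f)" for f
      by (rule power2_eq_imp_eq) (simp_all add: norm_fourier_L2 power_mult_distrib)
    then show "\<forall>f\<in>UNIV. sqrt ((2 * pi) ^ CARD('n)) * norm f \<le> norm (?F f)" by simp
  qed (simp_all add: bounded_linear_fourier_L2 complete_UNIV)
  then show "closed (range ?F)" by (simp add: complete_eq_closed)
  show "subspace (range ?F)"
    by (intro linear_subspace_image subspace_UNIV bounded_linear.linear bounded_linear_fourier_L2)
  fix g :: "'n L2" assume g: "\<And>z. z \<in> range ?F \<Longrightarrow> inner g z = 0"
  define h where "h = abs_L2 (\<lambda>x. cnj (rep_L2 g x))"
  have sq: "square_integrable (\<lambda>x. cnj (rep_L2 g x))"
    by (intro square_integrable_cnj square_integrable_rep_L2)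
  have "cinner_L2 g (?F f) = 0" for f
    using g unfolding cinner_L2_eq by (simp add: fourier_L2_scaleC[symmetric] Complex_eq_0)
  then have "cinner_L2 (abs_L2 (rep_L2 g)) (abs_L2 (fourier (indicator (box a b)))) = 0" for a b
    using fourier_L2_abs[OF integrable_indicator_box square_integrable_indicator_box square_integrable_fourier_box, of a b]
    by (metis abs_rep_L2)
  moreover have "(\<integral>x. cnj (rep_L2 g x) * fourier (indicator (box a b)) x \<partial>lebesgue)
      = cnj (\<integral>x. rep_L2 g x * cnj (fourier (indicator (box a b)) x) \<partial>lebesgue)" for a b
    unfolding Bochner_Integration.integral_cnj[symmetric] by simp
  ultimately have "cinner_L2 h (box_dual a b) = 0" for a b
    unfolding h_def box_dual_def cinner_L2_abs[OF sq square_integrable_cnj[OF square_integrable_fourier_box]]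
      cinner_L2_abs[OF square_integrable_rep_L2 square_integrable_fourier_box]
    by simp
  then have "?F h = 0"
    by (intro L2_zero_if_orthogonal_to_boxes) (simp add: fourier_L2_box)
  then have "h = 0" by (rule fourier_L2_eq_0)
  then have "AE x in lebesgue. cnj (rep_L2 g x) = 0"
    using rep_abs_L2[OF sq] rep_L2_zero unfolding h_def by fastforce
  then show "g = 0"
    unfolding L2_eq_iff using rep_L2_zero by eventually_elim simp
qed

section \<open>Smooth cutoff functions\<close>

text \<open>One-variable differentiability stated through a witness for the derivative, which suits
  sums, products and primitives better than \<open>Ck\<close>. Since \<open>smooth\<close> asks it
  for every k, every derivative is itself differentiable and so continuous.\<close>

primrec kdiff :: "nat \<Rightarrow> (real \<Rightarrow> real) \<Rightarrow> bool" where
  "kdiff 0 f \<longleftrightarrow> True"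
| "kdiff (Suc k) f \<longleftrightarrow> (\<exists>f'. (\<forall>x. (f has_real_derivative f' x) (at x)) \<and> kdiff k f')"

definition smooth :: "(real \<Rightarrow> real) \<Rightarrow> bool" where
  "smooth f \<longleftrightarrow> (\<forall>k. kdiff k f)"

lemma kdiff_Suc_D: "kdiff (Suc k) f \<Longrightarrow> kdiff k f"
proof (induction k arbitrary: f)
  case (Suc k)
  obtain f' where f': "\<forall>x. (f has_real_derivative f' x) (at x)" "kdiff (Suc k) f'"
    using Suc.prems unfolding kdiff.simps(2)[of "Suc k"] by blast
  then show ?case using Suc.IH[of f'] unfolding kdiff.simps(2)[of k f] by blast
qed simp

lemma kdiff_const: "kdiff k (\<lambda>_. c)"
proof (induction k arbitrary: c)
  case (Suc k)
  then show ?case by (auto intro!: exI[of _ "\<lambda>_. 0"])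
qed simp

lemma kdiff_add: "kdiff k f \<Longrightarrow> kdiff k g \<Longrightarrow> kdiff k (\<lambda>x. f x + g x)"
proof (induction k arbitrary: f g)
  case (Suc k)
  obtain f' g' where "\<forall>x. (f has_real_derivative f' x) (at x)" "kdiff k f'"
    "\<forall>x. (g has_real_derivative g' x) (at x)" "kdiff k g'"
    using Suc.prems by auto
  then show ?case
    unfolding kdiff.simps by (intro exI[of _ "\<lambda>x. f' x + g' x"]) (auto intro: Suc.IH DERIV_add)
qed simp

lemma kdiff_mult: "kdiff k f \<Longrightarrow> kdiff k g \<Longrightarrow> kdiff k (\<lambda>x. f x * g x)"
proof (induction k arbitrary: f g)
  case (Suc k)
  obtain f' g' where "\<forall>x. (f has_real_derivative f' x) (at x)" "kdiff k f'"
    "\<forall>x. (g has_real_derivative g' x) (at x)" "kdiff k g'"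
    using Suc.prems by auto
  moreover have "kdiff k f" "kdiff k g" using Suc.prems kdiff_Suc_D by blast+
  ultimately show ?case
    unfolding kdiff.simps
    by (intro exI[of _ "\<lambda>x. f' x * g x + g' x * f x"]) (auto intro!: kdiff_add Suc.IH DERIV_mult)
qed simp

lemma kdiff_affine: "kdiff k f \<Longrightarrow> kdiff k (\<lambda>x. f (c * x + d))"
proof (induction k arbitrary: f)
  case (Suc k)
  obtain f' where f': "\<And>x. (f has_real_derivative f' x) (at x)" "kdiff k f'" using Suc.prems by auto
  have "((\<lambda>x. f (c * x + d)) has_real_derivative c * f' (c * x + d)) (at x)" for x
    by (rule DERIV_chain'[OF _ f'(1), THEN DERIV_cong]) (auto intro!: derivative_eq_intros)
  moreover have "kdiff k (\<lambda>x. c * f' (c * x + d))"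
    by (rule kdiff_mult[OF kdiff_const Suc.IH[OF f'(2)]])
  ultimately show ?case
    unfolding kdiff.simps by (intro exI[of _ "\<lambda>x. c * f' (c * x + d)"] conjI allI)
qed simp

lemma smooth_const: "smooth (\<lambda>_. c)" by (simp add: smooth_def kdiff_const)

lemma smooth_add: "smooth f \<Longrightarrow> smooth g \<Longrightarrow> smooth (\<lambda>x. f x + g x)"
  by (simp add: smooth_def kdiff_add)

lemma smooth_mult: "smooth f \<Longrightarrow> smooth g \<Longrightarrow> smooth (\<lambda>x. f x * g x)"
  by (simp add: smooth_def kdiff_mult)

lemma smooth_affine: "smooth f \<Longrightarrow> smooth (\<lambda>x. f (c * x + d))"
  by (simp add: smooth_def kdiff_affine)

lemma smooth_diff: "smooth f \<Longrightarrow> smooth g \<Longrightarrow> smooth (\<lambda>x. f x - g x)"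
  using smooth_add[OF _ smooth_mult[OF smooth_const[of "-1"]], of f g] by simp

lemma smooth_primitive:
  assumes "\<And>x. (F has_real_derivative f x) (at x)" "smooth f" shows "smooth F"
  unfolding smooth_def
proof
  fix k show "kdiff k F"
  proof (cases k)
    case (Suc j)
    then show ?thesis using assms unfolding smooth_def by auto
  qed simp
qed

lemma smooth_derivative:
  assumes "\<And>x. (F has_real_derivative f x) (at x)" "smooth F" shows "smooth f"
  unfolding smooth_def
proof
  fix k
  have "kdiff (Suc k) F" using assms(2) by (simp add: smooth_def del: kdiff.simps)
  then obtain g where g: "\<And>x. (F has_real_derivative g x) (at x)" "kdiff k g" by auto
  have "f = g" using DERIV_unique[OF assms(1) g(1)] by blast
  then show "kdiff k f" using g(2) by simp
qed

lemma smooth_has_derivative: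
  assumes "smooth f"
  obtains f' where "\<And>x. (f has_real_derivative f' x) (at x)" "smooth f'"
proof -
  have "kdiff (Suc 0) f" using assms by (simp add: smooth_def del: kdiff.simps)
  then obtain f' where "\<And>x. (f has_real_derivative f' x) (at x)" by auto
  then show ?thesis using smooth_derivative[OF _ assms] that by blast
qed

lemma smooth_continuous: "smooth f \<Longrightarrow> continuous_on S f"
  using smooth_has_derivative[of f] DERIV_isCont by (metis continuous_at_imp_continuous_on)

lemma smooth_measurable: "smooth f \<Longrightarrow> f \<in> borel_measurable borel"
  by (rule borel_measurable_continuous_onI[OF smooth_continuous])

section \<open>Primitives and a smooth step\<close>

lemma primitive_exists:
  fixes f :: "real \<Rightarrow> real"
  assumes "continuous_on UNIV f"
  shows "\<exists>F. \<forall>x. (F has_real_derivative f x) (at x)"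
proof -
  \<comment> \<open>The signed integral from 0 to x: for each sign of x one of the two intervals is
    empty or a point, so its integral is 0.\<close>
  define F where "F x = integral {0..x} f - integral {x..0} f" for x
  have cont: "continuous_on {p..q} f" for p q using assms continuous_on_subset by blast
  have int: "f integrable_on {p..q}" for p q by (rule integrable_continuous_real[OF cont])
  have "(F has_real_derivative f x) (at x)" for x
  proof -
    \<comment> \<open>A base point to the left of both 0 and \<open>x\<close>, so that near
      \<open>x\<close> the function \<open>F\<close> is a single integral minus a constant, whatever
      the sign of \<open>x\<close>.\<close>
    define p where "p = min 0 x - 1"
    have eq: "F y = integral {p..y} f - integral {p..0} f" if "p < y" for y
    proof (cases "0 \<le> y")
      case True
      then have "integral {p..0} f + integral {0..y} f = integral {p..y} f"
        by (intro Henstock_Kurzweil_Integration.integral_combine int) (auto simp: p_def)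
      moreover have "integral {y..0} f = 0" using True by (cases "y = 0") auto
      ultimately show ?thesis by (simp add: F_def)
    next
      case False
      then have "integral {p..y} f + integral {y..0} f = integral {p..0} f"
        using that by (intro Henstock_Kurzweil_Integration.integral_combine int) auto
      then show ?thesis using False by (simp add: F_def)
    qed
    have "((\<lambda>y. integral {p..y} f) has_real_derivative f x) (at x within {p..x + 1})"
      by (rule integral_has_real_derivative[OF cont]) (auto simp: p_def)
    then have "((\<lambda>y. integral {p..y} f) has_real_derivative f x) (at x)"
      by (subst (asm) at_within_Icc_at) (auto simp: p_def)
    then have "((\<lambda>y. integral {p..y} f - integral {p..0} f) has_real_derivative f x - 0) (at x)"
      by (intro DERIV_diff DERIV_const)
    then have d: "((\<lambda>y. integral {p..y} f - integral {p..0} f) has_real_derivative f x) (at x)" by simp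
    show ?thesis
      by (rule has_field_derivative_transform_within_open[OF d, of "{p<..}"]) (auto simp: eq p_def)
  qed
  then show ?thesis by blast
qed

text \<open>Polynomials in 1/x times exp(-1/x), extended by 0. Taking all polynomials at once gives
  a family closed under differentiation, so smoothness follows by induction.\<close>

definition flat :: "real poly \<Rightarrow> real \<Rightarrow> real" where
  "flat p x = (if x > 0 then poly p (1 / x) * exp (- (1 / x)) else 0)"

lemma tendsto_poly_times_exp_minus: "((\<lambda>y. poly p y * exp (- y) :: real) \<longlongrightarrow> 0) at_top"
proof -
  have "((\<lambda>y. \<Sum>i\<le>degree p. coeff p i * (y ^ i / exp y)) \<longlongrightarrow> (\<Sum>i\<le>degree p. coeff p i * 0)) at_top"
    by (intro tendsto_intros tendsto_power_div_exp_0)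
  then show ?thesis
    by (simp add: poly_altdef sum_distrib_right exp_minus divide_inverse mult.assoc)
qed

text \<open>In the variable y = 1/x differentiation becomes - y^2 d/dy, which sends p exp(-y) to y^2
  (p - p') exp(-y). At 0 the difference quotient is y p(y) exp(-y), with \<open>pCons 0 p\<close> as
  the polynomial, and it tends to 0.\<close>

lemma flat_has_derivative: "(flat p has_real_derivative flat ([:0, 0, 1:] * (p - pderiv p)) x) (at x)"
proof (cases x "0 :: real" rule: linorder_cases)
  case less
  have "((\<lambda>_. 0) has_real_derivative 0) (at x)" by simp
  from has_field_derivative_transform_within_open[OF this, of "{..<0}" "flat p"] less
  show ?thesis by (simp add: flat_def)
next
  case greater
  have "((\<lambda>x. poly p (1 / x) * exp (- (1 / x))) has_real_derivative
      flat ([:0, 0, 1:] * (p - pderiv p)) x) (at x)"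
    using greater by (auto intro!: derivative_eq_intros DERIV_chain'[OF _ poly_DERIV]
        simp: flat_def power2_eq_square algebra_simps divide_simps)
  from has_field_derivative_transform_within_open[OF this, of "{0<..}" "flat p"] greater
  show ?thesis by (simp add: flat_def)
next
  case equal
  have "((\<lambda>y. poly (pCons 0 p) y * exp (- y)) \<longlongrightarrow> 0) at_top" by (rule tendsto_poly_times_exp_minus)
  from filterlim_compose[OF this filterlim_inverse_at_top_right]
  have "((\<lambda>t. poly (pCons 0 p) (inverse t) * exp (- inverse t)) \<longlongrightarrow> 0) (at_right 0)" by simp
  then have "((\<lambda>t. flat p t / t) \<longlongrightarrow> 0) (at_right 0)"
  proof (rule Lim_transform_eventually)
    show "\<forall>\<^sub>F t in at_right 0. poly (pCons 0 p) (inverse t) * exp (- inverse t) = flat p t / t"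
      using eventually_at_right_less[of "0::real"]
      by eventually_elim (simp add: flat_def inverse_eq_divide)
  qed
  moreover have "((\<lambda>t. flat p t / t) \<longlongrightarrow> 0) (at_left 0)"
  proof (rule Lim_transform_eventually[OF tendsto_const])
    show "\<forall>\<^sub>F t in at_left 0. 0 = flat p t / t"
      using eventually_at_left_real[of "-1" 0] by (auto simp: flat_def elim: eventually_mono)
  qed
  ultimately have "((\<lambda>t. flat p t / t) \<longlongrightarrow> 0) (at 0)" by (simp add: filterlim_split_at)
  then show ?thesis
    using equal by (simp add: DERIV_def flat_def)
qed

lemma smooth_flat: "smooth (flat p)"
proof -
  have "kdiff k (flat p)" for k
  proof (induction k arbitrary: p)
    case (Suc k)
    then show ?case using flat_has_derivative by auto
  qed simp
  then show ?thesis by (simp add: smooth_def)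
qed

lemma smooth_step_exists:
  "\<exists>\<sigma>. smooth \<sigma> \<and> (\<forall>x. 0 \<le> \<sigma> x \<and> \<sigma> x \<le> 1) \<and> (\<forall>x\<le>0. \<sigma> x = 0) \<and> (\<forall>x\<ge>1. \<sigma> x = (1::real)) \<and> mono \<sigma>"
proof -
  \<comment> \<open>A smooth bump, positive exactly on (0, 1); the step is its primitive, rescaled
    to run from 0 to 1.\<close>
  define \<rho> where "\<rho> x = flat 1 x * flat 1 ((-1) * x + 1)" for x
  have sm: "smooth \<rho>" unfolding \<rho>_def by (intro smooth_mult smooth_flat smooth_affine)
  have nn: "0 \<le> \<rho> x" for x by (simp add: \<rho>_def flat_def)
  have z: "\<rho> x = 0" if "x \<le> 0 \<or> x \<ge> 1" for x using that by (auto simp: \<rho>_def flat_def)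
  obtain F where F: "\<And>x. (F has_real_derivative \<rho> x) (at x)"
    using primitive_exists[OF smooth_continuous[OF sm]] by blast
  have mono: "F x \<le> F y" if "x \<le> y" for x y
    by (rule DERIV_nonneg_imp_nondecreasing[OF that]) (use F nn in blast)
  have const: "F x = F y" if "x \<le> y" "\<And>t. x \<le> t \<Longrightarrow> t \<le> y \<Longrightarrow> \<rho> t = 0" for x y
  proof (rule antisym[OF mono[OF that(1)]])
    show "F y \<le> F x"
      by (rule DERIV_nonpos_imp_nonincreasing[OF that(1)]) (use F that(2) in force)
  qed
  have F0: "F x = F 0" if "x \<le> 0" for x by (rule const[OF that]) (auto intro: z)
  have F1: "F x = F 1" if "x \<ge> 1" for x by (rule const[OF that, symmetric]) (auto intro: z)
  \<comment> \<open>Otherwise the monotone \<open>F\<close> would be constant on (0, 1),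
    contradicting that its derivative at 1/2 is positive.\<close>
  have "F 0 < F 1"
  proof (rule ccontr)
    assume "\<not> F 0 < F 1"
    then have "F x = F 0" if "x \<in> {0<..<1}" for x
      using mono[of 0 x] mono[of x 1] that by auto
    then have "((\<lambda>_. F 0) has_real_derivative \<rho> (1/2)) (at (1/2))"
      by (intro has_field_derivative_transform_within_open[OF F, of "{0<..<1}"]) auto
    then have "\<rho> (1/2) = 0" using DERIV_unique[OF _ DERIV_const] by blast
    then show False by (simp add: \<rho>_def flat_def)
  qed
  define \<sigma> where "\<sigma> x = (1 / (F 1 - F 0)) * (F x - F 0)" for x
  have F_le: "F 0 \<le> F x" "F x \<le> F 1" for x
    using mono[of 0 x] F0[of x] mono[of x 1] F1[of x] by linarith+
  have "smooth \<sigma>"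
    unfolding \<sigma>_def by (intro smooth_mult smooth_const smooth_diff smooth_primitive[OF F sm])
  moreover have "0 \<le> \<sigma> x \<and> \<sigma> x \<le> 1" for x
    using F_le[of x] \<open>F 0 < F 1\<close> by (simp add: \<sigma>_def)
  moreover have "\<sigma> x = 0" if "x \<le> 0" for x using F0[OF that] by (simp add: \<sigma>_def)
  moreover have "\<sigma> x = 1" if "x \<ge> 1" for x using F1[OF that] \<open>F 0 < F 1\<close> by (simp add: \<sigma>_def)
  moreover have "mono \<sigma>"
    using mono \<open>F 0 < F 1\<close> by (auto simp: mono_def \<sigma>_def intro!: divide_right_mono)
  ultimately show ?thesis by (intro exI[of _ \<sigma>]) blast
qed

section \<open>Smooth approximations of intervals and of their averages\<close>

definition smooth_step :: "real \<Rightarrow> real" where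
  "smooth_step = (SOME \<sigma>. smooth \<sigma> \<and> (\<forall>x. 0 \<le> \<sigma> x \<and> \<sigma> x \<le> 1) \<and> (\<forall>x\<le>0. \<sigma> x = 0) \<and> (\<forall>x\<ge>1. \<sigma> x = (1::real)) \<and> mono \<sigma>)"

lemma smooth_step:
  "smooth smooth_step" "0 \<le> smooth_step x" "smooth_step x \<le> 1"
  "x \<le> 0 \<Longrightarrow> smooth_step x = 0" "1 \<le> x \<Longrightarrow> smooth_step x = 1" "mono smooth_step"
  using someI_ex[OF smooth_step_exists] unfolding smooth_step_def[symmetric] by blast+

text \<open>Rises just to the right of a and falls just to the right of b, over lengths 1/(k + 1).
  Both ramps lie on the right, so the limit is the indicator of the half-open interval from a
  (excluded) to b.\<close>

definition plateau :: "real \<Rightarrow> real \<Rightarrow> nat \<Rightarrow> real \<Rightarrow> real" where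
  "plateau a b k x = smooth_step (real (Suc k) * (x - a)) - smooth_step (real (Suc k) * (x - b))"

lemma smooth_plateau: "smooth (plateau a b k)"
proof -
  have "smooth (\<lambda>x. smooth_step (real (Suc k) * x + (- real (Suc k) * a)) - smooth_step (real (Suc k) * x + (- real (Suc k) * b)))"
    by (intro smooth_diff smooth_affine smooth_step)
  then show ?thesis by (simp add: plateau_def[abs_def] algebra_simps)
qed

lemma plateau_bounds:
  assumes "a \<le> b"
  shows "0 \<le> plateau a b k x" "plateau a b k x \<le> 1"
proof -
  have "smooth_step (real (Suc k) * (x - b)) \<le> smooth_step (real (Suc k) * (x - a))"
    using assms by (intro monoD[OF smooth_step(6)] mult_left_mono) auto
  then show "0 \<le> plateau a b k x" by (simp add: plateau_def)
  show "plateau a b k x \<le> 1"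
    using smooth_step(2)[of "real (Suc k) * (x - b)"] smooth_step(3)[of "real (Suc k) * (x - a)"]
    by (simp add: plateau_def)
qed

lemma plateau_eq_0: "a \<le> b \<Longrightarrow> x \<notin> {a..b + 1 / real (Suc k)} \<Longrightarrow> plateau a b k x = 0"
proof -
  assume ab: "a \<le> b" and x: "x \<notin> {a..b + 1 / real (Suc k)}"
  show ?thesis
  proof (cases "x < a")
    case True
    then have "real (Suc k) * (x - a) \<le> 0" "real (Suc k) * (x - b) \<le> 0"
      using ab by (auto intro!: mult_nonneg_nonpos)
    then show ?thesis by (simp add: plateau_def smooth_step(4))
  next
    case False
    then have "1 \<le> real (Suc k) * (x - b)" using x by (simp add: field_simps)
    moreover have "real (Suc k) * (x - b) \<le> real (Suc k) * (x - a)" using ab by (intro mult_left_mono) auto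
    ultimately have "smooth_step (real (Suc k) * (x - b)) = 1" "smooth_step (real (Suc k) * (x - a)) = 1"
      by (intro smooth_step(5); linarith)+
    then show ?thesis by (simp add: plateau_def)
  qed
qed

text \<open>A support bound independent of \<open>k\<close>, as dominated convergence
  requires.\<close>

lemma plateau_eq_0_coarse: assumes "a \<le> b" "x \<notin> {a..b + 1}" shows "plateau a b k x = 0"
proof (rule plateau_eq_0[OF assms(1)])
  have "{a..b + 1 / real (Suc k)} \<subseteq> {a..b + 1}" by (simp add: atLeastatMost_subset_iff)
  then show "x \<notin> {a..b + 1 / real (Suc k)}" using assms(2) by blast
qed

lemma tendsto_smooth_step: "(\<lambda>k. smooth_step (real (Suc k) * (x - a))) \<longlonglongrightarrow> (if a < x then 1 else 0)"
proof (cases "a < x")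
  case True
  then obtain n where n: "1 / (x - a) < real n" using reals_Archimedean2 by blast
  have "smooth_step (real (Suc k) * (x - a)) = 1" if "k \<ge> n" for k
  proof (rule smooth_step(5))
    have "1 / (x - a) \<le> real (Suc k)" using n that by simp
    then show "1 \<le> real (Suc k) * (x - a)" using True by (simp add: field_simps)
  qed
  then have "\<forall>\<^sub>F k in sequentially. 1 = smooth_step (real (Suc k) * (x - a))"
    unfolding eventually_sequentially by (intro exI[of _ n]) simp
  then show ?thesis using True by (intro Lim_transform_eventually[OF tendsto_const]) simp_all
next
  case False
  then have "smooth_step (real (Suc k) * (x - a)) = 0" for k
    by (intro smooth_step(4) mult_nonneg_nonpos) auto
  then show ?thesis using False by simp
qed

lemma tendsto_plateau:
  assumes "a \<le> b"
  shows "(\<lambda>k. plateau a b k x) \<longlonglongrightarrow> indicator {a<..b} x"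
proof -
  have "(\<lambda>k. plateau a b k x) \<longlonglongrightarrow> (if a < x then 1 else 0) - (if b < x then 1 else 0)"
    unfolding plateau_def by (intro tendsto_diff tendsto_smooth_step)
  moreover have "(if a < x then 1 else 0) - (if b < x then 1 else 0) = indicat_real {a<..b} x"
    using assms by (auto split: split_indicator)
  ultimately show ?thesis by simp
qed

text \<open>Convolution with the indicator of [0, 1]. A primitive of a plateau has no compact
  support in general, but this primitive of the plateau minus its unit translate has.\<close>

definition plateau_avg :: "real \<Rightarrow> real \<Rightarrow> nat \<Rightarrow> real \<Rightarrow> real" where
  "plateau_avg a b k x = (\<integral>t. indicator {x - 1..x} t * plateau a b k t \<partial>lborel)"

definition indicator_avg :: "real \<Rightarrow> real \<Rightarrow> real \<Rightarrow> real" where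
  "indicator_avg a b x = (\<integral>t. indicator {x - 1..x} t * indicator {a<..b} t \<partial>lborel)"

lemma plateau_avg_deriv: "(plateau_avg a b k has_real_derivative plateau a b k x - plateau a b k (x - 1)) (at x)"
proof -
  obtain F where F: "\<And>x. (F has_real_derivative plateau a b k x) (at x)"
    using primitive_exists[OF smooth_continuous[OF smooth_plateau]] by blast
  have "plateau_avg a b k x = F x - F (x - 1)" for x
  proof -
    have "(\<integral>t. indicator {x - 1..x} t *\<^sub>R plateau a b k t \<partial>lborel) = F x - F (x - 1)"
      by (rule integral_FTC_Icc) (use F smooth_continuous[OF smooth_plateau] in
        \<open>auto simp: has_real_derivative_iff_has_vector_derivative[symmetric] intro: has_field_derivative_at_within\<close>)
    then show ?thesis by (simp add: plateau_avg_def)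
  qed
  then have eq: "plateau_avg a b k = (\<lambda>x. F x - F (x - 1))" by blast
  have "((\<lambda>x. F (x - 1)) has_real_derivative plateau a b k (x - 1)) (at x)"
    using DERIV_shift[of F "plateau a b k (x - 1)" x "-1"] F[of "x - 1"] by simp
  then show ?thesis unfolding eq by (intro DERIV_diff F)
qed

lemma smooth_plateau_avg: "smooth (plateau_avg a b k)"
proof (rule smooth_primitive[OF plateau_avg_deriv])
  have "smooth (\<lambda>x. plateau a b k (1 * x + (- 1)))" by (intro smooth_affine smooth_plateau)
  then show "smooth (\<lambda>x. plateau a b k x - plateau a b k (x - 1))"
    by (intro smooth_diff smooth_plateau) simp
qed

lemma plateau_avg_bound: assumes "a \<le> b" shows "\<bar>plateau_avg a b k x\<bar> \<le> 1"
proof -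
  have "norm (plateau_avg a b k x) \<le> (\<integral>t. norm (indicator {x - 1..x} t * plateau a b k t) \<partial>lborel)"
    unfolding plateau_avg_def by (rule integral_norm_bound)
  also have "\<dots> \<le> (\<integral>t. indicator {x - 1..x} t \<partial>lborel)"
    by (rule integral_mono') (use plateau_bounds[OF assms] in \<open>auto split: split_indicator\<close>)
  finally show ?thesis by simp
qed

lemma plateau_avg_eq_0: assumes "a \<le> b" "x \<notin> {a..b + 2}" shows "plateau_avg a b k x = 0"
proof -
  have z: "indicator {x - 1..x} t * plateau a b k t = 0" for t
  proof -
    have "t \<notin> {x - 1..x} \<or> t \<notin> {a..b + 1}" using assms(2) by auto
    then show ?thesis using plateau_eq_0_coarse[OF assms(1), of t k] by (auto split: split_indicator)
  qed
  show ?thesis by (simp only: plateau_avg_def z Bochner_Integration.integral_zero)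
qed

lemma tendsto_plateau_avg: assumes "a \<le> b" shows "(\<lambda>k. plateau_avg a b k x) \<longlonglongrightarrow> indicator_avg a b x"
  unfolding plateau_avg_def indicator_avg_def
proof (rule integral_dominated_convergence[where w = "indicator {x - 1..x}"])
  show "(\<lambda>t. indicator {x - 1..x} t * plateau a b k t) \<in> borel_measurable lborel" for k
    using smooth_measurable[OF smooth_plateau] by measurable
  show "AE t in lborel. (\<lambda>k. indicator {x - 1..x} t * plateau a b k t) \<longlonglongrightarrow> indicator {x - 1..x} t * indicator {a<..b} t"
    by (intro AE_I2 tendsto_intros tendsto_plateau assms)
  show "AE t in lborel. norm (indicator {x - 1..x} t * plateau a b k t) \<le> indicator {x - 1..x} t" for k
    using plateau_bounds[OF assms] by (auto split: split_indicator)
qed auto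

lemma indicator_avg_measurable: "a \<le> b \<Longrightarrow> indicator_avg a b \<in> borel_measurable borel"
  by (rule borel_measurable_LIMSEQ_real[OF tendsto_plateau_avg smooth_measurable[OF smooth_plateau_avg]])

text \<open>Translation by 1 multiplies the transform by exp(-\<i> \<xi>), and 1 - exp(-\<i> \<xi>)
  is \<i> \<xi> times the transform of the unit interval.\<close>

lemma fourier_interval_shift:
  assumes "a \<le> b" "\<xi> \<noteq> 0"
  shows "fourier_interval a b \<xi> - fourier_interval (a + 1) (b + 1) \<xi>
    = \<i> * of_real \<xi> * (fourier_interval 0 1 \<xi> * fourier_interval a b \<xi>)"
proof -
  have c: "cis (- ((c + 1) * \<xi>)) = cis (- \<xi>) * cis (- (c * \<xi>))" for c
    by (simp add: cis_mult algebra_simps)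
  have ab: "a + 1 \<le> b + 1" using assms(1) by simp
  have "fourier_interval (a + 1) (b + 1) \<xi> = cis (- \<xi>) * fourier_interval a b \<xi>"
    by (simp only: fourier_interval_eq[OF ab assms(2)] fourier_interval_eq[OF assms] c right_diff_distrib times_divide_eq_right)
  moreover have "\<i> * of_real \<xi> * fourier_interval 0 1 \<xi> = 1 - cis (- \<xi>)"
    using assms(2) by (simp add: fourier_interval_eq)
  ultimately show ?thesis
    by (simp add: left_diff_distrib flip: mult.assoc)
qed

text \<open>The convolution formula for two intervals, reached by integrating the smooth averages by
  parts: \<i> \<xi> times the transform of the average equals the transform of an interval minus its
  translate. Dividing by \<i> \<xi> is where \<xi> \<noteq> 0 enters.\<close>

lemma fourier_indicator_avg:
  assumes "a \<le> b" "\<xi> \<noteq> 0"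
  shows "(\<integral>t. exp (- (\<i> * of_real (t * \<xi>))) * of_real (indicator_avg a b t) \<partial>lborel)
    = fourier_interval 0 1 \<xi> * fourier_interval a b \<xi>"
    and "integrable lborel (\<lambda>t. exp (- (\<i> * of_real (t * \<xi>))) * of_real (indicator_avg a b t))"
proof -
  let ?e = "\<lambda>t. exp (- (\<i> * complex_of_real (t * \<xi>)))"
  let ?w = "indicat_real {a..b + 2}"
  have mp [measurable]: "plateau a b k \<in> borel_measurable borel" "plateau_avg a b k \<in> borel_measurable borel" for k
    by (intro smooth_measurable smooth_plateau smooth_plateau_avg)+
  have [measurable]: "indicator_avg a b \<in> borel_measurable borel"
    by (rule indicator_avg_measurable[OF assms(1)])
  have wi [simp]: "integrable lborel ?w"
    by (rule integrable_real_indicator) (use assms(1) in auto)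
  have bnd: "norm (plateau_avg a b k t) \<le> ?w t" "norm (plateau a b k t - plateau a b k (t - 1)) \<le> 2 * ?w t" for k t
  proof -
    show "norm (plateau_avg a b k t) \<le> ?w t"
      using plateau_avg_bound[OF assms(1), of k t] plateau_avg_eq_0[OF assms(1), of t k]
      by (cases "t \<in> {a..b + 2}") auto
    show "norm (plateau a b k t - plateau a b k (t - 1)) \<le> 2 * ?w t"
    proof (cases "t \<in> {a..b + 2}")
      case True
      then show ?thesis
        using plateau_bounds[OF assms(1), of k t] plateau_bounds[OF assms(1), of k "t - 1"] by auto
    next
      case False
      then have "t \<notin> {a..b + 1}" "t - 1 \<notin> {a..b + 1}" by auto
      then show ?thesis using plateau_eq_0_coarse[OF assms(1)] by simp
    qed
  qed
  have parts: "(\<integral>t. ?e t * of_real (plateau a b k t - plateau a b k (t - 1)) \<partial>lborel)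
      = \<i> * of_real \<xi> * (\<integral>t. ?e t * of_real (plateau_avg a b k t) \<partial>lborel)" for k
  proof -
    let ?F = "\<lambda>t. ?e t * of_real (plateau_avg a b k t)"
    let ?f = "\<lambda>t. ?e t * of_real (plateau a b k t - plateau a b k (t - 1)) - \<i> * of_real \<xi> * ?e t * of_real (plateau_avg a b k t)"
    have d1: "(?e has_vector_derivative - (\<i> * of_real \<xi>) * ?e t) (at t within S)" for t S
    proof -
      have "((\<lambda>z. exp (- (\<i> * (z * of_real \<xi>)))) has_field_derivative - (\<i> * of_real \<xi>) * exp (- (\<i> * (of_real t * of_real \<xi>)))) (at (of_real t))"
        by (auto intro!: derivative_eq_intros)
      from has_vector_derivative_real_field[OF this, of S] show ?thesis by simp
    qed
    have d2: "((\<lambda>t. complex_of_real (plateau_avg a b k t)) has_vector_derivative of_real (plateau a b k t - plateau a b k (t - 1))) (at t within S)" for t S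
      using plateau_avg_deriv[of a b k t]
      by (intro has_vector_derivative_of_real) (simp add: has_real_derivative_iff_has_vector_derivative[symmetric] has_field_derivative_at_within)
    have d: "(?F has_vector_derivative ?f t) (at t within S)" for t S
      using has_vector_derivative_mult[OF d1 d2, of t S] by (simp add: algebra_simps)
    have cp: "continuous_on S (plateau a b k)" "continuous_on S (\<lambda>x. plateau a b k (x - 1))" "continuous_on S (plateau_avg a b k)" for S
      using smooth_continuous[OF smooth_plateau, of UNIV a b k] smooth_continuous[OF smooth_plateau_avg]
      by (auto intro: continuous_on_subset intro!: continuous_on_compose2[of UNIV "plateau a b k" S "\<lambda>x. x - 1"] continuous_intros)
    \<comment> \<open>The average is supported in [a, b + 2], so a margin of 1 on each side makes
      both boundary terms vanish.\<close>
    have "(\<integral>t. indicator {a - 1..b + 3} t *\<^sub>R ?f t \<partial>lborel) = ?F (b + 3) - ?F (a - 1)"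
      by (rule integral_FTC_Icc) (use assms d in \<open>auto intro!: continuous_intros cp\<close>)
    moreover have "?F (b + 3) - ?F (a - 1) = 0" using plateau_avg_eq_0[OF assms(1)] by simp
    moreover have "indicator {a - 1..b + 3} t *\<^sub>R ?f t = ?f t" for t
      using bnd[of k t] by (auto split: split_indicator)
    ultimately have z: "(\<integral>t. ?f t \<partial>lborel) = 0" by simp
    have i1: "integrable lborel (\<lambda>t. ?e t * of_real (plateau a b k t - plateau a b k (t - 1)))"
      by (rule Bochner_Integration.integrable_bound[of _ "\<lambda>t. 2 * ?w t"])
        (use bnd(2)[of k] in \<open>auto simp: norm_mult simp del: of_real_diff\<close>)
    have i2: "integrable lborel (\<lambda>t. ?e t * of_real (plateau_avg a b k t))"
      by (rule Bochner_Integration.integrable_bound[of _ ?w]) (use bnd(1)[of k] in \<open>auto simp: norm_mult\<close>)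
    have "(\<integral>t. ?f t \<partial>lborel) = (\<integral>t. ?e t * of_real (plateau a b k t - plateau a b k (t - 1)) \<partial>lborel)
      - (\<integral>t. \<i> * of_real \<xi> * (?e t * of_real (plateau_avg a b k t)) \<partial>lborel)"
      by (subst Bochner_Integration.integral_diff[symmetric]) (use i1 i2 in \<open>auto simp: mult.assoc\<close>)
    then show ?thesis using z by simp
  qed
  have "(\<lambda>k. \<integral>t. ?e t * of_real (plateau_avg a b k t) \<partial>lborel) \<longlonglongrightarrow> (\<integral>t. ?e t * of_real (indicator_avg a b t) \<partial>lborel)"
    by (rule integral_dominated_convergence[where w = ?w])
      (use bnd in \<open>auto simp: norm_mult intro!: tendsto_intros tendsto_plateau_avg[OF assms(1)]\<close>)
  then have "(\<lambda>k. \<i> * of_real \<xi> * (\<integral>t. ?e t * of_real (plateau_avg a b k t) \<partial>lborel))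
      \<longlonglongrightarrow> \<i> * of_real \<xi> * (\<integral>t. ?e t * of_real (indicator_avg a b t) \<partial>lborel)"
    by (intro tendsto_intros)
  moreover have "(\<lambda>k. \<integral>t. ?e t * of_real (plateau a b k t - plateau a b k (t - 1)) \<partial>lborel)
      \<longlonglongrightarrow> (\<integral>t. ?e t * of_real (indicator {a<..b} t - indicator {a<..b} (t - 1)) \<partial>lborel)"
    by (rule integral_dominated_convergence[where w = "\<lambda>t. 2 * ?w t"])
      (use bnd in \<open>auto simp: norm_mult simp del: of_real_diff intro!: tendsto_intros tendsto_plateau[OF assms(1)]\<close>)
  ultimately have lim: "(\<integral>t. ?e t * of_real (indicator {a<..b} t - indicator {a<..b} (t - 1)) \<partial>lborel)
      = \<i> * of_real \<xi> * (\<integral>t. ?e t * of_real (indicator_avg a b t) \<partial>lborel)"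
    unfolding parts by (rule LIMSEQ_unique[rotated])
  have "(\<integral>t. ?e t * of_real (indicator {a<..b} t - indicator {a<..b} (t - 1)) \<partial>lborel)
      = (\<integral>t. ?e t * indicator {a<..<b} t - ?e t * indicator {a + 1<..<b + 1} t \<partial>lborel)"
  proof (rule integral_cong_AE)
    show "AE t in lborel. ?e t * of_real (indicator {a<..b} t - indicator {a<..b} (t - 1)) = ?e t * indicator {a<..<b} t - ?e t * indicator {a + 1<..<b + 1} t"
      using AE_lborel_singleton[of b] AE_lborel_singleton[of "b + 1"]
      by eventually_elim (auto split: split_indicator)
  qed measurable
  also have "\<dots> = fourier_interval a b \<xi> - fourier_interval (a + 1) (b + 1) \<xi>"
    unfolding fourier_interval_def
    by (rule Bochner_Integration.integral_diff) (rule integrable_exp_indicator)+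
  also have "\<dots> = \<i> * of_real \<xi> * (fourier_interval 0 1 \<xi> * fourier_interval a b \<xi>)"
    by (rule fourier_interval_shift[OF assms])
  finally show "(\<integral>t. ?e t * of_real (indicator_avg a b t) \<partial>lborel) = fourier_interval 0 1 \<xi> * fourier_interval a b \<xi>"
    using lim assms(2) by simp
  have nn: "norm (indicator_avg a b t) \<le> ?w t" for t
  proof (rule tendsto_upperbound[OF tendsto_norm[OF tendsto_plateau_avg[OF assms(1)]]])
    show "\<forall>\<^sub>F k in sequentially. norm (plateau_avg a b k t) \<le> ?w t" using bnd(1) by simp
  qed simp
  show "integrable lborel (\<lambda>t. ?e t * of_real (indicator_avg a b t))"
    by (rule Bochner_Integration.integrable_bound[of _ ?w]) (use nn in \<open>auto simp: norm_mult\<close>)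
qed

section \<open>Weak gradients and the Fourier transform\<close>

lemma cinner_L2_zero_right: "cinner_L2 f 0 = 0"
  using cinner_L2_add_right[of f 0 0] by simp

section \<open>Products of one-variable functions as test functions\<close>

lemma has_derivative_coordinate_prod:
  fixes f f' :: "'a::euclidean_space \<Rightarrow> real \<Rightarrow> real"
  assumes "\<And>b t. b \<in> Basis \<Longrightarrow> (f b has_real_derivative f' b t) (at t)"
  shows "((\<lambda>x. \<Prod>b\<in>Basis. f b (x \<bullet> b)) has_derivative
    (\<lambda>y. \<Sum>b\<in>Basis. (f' b (x \<bullet> b) * (y \<bullet> b)) * (\<Prod>j\<in>Basis - {b}. f j (x \<bullet> j)))) (at x)"
proof (rule has_derivative_prod)
  fix b :: 'a assume b: "b \<in> Basis"
  have "((\<lambda>x. x \<bullet> b) has_derivative (\<lambda>y. y \<bullet> b)) (at x)"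
    by (rule bounded_linear_imp_has_derivative) (rule bounded_linear_inner_left)
  moreover have "(f b has_derivative (*) (f' b (x \<bullet> b))) (at (x \<bullet> b))"
    using assms[OF b] by (simp add: has_field_derivative_def)
  ultimately show "((\<lambda>x. f b (x \<bullet> b)) has_derivative (\<lambda>y. f' b (x \<bullet> b) * (y \<bullet> b))) (at x)"
    by (rule has_derivative_compose)
qed

text \<open>Writing the partial derivative as a coordinate product with one factor replaced keeps it
  in the same class; this drives the induction that yields \<open>Ck\<close> for every
  order.\<close>

lemma frechet_derivative_coordinate_prod:
  fixes f f' :: "'a::euclidean_space \<Rightarrow> real \<Rightarrow> real"
  assumes "\<And>b t. b \<in> Basis \<Longrightarrow> (f b has_real_derivative f' b t) (at t)" and i: "i \<in> Basis"
  shows "frechet_derivative (\<lambda>x. \<Prod>b\<in>Basis. f b (x \<bullet> b)) (at x) i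
    = (\<Prod>b\<in>Basis. (f(i := f' i)) b (x \<bullet> b))"
proof -
  have "frechet_derivative (\<lambda>x. \<Prod>b\<in>Basis. f b (x \<bullet> b)) (at x) i
      = (\<Sum>b\<in>Basis. (f' b (x \<bullet> b) * (i \<bullet> b)) * (\<Prod>j\<in>Basis - {b}. f j (x \<bullet> j)))"
    using fun_cong[OF frechet_derivative_at[OF has_derivative_coordinate_prod[of f f' x, OF assms(1)]], of i] by simp
  also have "\<dots> = (\<Sum>b\<in>Basis. if b = i then f' b (x \<bullet> b) * (\<Prod>j\<in>Basis - {b}. f j (x \<bullet> j)) else 0)"
    using i by (intro sum.cong) (auto simp: inner_Basis)
  also have "\<dots> = f' i (x \<bullet> i) * (\<Prod>j\<in>Basis - {i}. f j (x \<bullet> j))" using i by simp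
  also have "\<dots> = (\<Prod>b\<in>Basis. (f(i := f' i)) b (x \<bullet> b))"
    using i by (subst prod.remove[of Basis i]) auto
  finally show ?thesis .
qed

lemma Ck_coordinate_prod:
  fixes f :: "'a::euclidean_space \<Rightarrow> real \<Rightarrow> real"
  assumes "\<And>b. b \<in> Basis \<Longrightarrow> smooth (f b)"
  shows "Ck k (\<lambda>x. \<Prod>b\<in>Basis. f b (x \<bullet> b))"
  using assms
proof (induction k arbitrary: f)
  case 0
  have "continuous_on UNIV (\<lambda>x. f b (x \<bullet> b))" if "b \<in> Basis" for b
    using smooth_continuous[OF 0[OF that], of UNIV]
    by (rule continuous_on_compose2) (auto intro!: continuous_intros)
  then show ?case by (auto intro!: continuous_on_prod)
next
  case (Suc k)
  have "\<exists>f'. \<forall>t. (f b has_real_derivative f' t) (at t)" if "b \<in> Basis" for b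
    using smooth_has_derivative[OF Suc.prems[OF that]] by blast
  then obtain f' where f': "\<And>b t. b \<in> Basis \<Longrightarrow> (f b has_real_derivative f' b t) (at t)" by metis
  have "smooth (f' b)" if "b \<in> Basis" for b
    using smooth_derivative[OF f'[OF that] Suc.prems[OF that]] .
  then have "Ck k (\<lambda>x. \<Prod>b\<in>Basis. (f(i := f' i)) b (x \<bullet> b))" if "i \<in> Basis" for i
    using Suc.prems that by (intro Suc.IH) auto
  then show ?case
    using has_derivative_coordinate_prod[of f f', OF f'] frechet_derivative_coordinate_prod[of f f', OF f']
    by (auto simp: differentiable_def)
qed

lemma test_function_coordinate_prod:
  fixes f :: "'a::euclidean_space \<Rightarrow> real \<Rightarrow> real"
  assumes "\<And>b. b \<in> Basis \<Longrightarrow> smooth (f b)"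
    and "\<And>b t. b \<in> Basis \<Longrightarrow> \<not> (A \<bullet> b < t \<and> t < B \<bullet> b) \<Longrightarrow> f b t = 0"
  shows "test_function UNIV (\<lambda>x. \<Prod>b\<in>Basis. f b (x \<bullet> b))"
proof -
  have "{x. (\<Prod>b\<in>Basis. f b (x \<bullet> b)) \<noteq> 0} \<subseteq> box A B"
  proof
    fix x assume "x \<in> {x. (\<Prod>b\<in>Basis. f b (x \<bullet> b)) \<noteq> 0}"
    then have "f b (x \<bullet> b) \<noteq> 0" if "b \<in> Basis" for b using that by auto
    then show "x \<in> box A B" using assms(2) unfolding mem_box by blast
  qed
  then have "bounded {x. (\<Prod>b\<in>Basis. f b (x \<bullet> b)) \<noteq> 0}"
    using bounded_box bounded_subset by blast
  then show ?thesis
    unfolding test_function_def using Ck_coordinate_prod[of f] assms(1) by (simp add: compact_closure)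
qed

lemma coordinate_prod_measurable:
  fixes h :: "'a::euclidean_space \<Rightarrow> real \<Rightarrow> real"
  assumes "\<And>b. b \<in> Basis \<Longrightarrow> h b \<in> borel_measurable borel"
  shows "(\<lambda>x. complex_of_real (\<Prod>b\<in>Basis. h b (x \<bullet> b))) \<in> borel_measurable lebesgue"
proof (rule lebesgue_measurable_of_borel)
  have "(\<lambda>x. h b (x \<bullet> b)) \<in> borel_measurable borel" if b: "b \<in> Basis" for b
  proof -
    have "(\<lambda>x::'a. x \<bullet> b) \<in> borel_measurable borel" by simp
    from measurable_compose[OF this assms[OF b]] show ?thesis .
  qed
  then have "(\<lambda>x. \<Prod>b\<in>Basis. h b (x \<bullet> b)) \<in> borel_measurable borel"
    by (intro borel_measurable_prod) auto
  from measurable_compose[OF this borel_measurable_of_real]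
  show "(\<lambda>x. complex_of_real (\<Prod>b\<in>Basis. h b (x \<bullet> b))) \<in> borel_measurable borel" .
qed

text \<open>Dominated convergence with a common box as support. The bound 2 covers plateaus, their
  averages and the difference of a plateau and its translate alike.\<close>

lemma tendsto_integral_coordinate_prod:
  fixes v :: "'n::finite L2" and f :: "nat \<Rightarrow> real^'n \<Rightarrow> real \<Rightarrow> real"
  assumes meas: "\<And>k b. b \<in> Basis \<Longrightarrow> f k b \<in> borel_measurable borel"
    and bound: "\<And>k b t. b \<in> Basis \<Longrightarrow> \<bar>f k b t\<bar> \<le> 2"
    and supp: "\<And>k b t. b \<in> Basis \<Longrightarrow> \<not> (A \<bullet> b < t \<and> t < B \<bullet> b) \<Longrightarrow> f k b t = 0"
    and lim: "\<And>b t. b \<in> Basis \<Longrightarrow> (\<lambda>k. f k b t) \<longlonglongrightarrow> g b t"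
  shows "(\<lambda>k. \<integral>x. rep_L2 v x * of_real (\<Prod>b\<in>Basis. f k b (x \<bullet> b)) \<partial>lebesgue)
    \<longlonglongrightarrow> (\<integral>x. rep_L2 v x * of_real (\<Prod>b\<in>Basis. g b (x \<bullet> b)) \<partial>lebesgue)"
proof (rule integral_dominated_convergence[where w = "\<lambda>x. 2 ^ CARD('n) * cmod (indicator (box A B) x * rep_L2 v x)"])
  have gm: "g b \<in> borel_measurable borel" if "b \<in> Basis" for b
    by (rule borel_measurable_LIMSEQ_real[OF lim[OF that] meas[OF that]])
  show "(\<lambda>x. rep_L2 v x * of_real (\<Prod>b\<in>Basis. g b (x \<bullet> b))) \<in> borel_measurable lebesgue"
    by (intro borel_measurable_times measurable_rep_L2 coordinate_prod_measurable gm)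
  show "(\<lambda>x. rep_L2 v x * of_real (\<Prod>b\<in>Basis. f k b (x \<bullet> b))) \<in> borel_measurable lebesgue" for k
    by (intro borel_measurable_times measurable_rep_L2 coordinate_prod_measurable meas)
  show "integrable lebesgue (\<lambda>x. 2 ^ CARD('n) * cmod (indicator (box A B) x * rep_L2 v x))"
    by (intro integrable_mult_right integrable_norm integrable_indicator_box_mult square_integrable_rep_L2)
  show "AE x in lebesgue. (\<lambda>k. rep_L2 v x * of_real (\<Prod>b\<in>Basis. f k b (x \<bullet> b)))
      \<longlonglongrightarrow> rep_L2 v x * of_real (\<Prod>b\<in>Basis. g b (x \<bullet> b))"
    by (intro AE_I2 tendsto_intros lim)
  show "AE x in lebesgue. norm (rep_L2 v x * of_real (\<Prod>b\<in>Basis. f k b (x \<bullet> b)))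
      \<le> 2 ^ CARD('n) * cmod (indicator (box A B) x * rep_L2 v x)" for k
  proof (rule AE_I2)
    fix x :: "real^'n"
    show "norm (rep_L2 v x * of_real (\<Prod>b\<in>Basis. f k b (x \<bullet> b)))
      \<le> 2 ^ CARD('n) * cmod (indicator (box A B) x * rep_L2 v x)"
    proof (cases "x \<in> box A B")
      case True
      have "\<bar>\<Prod>b\<in>Basis. f k b (x \<bullet> b)\<bar> \<le> (\<Prod>b\<in>(Basis :: (real^'n) set). 2)"
        unfolding abs_prod by (intro prod_mono) (auto simp: bound)
      then have "\<bar>\<Prod>b\<in>Basis. f k b (x \<bullet> b)\<bar> \<le> 2 ^ CARD('n)" by simp
      then show ?thesis
        using True by (simp add: norm_mult mult.commute mult_left_mono del: of_real_prod)
    next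
      case False
      then obtain b where "b \<in> Basis" "f k b (x \<bullet> b) = 0" using supp by (auto simp: mem_box)
      then have p: "(\<Prod>b\<in>Basis. f k b (x \<bullet> b)) = 0" by auto
      show ?thesis unfolding p by simp
    qed
  qed
qed

lemma AE_coordinate_neq: "j \<in> Basis \<Longrightarrow> AE x::'a::euclidean_space in lebesgue. x \<bullet> j \<noteq> c"
  using AE_not_in[of "{x::'a. x \<bullet> j = c}" lebesgue] negligible_standard_hyperplane[of j c]
  by (simp add: negligible_iff_null_sets)

lemma AE_halfopen_box:
  fixes a b :: "'a::euclidean_space"
  shows "AE x in lebesgue. (\<Prod>j\<in>Basis. indicat_real {a \<bullet> j<..b \<bullet> j} (x \<bullet> j)) = indicator (box a b) x"
proof -
  have "AE x in lebesgue. \<forall>j\<in>Basis. x \<bullet> j \<noteq> b \<bullet> j"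
    by (intro AE_finite_allI AE_coordinate_neq) auto
  then show ?thesis
  proof eventually_elim
    case (elim x)
    have "(\<Prod>j\<in>Basis. indicat_real {a \<bullet> j<..b \<bullet> j} (x \<bullet> j)) = (\<Prod>j\<in>Basis. indicat_real {a \<bullet> j<..<b \<bullet> j} (x \<bullet> j))"
      using elim by (intro prod.cong) (auto split: split_indicator)
    moreover have "complex_of_real (\<Prod>j\<in>Basis. indicat_real {a \<bullet> j<..<b \<bullet> j} (x \<bullet> j)) = of_real (indicator (box a b) x)"
      using indicator_box_eq_prod[of a b x] by (simp add: of_real_indicator)
    ultimately show ?case by (simp only: of_real_eq_iff)
  qed
qed

text \<open>Products of plateaus are test functions that converge to indicators of half-open boxes.
  These differ from the open boxes by faces of measure zero, and boxes determine an L2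
  function.\<close>

lemma L2_eqI_test_functions:
  fixes f h :: "'n::finite L2"
  assumes "\<And>\<phi>. test_function UNIV \<phi> \<Longrightarrow>
    (\<integral>x. rep_L2 f x * of_real (\<phi> x) \<partial>lebesgue) = (\<integral>x. rep_L2 h x * of_real (\<phi> x) \<partial>lebesgue)"
  shows "f = h"
proof (rule L2_eqI_boxes)
  fix a b :: "real^'n"
  show "cinner_L2 f (box_L2 a b) = cinner_L2 h (box_L2 a b)"
  proof (cases "\<forall>j\<in>Basis. a \<bullet> j \<le> b \<bullet> j")
    case True
    let ?p = "\<lambda>k j. plateau (a \<bullet> j) (b \<bullet> j) k"
    have supp: "?p k j t = 0" if "j \<in> Basis" "\<not> ((a - One) \<bullet> j < t \<and> t < (b + 2 *\<^sub>R One) \<bullet> j)" for k j t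
      using that True by (intro plateau_eq_0_coarse) (auto simp: inner_diff_left inner_add_left)
    have lim: "(\<lambda>k. \<integral>x. rep_L2 v x * of_real (\<Prod>j\<in>Basis. ?p k j (x \<bullet> j)) \<partial>lebesgue) \<longlonglongrightarrow> cinner_L2 v (box_L2 a b)" for v :: "'n L2"
    proof -
      have "(\<lambda>k. \<integral>x. rep_L2 v x * of_real (\<Prod>j\<in>Basis. ?p k j (x \<bullet> j)) \<partial>lebesgue)
          \<longlonglongrightarrow> (\<integral>x. rep_L2 v x * of_real (\<Prod>j\<in>Basis. indicator {a \<bullet> j<..b \<bullet> j} (x \<bullet> j)) \<partial>lebesgue)"
      proof (rule tendsto_integral_coordinate_prod[where A = "a - One" and B = "b + 2 *\<^sub>R One"])
        fix k :: nat and j :: "real^'n" and t assume "j \<in> Basis"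
        then show "\<bar>?p k j t\<bar> \<le> 2" "(\<lambda>k. ?p k j t) \<longlonglongrightarrow> indicator {a \<bullet> j<..b \<bullet> j} t"
          using True plateau_bounds[of "a \<bullet> j" "b \<bullet> j" k t] by (auto intro: tendsto_plateau)
      qed (use supp in \<open>auto intro: smooth_measurable smooth_plateau\<close>)
      moreover have "(\<integral>x. rep_L2 v x * of_real (\<Prod>j\<in>Basis. indicator {a \<bullet> j<..b \<bullet> j} (x \<bullet> j)) \<partial>lebesgue)
          = cinner_L2 v (box_L2 a b)"
      proof -
        have "(\<integral>x. rep_L2 v x * of_real (\<Prod>j\<in>Basis. indicator {a \<bullet> j<..b \<bullet> j} (x \<bullet> j)) \<partial>lebesgue)
            = (\<integral>x. rep_L2 v x * cnj (indicator (box a b) x) \<partial>lebesgue)"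
        proof (rule integral_cong_AE)
          show "(\<lambda>x. rep_L2 v x * complex_of_real (\<Prod>j\<in>Basis. indicator {a \<bullet> j<..b \<bullet> j} (x \<bullet> j))) \<in> borel_measurable lebesgue"
            by (intro borel_measurable_times measurable_rep_L2 coordinate_prod_measurable) simp
          show "(\<lambda>x. rep_L2 v x * cnj (indicator (box a b) x)) \<in> borel_measurable lebesgue"
            by (rule borel_measurable_integrable[OF integrable_mult_cnj[OF square_integrable_rep_L2 square_integrable_indicator_box]])
          show "AE x in lebesgue. rep_L2 v x * complex_of_real (\<Prod>j\<in>Basis. indicator {a \<bullet> j<..b \<bullet> j} (x \<bullet> j))
              = rep_L2 v x * cnj (indicator (box a b) x)"
            using AE_halfopen_box[of a b] by eventually_elim (simp add: cnj_indicator of_real_indicator del: of_real_prod)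
        qed
        also have "\<dots> = cinner_L2 (abs_L2 (rep_L2 v)) (box_L2 a b)"
          by (rule cinner_L2_abs[OF square_integrable_rep_L2 square_integrable_indicator_box, symmetric])
        finally show ?thesis by simp
      qed
      ultimately show ?thesis by simp
    qed
    have "test_function UNIV (\<lambda>x. \<Prod>j\<in>Basis. ?p k j (x \<bullet> j))" for k
      by (rule test_function_coordinate_prod[OF smooth_plateau supp])
    from assms[OF this] lim[of f] lim[of h] show ?thesis using LIMSEQ_unique by simp
  next
    case False
    then have "box a b = {}" using box_eq_empty(1) by force
    then have "box_L2 a b = 0" using abs_L2_zero by (simp add: indicator_def[abs_def])
    then show ?thesis by (simp add: cinner_L2_zero_right)
  qed
qed

section \<open>Weak gradients in terms of the L2 inner product\<close>

lemma weak_gradient_unique: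
  assumes g: "is_weak_gradient v g" and h: "is_weak_gradient v h"
  shows "g = h"
proof -
  have "g $ i = h $ i" for i
  proof (rule L2_eqI_test_functions)
    fix \<phi> :: "real^'a \<Rightarrow> real" assume \<phi>: "test_function UNIV \<phi>"
    have "- (\<integral>x. rep_L2 (g $ i) x * of_real (\<phi> x) \<partial>lebesgue) = - (\<integral>x. rep_L2 (h $ i) x * of_real (\<phi> x) \<partial>lebesgue)"
      using trans[OF sym[OF g[unfolded is_weak_gradient_def, rule_format, OF \<phi>]]
          h[unfolded is_weak_gradient_def, rule_format, OF \<phi>]] .
    then show "(\<integral>x. rep_L2 (g $ i) x * of_real (\<phi> x) \<partial>lebesgue) = (\<integral>x. rep_L2 (h $ i) x * of_real (\<phi> x) \<partial>lebesgue)"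
      by (simp only: neg_equal_iff_equal)
  qed
  then show ?thesis by (simp add: vec_eq_iff)
qed

lemma continuous_compact_support_square_integrable:
  fixes f :: "real^'n \<Rightarrow> real"
  assumes "continuous_on UNIV f" "compact K" "\<And>x. x \<notin> K \<Longrightarrow> f x = 0"
  shows "square_integrable (\<lambda>x. complex_of_real (f x))"
proof -
  have "integrable lborel (\<lambda>x. indicator K x *\<^sub>R (f x)\<^sup>2)"
    using assms(1,2) by (intro borel_integrable_compact continuous_intros) (auto intro: continuous_on_subset)
  moreover have "(\<lambda>x. indicator K x *\<^sub>R (f x)\<^sup>2) = (\<lambda>x. (f x)\<^sup>2)"
    using assms(3) by (auto simp: fun_eq_iff split: split_indicator)
  ultimately have "integrable lborel (\<lambda>x. (f x)\<^sup>2)" by (simp only:)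
  moreover have f: "f \<in> borel_measurable borel" using assms(1) by (rule borel_measurable_continuous_onI)
  ultimately have "integrable lebesgue (\<lambda>x. (f x)\<^sup>2)" by (subst integrable_completion) simp_all
  then show ?thesis
    using lebesgue_measurable_of_borel[OF f] by (simp add: square_integrable_def)
qed

lemma test_function_square_integrable:
  fixes \<phi> :: "real^'n \<Rightarrow> real"
  assumes "test_function \<Omega> \<phi>"
  shows "square_integrable (\<lambda>x. complex_of_real (\<phi> x))"
    and "square_integrable (\<lambda>x. complex_of_real (frechet_derivative \<phi> (at x) (axis i 1)))"
proof -
  let ?K = "closure {x. \<phi> x \<noteq> 0}"
  have z: "\<phi> x = 0" if "x \<notin> ?K" for x
    using that closure_subset[of "{x. \<phi> x \<noteq> 0}"] by auto
  have "compact ?K" using assms by (simp add: test_function_def)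
  have "Ck 0 \<phi>" "Ck (Suc 0) \<phi>" using assms unfolding test_function_def by (simp_all del: Ck.simps)
  then have c: "continuous_on UNIV \<phi>" "continuous_on UNIV (\<lambda>x. frechet_derivative \<phi> (at x) (axis i 1))"
    by (auto simp: axis_in_Basis_iff)
  show "square_integrable (\<lambda>x. complex_of_real (\<phi> x))"
    by (rule continuous_compact_support_square_integrable[OF c(1) \<open>compact ?K\<close> z])
  have "frechet_derivative \<phi> (at x) (axis i 1) = 0" if "x \<notin> ?K" for x
  proof -
    have "(\<phi> has_derivative (\<lambda>_. 0)) (at x)"
    proof (rule has_derivative_transform_within_open)
      show "((\<lambda>_. 0) has_derivative (\<lambda>_. 0)) (at x)" by (rule has_derivative_const)
      show "open (- ?K)" by (rule open_Compl[OF closed_closure])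
      show "x \<in> - ?K" using that by simp
      show "0 = \<phi> y" if "y \<in> - ?K" for y using z[of y] that by simp
    qed
    from frechet_derivative_at[OF this] show ?thesis by metis
  qed
  then show "square_integrable (\<lambda>x. complex_of_real (frechet_derivative \<phi> (at x) (axis i 1)))"
    by (rule continuous_compact_support_square_integrable[OF c(2) \<open>compact ?K\<close>])
qed

lemma integral_of_real_eq_cinner_L2:
  assumes "square_integrable (\<lambda>x. complex_of_real (f x))"
  shows "(\<integral>x. rep_L2 v x * of_real (f x) \<partial>lebesgue) = cinner_L2 v (abs_L2 (\<lambda>x. of_real (f x)))"
  using cinner_L2_abs[OF square_integrable_rep_L2[of v] assms] by simp

text \<open>Test functions and their derivatives are square integrable, so the defining integrals
  are inner products; linearity and closedness of the weak gradient then come from those of the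
  inner product.\<close>

lemma is_weak_gradient_iff:
  "is_weak_gradient v g \<longleftrightarrow> (\<forall>i \<phi>. test_function UNIV \<phi> \<longrightarrow>
     cinner_L2 v (abs_L2 (\<lambda>x. of_real (frechet_derivative \<phi> (at x) (axis i 1))))
       = - cinner_L2 (g $ i) (abs_L2 (\<lambda>x. of_real (\<phi> x))))"
  unfolding is_weak_gradient_def
  by (auto simp: integral_of_real_eq_cinner_L2 test_function_square_integrable)

section \<open>The transform of a weak gradient\<close>

lemma fourier_measurable:
  fixes F :: "real^'n \<Rightarrow> complex"
  assumes [measurable]: "F \<in> borel_measurable lebesgue"
  shows "fourier F \<in> borel_measurable lebesgue"
proof -
  interpret sigma_finite_measure "lebesgue :: (real^'n) measure" by (rule sigma_finite_lebesgue)
  have [measurable]: "(\<lambda>x. x) \<in> (lebesgue :: (real^'n) measure) \<rightarrow>\<^sub>M borel"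
    by (rule lebesgue_measurable_of_borel) simp
  have "(\<lambda>p. fst p :: real^'n) \<in> borel_measurable (lebesgue \<Otimes>\<^sub>M (lebesgue :: (real^'n) measure))"
    "(\<lambda>p. snd p :: real^'n) \<in> borel_measurable ((lebesgue :: (real^'n) measure) \<Otimes>\<^sub>M lebesgue)"
    by measurable
  then have [measurable]: "(\<lambda>p. snd p \<bullet> fst p :: real) \<in> borel_measurable ((lebesgue :: (real^'n) measure) \<Otimes>\<^sub>M (lebesgue :: (real^'n) measure))"
    by (intro borel_measurable_inner)
  show ?thesis
    unfolding fourier_def[abs_def] by (rule borel_measurable_lebesgue_integral) (simp add: split_beta)
qed

lemma square_integrable_bounded_mult:
  assumes f: "square_integrable f" and m: "m \<in> borel_measurable lebesgue" and K: "AE x in lebesgue. cmod (m x) \<le> K"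
  shows "square_integrable (\<lambda>x. m x * f x)"
proof -
  have [measurable]: "f \<in> borel_measurable lebesgue" "m \<in> borel_measurable lebesgue"
    using f m by (auto simp: square_integrable_def)
  have "integrable lebesgue (\<lambda>x. (cmod (m x * f x))\<^sup>2)"
  proof (rule Bochner_Integration.integrable_bound)
    show "integrable lebesgue (\<lambda>x. K\<^sup>2 * (cmod (f x))\<^sup>2)" using f by (simp add: square_integrable_def)
    show "AE x in lebesgue. norm ((cmod (m x * f x))\<^sup>2) \<le> norm (K\<^sup>2 * (cmod (f x))\<^sup>2)"
      using K
    proof eventually_elim
      case (elim x)
      then have "(cmod (m x))\<^sup>2 * (cmod (f x))\<^sup>2 \<le> K\<^sup>2 * (cmod (f x))\<^sup>2"
        by (intro mult_right_mono power_mono) auto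
      then show ?case by (simp add: norm_mult power_mult_distrib)
    qed
  qed measurable
  then show ?thesis by (simp add: square_integrable_def)
qed

lemma fourier_interval_0_1_bound: "cmod (fourier_interval 0 1 \<xi>) \<le> 1"
proof -
  have "cmod (fourier_interval 0 1 \<xi>) \<le> (\<integral>x. cmod (exp (- (\<i> * of_real (x * \<xi>))) * indicator {0<..<1} x) \<partial>lborel)"
    unfolding fourier_interval_def by (rule integral_norm_bound)
  also have "\<dots> = (\<integral>x. indicator {0<..<1::real} x \<partial>lborel)"
    by (rule Bochner_Integration.integral_cong[OF refl]) (auto simp: norm_mult split: split_indicator)
  finally show ?thesis by simp
qed

lemma fourier_interval_0_1: "\<xi> \<noteq> 0 \<Longrightarrow> \<i> * of_real \<xi> * fourier_interval 0 1 \<xi> = 1 - cis (- \<xi>)"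
  by (simp add: fourier_interval_eq)

text \<open>A zero at a nonzero coordinate forces exp(-\<i> t) = 1, hence a multiple of 2 pi.
  Countably many hyperplanes are null, which later permits cancelling this factor.\<close>

lemma AE_fourier_interval_0_1_nonzero:
  fixes e :: "'a::euclidean_space"
  assumes "e \<in> Basis"
  shows "AE \<xi> in lebesgue. fourier_interval 0 1 (\<xi> \<bullet> e) \<noteq> 0"
proof -
  have "AE \<xi> in lebesgue. \<forall>n::int. \<xi> \<bullet> e \<noteq> 2 * pi * of_int n"
    using AE_coordinate_neq[OF assms] by (simp add: AE_all_countable)
  then show ?thesis
  proof eventually_elim
    case (elim \<xi>)
    show ?case
    proof
      assume z: "fourier_interval 0 1 (\<xi> \<bullet> e) = 0"
      have "\<xi> \<bullet> e \<noteq> 0" using spec[OF elim, of 0] by simp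
      then have "cis (- (\<xi> \<bullet> e)) = 1" using fourier_interval_0_1[of "\<xi> \<bullet> e"] z by simp
      then have "cos (\<xi> \<bullet> e) = 1" by (simp add: complex_eq_iff)
      then obtain n :: int where "\<xi> \<bullet> e = of_int n * 2 * pi" using cos_one_2pi_int by blast
      then show False using spec[OF elim, of n] by (simp add: mult_ac)
    qed
  qed
qed

text \<open>Averaging in the direction i only gives test functions whose derivative in that
  direction is a product of plateaus minus its unit translate. The definition of the weak gradient
  is applied to these and k is sent to infinity.\<close>

lemma weak_gradient_box:
  fixes v :: "'n::finite L2"
  assumes grad: "is_weak_gradient v g" and ab: "\<And>j. j \<in> Basis \<Longrightarrow> a \<bullet> j \<le> b \<bullet> j"
  defines "\<Theta> \<equiv> \<lambda>i x. \<Prod>j\<in>Basis. (if j = axis i 1 then indicator_avg (a \<bullet> j) (b \<bullet> j) else indicator {a \<bullet> j<..b \<bullet> j}) (x \<bullet> j)"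
  shows "cinner_L2 v (box_L2 a b - box_L2 (a + axis i 1) (b + axis i 1))
    = - (\<integral>x. rep_L2 (g $ i) x * of_real (\<Theta> i x) \<partial>lebesgue)"
proof -
  let ?e = "axis i 1 :: real^'n"
  have e: "?e \<in> Basis" by (simp add: axis_in_Basis_iff)
  \<comment> \<open>\<open>p\<close> holds the plain plateau factors, \<open>q\<close> those of the
    test function with the average in the direction \<open>?e\<close>, and \<open>r\<close> those of
    its derivative in that direction.\<close>
  define p where "p k j = plateau (a \<bullet> j) (b \<bullet> j) k" for k and j :: "real^'n"
  define q where "q k = (p k)(?e := plateau_avg (a \<bullet> ?e) (b \<bullet> ?e) k)" for k
  define r where "r k = (p k)(?e := (\<lambda>t. plateau (a \<bullet> ?e) (b \<bullet> ?e) k t - plateau (a \<bullet> ?e) (b \<bullet> ?e) k (t - 1)))" for k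
  \<comment> \<open>Corners of a box containing all supports: averages and translated plateaus reach
    up to b + 2, and strict inequalities leave a margin of 1 on each side.\<close>
  define A where "A = a - One"
  define B where "B = b + 3 *\<^sub>R One"
  have AB: "A \<bullet> j = a \<bullet> j - 1" "B \<bullet> j = b \<bullet> j + 3" if "j \<in> Basis" for j
    using that by (simp_all add: A_def B_def inner_diff_left inner_add_left)
  have smq: "smooth (q k j)" for k j
    by (simp add: q_def p_def smooth_plateau smooth_plateau_avg)
  have smr: "smooth (r k j)" for k j
  proof -
    have "smooth (\<lambda>t. plateau (a \<bullet> ?e) (b \<bullet> ?e) k (1 * t + (- 1)))"
      by (intro smooth_affine smooth_plateau)
    then show ?thesis by (simp add: r_def p_def smooth_plateau smooth_diff)
  qed
  have z: "p k j t = 0" "q k j t = 0" "r k j t = 0" if j: "j \<in> Basis" and t: "\<not> (A \<bullet> j < t \<and> t < B \<bullet> j)" for k j t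
  proof -
    have "t \<notin> {a \<bullet> j..b \<bullet> j + 1}" "t \<notin> {a \<bullet> j..b \<bullet> j + 2}" "t - 1 \<notin> {a \<bullet> j..b \<bullet> j + 1}"
      using t AB[OF j] by auto
    then show "p k j t = 0" "q k j t = 0" "r k j t = 0"
      using plateau_eq_0_coarse[OF ab[OF j]] plateau_avg_eq_0[OF ab[OF j]]
      by (auto simp: p_def q_def r_def)
  qed
  have bnd: "\<bar>p k j t\<bar> \<le> 1" "\<bar>q k j t\<bar> \<le> 2" "\<bar>r k j t\<bar> \<le> 2" if j: "j \<in> Basis" for k j t
  proof -
    have *: "\<bar>plateau (a \<bullet> j) (b \<bullet> j) k t\<bar> \<le> 1" for t
      using plateau_bounds[OF ab[OF j], of k t] by simp
    show "\<bar>p k j t\<bar> \<le> 1" using * by (simp add: p_def)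
    show "\<bar>q k j t\<bar> \<le> 2"
      using *[of t] plateau_avg_bound[OF ab[OF j], of k t] by (auto simp: q_def p_def)
    show "\<bar>r k j t\<bar> \<le> 2"
      using *[of t] *[of "t - 1"] by (auto simp: r_def p_def)
  qed
  have tf: "test_function UNIV (\<lambda>x. \<Prod>j\<in>Basis. q k j (x \<bullet> j))" for k
    by (rule test_function_coordinate_prod[OF smq z(2)])
  have fd: "frechet_derivative (\<lambda>x. \<Prod>j\<in>Basis. q k j (x \<bullet> j)) (at x) ?e = (\<Prod>j\<in>Basis. r k j (x \<bullet> j))" for k x
  proof -
    have "\<exists>f'. \<forall>t. (q k j has_real_derivative f' t) (at t)" for j
      using smooth_has_derivative[OF smq] by blast
    then obtain q' where q': "\<And>j t. (q k j has_real_derivative q' j t) (at t)" by metis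
    have "(q k ?e has_real_derivative r k ?e t) (at t)" for t
      using plateau_avg_deriv by (simp add: q_def r_def)
    then have "q' ?e = r k ?e" using DERIV_unique[OF q'] by blast
    moreover have "(q k)(?e := r k ?e) = r k" by (simp add: q_def r_def)
    ultimately show ?thesis
      using frechet_derivative_coordinate_prod[of "q k" q', OF q' e, of x] by simp
  qed
  have parts: "(\<integral>x. rep_L2 v x * of_real (\<Prod>j\<in>Basis. r k j (x \<bullet> j)) \<partial>lebesgue)
      = - (\<integral>x. rep_L2 (g $ i) x * of_real (\<Prod>j\<in>Basis. q k j (x \<bullet> j)) \<partial>lebesgue)" for k
    using grad[unfolded is_weak_gradient_def, rule_format, OF tf[of k], of i] unfolding fd .
  let ?h = "\<lambda>j. indicator {a \<bullet> j<..b \<bullet> j} :: real \<Rightarrow> real"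
  let ?d = "\<lambda>j. if j = ?e then (\<lambda>t. ?h ?e t - ?h ?e (t - 1)) else ?h j"
  let ?\<theta> = "\<lambda>j. if j = ?e then indicator_avg (a \<bullet> j) (b \<bullet> j) else ?h j"
  have "(\<lambda>k. \<integral>x. rep_L2 v x * of_real (\<Prod>j\<in>Basis. r k j (x \<bullet> j)) \<partial>lebesgue)
      \<longlonglongrightarrow> (\<integral>x. rep_L2 v x * of_real (\<Prod>j\<in>Basis. ?d j (x \<bullet> j)) \<partial>lebesgue)"
  proof (rule tendsto_integral_coordinate_prod[where A = A and B = B])
    fix k :: nat and j :: "real^'n" and t assume j: "j \<in> Basis"
    show "(\<lambda>k. r k j t) \<longlonglongrightarrow> ?d j t"
      using tendsto_plateau[OF ab[OF j]] by (auto simp: r_def p_def intro!: tendsto_diff)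
  qed (use z bnd in \<open>auto intro: smooth_measurable smr\<close>)
  moreover have "(\<lambda>k. - (\<integral>x. rep_L2 (g $ i) x * of_real (\<Prod>j\<in>Basis. q k j (x \<bullet> j)) \<partial>lebesgue))
      \<longlonglongrightarrow> - (\<integral>x. rep_L2 (g $ i) x * of_real (\<Prod>j\<in>Basis. ?\<theta> j (x \<bullet> j)) \<partial>lebesgue)"
  proof (intro tendsto_minus tendsto_integral_coordinate_prod[where A = A and B = B])
    fix k :: nat and j :: "real^'n" and t assume j: "j \<in> Basis"
    show "(\<lambda>k. q k j t) \<longlonglongrightarrow> ?\<theta> j t"
      using tendsto_plateau[OF ab[OF j]] tendsto_plateau_avg[OF ab[OF j]] by (auto simp: q_def p_def)
  qed (use z bnd in \<open>auto intro: smooth_measurable smq\<close>)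
  ultimately have "(\<integral>x. rep_L2 v x * of_real (\<Prod>j\<in>Basis. ?d j (x \<bullet> j)) \<partial>lebesgue) = - (\<integral>x. rep_L2 (g $ i) x * of_real (\<Theta> i x) \<partial>lebesgue)"
    unfolding parts \<Theta>_def by (rule LIMSEQ_unique)
  moreover have "(\<integral>x. rep_L2 v x * of_real (\<Prod>j\<in>Basis. ?d j (x \<bullet> j)) \<partial>lebesgue)
      = cinner_L2 v (box_L2 a b - box_L2 (a + ?e) (b + ?e))"
  proof -
    let ?D = "\<lambda>x. indicator (box a b) x - indicator (box (a + ?e) (b + ?e)) x :: complex"
    have sq: "square_integrable ?D"
      by (intro square_integrable_diff square_integrable_indicator_box)
    have "(\<integral>x. rep_L2 v x * of_real (\<Prod>j\<in>Basis. ?d j (x \<bullet> j)) \<partial>lebesgue) = (\<integral>x. rep_L2 v x * cnj (?D x) \<partial>lebesgue)"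
    proof (rule integral_cong_AE)
      show "(\<lambda>x. rep_L2 v x * complex_of_real (\<Prod>j\<in>Basis. ?d j (x \<bullet> j))) \<in> borel_measurable lebesgue"
        by (intro borel_measurable_times measurable_rep_L2 coordinate_prod_measurable) simp
      show "(\<lambda>x. rep_L2 v x * cnj (?D x)) \<in> borel_measurable lebesgue"
        by (rule borel_measurable_integrable[OF integrable_mult_cnj[OF square_integrable_rep_L2 sq]])
      have split: "(\<Prod>j\<in>Basis. ?d j (x \<bullet> j)) = (\<Prod>j\<in>Basis. ?h j (x \<bullet> j)) - (\<Prod>j\<in>Basis. indicator {(a + ?e) \<bullet> j<..(b + ?e) \<bullet> j} (x \<bullet> j))" for x
      proof -
        have e1: "(\<Prod>j\<in>Basis - {?e}. ?d j (x \<bullet> j)) = (\<Prod>j\<in>Basis - {?e}. ?h j (x \<bullet> j))"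
          by (intro prod.cong) auto
        have e2: "(\<Prod>j\<in>Basis - {?e}. indicator {(a + ?e) \<bullet> j<..(b + ?e) \<bullet> j} (x \<bullet> j)) = (\<Prod>j\<in>Basis - {?e}. ?h j (x \<bullet> j))"
          using e by (intro prod.cong) (auto simp: inner_add_left inner_Basis)
        have e3: "indicator {(a + ?e) \<bullet> ?e<..(b + ?e) \<bullet> ?e} (x \<bullet> ?e) = ?h ?e (x \<bullet> ?e - 1)"
          using e by (auto simp: inner_add_left inner_Basis split: split_indicator)
        show ?thesis
          by (subst (1 2 3) prod.remove[OF finite_Basis e]) (simp only: e1 e2 e3, simp add: left_diff_distrib)
      qed
      show "AE x in lebesgue. rep_L2 v x * complex_of_real (\<Prod>j\<in>Basis. ?d j (x \<bullet> j)) = rep_L2 v x * cnj (?D x)"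
        using AE_halfopen_box[of a b] AE_halfopen_box[of "a + ?e" "b + ?e"]
        by eventually_elim (simp only: split, simp add: cnj_indicator of_real_indicator)
    qed
    also have "\<dots> = cinner_L2 (abs_L2 (rep_L2 v)) (abs_L2 ?D)"
      by (rule cinner_L2_abs[OF square_integrable_rep_L2 sq, symmetric])
    also have "abs_L2 ?D = box_L2 a b - box_L2 (a + ?e) (b + ?e)"
      by (intro abs_L2_diff square_integrable_indicator_box)
    finally show ?thesis by simp
  qed
  ultimately show ?thesis by simp
qed

lemma indicator_avg_bound:
  assumes "a \<le> b" shows "\<bar>indicator_avg a b t\<bar> \<le> indicator {a..b + 2} t"
proof -
  have "(\<lambda>k. \<bar>plateau_avg a b k t\<bar>) \<longlonglongrightarrow> \<bar>indicator_avg a b t\<bar>"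
    by (intro tendsto_rabs tendsto_plateau_avg assms)
  moreover have "\<bar>plateau_avg a b k t\<bar> \<le> indicator {a..b + 2} t" for k
    using plateau_avg_bound[OF assms, of k t] plateau_avg_eq_0[OF assms, of t k]
    by (cases "t \<in> {a..b + 2}") auto
  ultimately show ?thesis by (intro LIMSEQ_le_const2) auto
qed

lemma integrable_indicator_avg: "a \<le> b \<Longrightarrow> integrable lborel (\<lambda>t. complex_of_real (indicator_avg a b t))"
proof (rule Bochner_Integration.integrable_bound)
  assume ab: "a \<le> b"
  then show "integrable lborel (indicat_real {a..b + 2})" by (intro integrable_real_indicator) auto
  show "AE t in lborel. norm (complex_of_real (indicator_avg a b t)) \<le> norm (indicat_real {a..b + 2} t)"
    using indicator_avg_bound[OF ab] by simp
  have [measurable]: "indicator_avg a b \<in> borel_measurable borel" by (rule indicator_avg_measurable[OF ab])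
  show "(\<lambda>t. complex_of_real (indicator_avg a b t)) \<in> borel_measurable lborel" by measurable
qed

lemma exp_inner_prod:
  fixes x \<xi> :: "'a::euclidean_space"
  shows "exp (- (\<i> * complex_of_real (x \<bullet> \<xi>))) = (\<Prod>j\<in>Basis. exp (- (\<i> * of_real ((x \<bullet> j) * (\<xi> \<bullet> j)))))"
proof -
  have "- (\<i> * complex_of_real (x \<bullet> \<xi>)) = (\<Sum>j\<in>Basis. - (\<i> * of_real ((x \<bullet> j) * (\<xi> \<bullet> j))))"
    by (simp add: euclidean_inner[of x \<xi>] sum_distrib_left sum_negf)
  then show ?thesis by (simp add: exp_sum)
qed

lemma fourier_interval_halfopen:
  "(\<integral>t. exp (- (\<i> * of_real (t * \<xi>))) * of_real (indicator {a<..b} t) \<partial>lborel) = fourier_interval a b \<xi>"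
  "integrable lborel (\<lambda>t. exp (- (\<i> * of_real (t * \<xi>))) * complex_of_real (indicator {a<..b} t))"
proof -
  have ae: "AE t in lborel. exp (- (\<i> * of_real (t * \<xi>))) * indicator {a<..<b} t = exp (- (\<i> * of_real (t * \<xi>))) * complex_of_real (indicator {a<..b} t)"
    using AE_lborel_singleton[of b] by eventually_elim (auto split: split_indicator)
  show "(\<integral>t. exp (- (\<i> * of_real (t * \<xi>))) * of_real (indicator {a<..b} t) \<partial>lborel) = fourier_interval a b \<xi>"
    unfolding fourier_interval_def using ae by (intro integral_cong_AE) auto
  show "integrable lborel (\<lambda>t. exp (- (\<i> * of_real (t * \<xi>))) * complex_of_real (indicator {a<..b} t))"
    by (rule integrable_cong_AE_imp[OF integrable_exp_indicator _ ae]) measurable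
qed

definition box_avg :: "real^'n \<Rightarrow> real^'n \<Rightarrow> 'n \<Rightarrow> real^'n \<Rightarrow> real" where
  "box_avg a b i x = (\<Prod>j\<in>Basis. (if j = axis i 1 then indicator_avg (a \<bullet> j) (b \<bullet> j) else indicator {a \<bullet> j<..b \<bullet> j}) (x \<bullet> j))"

lemma box_avg_integrable:
  fixes a b :: "real^'n"
  assumes ab: "\<And>j. j \<in> Basis \<Longrightarrow> a \<bullet> j \<le> b \<bullet> j"
  shows "integrable lebesgue (\<lambda>x. complex_of_real (box_avg a b i x))"
    and "square_integrable (\<lambda>x. complex_of_real (box_avg a b i x))"
proof -
  let ?f = "\<lambda>j. if j = axis i 1 then indicator_avg (a \<bullet> j) (b \<bullet> j) else indicator {a \<bullet> j<..b \<bullet> j}"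
  have fi: "integrable lborel (\<lambda>t. complex_of_real (?f j t))" if j: "j \<in> Basis" for j
    using integrable_indicator_avg[OF ab[OF j]] fourier_interval_halfopen(2)[of 0] by auto
  have i: "integrable lborel (\<lambda>x. \<Prod>j\<in>Basis. complex_of_real (?f j (x \<bullet> j)))"
    by (rule lborel_prod(1)[of "\<lambda>j t. complex_of_real (?f j t)", OF fi])
  then have "integrable lborel (\<lambda>x. complex_of_real (box_avg a b i x))"
    by (simp add: box_avg_def of_real_prod)
  then show i1: "integrable lebesgue (\<lambda>x. complex_of_real (box_avg a b i x))"
    by (subst integrable_completion) auto
  have le: "\<bar>box_avg a b i x\<bar> \<le> 1" for x
  proof -
    have "\<bar>?f j (x \<bullet> j)\<bar> \<le> 1" if j: "j \<in> Basis" for j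
      using order_trans[OF indicator_avg_bound[OF ab[OF j], of "x \<bullet> j"] indicator_le_1] by (auto split: split_indicator)
    then show ?thesis unfolding box_avg_def abs_prod by (intro prod_le_1) auto
  qed
  have m: "(\<lambda>x. complex_of_real (box_avg a b i x)) \<in> borel_measurable lebesgue"
    by (rule borel_measurable_integrable[OF i1])
  have "integrable lebesgue (\<lambda>x. (cmod (complex_of_real (box_avg a b i x)))\<^sup>2)"
  proof (rule Bochner_Integration.integrable_bound[OF i1])
    show "AE x in lebesgue. norm ((cmod (complex_of_real (box_avg a b i x)))\<^sup>2) \<le> norm (complex_of_real (box_avg a b i x))"
    proof (rule AE_I2)
      fix x
      have "\<bar>box_avg a b i x\<bar>\<^sup>2 \<le> \<bar>box_avg a b i x\<bar>" using mult_right_mono[OF le[of x], of "\<bar>box_avg a b i x\<bar>"] by (simp add: power2_eq_square)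
      then show "norm ((cmod (complex_of_real (box_avg a b i x)))\<^sup>2) \<le> norm (complex_of_real (box_avg a b i x))" by simp
    qed
    show "(\<lambda>x. (cmod (complex_of_real (box_avg a b i x)))\<^sup>2) \<in> borel_measurable lebesgue" using m by measurable
  qed
  then show "square_integrable (\<lambda>x. complex_of_real (box_avg a b i x))"
    using m by (simp add: square_integrable_def)
qed

lemma fourier_box_avg:
  fixes a b \<xi> :: "real^'n"
  assumes ab: "\<And>j. j \<in> Basis \<Longrightarrow> a \<bullet> j \<le> b \<bullet> j" and \<xi>: "\<xi> \<bullet> axis i 1 \<noteq> 0"
  shows "fourier (\<lambda>x. of_real (box_avg a b i x)) \<xi>
    = fourier_interval 0 1 (\<xi> \<bullet> axis i 1) * fourier (indicator (box a b)) \<xi>"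
proof -
  let ?e = "axis i 1 :: real^'n"
  have e: "?e \<in> Basis" by (simp add: axis_in_Basis_iff)
  let ?f = "\<lambda>j. if j = ?e then indicator_avg (a \<bullet> j) (b \<bullet> j) else indicator {a \<bullet> j<..b \<bullet> j}"
  let ?F = "\<lambda>j t. exp (- (\<i> * of_real (t * (\<xi> \<bullet> j)))) * complex_of_real (?f j t)"
  have int: "integrable lborel (?F j)" if j: "j \<in> Basis" for j
    using fourier_indicator_avg(2)[OF ab[OF e] \<xi>] fourier_interval_halfopen(2) by auto
  have eq: "exp (- (\<i> * of_real (x \<bullet> \<xi>))) * of_real (box_avg a b i x) = (\<Prod>j\<in>Basis. ?F j (x \<bullet> j))" for x
    by (simp only: exp_inner_prod box_avg_def of_real_prod prod.distrib)
  have "fourier (\<lambda>x. of_real (box_avg a b i x)) \<xi> = (\<integral>x. (\<Prod>j\<in>Basis. ?F j (x \<bullet> j)) \<partial>lborel)"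
    unfolding fourier_def eq
    by (rule integral_completion) (use borel_measurable_integrable[OF lborel_prod(1)[of ?F, OF int]] in simp)
  also have "\<dots> = (\<Prod>j\<in>Basis. \<integral>t. ?F j t \<partial>lborel)"
    by (rule lborel_prod(2)[of ?F, OF int])
  also have "\<dots> = (\<Prod>j\<in>Basis. (if j = ?e then fourier_interval 0 1 (\<xi> \<bullet> ?e) else 1) * fourier_interval (a \<bullet> j) (b \<bullet> j) (\<xi> \<bullet> j))"
    by (intro prod.cong refl) (use fourier_indicator_avg(1)[OF ab[OF e] \<xi>] fourier_interval_halfopen(1) in auto)
  also have "\<dots> = fourier_interval 0 1 (\<xi> \<bullet> ?e) * fourier (indicator (box a b)) \<xi>"
    using e by (simp add: prod.distrib fourier_indicator_box)
  finally show ?thesis .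
qed

text \<open>Only the factor in the direction i changes under the translation. Compared with
  \<open>fourier_box_avg\<close>, the right-hand side is \<i> times that coordinate of \<xi> times
  the transform of \<open>box_avg\<close>.\<close>

lemma fourier_shifted_box:
  fixes a b \<xi> :: "real^'n"
  assumes ab: "\<And>j. j \<in> Basis \<Longrightarrow> a \<bullet> j \<le> b \<bullet> j" and \<xi>: "\<xi> \<bullet> axis i 1 \<noteq> 0"
  shows "fourier (indicator (box a b)) \<xi> - fourier (indicator (box (a + axis i 1) (b + axis i 1))) \<xi>
    = \<i> * of_real (\<xi> \<bullet> axis i 1) * (fourier_interval 0 1 (\<xi> \<bullet> axis i 1) * fourier (indicator (box a b)) \<xi>)"
proof -
  let ?e = "axis i 1 :: real^'n"
  have e: "?e \<in> Basis" by (simp add: axis_in_Basis_iff)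
  let ?R = "\<Prod>j\<in>Basis - {?e}. fourier_interval (a \<bullet> j) (b \<bullet> j) (\<xi> \<bullet> j)"
  have 1: "fourier (indicator (box a b)) \<xi> = fourier_interval (a \<bullet> ?e) (b \<bullet> ?e) (\<xi> \<bullet> ?e) * ?R"
    unfolding fourier_indicator_box by (rule prod.remove[OF finite_Basis e])
  have "(\<Prod>j\<in>Basis - {?e}. fourier_interval ((a + ?e) \<bullet> j) ((b + ?e) \<bullet> j) (\<xi> \<bullet> j)) = ?R"
    using e by (intro prod.cong) (auto simp: inner_add_left inner_Basis)
  then have 2: "fourier (indicator (box (a + ?e) (b + ?e))) \<xi> = fourier_interval (a \<bullet> ?e + 1) (b \<bullet> ?e + 1) (\<xi> \<bullet> ?e) * ?R"
    unfolding fourier_indicator_box prod.remove[OF finite_Basis e] using e by (simp add: inner_add_left inner_Basis)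
  show ?thesis
    unfolding 1 2 left_diff_distrib[symmetric] fourier_interval_shift[OF ab[OF e] \<xi>] by (simp only: mult.assoc)
qed

text \<open>Box identities for the weak gradient become, after Plancherel, the statement that the
  desired difference, multiplied by the bounded factor \<open>cnj (\<mu> \<xi>)\<close>, is
  orthogonal to the transforms of all boxes. Hence the product vanishes, and \<open>\<mu>\<close> is
  nonzero almost everywhere.\<close>

lemma fourier_weak_gradient:
  fixes v :: "'n::finite L2"
  assumes grad: "is_weak_gradient v g"
  shows "AE \<xi> in lebesgue. rep_L2 (fourier_L2 (g $ i)) \<xi> = \<i> * of_real (\<xi> $ i) * rep_L2 (fourier_L2 v) \<xi>"
proof -
  let ?e = "axis i 1 :: real^'n"
  have e: "?e \<in> Basis" by (simp add: axis_in_Basis_iff)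
  define \<mu> where "\<mu> \<xi> = fourier_interval 0 1 (\<xi> \<bullet> ?e)" for \<xi>
  \<comment> \<open>Multiplying by the coordinate alone could leave L2; together with
    \<open>\<mu>\<close> it is 1 - exp(-\<i> t) for nonzero t, bounded by 2.\<close>
  define m where "m \<xi> = \<i> * of_real (\<xi> \<bullet> ?e) * \<mu> \<xi>" for \<xi>
  have \<mu>_meas: "\<mu> \<in> borel_measurable lebesgue"
    unfolding \<mu>_def[abs_def] by (rule lebesgue_measurable_of_borel) measurable
  have m_meas: "m \<in> borel_measurable lebesgue"
    unfolding m_def[abs_def] \<mu>_def by (rule lebesgue_measurable_of_borel) measurable
  have \<mu>_bound: "cmod (\<mu> \<xi>) \<le> 1" for \<xi> by (simp add: \<mu>_def fourier_interval_0_1_bound)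
  have m_bound: "cmod (m \<xi>) \<le> 2" for \<xi>
  proof (cases "\<xi> \<bullet> ?e = 0")
    case False
    then have "m \<xi> = 1 - cis (- (\<xi> \<bullet> ?e))" unfolding m_def \<mu>_def by (rule fourier_interval_0_1)
    then show ?thesis using norm_triangle_ineq4[of 1 "cis (- (\<xi> \<bullet> ?e))"] by simp
  qed (simp add: m_def)
  have neq: "AE \<xi> in lebesgue. \<xi> \<bullet> ?e \<noteq> 0" by (rule AE_coordinate_neq[OF e])
  \<comment> \<open>The conjugate of \<open>m\<close> is - \<i> times the coordinate times the
    conjugate of \<open>\<mu>\<close>, so this is \<open>cnj (\<mu> \<xi>)\<close> times the
    difference of the two sides of the claim, split into two L2 functions.\<close>
  define w where "w \<xi> = cnj (m \<xi>) * rep_L2 (fourier_L2 v) \<xi> + cnj (\<mu> \<xi>) * rep_L2 (fourier_L2 (g $ i)) \<xi>" for \<xi>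
  have sq1: "square_integrable (\<lambda>\<xi>. cnj (m \<xi>) * rep_L2 (fourier_L2 v) \<xi>)"
    by (rule square_integrable_bounded_mult[OF square_integrable_rep_L2 cnj_measurable[OF m_meas], where K = 2]) (simp add: m_bound)
  have sq2: "square_integrable (\<lambda>\<xi>. cnj (\<mu> \<xi>) * rep_L2 (fourier_L2 (g $ i)) \<xi>)"
    by (rule square_integrable_bounded_mult[OF square_integrable_rep_L2 cnj_measurable[OF \<mu>_meas], where K = 1]) (simp add: \<mu>_bound)
  have sqw: "square_integrable w" unfolding w_def[abs_def] by (rule square_integrable_add[OF sq1 sq2])
  have orth: "cinner_L2 (abs_L2 w) (fourier_L2 (box_L2 a b)) = 0" for a b
  proof (cases "\<forall>j\<in>Basis. a \<bullet> j \<le> b \<bullet> j")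
    case False
    then have "box a b = {}" using box_eq_empty(1) by force
    then have "box_L2 a b = 0" using abs_L2_zero by (simp add: indicator_def[abs_def])
    then show ?thesis by (simp add: cinner_L2_zero_right linear_0[OF bounded_linear.linear[OF bounded_linear_fourier_L2]])
  next
    case True
    then have ab: "\<And>j. j \<in> Basis \<Longrightarrow> a \<bullet> j \<le> b \<bullet> j" by blast
    let ?Q = "fourier (indicator (box a b))"
    let ?Q' = "fourier (indicator (box (a + ?e) (b + ?e)))"
    let ?T = "\<lambda>x. complex_of_real (box_avg a b i x)"
    have FT: "AE \<xi> in lebesgue. fourier ?T \<xi> = \<mu> \<xi> * ?Q \<xi>"
      using neq by eventually_elim (simp add: \<mu>_def fourier_box_avg[OF ab])
    have sqFT: "square_integrable (fourier ?T)"
    proof -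
      have meas: "fourier ?T \<in> borel_measurable lebesgue"
        by (rule fourier_measurable[OF borel_measurable_integrable[OF box_avg_integrable(1)[OF ab]]])
      have "square_integrable (\<lambda>\<xi>. \<mu> \<xi> * ?Q \<xi>)"
        by (rule square_integrable_bounded_mult[OF square_integrable_fourier_box \<mu>_meas, where K = 1]) (simp add: \<mu>_bound)
      then have "integrable lebesgue (\<lambda>\<xi>. (cmod (\<mu> \<xi> * ?Q \<xi>))\<^sup>2)" by (simp add: square_integrable_def)
      then have "integrable lebesgue (\<lambda>\<xi>. (cmod (fourier ?T \<xi>))\<^sup>2)"
        by (rule integrable_cong_AE_imp) (use FT meas in auto)
      then show ?thesis using meas by (simp add: square_integrable_def)
    qed
    have sqD: "square_integrable (\<lambda>\<xi>. ?Q \<xi> - ?Q' \<xi>)"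
      by (intro square_integrable_diff square_integrable_fourier_box)
    have FD: "AE \<xi> in lebesgue. ?Q \<xi> - ?Q' \<xi> = m \<xi> * ?Q \<xi>"
      using neq by eventually_elim (simp add: m_def \<mu>_def fourier_shifted_box[OF ab])
    have fD: "fourier_L2 (box_L2 a b - box_L2 (a + ?e) (b + ?e)) = abs_L2 (\<lambda>\<xi>. ?Q \<xi> - ?Q' \<xi>)"
      by (simp add: fourier_L2_diff abs_L2_diff square_integrable_fourier_box
          fourier_L2_abs[OF integrable_indicator_box square_integrable_indicator_box square_integrable_fourier_box])
    have fT: "fourier_L2 (abs_L2 ?T) = abs_L2 (fourier ?T)"
      by (rule fourier_L2_abs[OF box_avg_integrable[OF ab] sqFT])
    have "cinner_L2 v (box_L2 a b - box_L2 (a + ?e) (b + ?e)) = - (\<integral>x. rep_L2 (g $ i) x * ?T x \<partial>lebesgue)"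
      unfolding box_avg_def by (rule weak_gradient_box[OF grad ab])
    also have "(\<integral>x. rep_L2 (g $ i) x * ?T x \<partial>lebesgue) = cinner_L2 (g $ i) (abs_L2 ?T)"
      by (rule integral_of_real_eq_cinner_L2[OF box_avg_integrable(2)[OF ab]])
    finally have "cinner_L2 (fourier_L2 v) (fourier_L2 (box_L2 a b - box_L2 (a + ?e) (b + ?e)))
        = - cinner_L2 (fourier_L2 (g $ i)) (fourier_L2 (abs_L2 ?T))"
      by (simp add: cinner_fourier_L2)
    then have "cinner_L2 (abs_L2 (rep_L2 (fourier_L2 v))) (abs_L2 (\<lambda>\<xi>. ?Q \<xi> - ?Q' \<xi>))
        + cinner_L2 (abs_L2 (rep_L2 (fourier_L2 (g $ i)))) (abs_L2 (fourier ?T)) = 0"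
      by (simp add: fD fT)
    then have sum0: "(\<integral>\<xi>. rep_L2 (fourier_L2 v) \<xi> * cnj (?Q \<xi> - ?Q' \<xi>) \<partial>lebesgue)
        + (\<integral>\<xi>. rep_L2 (fourier_L2 (g $ i)) \<xi> * cnj (fourier ?T \<xi>) \<partial>lebesgue) = 0"
      by (simp only: cinner_L2_abs[OF square_integrable_rep_L2 sqD] cinner_L2_abs[OF square_integrable_rep_L2 sqFT])
    have i1: "integrable lebesgue (\<lambda>\<xi>. (cnj (m \<xi>) * rep_L2 (fourier_L2 v) \<xi>) * cnj (?Q \<xi>))"
      and i2: "integrable lebesgue (\<lambda>\<xi>. (cnj (\<mu> \<xi>) * rep_L2 (fourier_L2 (g $ i)) \<xi>) * cnj (?Q \<xi>))"
      by (intro integrable_mult_cnj sq1 sq2 square_integrable_fourier_box)+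
    have "(\<integral>\<xi>. rep_L2 (fourier_L2 v) \<xi> * cnj (?Q \<xi> - ?Q' \<xi>) \<partial>lebesgue)
        = (\<integral>\<xi>. (cnj (m \<xi>) * rep_L2 (fourier_L2 v) \<xi>) * cnj (?Q \<xi>) \<partial>lebesgue)"
    proof (rule integral_cong_AE)
      show "AE \<xi> in lebesgue. rep_L2 (fourier_L2 v) \<xi> * cnj (?Q \<xi> - ?Q' \<xi>) = (cnj (m \<xi>) * rep_L2 (fourier_L2 v) \<xi>) * cnj (?Q \<xi>)"
        using FD by eventually_elim (simp only: complex_cnj_mult mult_ac)
      show "(\<lambda>\<xi>. rep_L2 (fourier_L2 v) \<xi> * cnj (?Q \<xi> - ?Q' \<xi>)) \<in> borel_measurable lebesgue"
        by (rule borel_measurable_integrable[OF integrable_mult_cnj[OF square_integrable_rep_L2 sqD]])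
    qed (rule borel_measurable_integrable[OF i1])
    moreover have "(\<integral>\<xi>. rep_L2 (fourier_L2 (g $ i)) \<xi> * cnj (fourier ?T \<xi>) \<partial>lebesgue)
        = (\<integral>\<xi>. (cnj (\<mu> \<xi>) * rep_L2 (fourier_L2 (g $ i)) \<xi>) * cnj (?Q \<xi>) \<partial>lebesgue)"
    proof (rule integral_cong_AE)
      show "AE \<xi> in lebesgue. rep_L2 (fourier_L2 (g $ i)) \<xi> * cnj (fourier ?T \<xi>) = (cnj (\<mu> \<xi>) * rep_L2 (fourier_L2 (g $ i)) \<xi>) * cnj (?Q \<xi>)"
        using FT by eventually_elim (simp only: complex_cnj_mult mult_ac)
      show "(\<lambda>\<xi>. rep_L2 (fourier_L2 (g $ i)) \<xi> * cnj (fourier ?T \<xi>)) \<in> borel_measurable lebesgue"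
        by (rule borel_measurable_integrable[OF integrable_mult_cnj[OF square_integrable_rep_L2 sqFT]])
    qed (rule borel_measurable_integrable[OF i2])
    ultimately have "(\<integral>\<xi>. w \<xi> * cnj (?Q \<xi>) \<partial>lebesgue) = 0"
      using sum0 Bochner_Integration.integral_add[OF i1 i2] by (simp add: w_def distrib_right)
    then show ?thesis
      by (simp add: cinner_L2_abs[OF sqw square_integrable_fourier_box]
          fourier_L2_abs[OF integrable_indicator_box square_integrable_indicator_box square_integrable_fourier_box])
  qed
  \<comment> \<open>By surjectivity \<open>w\<close> is itself a transform, and the isometry turns
    orthogonality to transforms of boxes into orthogonality of \<open>y\<close> to the boxes
    themselves.\<close>
  obtain y where y: "fourier_L2 y = abs_L2 w" using surj_fourier_L2 by (metis UNIV_I imageE)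
  have "cinner_L2 y (box_L2 a b) = 0" for a b
    using orth[of a b] cinner_fourier_L2[of y "box_L2 a b"] by (simp add: y)
  then have "y = 0" by (rule L2_zero_if_orthogonal_to_boxes)
  then have "abs_L2 w = 0"
    using y linear_0[OF bounded_linear.linear[OF bounded_linear_fourier_L2]] by metis
  then have "AE \<xi> in lebesgue. rep_L2 (abs_L2 w) \<xi> = 0" using rep_L2_zero by simp
  with rep_abs_L2[OF sqw] AE_fourier_interval_0_1_nonzero[OF e]
  show ?thesis
  proof eventually_elim
    case (elim \<xi>)
    have "cnj (\<mu> \<xi>) * (rep_L2 (fourier_L2 (g $ i)) \<xi> - \<i> * of_real (\<xi> \<bullet> ?e) * rep_L2 (fourier_L2 v) \<xi>) = 0"
      using elim(1,3) by (auto simp: w_def m_def algebra_simps)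
    then show ?case using elim(2) by (simp add: \<mu>_def inner_axis)
  qed
qed

section \<open>The Sobolev space and the fractional Laplacian\<close>

lemma is_weak_gradient_add:
  "is_weak_gradient v g \<Longrightarrow> is_weak_gradient w h \<Longrightarrow> is_weak_gradient (v + w) (g + h)"
  unfolding is_weak_gradient_iff by (simp add: cinner_L2_add_left)

lemma is_weak_gradient_scaleC:
  "is_weak_gradient v g \<Longrightarrow> is_weak_gradient (scaleC_L2 z v) (\<chi> i. scaleC_L2 z (g $ i))"
  unfolding is_weak_gradient_iff by (simp add: cinner_L2_scaleC_left)

lemma is_weak_gradient_scaleR:
  "is_weak_gradient v g \<Longrightarrow> is_weak_gradient (r *\<^sub>R v) (r *\<^sub>R g)"
  unfolding is_weak_gradient_iff by (simp add: cinner_L2_scaleR_left)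

lemma cinner_L2_zero_left: "cinner_L2 0 f = 0"
  using cinner_L2_add_left[of 0 0 f] by simp

lemma is_weak_gradient_zero: "is_weak_gradient 0 0"
  unfolding is_weak_gradient_iff by (simp add: cinner_L2_zero_left)

lemma weak_gradient_eqI: "is_weak_gradient v g \<Longrightarrow> weak_gradient v = g"
  unfolding weak_gradient_def using weak_gradient_unique by blast

lemma is_weak_gradient_weak_gradient: "v \<in> H1 \<Longrightarrow> is_weak_gradient v (weak_gradient v)"
  unfolding H1_def using weak_gradient_eqI by auto

lemma H1_I: "is_weak_gradient v g \<Longrightarrow> v \<in> H1" by (auto simp: H1_def)

lemma closed_weak_gradient_graph: "closed {p :: 'n::finite L2 \<times> (('n L2)^'n). is_weak_gradient (fst p) (snd p)}"
proof (rule closed_sequential_limits[THEN iffD2], intro allI impI, elim conjE)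
  fix p :: "nat \<Rightarrow> 'n L2 \<times> (('n L2)^'n)" and l
  assume p: "\<forall>n. p n \<in> {p. is_weak_gradient (fst p) (snd p)}" and l: "p \<longlonglongrightarrow> l"
  have "is_weak_gradient (fst l) (snd l)"
    unfolding is_weak_gradient_iff
  proof (intro allI impI)
    fix i and \<phi> :: "real^'n \<Rightarrow> real" assume \<phi>: "test_function UNIV \<phi>"
    let ?d = "abs_L2 (\<lambda>x. complex_of_real (frechet_derivative \<phi> (at x) (axis i 1)))"
    let ?f = "abs_L2 (\<lambda>x. complex_of_real (\<phi> x))"
    have eq: "cinner_L2 (fst (p n)) ?d = - cinner_L2 (snd (p n) $ i) ?f" for n
      using p \<phi> unfolding is_weak_gradient_iff by blast
    have "(\<lambda>n. cinner_L2 (fst (p n)) ?d) \<longlonglongrightarrow> cinner_L2 (fst l) ?d"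
      by (intro tendsto_cinner_L2 tendsto_fst l tendsto_const)
    moreover have "(\<lambda>n. - cinner_L2 (snd (p n) $ i) ?f) \<longlonglongrightarrow> - cinner_L2 (snd l $ i) ?f"
      by (intro tendsto_minus tendsto_cinner_L2 tendsto_vec_nth tendsto_snd l tendsto_const)
    ultimately show "cinner_L2 (fst l) ?d = - cinner_L2 (snd l $ i) ?f"
      unfolding eq by (rule LIMSEQ_unique)
  qed
  then show "l \<in> {p. is_weak_gradient (fst p) (snd p)}" by simp
qed

text \<open>Elements of \<open>H\<^sup>1\<close> are encoded as pairs of a function and its weak gradient, so that the
  Hilbert space structure is inherited from a product of copies of \<open>L\<^sup>2\<close>.\<close>

typedef (overloaded) 'n sobolev = "{p :: 'n::finite L2 \<times> (('n L2)^'n). is_weak_gradient (fst p) (snd p)}"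
  morphisms Rep_sobolev Abs_sobolev
  using is_weak_gradient_zero by (intro exI[of _ "(0, 0)"]) simp

instantiation sobolev :: (finite) real_inner
begin

definition zero_sobolev :: "'a sobolev" where "zero_sobolev = Abs_sobolev 0"
definition plus_sobolev :: "'a sobolev \<Rightarrow> 'a sobolev \<Rightarrow> 'a sobolev" where
  "plus_sobolev x y = Abs_sobolev (Rep_sobolev x + Rep_sobolev y)"
definition scaleR_sobolev :: "real \<Rightarrow> 'a sobolev \<Rightarrow> 'a sobolev" where
  "scaleR_sobolev r x = Abs_sobolev (r *\<^sub>R Rep_sobolev x)"
definition uminus_sobolev :: "'a sobolev \<Rightarrow> 'a sobolev" where "uminus_sobolev x = (-1) *\<^sub>R x"
definition minus_sobolev :: "'a sobolev \<Rightarrow> 'a sobolev \<Rightarrow> 'a sobolev" where "minus_sobolev x y = x + - y"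
definition inner_sobolev :: "'a sobolev \<Rightarrow> 'a sobolev \<Rightarrow> real" where
  "inner_sobolev x y = inner (Rep_sobolev x) (Rep_sobolev y)"
definition norm_sobolev :: "'a sobolev \<Rightarrow> real" where "norm_sobolev x = sqrt (inner x x)"
definition sgn_sobolev :: "'a sobolev \<Rightarrow> 'a sobolev" where "sgn_sobolev x = scaleR (inverse (norm x)) x"
definition dist_sobolev :: "'a sobolev \<Rightarrow> 'a sobolev \<Rightarrow> real" where "dist_sobolev x y = norm (x - y)"
definition uniformity_sobolev :: "('a sobolev \<times> 'a sobolev) filter" where
  "uniformity_sobolev = (INF e\<in>{0<..}. principal {(x, y). dist x y < e})"
definition open_sobolev :: "'a sobolev set \<Rightarrow> bool" where
  "open_sobolev U \<longleftrightarrow> (\<forall>x\<in>U. eventually (\<lambda>(x', y). x' = x \<longrightarrow> y \<in> U) uniformity)"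

lemma Rep_sobolev_zero: "Rep_sobolev (0 :: 'a sobolev) = 0"
  unfolding zero_sobolev_def by (rule Abs_sobolev_inverse) (simp add: is_weak_gradient_zero)

lemma Rep_sobolev_add: "Rep_sobolev (x + y :: 'a sobolev) = Rep_sobolev x + Rep_sobolev y"
  unfolding plus_sobolev_def
  by (rule Abs_sobolev_inverse) (use Rep_sobolev[of x] Rep_sobolev[of y] in \<open>simp add: is_weak_gradient_add\<close>)

lemma Rep_sobolev_scaleR: "Rep_sobolev (r *\<^sub>R x :: 'a sobolev) = r *\<^sub>R Rep_sobolev x"
  unfolding scaleR_sobolev_def
  by (rule Abs_sobolev_inverse) (use Rep_sobolev[of x] in \<open>simp add: is_weak_gradient_scaleR\<close>)

instance
proof
  fix x y z :: "'a sobolev" and r q :: real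
  note Rep = Rep_sobolev_inject[symmetric] Rep_sobolev_add Rep_sobolev_scaleR Rep_sobolev_zero
  show "x + y + z = x + (y + z)" by (simp add: Rep add.assoc)
  show "x + y = y + x" by (simp add: Rep add.commute)
  show "0 + x = x" by (simp add: Rep)
  show "- x + x = 0" by (simp add: Rep uminus_sobolev_def)
  show "x - y = x + - y" by (rule minus_sobolev_def)
  show "r *\<^sub>R (x + y) = r *\<^sub>R x + r *\<^sub>R y" by (simp add: Rep scaleR_add_right)
  show "(r + q) *\<^sub>R x = r *\<^sub>R x + q *\<^sub>R x" by (simp add: Rep scaleR_add_left)
  show "r *\<^sub>R q *\<^sub>R x = (r * q) *\<^sub>R x" by (simp add: Rep)
  show "1 *\<^sub>R x = x" by (simp add: Rep)
  show "sgn x = scaleR (inverse (norm x)) x" by (rule sgn_sobolev_def)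
  show "dist x y = norm (x - y)" by (rule dist_sobolev_def)
  show "uniformity = (INF e\<in>{0<..}. principal {(x::'a sobolev, y). dist x y < e})"
    by (rule uniformity_sobolev_def)
  show "open U = (\<forall>x\<in>U. eventually (\<lambda>(x', y). x' = x \<longrightarrow> y \<in> U) uniformity)" for U :: "'a sobolev set"
    by (rule open_sobolev_def)
  show "inner x y = inner y x" by (simp add: inner_sobolev_def inner_commute)
  show "inner (x + y) z = inner x z + inner y z" by (simp add: inner_sobolev_def Rep inner_add_left)
  show "inner (r *\<^sub>R x) y = r * inner x y" by (simp add: inner_sobolev_def Rep)
  show "0 \<le> inner x x" by (simp add: inner_sobolev_def)
  show "(inner x x = 0) = (x = 0)" by (simp add: inner_sobolev_def Rep)
  show "norm x = sqrt (inner x x)" by (rule norm_sobolev_def)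
qed

end

lemma Rep_sobolev_diff: "Rep_sobolev (x - y) = Rep_sobolev x - Rep_sobolev y"
  using Rep_sobolev_add[of x "- y"] Rep_sobolev_scaleR[of "-1" y] by simp

lemma norm_Rep_sobolev: "norm (Rep_sobolev x) = norm x"
  by (simp add: norm_eq_sqrt_inner inner_sobolev_def)

lemma bounded_linear_Rep_sobolev: "bounded_linear Rep_sobolev"
  by (rule bounded_linear_intro[where K = 1]) (simp_all add: Rep_sobolev_add Rep_sobolev_scaleR norm_Rep_sobolev)

instance sobolev :: (finite) banach
proof
  fix X :: "nat \<Rightarrow> 'a sobolev" assume X: "Cauchy X"
  have "Cauchy (\<lambda>n. Rep_sobolev (X n))"
    by (rule bounded_linear.Cauchy[OF bounded_linear_Rep_sobolev X])
  then obtain l where l: "(\<lambda>n. Rep_sobolev (X n)) \<longlonglongrightarrow> l"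
    using Cauchy_convergent_iff convergent_def by blast
  then have "l \<in> {p. is_weak_gradient (fst p) (snd p)}"
    using closed_sequentially[OF closed_weak_gradient_graph, of "\<lambda>n. Rep_sobolev (X n)"] Rep_sobolev by blast
  then have Rl: "Rep_sobolev (Abs_sobolev l) = l" by (rule Abs_sobolev_inverse)
  have "(\<lambda>n. norm (X n - Abs_sobolev l)) \<longlonglongrightarrow> 0"
    using tendsto_norm[OF LIM_zero[OF l]] by (simp add: norm_Rep_sobolev[symmetric] Rep_sobolev_diff Rl)
  then have "X \<longlonglongrightarrow> Abs_sobolev l" by (simp add: LIM_zero_iff tendsto_norm_zero_iff)
  then show "convergent X" by (auto simp: convergent_def)
qed

definition fun_of :: "'n::finite sobolev \<Rightarrow> 'n L2" where "fun_of x = fst (Rep_sobolev x)"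
definition sobolev_of :: "'n::finite L2 \<Rightarrow> 'n sobolev" where "sobolev_of v = Abs_sobolev (v, weak_gradient v)"

lemma fun_of_H1: "fun_of x \<in> H1"
  using Rep_sobolev[of x] by (auto simp: fun_of_def intro: H1_I)

lemma Rep_sobolev_eq: "Rep_sobolev x = (fun_of x, weak_gradient (fun_of x))"
  using Rep_sobolev[of x] weak_gradient_eqI[of "fun_of x" "snd (Rep_sobolev x)"] by (simp add: fun_of_def)

lemma Rep_sobolev_of: "v \<in> H1 \<Longrightarrow> Rep_sobolev (sobolev_of v) = (v, weak_gradient v)"
  unfolding sobolev_of_def by (rule Abs_sobolev_inverse) (simp add: is_weak_gradient_weak_gradient)

lemma fun_of_sobolev_of [simp]: "v \<in> H1 \<Longrightarrow> fun_of (sobolev_of v) = v"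
  by (simp add: fun_of_def Rep_sobolev_of)

lemma sobolev_of_fun_of [simp]: "sobolev_of (fun_of x) = x"
  unfolding sobolev_of_def Rep_sobolev_eq[symmetric] by (rule Rep_sobolev_inverse)

lemma H1_norm_fun_of: "H1_norm (fun_of x) = norm x"
  unfolding norm_Rep_sobolev[symmetric] Rep_sobolev_eq norm_Pair H1_norm_def ..

lemma bounded_linear_fun_of: "bounded_linear fun_of"
  unfolding fun_of_def by (rule bounded_linear_compose[OF bounded_linear_fst bounded_linear_Rep_sobolev])

lemma bounded_linear_weak_gradient_fun_of: "bounded_linear (\<lambda>x. weak_gradient (fun_of x))"
  using bounded_linear_compose[OF bounded_linear_snd bounded_linear_Rep_sobolev] by (simp add: Rep_sobolev_eq)

lemma fun_of_add: "fun_of (x + y) = fun_of x + fun_of y" by (simp add: fun_of_def Rep_sobolev_add)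
lemma fun_of_diff: "fun_of (x - y) = fun_of x - fun_of y" by (simp add: fun_of_def Rep_sobolev_diff)
lemma fun_of_scaleR: "fun_of (r *\<^sub>R x) = r *\<^sub>R fun_of x" by (simp add: fun_of_def Rep_sobolev_scaleR)

lemma fun_of_inject: "fun_of x = fun_of y \<longleftrightarrow> x = y"
  by (metis sobolev_of_fun_of)

lemma H1_diff: "v \<in> H1 \<Longrightarrow> w \<in> H1 \<Longrightarrow> v - w \<in> H1"
  by (metis fun_of_diff fun_of_H1 fun_of_sobolev_of)

lemma H1_scaleC: "v \<in> H1 \<Longrightarrow> scaleC_L2 z v \<in> H1"
  using is_weak_gradient_scaleC[OF is_weak_gradient_weak_gradient] by (rule H1_I)

lemma weak_gradient_scaleC: "v \<in> H1 \<Longrightarrow> weak_gradient (scaleC_L2 z v) = (\<chi> i. scaleC_L2 z (weak_gradient v $ i))"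
  using is_weak_gradient_scaleC[OF is_weak_gradient_weak_gradient] by (rule weak_gradient_eqI)

lemma weak_gradient_add: "v \<in> H1 \<Longrightarrow> w \<in> H1 \<Longrightarrow> weak_gradient (v + w) = weak_gradient v + weak_gradient w"
  using is_weak_gradient_add[OF is_weak_gradient_weak_gradient is_weak_gradient_weak_gradient] by (rule weak_gradient_eqI)

lemma norm_vec_sq: "(norm (g :: ('a::real_inner)^'n))\<^sup>2 = (\<Sum>i\<in>UNIV. (norm (g $ i))\<^sup>2)"
  by (simp add: power2_norm_eq_inner inner_vec_def)

lemma H1_norm_scaleC: "v \<in> H1 \<Longrightarrow> H1_norm (scaleC_L2 z v) = cmod z * H1_norm v"
proof -
  assume v: "v \<in> H1"
  have "(norm (weak_gradient (scaleC_L2 z v)))\<^sup>2 = (cmod z * norm (weak_gradient v))\<^sup>2"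
    by (simp add: weak_gradient_scaleC[OF v] norm_vec_sq norm_scaleC_L2 power_mult_distrib sum_distrib_left)
  then have "H1_norm (scaleC_L2 z v) = sqrt ((cmod z)\<^sup>2 * ((norm v)\<^sup>2 + (norm (weak_gradient v))\<^sup>2))"
    by (simp add: H1_norm_def norm_scaleC_L2 power_mult_distrib distrib_left)
  then show ?thesis by (simp add: H1_norm_def real_sqrt_mult)
qed

section \<open>The fractional Laplacian on H1\<close>

lemma powr_sq_le: assumes "0 < s" "s < 1" "0 \<le> r" shows "((r::real) powr s)\<^sup>2 \<le> 1 + r\<^sup>2"
proof (cases "r \<le> 1")
  case True
  then have "r powr s \<le> 1" using assms powr_mono2[of s r 1] by simp
  then have "(r powr s)\<^sup>2 \<le> 1" by (simp add: power_le_one)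
  then show ?thesis by (smt (verit) zero_le_power2)
next
  case False
  then have "r powr s \<le> r powr 1" using assms by (intro powr_mono) auto
  then have "(r powr s)\<^sup>2 \<le> r\<^sup>2" using False by (intro power_mono) auto
  then show ?thesis by simp
qed

text \<open>Pointwise the squared multiplier is at most 1 + |\<xi>|^2, and |\<xi>|^2 |v^|^2 is the
  sum of the squared transforms of the partial derivatives, where v^ is the transform of v. The
  exponent is left as 2 (s / 2) to match \<open>frac_laplacian\<close>.\<close>

lemma fourier_multiplier_H1:
  fixes v :: "'n::finite L2"
  assumes v: "v \<in> H1" and s: "0 < s" "s < 1"
  defines "f \<equiv> \<lambda>\<xi>. of_real (norm \<xi> powr (2 * (s / 2))) * rep_L2 (fourier_L2 v) \<xi>"
  shows "square_integrable f"
    and "(norm (abs_L2 f))\<^sup>2 \<le> (2 * pi) ^ CARD('n) * ((norm v)\<^sup>2 + (norm (weak_gradient v))\<^sup>2)"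
proof -
  let ?V = "rep_L2 (fourier_L2 v)"
  let ?G = "\<lambda>i. rep_L2 (fourier_L2 (weak_gradient v $ i))"
  let ?b = "\<lambda>\<xi>. (cmod (?V \<xi>))\<^sup>2 + (\<Sum>i\<in>UNIV. (cmod (?G i \<xi>))\<^sup>2)"
  have bint: "integrable lebesgue ?b"
    by (intro Bochner_Integration.integrable_add Bochner_Integration.integrable_sum integrable_norm_sq_rep_L2)
  have "AE \<xi> in lebesgue. \<forall>i\<in>UNIV. ?G i \<xi> = \<i> * of_real (\<xi> $ i) * ?V \<xi>"
    by (intro AE_finite_allI fourier_weak_gradient is_weak_gradient_weak_gradient v) simp
  then have ae: "AE \<xi> in lebesgue. (cmod (f \<xi>))\<^sup>2 \<le> ?b \<xi>"
  proof eventually_elim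
    case (elim \<xi>)
    have "(norm \<xi>)\<^sup>2 = (\<Sum>i\<in>UNIV. (\<xi> $ i)\<^sup>2)" by (simp add: norm_vec_sq)
    then have "(norm \<xi>)\<^sup>2 * (cmod (?V \<xi>))\<^sup>2 = (\<Sum>i\<in>UNIV. (cmod (?G i \<xi>))\<^sup>2)"
      using elim by (simp add: sum_distrib_right norm_mult power_mult_distrib)
    moreover have "(norm \<xi> powr s)\<^sup>2 * (cmod (?V \<xi>))\<^sup>2 \<le> (1 + (norm \<xi>)\<^sup>2) * (cmod (?V \<xi>))\<^sup>2"
      using powr_sq_le[OF s norm_ge_zero] by (intro mult_right_mono) auto
    ultimately show ?case by (simp add: f_def norm_mult power_mult_distrib distrib_right)
  qed
  have [measurable]: "f \<in> borel_measurable lebesgue"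
  proof -
    have "(\<lambda>\<xi>::real^'n. complex_of_real (norm \<xi> powr (2 * (s / 2)))) \<in> borel_measurable lebesgue"
      by (rule lebesgue_measurable_of_borel) measurable
    then show ?thesis unfolding f_def by measurable
  qed
  have fint: "integrable lebesgue (\<lambda>\<xi>. (cmod (f \<xi>))\<^sup>2)"
    by (rule Bochner_Integration.integrable_bound[OF bint]) (use ae in \<open>auto elim: eventually_mono\<close>)
  then show sq: "square_integrable f" by (simp add: square_integrable_def)
  have "(norm (abs_L2 f))\<^sup>2 \<le> (\<integral>\<xi>. ?b \<xi> \<partial>lebesgue)"
    unfolding norm_abs_L2[OF sq] by (rule integral_mono_AE[OF fint bint ae])
  also have "\<dots> = (norm (fourier_L2 v))\<^sup>2 + (\<Sum>i\<in>UNIV. (norm (fourier_L2 (weak_gradient v $ i)))\<^sup>2)"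
    by (simp add: norm_L2_sq integrable_norm_sq_rep_L2)
  also have "\<dots> = (2 * pi) ^ CARD('n) * ((norm v)\<^sup>2 + (norm (weak_gradient v))\<^sup>2)"
    by (simp add: norm_fourier_L2 norm_vec_sq distrib_left sum_distrib_left)
  finally show "(norm (abs_L2 f))\<^sup>2 \<le> (2 * pi) ^ CARD('n) * ((norm v)\<^sup>2 + (norm (weak_gradient v))\<^sup>2)" .
qed

lemma fourier_L2_inject: "fourier_L2 f = fourier_L2 g \<Longrightarrow> f = g"
  using fourier_L2_eq_0[of "f - g"] by (simp add: fourier_L2_diff)

lemma frac_laplacian_eqI:
  assumes "AE \<xi> in lebesgue. rep_L2 (fourier_L2 w) \<xi> = of_real (norm \<xi> powr (2 * \<sigma>)) * rep_L2 (fourier_L2 v) \<xi>"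
  shows "frac_laplacian \<sigma> v = w"
  unfolding frac_laplacian_def
proof (rule the_equality, rule assms)
  fix y assume "AE \<xi> in lebesgue. rep_L2 (fourier_L2 y) \<xi> = of_real (norm \<xi> powr (2 * \<sigma>)) * rep_L2 (fourier_L2 v) \<xi>"
  then have "AE \<xi> in lebesgue. rep_L2 (fourier_L2 y) \<xi> = rep_L2 (fourier_L2 w) \<xi>"
    using assms by eventually_elim simp
  then show "y = w" using L2_eq_iff fourier_L2_inject by blast
qed

text \<open>Surjectivity of the transform supplies a preimage of the multiplied transform, and
  injectivity makes it the only one. The powers of 2 pi cancel, so the bound has constant 1, as the
  explicit \<open>C\<close> requires.\<close>

lemma frac_laplacian_H1:
  fixes v :: "'n::finite L2"
  assumes v: "v \<in> H1" and s: "0 < s" "s < 1"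
  shows "AE \<xi> in lebesgue. rep_L2 (fourier_L2 (frac_laplacian (s / 2) v)) \<xi>
      = of_real (norm \<xi> powr (2 * (s / 2))) * rep_L2 (fourier_L2 v) \<xi>"
    and "norm (frac_laplacian (s / 2) v) \<le> H1_norm v"
proof -
  let ?f = "\<lambda>\<xi>. of_real (norm \<xi> powr (2 * (s / 2))) * rep_L2 (fourier_L2 v) \<xi>"
  note f = fourier_multiplier_H1[OF v s]
  obtain w where w: "fourier_L2 w = abs_L2 ?f" using surj_fourier_L2 by (metis UNIV_I imageE)
  have ae: "AE \<xi> in lebesgue. rep_L2 (fourier_L2 w) \<xi> = ?f \<xi>"
    unfolding w by (rule rep_abs_L2[OF f(1)])
  have eq: "frac_laplacian (s / 2) v = w" by (rule frac_laplacian_eqI[OF ae])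
  show "AE \<xi> in lebesgue. rep_L2 (fourier_L2 (frac_laplacian (s / 2) v)) \<xi> = ?f \<xi>"
    unfolding eq by (rule ae)
  have "(2 * pi) ^ CARD('n) * (norm w)\<^sup>2 \<le> (2 * pi) ^ CARD('n) * ((norm v)\<^sup>2 + (norm (weak_gradient v))\<^sup>2)"
    using f(2) unfolding w[symmetric] norm_fourier_L2 .
  then have "(norm w)\<^sup>2 \<le> (norm v)\<^sup>2 + (norm (weak_gradient v))\<^sup>2" by simp
  then show "norm (frac_laplacian (s / 2) v) \<le> H1_norm v"
    unfolding eq H1_norm_def by (intro real_le_rsqrt)
qed

lemma frac_laplacian_add:
  assumes "v \<in> H1" "w \<in> H1" "0 < s" "s < 1"
  shows "frac_laplacian (s / 2) (v + w) = frac_laplacian (s / 2) v + frac_laplacian (s / 2) w"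
proof (rule frac_laplacian_eqI)
  show "AE \<xi> in lebesgue. rep_L2 (fourier_L2 (frac_laplacian (s / 2) v + frac_laplacian (s / 2) w)) \<xi>
      = of_real (norm \<xi> powr (2 * (s / 2))) * rep_L2 (fourier_L2 (v + w)) \<xi>"
    unfolding fourier_L2_add
    using frac_laplacian_H1(1)[OF assms(1,3,4)] frac_laplacian_H1(1)[OF assms(2,3,4)]
      rep_L2_add[of "fourier_L2 v" "fourier_L2 w"]
      rep_L2_add[of "fourier_L2 (frac_laplacian (s / 2) v)" "fourier_L2 (frac_laplacian (s / 2) w)"]
    by eventually_elim (simp add: distrib_left)
qed

lemma frac_laplacian_scaleC:
  assumes "v \<in> H1" "0 < s" "s < 1"
  shows "frac_laplacian (s / 2) (scaleC_L2 z v) = scaleC_L2 z (frac_laplacian (s / 2) v)"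
proof (rule frac_laplacian_eqI)
  show "AE \<xi> in lebesgue. rep_L2 (fourier_L2 (scaleC_L2 z (frac_laplacian (s / 2) v))) \<xi>
      = of_real (norm \<xi> powr (2 * (s / 2))) * rep_L2 (fourier_L2 (scaleC_L2 z v)) \<xi>"
    unfolding fourier_L2_scaleC
    using frac_laplacian_H1(1)[OF assms] rep_L2_scaleC[of z "fourier_L2 v"]
      rep_L2_scaleC[of z "fourier_L2 (frac_laplacian (s / 2) v)"]
    by eventually_elim simp
qed

lemma bounded_linear_frac_laplacian:
  assumes "0 < s" "s < 1"
  shows "bounded_linear (\<lambda>x. frac_laplacian (s / 2) (fun_of x))"
proof (rule bounded_linear_intro[where K = 1])
  show "norm (frac_laplacian (s / 2) (fun_of x)) \<le> norm x * 1" for x :: "'a sobolev"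
    using frac_laplacian_H1(2)[OF fun_of_H1 assms] by (simp add: H1_norm_fun_of)
qed (simp_all add: fun_of_add fun_of_scaleR frac_laplacian_add fun_of_H1 assms frac_laplacian_scaleC scaleR_L2_def)

section \<open>Multiplication by bounded coefficients\<close>

lemma Linfty_AE: assumes "a \<in> Linfty" shows "AE x in lebesgue. \<bar>a x\<bar> \<le> Linfty_norm a"
proof -
  let ?E = "esssup lebesgue (\<lambda>x. ereal \<bar>a x\<bar>)"
  have "AE x in lebesgue. ereal \<bar>a x\<bar> \<le> ?E" by (rule esssup_AE)
  moreover have "?E < \<infinity>" using assms by (simp add: Linfty_def)
  ultimately show ?thesis
  proof (elim eventually_mono)
    fix x assume "ereal \<bar>a x\<bar> \<le> ?E"
    then show "\<bar>a x\<bar> \<le> Linfty_norm a"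
      using \<open>?E < \<infinity>\<close> unfolding Linfty_norm_def by (cases ?E) auto
  qed
qed

text \<open>An essential bound below 0 for an absolute value would make the whole space a null
  set.\<close>

lemma Linfty_norm_nonneg: assumes "(a :: real^'n \<Rightarrow> real) \<in> Linfty" shows "0 \<le> Linfty_norm a"
proof (rule ccontr)
  assume "\<not> 0 \<le> Linfty_norm a"
  then have "AE x::real^'n in lebesgue. False"
    using Linfty_AE[OF assms] by (auto elim!: eventually_mono)
  then have "AE x::real^'n in lborel. False" by (subst (asm) AE_completion_iff)
  then show False
    using AE_iff_measurable[of UNIV lborel "\<lambda>_::real^'n. False"] by simp
qed

definition mult_L2 :: "(real^'n \<Rightarrow> real) \<Rightarrow> 'n::finite L2 \<Rightarrow> 'n L2" where
  "mult_L2 a f = abs_L2 (\<lambda>x. of_real (a x) * rep_L2 f x)"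

lemma square_integrable_Linfty_mult:
  assumes "a \<in> Linfty" shows "square_integrable (\<lambda>x. of_real (a x) * rep_L2 f x)"
proof (rule square_integrable_bounded_mult[OF square_integrable_rep_L2])
  show "(\<lambda>x. complex_of_real (a x)) \<in> borel_measurable lebesgue"
    using assms measurable_compose[OF _ borel_measurable_of_real] by (auto simp: Linfty_def)
  show "AE x in lebesgue. cmod (complex_of_real (a x)) \<le> Linfty_norm a"
    using Linfty_AE[OF assms] by simp
qed

lemma rep_mult_L2: "a \<in> Linfty \<Longrightarrow> AE x in lebesgue. rep_L2 (mult_L2 a f) x = of_real (a x) * rep_L2 f x"
  unfolding mult_L2_def by (intro rep_abs_L2 square_integrable_Linfty_mult)

lemma cinner_mult_L2:
  assumes "a \<in> Linfty"
  shows "cinner_L2 (mult_L2 a f) g = (\<integral>x. of_real (a x) * rep_L2 f x * cnj (rep_L2 g x) \<partial>lebesgue)"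
    and "integrable lebesgue (\<lambda>x. of_real (a x) * rep_L2 f x * cnj (rep_L2 g x))"
  using cinner_L2_abs[OF square_integrable_Linfty_mult[OF assms] square_integrable_rep_L2, of f g]
    integrable_mult_cnj[OF square_integrable_Linfty_mult[OF assms] square_integrable_rep_L2, of f g]
  by (simp_all add: mult_L2_def)

lemma mult_L2_sym:
  assumes "a \<in> Linfty" shows "cinner_L2 (mult_L2 a f) g = cinner_L2 f (mult_L2 a g)"
  unfolding cinner_L2_commute[of f "mult_L2 a g"] cinner_mult_L2[OF assms]
    Bochner_Integration.integral_cnj[symmetric] by (simp add: mult_ac)

lemma inner_mult_L2_self:
  assumes "a \<in> Linfty"
  shows "inner (mult_L2 a f) f = (\<integral>x. a x * (cmod (rep_L2 f x))\<^sup>2 \<partial>lebesgue)"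
    and "integrable lebesgue (\<lambda>x. a x * (cmod (rep_L2 f x))\<^sup>2)"
proof -
  have eq: "of_real (a x) * rep_L2 f x * cnj (rep_L2 f x) = of_real (a x * (cmod (rep_L2 f x))\<^sup>2)" for x
    by (simp only: of_real_mult complex_norm_square mult.assoc)
  show "integrable lebesgue (\<lambda>x. a x * (cmod (rep_L2 f x))\<^sup>2)"
    using integrable_Re[OF cinner_mult_L2(2)[OF assms, of f f]] unfolding eq by simp
  show "inner (mult_L2 a f) f = (\<integral>x. a x * (cmod (rep_L2 f x))\<^sup>2 \<partial>lebesgue)"
    unfolding inner_L2_def cinner_mult_L2(1)[OF assms] eq integral_complex_of_real by simp
qed

lemma mult_L2_lower:
  assumes "a \<in> Linfty" "AE x in lebesgue. a0 \<le> a x"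
  shows "a0 * (norm f)\<^sup>2 \<le> inner (mult_L2 a f) f"
proof -
  have "(\<integral>x. a0 * (cmod (rep_L2 f x))\<^sup>2 \<partial>lebesgue) \<le> (\<integral>x. a x * (cmod (rep_L2 f x))\<^sup>2 \<partial>lebesgue)"
  proof (rule integral_mono_AE)
    show "AE x in lebesgue. a0 * (cmod (rep_L2 f x))\<^sup>2 \<le> a x * (cmod (rep_L2 f x))\<^sup>2"
      using assms(2) by eventually_elim (simp add: mult_right_mono)
  qed (simp_all add: integrable_norm_sq_rep_L2 inner_mult_L2_self(2)[OF assms(1)])
  then show ?thesis by (simp add: inner_mult_L2_self(1)[OF assms(1)] norm_L2_sq)
qed

lemma mult_L2_upper:
  assumes "a \<in> Linfty"
  shows "inner (mult_L2 a f) f \<le> Linfty_norm a * (norm f)\<^sup>2"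
proof -
  have "(\<integral>x. a x * (cmod (rep_L2 f x))\<^sup>2 \<partial>lebesgue) \<le> (\<integral>x. Linfty_norm a * (cmod (rep_L2 f x))\<^sup>2 \<partial>lebesgue)"
  proof (rule integral_mono_AE)
    show "AE x in lebesgue. a x * (cmod (rep_L2 f x))\<^sup>2 \<le> Linfty_norm a * (cmod (rep_L2 f x))\<^sup>2"
      using Linfty_AE[OF assms] by eventually_elim (simp add: mult_right_mono)
  qed (simp_all add: integrable_norm_sq_rep_L2 inner_mult_L2_self(2)[OF assms(1)])
  then show ?thesis by (simp add: inner_mult_L2_self(1)[OF assms(1)] norm_L2_sq)
qed

lemma bounded_linear_mult_L2:
  assumes "a \<in> Linfty" shows "bounded_linear (mult_L2 a)"
proof (rule bounded_linear_intro[where K = "Linfty_norm a"])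
  show "mult_L2 a (f + g) = mult_L2 a f + mult_L2 a g" for f g
    unfolding L2_eq_iff
    using rep_mult_L2[OF assms, of "f + g"] rep_mult_L2[OF assms, of f] rep_mult_L2[OF assms, of g]
      rep_L2_add[of f g] rep_L2_add[of "mult_L2 a f" "mult_L2 a g"]
    by eventually_elim (simp add: distrib_left)
  show "mult_L2 a (r *\<^sub>R f) = r *\<^sub>R mult_L2 a f" for r f
    unfolding L2_eq_iff
    using rep_mult_L2[OF assms, of "r *\<^sub>R f"] rep_mult_L2[OF assms, of f]
      rep_L2_scaleR[of r f] rep_L2_scaleR[of r "mult_L2 a f"]
    by eventually_elim simp
  show "norm (mult_L2 a f) \<le> norm f * Linfty_norm a" for f
  proof (rule power2_le_imp_le)
    have "(norm (mult_L2 a f))\<^sup>2 \<le> (\<integral>x. (Linfty_norm a)\<^sup>2 * (cmod (rep_L2 f x))\<^sup>2 \<partial>lebesgue)"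
      unfolding mult_L2_def norm_abs_L2[OF square_integrable_Linfty_mult[OF assms]]
    proof (rule integral_mono_AE)
      show "AE x in lebesgue. (cmod (of_real (a x) * rep_L2 f x))\<^sup>2 \<le> (Linfty_norm a)\<^sup>2 * (cmod (rep_L2 f x))\<^sup>2"
        using Linfty_AE[OF assms]
      proof eventually_elim
        case (elim x)
        then have "\<bar>a x\<bar>\<^sup>2 \<le> (Linfty_norm a)\<^sup>2" by (intro power_mono) auto
        then show ?case by (simp add: norm_mult power_mult_distrib mult_right_mono)
      qed
      show "integrable lebesgue (\<lambda>x. (cmod (of_real (a x) * rep_L2 f x))\<^sup>2)"
        using square_integrable_Linfty_mult[OF assms, of f] by (simp add: square_integrable_def)
    qed (simp add: integrable_norm_sq_rep_L2)
    then show "(norm (mult_L2 a f))\<^sup>2 \<le> (norm f * Linfty_norm a)\<^sup>2"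
      by (simp add: norm_L2_sq power_mult_distrib mult.commute)
    show "0 \<le> norm f * Linfty_norm a" using Linfty_norm_nonneg[OF assms] by simp
  qed
qed

lemma inner_left_eqI:
  assumes "\<And>z. inner x z = inner y (z :: 'a::real_inner)" shows "x = y"
proof -
  have "inner (x - y) (x - y) = 0" unfolding inner_diff_left[of x y] using assms by simp
  then show ?thesis by simp
qed

text \<open>Riesz representation of y \<mapsto> (P x, Q y) for each x. Each summand of
  \<open>B\<close> has this shape, with \<open>Q\<close> a derivative or the embedding into L2 and
  \<open>P\<close> the same map followed by a coefficient.\<close>

lemma pullback_operator:
  fixes P Q :: "'a::{real_inner, banach} \<Rightarrow> 'b::real_inner"
  assumes P: "bounded_linear P" and Q: "bounded_linear Q"
  shows "\<exists>A. bounded_linear A \<and> (\<forall>x y. inner (A x) y = inner (P x) (Q y))"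
proof -
  have "\<exists>z. \<forall>y. inner (P x) (Q y) = inner z y" for x
    by (intro riesz_representation bounded_linear_compose[OF bounded_linear_inner_right Q])
  then obtain A where A: "\<And>x y. inner (A x) y = inner (P x) (Q y)" by metis
  obtain K where K: "0 < K" "\<And>x. norm (P x) \<le> norm x * K" using bounded_linear.pos_bounded[OF P] by blast
  obtain L where L: "0 < L" "\<And>x. norm (Q x) \<le> norm x * L" using bounded_linear.pos_bounded[OF Q] by blast
  have "bounded_linear A"
  proof (rule bounded_linear_intro[where K = "K * L"])
    show "A (x + y) = A x + A y" for x y
      by (rule inner_left_eqI) (simp add: A inner_add_left linear_add[OF bounded_linear.linear[OF P]])
    show "A (r *\<^sub>R x) = r *\<^sub>R A x" for r x
      by (rule inner_left_eqI) (simp add: A linear_scale[OF bounded_linear.linear[OF P]])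
    show "norm (A x) \<le> norm x * (K * L)" for x
    proof (cases "A x = 0")
      case False
      have "norm (A x) * norm (A x) = inner (P x) (Q (A x))"
        by (simp add: A[symmetric] power2_norm_eq_inner flip: power2_eq_square)
      also have "\<dots> \<le> norm (P x) * norm (Q (A x))" by (rule norm_cauchy_schwarz)
      also have "\<dots> \<le> (norm x * K) * (norm (A x) * L)" using K L by (intro mult_mono) auto
      finally have "norm (A x) * norm (A x) \<le> norm x * (K * L) * norm (A x)" by (simp add: mult_ac)
      then show ?thesis using False by simp
    qed (use K L in auto)
  qed
  then show ?thesis using A by blast
qed

section \<open>Existence of a weak solution\<close>

lemma zero_H1: "0 \<in> H1" by (rule H1_I[OF is_weak_gradient_zero])

lemma H1_norm_zero: "H1_norm 0 = 0"
  using weak_gradient_eqI[OF is_weak_gradient_zero] by (simp add: H1_norm_def)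

lemma H1_unit_ball_nonempty: "{\<phi> \<in> H1. H1_norm \<phi> \<le> 1} \<noteq> {}"
proof -
  have "0 \<in> {\<phi> \<in> H1. H1_norm (\<phi> :: 'a L2) \<le> 1}" using zero_H1 by (simp add: H1_norm_zero)
  then show ?thesis by blast
qed

lemma H1_dual_norm_upper:
  assumes "\<And>\<phi>. \<phi> \<in> H1 \<Longrightarrow> cmod (F \<phi>) \<le> K * H1_norm \<phi>" "0 \<le> K"
  shows "H1_dual_norm F \<le> K"
  unfolding H1_dual_norm_def
proof (rule cSUP_least[OF H1_unit_ball_nonempty])
  fix \<phi> :: "'a L2" assume "\<phi> \<in> {\<phi> \<in> H1. H1_norm \<phi> \<le> 1}"
  then show "cmod (F \<phi>) \<le> K"
    using assms(1)[of \<phi>] mult_left_mono[of "H1_norm \<phi>" 1 K] assms(2) by auto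
qed

lemma H1_dual_norm_bound:
  assumes "\<phi> \<in> H1" "H1_norm \<phi> \<le> 1" "\<And>\<phi>. \<phi> \<in> H1 \<Longrightarrow> cmod (F \<phi>) \<le> K * H1_norm \<phi>" "0 \<le> K"
  shows "cmod (F \<phi>) \<le> H1_dual_norm F"
  unfolding H1_dual_norm_def
proof (rule cSUP_upper)
  show "\<phi> \<in> {\<phi> \<in> H1. H1_norm \<phi> \<le> 1}" using assms by blast
  show "bdd_above ((\<lambda>\<phi>. cmod (F \<phi>)) ` {\<phi> \<in> H1. H1_norm \<phi> \<le> 1})"
  proof (rule bdd_aboveI2)
    fix \<phi> :: "'a L2" assume "\<phi> \<in> {\<phi> \<in> H1. H1_norm \<phi> \<le> 1}"
    then show "cmod (F \<phi>) \<le> K"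
      using assms(3)[of \<phi>] mult_left_mono[of "H1_norm \<phi>" 1 K] assms(4) by auto
  qed
qed

section \<open>The form \<open>B\<close> on H1, its operator and its functionals\<close>

locale parabolic_form =
  fixes a b c :: "real^'n::finite \<Rightarrow> real" and a0 b0 c0 s :: real
  assumes s: "0 < s" "s < 1"
    and Linfty: "a \<in> Linfty" "b \<in> Linfty" "c \<in> Linfty"
    and pos: "0 < a0" "0 < b0" "0 < c0"
    and lower: "AE x in lebesgue. a0 \<le> a x" "AE x in lebesgue. b0 \<le> b x" "AE x in lebesgue. c0 \<le> c x"
begin

abbreviation B :: "'n L2 \<Rightarrow> 'n L2 \<Rightarrow> complex" where "B \<equiv> sesq_form a b c s"

abbreviation \<Lambda> :: "'n L2 \<Rightarrow> 'n L2" where "\<Lambda> \<equiv> frac_laplacian (s / 2)"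

lemma B_eq: "B v \<phi> = (\<Sum>i\<in>UNIV. cinner_L2 (mult_L2 a (weak_gradient v $ i)) (weak_gradient \<phi> $ i))
    + cinner_L2 (mult_L2 b (\<Lambda> v)) (\<Lambda> \<phi>) + cinner_L2 (mult_L2 c v) \<phi>"
proof -
  have "(\<integral>x. of_real (a x) * (\<Sum>i\<in>UNIV. rep_L2 (weak_gradient v $ i) x * cnj (rep_L2 (weak_gradient \<phi> $ i) x)) \<partial>lebesgue)
      = (\<integral>x. (\<Sum>i\<in>UNIV. of_real (a x) * rep_L2 (weak_gradient v $ i) x * cnj (rep_L2 (weak_gradient \<phi> $ i) x)) \<partial>lebesgue)"
    by (simp add: sum_distrib_left mult.assoc)
  also have "\<dots> = (\<Sum>i\<in>UNIV. cinner_L2 (mult_L2 a (weak_gradient v $ i)) (weak_gradient \<phi> $ i))"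
    by (simp add: cinner_mult_L2[OF Linfty(1)])
  finally show ?thesis
    unfolding sesq_form_def by (simp add: cinner_mult_L2(1)[OF Linfty(2)] cinner_mult_L2(1)[OF Linfty(3)])
qed

lemma B_add_right: "\<phi> \<in> H1 \<Longrightarrow> \<psi> \<in> H1 \<Longrightarrow> B v (\<phi> + \<psi>) = B v \<phi> + B v \<psi>"
  by (simp add: B_eq weak_gradient_add frac_laplacian_add s cinner_L2_add_right sum.distrib)

lemma B_scaleC_right: "\<phi> \<in> H1 \<Longrightarrow> B v (scaleC_L2 z \<phi>) = cnj z * B v \<phi>"
  by (simp add: B_eq weak_gradient_scaleC frac_laplacian_scaleC s cinner_L2_scaleC_right sum_distrib_left distrib_left)

lemma B_commute: "B v \<phi> = cnj (B \<phi> v)"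
proof -
  have *: "cinner_L2 (mult_L2 k f) g = cnj (cinner_L2 (mult_L2 k g) f)" if "k \<in> Linfty" for k and f g :: "'n L2"
    by (subst mult_L2_sym[OF that]) (rule cinner_L2_commute)
  show ?thesis
    unfolding B_eq complex_cnj_add cnj_sum by (intro arg_cong2[where f = "(+)"] sum.cong refl * Linfty)
qed

lemma B_add_left: "v \<in> H1 \<Longrightarrow> w \<in> H1 \<Longrightarrow> B (v + w) \<phi> = B v \<phi> + B w \<phi>"
  using B_add_right[of v w \<phi>] by (metis B_commute complex_cnj_add)

lemma B_diff_left: "v \<in> H1 \<Longrightarrow> w \<in> H1 \<Longrightarrow> B (v - w) \<phi> = B v \<phi> - B w \<phi>"
  using B_add_left[of "v - w" w \<phi>] by (simp add: H1_diff)

lemma operator_exists: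
  "\<exists>A :: 'n sobolev \<Rightarrow> 'n sobolev. bounded_linear A \<and> (\<forall>x y. inner (A x) y = Re (B (fun_of x) (fun_of y)))"
proof -
  have grad: "bounded_linear (\<lambda>x. weak_gradient (fun_of x) $ i)" for i :: 'n
    by (rule bounded_linear_compose[OF bounded_linear_vec_nth bounded_linear_weak_gradient_fun_of])
  have "\<exists>A. bounded_linear A \<and> (\<forall>x y :: 'n sobolev. inner (A x) y = inner (mult_L2 a (weak_gradient (fun_of x) $ i)) (weak_gradient (fun_of y) $ i))" for i
    by (rule pullback_operator[OF bounded_linear_compose[OF bounded_linear_mult_L2[OF Linfty(1)] grad] grad])
  then obtain A1 where A1: "\<And>i. bounded_linear (A1 i)" "\<And>i x y. inner (A1 i x) y = inner (mult_L2 a (weak_gradient (fun_of x) $ i)) (weak_gradient (fun_of y) $ i)"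
    by metis
  obtain A2 where A2: "bounded_linear A2" "\<And>x y :: 'n sobolev. inner (A2 x) y = inner (mult_L2 b (\<Lambda> (fun_of x))) (\<Lambda> (fun_of y))"
    using pullback_operator[OF bounded_linear_compose[OF bounded_linear_mult_L2[OF Linfty(2)] bounded_linear_frac_laplacian[OF s]] bounded_linear_frac_laplacian[OF s]]
    by blast
  obtain A3 where A3: "bounded_linear A3" "\<And>x y :: 'n sobolev. inner (A3 x) y = inner (mult_L2 c (fun_of x)) (fun_of y)"
    using pullback_operator[OF bounded_linear_compose[OF bounded_linear_mult_L2[OF Linfty(3)] bounded_linear_fun_of] bounded_linear_fun_of]
    by blast
  have "bounded_linear (\<lambda>x. (\<Sum>i\<in>UNIV. A1 i x) + A2 x + A3 x)"
    by (intro bounded_linear_add bounded_linear_sum A1 A2 A3)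
  moreover have "inner ((\<Sum>i\<in>UNIV. A1 i x) + A2 x + A3 x) y = Re (B (fun_of x) (fun_of y))" for x y
    by (simp add: B_eq inner_add_left inner_sum_left A1 A2 A3 Re_cinner_L2)
  ultimately show ?thesis by blast
qed

definition A :: "'n sobolev \<Rightarrow> 'n sobolev" where
  "A = (SOME A. bounded_linear A \<and> (\<forall>x y. inner (A x) y = Re (B (fun_of x) (fun_of y))))"

lemma A: "bounded_linear A" "inner (A x) y = Re (B (fun_of x) (fun_of y))"
  using someI_ex[OF operator_exists] unfolding A_def[symmetric] by blast+

definition M :: "'n sobolev \<Rightarrow> 'n sobolev" where
  "M = (SOME M. bounded_linear M \<and> (\<forall>x y. inner (M x) y = inner (fun_of x) (fun_of y)))"

lemma M: "bounded_linear M" "inner (M x) y = inner (fun_of x) (fun_of y)"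
proof -
  have "\<exists>M :: 'n sobolev \<Rightarrow> 'n sobolev. bounded_linear M \<and> (\<forall>x y. inner (M x) y = inner (fun_of x) (fun_of y))"
    by (rule pullback_operator[OF bounded_linear_fun_of bounded_linear_fun_of])
  from someI_ex[OF this] show "bounded_linear M" "inner (M x) y = inner (fun_of x) (fun_of y)"
    unfolding M_def[symmetric] by blast+
qed

text \<open>The three terms are kept apart rather than merged into a coercivity constant: the final
  estimate divides by a0 and by b0 separately.\<close>

lemma A_lower: "a0 * (norm (weak_gradient (fun_of x)))\<^sup>2 + b0 * (norm (\<Lambda> (fun_of x)))\<^sup>2 + c0 * (norm (fun_of x))\<^sup>2 \<le> inner (A x) x"
proof -
  have "a0 * (norm (weak_gradient (fun_of x)))\<^sup>2 = (\<Sum>i\<in>UNIV. a0 * (norm (weak_gradient (fun_of x) $ i))\<^sup>2)"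
    by (simp add: norm_vec_sq sum_distrib_left)
  also have "\<dots> \<le> (\<Sum>i\<in>UNIV. inner (mult_L2 a (weak_gradient (fun_of x) $ i)) (weak_gradient (fun_of x) $ i))"
    by (intro sum_mono mult_L2_lower Linfty lower)
  finally show ?thesis
    using mult_L2_lower[OF Linfty(2) lower(2), of "\<Lambda> (fun_of x)"] mult_L2_lower[OF Linfty(3) lower(3), of "fun_of x"]
    by (simp add: A(2) B_eq Re_cinner_L2)
qed

text \<open>Each of the three parts is at most the sup norm of its coefficient times the full
  squared H1 norm, the fractional part by the bound with constant 1. This sum of sup norms reappears
  in \<open>C\<close>.\<close>

lemma A_upper: "inner (A x) x \<le> (Linfty_norm a + Linfty_norm b + Linfty_norm c) * (norm x)\<^sup>2"
proof -
  have n: "(norm x)\<^sup>2 = (norm (fun_of x))\<^sup>2 + (norm (weak_gradient (fun_of x)))\<^sup>2"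
    unfolding H1_norm_fun_of[symmetric] H1_norm_def by simp
  have "(\<Sum>i\<in>UNIV. inner (mult_L2 a (weak_gradient (fun_of x) $ i)) (weak_gradient (fun_of x) $ i))
      \<le> (\<Sum>i\<in>UNIV. Linfty_norm a * (norm (weak_gradient (fun_of x) $ i))\<^sup>2)"
    by (intro sum_mono mult_L2_upper Linfty)
  also have "\<dots> = Linfty_norm a * (norm (weak_gradient (fun_of x)))\<^sup>2"
    by (simp add: norm_vec_sq sum_distrib_left)
  also have "\<dots> \<le> Linfty_norm a * (norm x)\<^sup>2"
    using Linfty_norm_nonneg[OF Linfty(1)] by (intro mult_left_mono) (auto simp: n)
  finally have 1: "(\<Sum>i\<in>UNIV. inner (mult_L2 a (weak_gradient (fun_of x) $ i)) (weak_gradient (fun_of x) $ i)) \<le> Linfty_norm a * (norm x)\<^sup>2" .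
  have "(norm (\<Lambda> (fun_of x)))\<^sup>2 \<le> (norm x)\<^sup>2"
    using frac_laplacian_H1(2)[OF fun_of_H1 s] by (intro power_mono) (auto simp: H1_norm_fun_of)
  then have "Linfty_norm b * (norm (\<Lambda> (fun_of x)))\<^sup>2 \<le> Linfty_norm b * (norm x)\<^sup>2"
    using Linfty_norm_nonneg[OF Linfty(2)] by (intro mult_left_mono) auto
  moreover have "Linfty_norm c * (norm (fun_of x))\<^sup>2 \<le> Linfty_norm c * (norm x)\<^sup>2"
    using Linfty_norm_nonneg[OF Linfty(3)] by (intro mult_left_mono) (auto simp: n)
  ultimately show ?thesis
    using 1 mult_L2_upper[OF Linfty(2), of "\<Lambda> (fun_of x)"] mult_L2_upper[OF Linfty(3), of "fun_of x"]
    by (simp add: A(2) B_eq Re_cinner_L2 distrib_right)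
qed

lemma evolution: "symmetric_evolution M A (min a0 c0)"
proof (rule symmetric_evolution.intro)
  show "bounded_linear M" by (rule M)
  show "inner (M x) y = inner x (M y)" for x y
    by (metis M(2) inner_commute)
  show "0 \<le> inner (M x) x" for x by (simp add: M(2))
  show "x = 0" if "inner (M x) x = 0" for x
  proof -
    have "fun_of x = fun_of 0" using that by (simp add: M(2) linear_0[OF bounded_linear.linear[OF bounded_linear_fun_of]])
    then show ?thesis by (simp add: fun_of_inject)
  qed
  show "bounded_linear A" by (rule A)
  show "inner (A x) y = inner x (A y)" for x y
    unfolding inner_commute[of x] A(2) by (subst B_commute) simp
  show "0 < min a0 c0" using pos by simp
  show "min a0 c0 * (norm x)\<^sup>2 \<le> inner (A x) x" for x
  proof -
    have n: "(norm x)\<^sup>2 = (norm (fun_of x))\<^sup>2 + (norm (weak_gradient (fun_of x)))\<^sup>2"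
      unfolding H1_norm_fun_of[symmetric] H1_norm_def by simp
    have "min a0 c0 * (norm (fun_of x))\<^sup>2 \<le> c0 * (norm (fun_of x))\<^sup>2"
      "min a0 c0 * (norm (weak_gradient (fun_of x)))\<^sup>2 \<le> a0 * (norm (weak_gradient (fun_of x)))\<^sup>2"
      by (intro mult_right_mono; simp)+
    moreover have "0 \<le> b0 * (norm (\<Lambda> (fun_of x)))\<^sup>2" using pos by simp
    ultimately show ?thesis using A_lower[of x] by (simp add: n distrib_left)
  qed
qed

lemma B_bounded: "\<exists>K\<ge>0. \<forall>v\<in>H1. \<forall>\<phi>\<in>H1. cmod (B v \<phi>) \<le> K * H1_norm v * H1_norm \<phi>"
proof -
  obtain K where K: "K > 0" "\<And>x. norm (A x) \<le> norm x * K" using bounded_linear.pos_bounded[OF A(1)] by blast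
  have re: "\<bar>Re (B v \<phi>)\<bar> \<le> K * H1_norm v * H1_norm \<phi>" if "v \<in> H1" "\<phi> \<in> H1" for v \<phi>
  proof -
    have "\<bar>Re (B v \<phi>)\<bar> = \<bar>inner (A (sobolev_of v)) (sobolev_of \<phi>)\<bar>" using that by (simp add: A(2))
    also have "\<dots> \<le> norm (A (sobolev_of v)) * norm (sobolev_of \<phi>)" by (rule Cauchy_Schwarz_ineq2)
    also have "\<dots> \<le> norm (sobolev_of v) * K * norm (sobolev_of \<phi>)" by (intro mult_right_mono K) simp
    finally show ?thesis using that by (simp add: mult_ac flip: H1_norm_fun_of)
  qed
  have "cmod (B v \<phi>) \<le> (2 * K) * H1_norm v * H1_norm \<phi>" if "v \<in> H1" "\<phi> \<in> H1" for v \<phi>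
  proof -
    have "cmod (B v \<phi>) \<le> \<bar>Re (B v \<phi>)\<bar> + \<bar>Im (B v \<phi>)\<bar>" by (rule cmod_le)
    \<comment> \<open>Conjugate linearity gives B v (\<i> \<phi>) = - \<i> B v \<phi>, and \<i>
      \<phi> has the same H1 norm; the price is the factor 2.\<close>
    also have "Im (B v \<phi>) = Re (B v (scaleC_L2 \<i> \<phi>))" using that by (simp add: B_scaleC_right)
    finally show ?thesis
      using re[OF that] re[OF that(1) H1_scaleC[OF that(2)], of \<i>] that by (simp add: H1_norm_scaleC)
  qed
  then show ?thesis using K(1) by (intro exI[of _ "2 * K"]) auto
qed

definition BK :: real where
  "BK = (SOME K. K \<ge> 0 \<and> (\<forall>v\<in>H1. \<forall>\<phi>\<in>H1. cmod (B v \<phi>) \<le> K * H1_norm v * H1_norm \<phi>))"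

lemma BK: "BK \<ge> 0" "v \<in> H1 \<Longrightarrow> \<phi> \<in> H1 \<Longrightarrow> cmod (B v \<phi>) \<le> BK * H1_norm v * H1_norm \<phi>"
  using someI_ex[OF B_bounded] unfolding BK_def[symmetric] by blast+

text \<open>The functional that the equation prescribes as the time derivative when the solution is
  at \<open>x\<close>.\<close>

definition dual_of :: "'n sobolev \<Rightarrow> 'n L2 \<Rightarrow> complex" where
  "dual_of x = (\<lambda>\<phi>. - B (fun_of x) \<phi>)"

lemma dual_of_bound: "\<phi> \<in> H1 \<Longrightarrow> cmod (dual_of x \<phi>) \<le> (BK * norm x) * H1_norm \<phi>"
  using BK(2)[OF fun_of_H1] by (simp add: dual_of_def H1_norm_fun_of)

lemma dual_of_H1_dual: "dual_of x \<in> H1_dual"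
  unfolding H1_dual_def using dual_of_bound[of _ x]
  by (auto simp: dual_of_def B_add_right B_scaleC_right)

lemma dual_of_diff: "dual_of x - dual_of y = dual_of (x - y)"
  by (simp add: fun_eq_iff dual_of_def fun_of_diff B_diff_left fun_of_H1)

lemma dual_of_norm: "H1_dual_norm (dual_of x) \<le> BK * norm x"
  using dual_of_bound BK(1) by (intro H1_dual_norm_upper) auto

lemma dual_of_norm_nonneg: "0 \<le> H1_dual_norm (dual_of x)"
proof -
  have "cmod (dual_of x 0) \<le> H1_dual_norm (dual_of x)"
    by (rule H1_dual_norm_bound[where K = "BK * norm x"]) (simp_all add: zero_H1 H1_norm_zero dual_of_bound BK(1))
  then show ?thesis using norm_ge_zero order_trans by blast
qed

text \<open>\<open>H1_dual_norm\<close> is a supremum over bare functions, not the norm of a type.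
  This Lipschitz estimate makes the dual norm of the time derivative continuous along the solution,
  hence square integrable.\<close>

lemma dual_of_norm_triangle: "H1_dual_norm (dual_of x) \<le> H1_dual_norm (dual_of y) + BK * norm (x - y)"
proof -
  have "H1_dual_norm (dual_of x) \<le> H1_dual_norm (dual_of y) + H1_dual_norm (dual_of (x - y))"
    unfolding H1_dual_norm_def[of "dual_of x"]
  proof (rule cSUP_least[OF H1_unit_ball_nonempty])
    fix \<phi> :: "'n L2" assume "\<phi> \<in> {\<phi> \<in> H1. H1_norm \<phi> \<le> 1}"
    then have \<phi>: "\<phi> \<in> H1" "H1_norm \<phi> \<le> 1" by auto
    have "dual_of x \<phi> = dual_of y \<phi> + dual_of (x - y) \<phi>"
      using dual_of_diff[of x y] by (metis add.commute diff_add_cancel fun_diff_def)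
    then have "cmod (dual_of x \<phi>) \<le> cmod (dual_of y \<phi>) + cmod (dual_of (x - y) \<phi>)"
      by (simp add: norm_triangle_ineq)
    also have "\<dots> \<le> H1_dual_norm (dual_of y) + H1_dual_norm (dual_of (x - y))"
      by (intro add_mono H1_dual_norm_bound[OF \<phi>, where K = "BK * norm y"] H1_dual_norm_bound[OF \<phi>, where K = "BK * norm (x - y)"])
        (use dual_of_bound BK(1) in auto)
    finally show "cmod (dual_of x \<phi>) \<le> H1_dual_norm (dual_of y) + H1_dual_norm (dual_of (x - y))" .
  qed
  then show ?thesis using dual_of_norm[of "x - y"] by linarith
qed

end

section \<open>Continuous curves as elements of Bochner spaces\<close>

lemma strongly_measurable_continuous:
  fixes U :: "real \<Rightarrow> 'b::real_normed_vector" and F :: "'b \<Rightarrow> 'x::minus"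
  assumes T: "0 < T" and U: "continuous_on {0..T} U"
    and X: "\<And>x. F x \<in> X" and N: "\<And>x y. 0 \<le> N (F x - F y)" "\<And>x y. N (F x - F y) \<le> K * norm (x - y)"
  shows "strongly_measurable T X N (\<lambda>t. F (U t))"
proof -
  \<comment> \<open>The curve is sampled at the last grid point of step 1/(k + 1) not exceeding t.
    Rounding down keeps the sample in [0, t], where \<open>U\<close> is continuous, and only
    finitely many values occur on (0, T).\<close>
  define h where "h k t = F (U (of_int \<lfloor>t * real (Suc k)\<rfloor> / real (Suc k)))" for k t
  have simple: "simple_function (lebesgue_on {0<..<T}) (h k)" for k
  proof -
    have "simple_function (lebesgue_on {0<..<T}) (\<lambda>t. \<lfloor>t * real (Suc k)\<rfloor>)"
      unfolding simple_function_def
    proof (intro conjI ballI)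
      have "(\<lambda>t. \<lfloor>t * real (Suc k)\<rfloor>) ` space (lebesgue_on {0<..<T}) \<subseteq> {0..\<lfloor>T * real (Suc k)\<rfloor>}"
        by (auto intro!: floor_mono mult_right_mono)
      then show "finite ((\<lambda>t. \<lfloor>t * real (Suc k)\<rfloor>) ` space (lebesgue_on {0<..<T}))"
        by (rule finite_subset) simp
      fix z
      have "(\<lambda>t. \<lfloor>t * real (Suc k)\<rfloor>) -` {z} \<in> sets borel"
        using measurable_sets[of "\<lambda>t. \<lfloor>t * real (Suc k)\<rfloor>" borel "count_space UNIV" "{z}"] by simp
      then have "(\<lambda>t. \<lfloor>t * real (Suc k)\<rfloor>) -` {z} \<in> sets lebesgue" by (simp add: sets_completionI_sets)
      then show "(\<lambda>t. \<lfloor>t * real (Suc k)\<rfloor>) -` {z} \<inter> space (lebesgue_on {0<..<T}) \<in> sets (lebesgue_on {0<..<T})"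
        by (auto simp: sets_restrict_space Int_commute)
    qed
    then show ?thesis unfolding h_def[abs_def] by (rule simple_function_compose1)
  qed
  have conv: "(\<lambda>k. N (h k t - F (U t))) \<longlonglongrightarrow> 0" if t: "t \<in> {0<..<T}" for t
  proof -
    define q where "q k = of_int \<lfloor>t * real (Suc k)\<rfloor> / real (Suc k)" for k
    have q: "t - 1 / real (Suc k) \<le> q k" "q k \<le> t" "0 \<le> q k" for k
    proof -
      define n where "n = real (Suc k)"
      have n: "n > 0" by (simp add: n_def)
      have "t * n - 1 \<le> of_int \<lfloor>t * n\<rfloor>" "of_int \<lfloor>t * n\<rfloor> \<le> t * n" by linarith+
      moreover have "0 \<le> \<lfloor>t * n\<rfloor>" using t n by simp
      moreover have "(t * n - 1) / n = t - 1 / n" "t * n / n = t" using n by (simp_all add: diff_divide_distrib)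
      ultimately show "t - 1 / real (Suc k) \<le> q k" "q k \<le> t" "0 \<le> q k"
        using n divide_right_mono[of "t * n - 1" "of_int \<lfloor>t * n\<rfloor>" n] divide_right_mono[of "of_int \<lfloor>t * n\<rfloor>" "t * n" n]
        unfolding q_def n_def[symmetric] by simp_all
    qed
    have "(\<lambda>k. t - 1 / real (Suc k)) \<longlonglongrightarrow> t - 0"
      using LIMSEQ_inverse_real_of_nat by (intro tendsto_intros) (simp add: inverse_eq_divide)
    then have "q \<longlonglongrightarrow> t"
      by (intro real_tendsto_sandwich[of "\<lambda>k. t - 1 / real (Suc k)" q _ "\<lambda>_. t"]) (use q in auto)
    then have "(\<lambda>k. U (q k)) \<longlonglongrightarrow> U t"
      by (intro continuous_on_tendsto_compose[OF U]) (use t q order_trans[OF q(2)] in \<open>auto intro!: always_eventually\<close>)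
    then have "(\<lambda>k. K * norm (U (q k) - U t)) \<longlonglongrightarrow> K * 0"
      by (intro tendsto_intros tendsto_norm_zero LIM_zero)
    then have "(\<lambda>k. K * norm (U (q k) - U t)) \<longlonglongrightarrow> 0" by simp
    then show ?thesis
      by (rule real_tendsto_sandwich[OF _ _ tendsto_const, rotated 2]) (use N in \<open>auto simp: h_def q_def\<close>)
  qed
  show ?thesis
    unfolding strongly_measurable_def
    using simple conv X
    by (intro conjI exI[of _ h] allI ballI AE_I2) (auto simp: h_def)
qed

lemma integrable_continuous_lebesgue_on:
  fixes f :: "real \<Rightarrow> 'b::euclidean_space"
  assumes "continuous_on {0..T} f"
  shows "integrable (lebesgue_on {0<..<T}) f"
    and "integral\<^sup>L (lebesgue_on {0<..<T}) f = (\<integral>t. indicator {0..T} t *\<^sub>R f t \<partial>lborel)"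
proof -
  have i: "integrable lborel (\<lambda>t. indicator {0..T} t *\<^sub>R f t)"
    using borel_integrable_compact[OF _ assms] by simp
  then have il: "integrable lebesgue (\<lambda>t. indicator {0..T} t *\<^sub>R f t)"
    by (subst integrable_completion) auto
  have m: "(\<lambda>t. indicator {0<..<T} t *\<^sub>R f t) \<in> borel_measurable lebesgue"
  proof -
    have "(\<lambda>t. indicator {0<..<T} t *\<^sub>R (indicator {0..T} t *\<^sub>R f t)) \<in> borel_measurable lebesgue"
      by (intro borel_measurable_scaleR borel_measurable_indicator borel_measurable_integrable[OF il]) simp
    moreover have "(\<lambda>t. indicator {0<..<T} t *\<^sub>R (indicator {0..T} t *\<^sub>R f t)) = (\<lambda>t. indicator {0<..<T} t *\<^sub>R f t)"
      by (auto simp: fun_eq_iff split: split_indicator)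
    ultimately show ?thesis by (simp only:)
  qed
  have ae: "AE t in lebesgue. indicator {0..T} t *\<^sub>R f t = indicator {0<..<T} t *\<^sub>R f t"
    using AE_completion[OF AE_lborel_singleton[of 0]] AE_completion[OF AE_lborel_singleton[of T]]
    by eventually_elim (auto split: split_indicator)
  have S: "{0<..<T} \<inter> space lebesgue \<in> sets lebesgue" by simp
  show "integrable (lebesgue_on {0<..<T}) f"
    unfolding integrable_restrict_space[OF S] by (rule integrable_cong_AE_imp[OF il m ae])
  show "integral\<^sup>L (lebesgue_on {0<..<T}) f = (\<integral>t. indicator {0..T} t *\<^sub>R f t \<partial>lborel)"
    unfolding integral_restrict_space[OF S]
    using integral_cong_AE[OF borel_measurable_integrable[OF il] m ae] integral_completion[of "\<lambda>t. indicator {0..T} t *\<^sub>R f t" lborel] borel_measurable_integrable[OF i]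
    by simp
qed

lemma test_function_real:
  fixes \<psi> :: "real \<Rightarrow> real"
  assumes "test_function \<Omega> \<psi>"
  shows "(\<psi> has_real_derivative deriv \<psi> t) (at t)" "continuous_on S (deriv \<psi>)" "t \<notin> \<Omega> \<Longrightarrow> \<psi> t = 0"
proof -
  have "Ck (Suc 0) \<psi>" using assms unfolding test_function_def by blast
  then have d: "\<And>t. \<psi> differentiable (at t)" and c: "continuous_on UNIV (\<lambda>t. frechet_derivative \<psi> (at t) 1)" by auto
  show D: "(\<psi> has_real_derivative deriv \<psi> t) (at t)" for t
    using d[of t] by (simp add: DERIV_deriv_iff_real_differentiable)
  have "frechet_derivative \<psi> (at t) 1 = deriv \<psi> t" for t
    using fun_cong[OF frechet_derivative_at[OF D[of t, unfolded has_field_derivative_def]], of 1] by simp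
  then show "continuous_on S (deriv \<psi>)" using c continuous_on_subset by fastforce
  show "\<psi> t = 0" if "t \<notin> \<Omega>"
    using assms that closure_subset[of "{x. \<psi> x \<noteq> 0}"] unfolding test_function_def by auto
qed

context parabolic_form
begin

text \<open>The curve \<open>U\<close> in the Hilbert space stays in the conclusion because the
  energy inequality is phrased with \<open>A\<close>; the bounds on the individual norms are
  extracted from it later.\<close>

theorem weak_solution_exists:
  assumes T: "0 < T" and u0: "u0 \<in> H1"
  shows "\<exists>U. continuous_on {0..T} U \<and> weak_solution a b c s T u0 (\<lambda>t. fun_of (U t)) \<and>
    (\<exists>u' \<in> bochner_L2 T H1_dual H1_dual_norm. is_weak_time_derivative T (\<lambda>t. fun_of (U t)) u') \<and>
    (\<lambda>t. fun_of (U t)) \<in> bochner_Linfty T H1 H1_norm \<and> continuous_on {0..T} (\<lambda>t. fun_of (U t)) \<and>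
    (\<forall>t\<in>{0..T}. inner (A (U t)) (U t) \<le> inner (A (sobolev_of u0)) (sobolev_of u0) \<and> norm (fun_of (U t)) \<le> norm u0)"
proof -
  obtain U where U0: "U 0 = sobolev_of u0" and U: "continuous_on {0..T} U"
    and dU: "\<And>\<phi> t. t \<in> {0..T} \<Longrightarrow> ((\<lambda>t. inner (M (U t)) \<phi>) has_real_derivative - inner (A (U t)) \<phi>) (at t within {0..T})"
    and eU: "\<And>t. t \<in> {0..T} \<Longrightarrow> inner (A (U t)) (U t) \<le> inner (A (sobolev_of u0)) (sobolev_of u0)"
    and mU: "\<And>t. t \<in> {0..T} \<Longrightarrow> inner (M (U t)) (U t) \<le> inner (M (sobolev_of u0)) (sobolev_of u0)"
    using symmetric_evolution.evolution_exists[OF evolution, of T "sobolev_of u0"] T by auto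
  let ?u = "\<lambda>t. fun_of (U t)"
  have cu: "continuous_on {0..T} ?u"
    by (rule bounded_linear.continuous_on[OF bounded_linear_fun_of U])
  have smu: "strongly_measurable T H1 H1_norm ?u"
    by (rule strongly_measurable_continuous[OF T U, where K = 1]) (auto simp: fun_of_H1 fun_of_diff[symmetric] H1_norm_fun_of)
  have intu: "integrable (lebesgue_on {0<..<T}) (\<lambda>t. (H1_norm (?u t))\<^sup>2)"
    unfolding H1_norm_fun_of by (intro integrable_continuous_lebesgue_on continuous_intros U)
  have bu: "?u \<in> bochner_L2 T H1 H1_norm" using smu intu by (simp add: bochner_L2_def)
  have "bounded (U ` {0..T})" by (intro compact_imp_bounded compact_continuous_image U) simp
  then obtain R where R: "\<And>t. t \<in> {0..T} \<Longrightarrow> norm (U t) \<le> R" unfolding bounded_iff by blast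
  have binf: "?u \<in> bochner_Linfty T H1 H1_norm"
    using smu R by (auto simp: bochner_Linfty_def H1_norm_fun_of intro!: exI[of _ R] AE_I2)
  let ?u' = "\<lambda>t. dual_of (U t)"
  have smu': "strongly_measurable T H1_dual H1_dual_norm ?u'"
    by (rule strongly_measurable_continuous[OF T U, where K = BK]) (auto simp: dual_of_H1_dual dual_of_diff dual_of_norm_nonneg dual_of_norm)
  have "continuous_on {0..T} (\<lambda>t. H1_dual_norm (?u' t))"
  proof -
    have "\<bar>H1_dual_norm (dual_of x) - H1_dual_norm (dual_of y)\<bar> \<le> BK * norm (x - y)" for x y
      using dual_of_norm_triangle[of x y] dual_of_norm_triangle[of y x] by (simp add: norm_minus_commute)
    then have "continuous_on UNIV (\<lambda>x. H1_dual_norm (dual_of x))"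
      by (intro lipschitz_on_continuous_on[OF lipschitz_onI[where L = BK]]) (auto simp: dist_norm BK(1))
    from continuous_on_compose2[OF this U] show ?thesis by simp
  qed
  then have "integrable (lebesgue_on {0<..<T}) (\<lambda>t. (H1_dual_norm (?u' t))\<^sup>2)"
    by (intro integrable_continuous_lebesgue_on continuous_intros)
  then have bu': "?u' \<in> bochner_L2 T H1_dual H1_dual_norm" using smu' by (simp add: bochner_L2_def)
  have wtd: "is_weak_time_derivative T ?u ?u'"
    unfolding is_weak_time_derivative_def
  proof (intro allI impI ballI)
    fix \<psi> :: "real \<Rightarrow> real" and \<phi> :: "'n L2"
    assume \<psi>: "test_function {0<..<T} \<psi>" and \<phi>: "\<phi> \<in> H1"
    let ?G = "\<lambda>t. cinner_L2 (?u t) \<phi>"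
    have re: "((\<lambda>t. inner (?u t) \<phi>) has_real_derivative - Re (B (?u t) \<phi>)) (at t within {0..T})" if "t \<in> {0..T}" "\<phi> \<in> H1" for t \<phi>
      using dU[OF that(1), of "sobolev_of \<phi>"] that(2) by (simp add: M(2) A(2))
    \<comment> \<open>The evolution equation is real. Used for \<phi> and for \<i> \<phi> it gives
      the real and the imaginary part of the complex identity.\<close>
    have dG: "(?G has_vector_derivative - B (?u t) \<phi>) (at t within {0..T})" if t: "t \<in> {0..T}" for t
    proof -
      have "((\<lambda>t. of_real (inner (?u t) \<phi>) + \<i> * of_real (inner (?u t) (scaleC_L2 \<i> \<phi>))) has_vector_derivative
          of_real (- Re (B (?u t) \<phi>)) + \<i> * of_real (- Re (B (?u t) (scaleC_L2 \<i> \<phi>)))) (at t within {0..T})"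
        using re[OF t \<phi>] re[OF t H1_scaleC[OF \<phi>]]
        by (intro has_vector_derivative_add has_vector_derivative_mult_right has_vector_derivative_of_real)
          (simp_all add: has_real_derivative_iff_has_vector_derivative)
      moreover have "(\<lambda>t. of_real (inner (?u t) \<phi>) + \<i> * of_real (inner (?u t) (scaleC_L2 \<i> \<phi>))) = ?G"
        by (simp add: fun_eq_iff cinner_L2_eq Complex_eq)
      moreover have "of_real (- Re (B (?u t) \<phi>)) + \<i> * of_real (- Re (B (?u t) (scaleC_L2 \<i> \<phi>))) = - B (?u t) \<phi>"
        by (simp add: complex_eq_iff B_scaleC_right[OF \<phi>])
      ultimately show ?thesis by simp
    qed
    have d\<psi>: "((\<lambda>t. complex_of_real (\<psi> t)) has_vector_derivative of_real (deriv \<psi> t)) (at t within {0..T})" for t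
      using test_function_real(1)[OF \<psi>, of t]
      by (intro has_vector_derivative_of_real) (simp add: has_real_derivative_iff_has_vector_derivative[symmetric] has_field_derivative_at_within)
    have cG: "continuous_on {0..T} ?G"
      using dG has_vector_derivative_continuous continuous_on_eq_continuous_within by blast
    have cB: "continuous_on {0..T} (\<lambda>t. B (?u t) \<phi>)"
    proof -
      have cr: "continuous_on {0..T} (\<lambda>t. Re (B (?u t) \<phi>))" if "\<phi> \<in> H1" for \<phi>
        using that continuous_on_inner[OF bounded_linear.continuous_on[OF A(1) U] continuous_on_const[of _ "sobolev_of \<phi>"]]
        by (simp add: A(2))
      have "continuous_on {0..T} (\<lambda>t. of_real (Re (B (?u t) \<phi>)) + \<i> * of_real (Re (B (?u t) (scaleC_L2 \<i> \<phi>))))"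
        by (intro continuous_on_add continuous_on_mult continuous_on_const continuous_on_of_real cr \<phi> H1_scaleC)
      moreover have "of_real (Re (B (?u t) \<phi>)) + \<i> * of_real (Re (B (?u t) (scaleC_L2 \<i> \<phi>))) = B (?u t) \<phi>" for t
        by (simp add: complex_eq_iff B_scaleC_right[OF \<phi>])
      ultimately show ?thesis by simp
    qed
    have c\<psi>: "continuous_on {0..T} (\<lambda>t. complex_of_real (\<psi> t))"
      using d\<psi> has_vector_derivative_continuous continuous_on_eq_continuous_within by blast
    have cd: "continuous_on {0..T} (\<lambda>t. complex_of_real (deriv \<psi> t))"
      by (intro continuous_intros test_function_real(2)[OF \<psi>])
    have c1: "continuous_on {0..T} (\<lambda>t. ?G t * of_real (deriv \<psi> t))" by (intro continuous_intros cG cd)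
    have c2: "continuous_on {0..T} (\<lambda>t. ?u' t \<phi> * of_real (\<psi> t))"
      unfolding dual_of_def by (intro continuous_intros cB c\<psi>)
    \<comment> \<open>Integration by parts on the closed interval; the boundary terms vanish because
      \<psi> is 0 outside the open interval, in particular at 0 and T.\<close>
    have "(\<integral>t. indicator {0..T} t *\<^sub>R (?G t * of_real (deriv \<psi> t) + ?u' t \<phi> * of_real (\<psi> t)) \<partial>lborel)
        = ?G T * of_real (\<psi> T) - ?G 0 * of_real (\<psi> 0)"
    proof (rule integral_FTC_Icc)
      show "((\<lambda>t. ?G t * of_real (\<psi> t)) has_vector_derivative ?G t * of_real (deriv \<psi> t) + ?u' t \<phi> * of_real (\<psi> t)) (at t within {0..T})"
        if "0 \<le> t" "t \<le> T" for t
        using has_vector_derivative_mult[OF dG d\<psi>, of t] that by (simp add: dual_of_def)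
    qed (use T c1 c2 in \<open>auto intro: continuous_intros\<close>)
    also have "\<dots> = 0" using test_function_real(3)[OF \<psi>] by simp
    finally have "integral\<^sup>L (lebesgue_on {0<..<T}) (\<lambda>t. ?G t * of_real (deriv \<psi> t) + ?u' t \<phi> * of_real (\<psi> t)) = 0"
      using integrable_continuous_lebesgue_on(2)[OF continuous_on_add[OF c1 c2]] by simp
    then have "integral\<^sup>L (lebesgue_on {0<..<T}) (\<lambda>t. ?G t * of_real (deriv \<psi> t)) + integral\<^sup>L (lebesgue_on {0<..<T}) (\<lambda>t. ?u' t \<phi> * of_real (\<psi> t)) = 0"
      by (simp add: integrable_continuous_lebesgue_on(1)[OF c1] integrable_continuous_lebesgue_on(1)[OF c2])
    then show "(\<integral>t. ?G t * of_real (deriv \<psi> t) \<partial>lebesgue_on {0<..<T}) = - (\<integral>t. ?u' t \<phi> * of_real (\<psi> t) \<partial>lebesgue_on {0<..<T})"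
      by (simp add: eq_neg_iff_add_eq_0)
  qed
  have "weak_solution a b c s T u0 ?u"
    unfolding weak_solution_def
  proof (intro conjI)
    show "?u \<in> bochner_L2 T H1 H1_norm" by (rule bu)
    show "\<exists>w. continuous_on {0..T} w \<and> (AE t in lebesgue_on {0<..<T}. w t = ?u t) \<and> w 0 = u0"
      using cu U0 u0 by (intro exI[of _ ?u]) simp
    show "\<exists>u'\<in>bochner_L2 T H1_dual H1_dual_norm. is_weak_time_derivative T ?u u' \<and>
        (AE t in lebesgue_on {0<..<T}. \<forall>\<phi>\<in>H1. u' t \<phi> + B (?u t) \<phi> = 0)"
      using bu' wtd by (intro bexI[of _ ?u']) (auto simp: dual_of_def)
  qed
  moreover have "norm (?u t) \<le> norm u0" if "t \<in> {0..T}" for t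
  proof -
    have "(norm (?u t))\<^sup>2 \<le> (norm u0)\<^sup>2" using mU[OF that] u0 by (simp add: M(2) power2_norm_eq_inner)
    then show ?thesis by (rule power2_le_imp_le) simp
  qed
  ultimately show ?thesis using U bu' wtd binf cu eU by blast
qed

end

section \<open>The weak form integrated in time\<close>

text \<open>Completeness of Lebesgue measure. The functions of time in a weak solution are tied
  together only almost everywhere, and this transfers measurability from one to another before
  integrals are compared.\<close>

lemma borel_measurable_AE_lebesgue_on:
  fixes f g :: "'a::euclidean_space \<Rightarrow> 'b::real_normed_vector"
  assumes f: "f \<in> borel_measurable (lebesgue_on S)" and S: "S \<in> sets lebesgue"
    and ae: "AE x in lebesgue_on S. f x = g x"
  shows "g \<in> borel_measurable (lebesgue_on S)"
proof -
  have S': "S \<inter> space lebesgue \<in> sets lebesgue" using S by simp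
  have ae': "AE x in lebesgue. indicator S x *\<^sub>R f x = indicator S x *\<^sub>R g x"
    using ae unfolding AE_restrict_space_iff[OF S'] by (auto elim!: eventually_mono split: split_indicator)
  have f': "(\<lambda>x. indicator S x *\<^sub>R f x) \<in> borel_measurable lebesgue"
    using f unfolding borel_measurable_restrict_space_iff[OF S'] .
  have "(\<lambda>x. indicator S x *\<^sub>R g x) \<in> borel_measurable lebesgue"
  proof (rule borel_measurableI)
    fix U :: "'b set" assume "open U"
    then have fU: "(\<lambda>x. indicator S x *\<^sub>R f x) -` U \<inter> space lebesgue \<in> sets lebesgue"
      by (intro measurable_sets[OF f']) simp
    have aeU: "AE x in lebesgue. x \<in> (\<lambda>x. indicator S x *\<^sub>R f x) -` U \<inter> space lebesgue \<longleftrightarrow>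
        x \<in> (\<lambda>x. indicator S x *\<^sub>R g x) -` U \<inter> space lebesgue"
      using ae' by (auto elim!: eventually_mono)
    show "(\<lambda>x. indicator S x *\<^sub>R g x) -` U \<inter> space lebesgue \<in> sets lebesgue"
      by (rule completion.in_sets_AE[OF aeU fU]) auto
  qed
  then show ?thesis unfolding borel_measurable_restrict_space_iff[OF S'] .
qed

lemma finite_measure_interval: "finite_measure (lebesgue_on {0<..<T::real})"
  by (rule finite_measure_lebesgue_on) simp

lemma bochner_L2_integrable_norm:
  fixes v :: "real \<Rightarrow> 'n::finite L2"
  assumes "v \<in> bochner_L2 T H1 H1_norm"
  shows "integrable (lebesgue_on {0<..<T}) (\<lambda>t. H1_norm (v t))"
proof -
  interpret finite_measure "lebesgue_on {0<..<T}" by (rule finite_measure_interval)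
  have i: "integrable (lebesgue_on {0<..<T}) (\<lambda>t. (H1_norm (v t))\<^sup>2)" using assms by (simp add: bochner_L2_def)
  have nn: "0 \<le> H1_norm w" for w :: "'n L2" by (simp add: H1_norm_def)
  have "(\<lambda>t. sqrt ((H1_norm (v t))\<^sup>2)) \<in> borel_measurable (lebesgue_on {0<..<T})"
    using borel_measurable_integrable[OF i] by measurable
  then have m: "(\<lambda>t. H1_norm (v t)) \<in> borel_measurable (lebesgue_on {0<..<T})"
    using nn by simp
  have "integrable (lebesgue_on {0<..<T}) (\<lambda>t. 1 + (H1_norm (v t))\<^sup>2)" using i by simp
  then show ?thesis
  proof (rule Bochner_Integration.integrable_bound[OF _ m], intro AE_I2)
    fix t
    have "2 * H1_norm (v t) \<le> 1 + (H1_norm (v t))\<^sup>2"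
      using sum_squares_bound[of 1 "H1_norm (v t)"] by simp
    then show "norm (H1_norm (v t)) \<le> norm (1 + (H1_norm (v t))\<^sup>2)" using nn[of "v t"] by simp
  qed
qed

context parabolic_form
begin

text \<open>Measurability comes from the simple functions approximating v in the H1 norm, since B(.,
  \<phi>) is continuous there. Integrability follows from that of the H1 norm on a bounded
  interval.\<close>

lemma B_integrable:
  assumes v: "v \<in> bochner_L2 T H1 H1_norm" and \<phi>: "\<phi> \<in> H1"
  shows "integrable (lebesgue_on {0<..<T}) (\<lambda>t. B (v t) \<phi>)"
proof -
  let ?I = "lebesgue_on {0<..<T}"
  have vH: "AE t in ?I. v t \<in> H1"
    using v by (simp add: bochner_L2_def strongly_measurable_def)
  obtain h where h: "\<And>k. simple_function ?I (h k)" "\<And>k t. t \<in> {0<..<T} \<Longrightarrow> h k t \<in> H1"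
    "AE t in ?I. (\<lambda>k. H1_norm (h k t - v t)) \<longlonglongrightarrow> 0"
    using v unfolding bochner_L2_def strongly_measurable_def by blast
  have hm: "(\<lambda>t. B (h k t) \<phi>) \<in> borel_measurable ?I" for k
    by (rule borel_measurable_simple_function[OF simple_function_compose1[OF h(1)]])
  have lim: "AE t in ?I. lim (\<lambda>k. B (h k t) \<phi>) = B (v t) \<phi>"
    using vH h(3) AE_space[of ?I]
  proof eventually_elim
    case (elim t)
    have "(\<lambda>k. BK * H1_norm (h k t - v t) * H1_norm \<phi>) \<longlonglongrightarrow> BK * 0 * H1_norm \<phi>"
      by (intro tendsto_intros elim)
    then have "(\<lambda>k. BK * H1_norm (h k t - v t) * H1_norm \<phi>) \<longlonglongrightarrow> 0" by simp
    then have "(\<lambda>k. B (h k t) \<phi> - B (v t) \<phi>) \<longlonglongrightarrow> 0"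
    proof (rule Lim_null_comparison[rotated], intro always_eventually allI)
      fix k
      have "h k t \<in> H1" using elim by (intro h(2)) simp
      then show "norm (B (h k t) \<phi> - B (v t) \<phi>) \<le> BK * H1_norm (h k t - v t) * H1_norm \<phi>"
        using BK(2)[OF H1_diff \<phi>, of "h k t" "v t"] elim(1) by (simp add: B_diff_left)
    qed
    then show ?case by (intro limI) (simp add: LIM_zero_iff)
  qed
  have m: "(\<lambda>t. B (v t) \<phi>) \<in> borel_measurable ?I"
    by (rule borel_measurable_AE_lebesgue_on[OF borel_measurable_lim_metric[OF hm] _ lim]) simp
  have "integrable ?I (\<lambda>t. BK * H1_norm (v t) * H1_norm \<phi>)"
    by (intro integrable_mult_left integrable_mult_right bochner_L2_integrable_norm[OF v])
  then show ?thesis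
  proof (rule Bochner_Integration.integrable_bound[OF _ m])
    show "AE t in ?I. norm (B (v t) \<phi>) \<le> norm (BK * H1_norm (v t) * H1_norm \<phi>)"
      using vH by eventually_elim (use BK(2)[OF _ \<phi>] in force)
  qed
qed

end

section \<open>Testing in time with smooth plateaus\<close>

lemma test_function_plateau:
  assumes "0 < p" "p \<le> q" "q + 1 / real (Suc k) < T"
  shows "test_function {0<..<T} (plateau p q k)"
  unfolding test_function_def
proof (intro conjI allI)
  \<comment> \<open>The basis of \<open>real\<close> is {1}, so the coordinate product is the
    plateau itself.\<close>
  show "Ck j (plateau p q k)" for j
    using Ck_coordinate_prod[of "\<lambda>_::real. plateau p q k" j] smooth_plateau by simp
  have sub: "closure {t. plateau p q k t \<noteq> 0} \<subseteq> {p..q + 1 / real (Suc k)}"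
  proof (intro closure_minimal subsetI)
    fix t assume "t \<in> {t. plateau p q k t \<noteq> 0}"
    then show "t \<in> {p..q + 1 / real (Suc k)}" using plateau_eq_0[OF assms(2), of t k] by blast
  qed simp
  then show "compact (closure {t. plateau p q k t \<noteq> 0})"
    by (meson bounded_closed_interval bounded_subset closed_closure compact_eq_bounded_closed)
  show "closure {t. plateau p q k t \<noteq> 0} \<subseteq> {0<..<T}"
    using sub assms by (auto simp del: of_nat_Suc)
qed

text \<open>The derivative has integral 1 and support in [0, 1], so its rescaled copies form an
  approximate identity. The derivative of a plateau is the difference of two of them, centred at its
  two ramps.\<close>

lemma smooth_step_derivative:
  obtains d where "\<And>x. (smooth_step has_real_derivative d x) (at x)" "continuous_on UNIV d"
    "\<And>x. x \<notin> {0..1} \<Longrightarrow> d x = 0" "has_bochner_integral lborel d 1"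
proof -
  obtain d where d: "\<And>x. (smooth_step has_real_derivative d x) (at x)" "smooth d"
    using smooth_has_derivative[OF smooth_step(1)] by blast
  have cont: "continuous_on UNIV d" by (rule smooth_continuous[OF d(2)])
  have z: "d x = 0" if "x \<notin> {0..1}" for x
  proof (cases "x < 0")
    case True
    have "((\<lambda>_. 0) has_real_derivative d x) (at x)"
      by (rule has_field_derivative_transform_within_open[OF d(1), of "{..<0}"]) (use True smooth_step(4) in auto)
    then show ?thesis using DERIV_unique[OF _ DERIV_const] by blast
  next
    case False
    have "((\<lambda>_. 1) has_real_derivative d x) (at x)"
      by (rule has_field_derivative_transform_within_open[OF d(1), of "{1<..}"]) (use False that smooth_step(5) in auto)
    then show ?thesis using DERIV_unique[OF _ DERIV_const] by blast
  qed
  have "has_bochner_integral lborel (\<lambda>x. indicator {0..1} x *\<^sub>R d x) (smooth_step 1 - smooth_step 0)"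
    by (rule has_bochner_integral_FTC_Icc)
      (use d(1) continuous_on_subset[OF cont] in \<open>auto simp: has_real_derivative_iff_has_vector_derivative[symmetric] intro: has_field_derivative_at_within\<close>)
  moreover have "(\<lambda>x. indicator {0..1} x *\<^sub>R d x) = d"
    using z by (auto simp: fun_eq_iff split: split_indicator)
  ultimately have "has_bochner_integral lborel d 1"
    by (simp add: smooth_step)
  then show ?thesis using that d(1) cont z by blast
qed

text \<open>Substituting r = (k + 1)(t - p) moves the dependence on k into the argument of the
  bounded continuous \<open>G\<close>, where dominated convergence applies.\<close>

lemma tendsto_approximate_identity:
  fixes G :: "real \<Rightarrow> complex" and d :: "real \<Rightarrow> real"
  assumes G: "continuous_on UNIV G" "\<And>t. cmod (G t) \<le> K"
    and d: "has_bochner_integral lborel d 1"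
  shows "(\<lambda>k. \<integral>t. G t * of_real (real (Suc k) * d (real (Suc k) * (t - p))) \<partial>lborel) \<longlonglongrightarrow> G p"
proof -
  have [measurable]: "G \<in> borel_measurable borel" by (rule borel_measurable_continuous_onI[OF G(1)])
  have di: "integrable lborel d" "(\<integral>x. d x \<partial>lborel) = 1" using d by (auto simp: has_bochner_integral_iff)
  have [measurable]: "d \<in> borel_measurable borel" using borel_measurable_integrable[OF di(1)] by simp
  have eq: "(\<integral>t. G t * of_real (real (Suc k) * d (real (Suc k) * (t - p))) \<partial>lborel)
      = (\<integral>r. G (p + (1 / real (Suc k)) * r) * of_real (d r) \<partial>lborel)" for k
  proof -
    define n where "n = real (Suc k)"
    have n: "n > 0" by (simp add: n_def)
    have "(\<integral>t. G t * of_real (n * d (n * (t - p))) \<partial>lborel)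
        = \<bar>1 / n\<bar> *\<^sub>R (\<integral>r. G (p + (1 / n) * r) * of_real (n * d (n * ((p + (1 / n) * r) - p))) \<partial>lborel)"
      by (rule lborel_integral_real_affine) (use n in simp)
    also have "\<dots> = (\<integral>r. (1 / n) *\<^sub>R (G (p + (1 / n) * r) * of_real (n * d r)) \<partial>lborel)"
      using n by (simp del: scaleR_scaleR)
    also have "\<dots> = (\<integral>r. G (p + (1 / n) * r) * of_real (d r) \<partial>lborel)"
      using n by (intro Bochner_Integration.integral_cong refl) (simp add: scaleR_conv_of_real)
    finally show ?thesis by (simp add: n_def)
  qed
  have "(\<lambda>k. \<integral>r. G (p + (1 / real (Suc k)) * r) * of_real (d r) \<partial>lborel) \<longlonglongrightarrow> (\<integral>r. G p * of_real (d r) \<partial>lborel)"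
  proof (rule integral_dominated_convergence[where w = "\<lambda>r. K * \<bar>d r\<bar>"])
    show "AE r in lborel. (\<lambda>k. G (p + (1 / real (Suc k)) * r) * of_real (d r)) \<longlonglongrightarrow> G p * of_real (d r)"
    proof (rule AE_I2)
      fix r
      have "(\<lambda>k. p + (1 / real (Suc k)) * r) \<longlonglongrightarrow> p + 0 * r"
        using LIMSEQ_inverse_real_of_nat by (intro tendsto_intros) (simp add: inverse_eq_divide)
      then have "(\<lambda>k. G (p + (1 / real (Suc k)) * r)) \<longlonglongrightarrow> G p"
        by (intro continuous_on_tendsto_compose[OF G(1)]) auto
      then show "(\<lambda>k. G (p + (1 / real (Suc k)) * r) * of_real (d r)) \<longlonglongrightarrow> G p * of_real (d r)"
        by (intro tendsto_intros)
    qed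
    show "AE r in lborel. norm (G (p + (1 / real (Suc k)) * r) * of_real (d r)) \<le> K * \<bar>d r\<bar>" for k
      using G(2) by (auto simp: norm_mult intro!: mult_right_mono)
  qed (use di in \<open>auto intro: integrable_mult_right integrable_abs\<close>)
  also have "(\<integral>r. G p * of_real (d r) \<partial>lborel) = G p"
    using di by simp
  finally show ?thesis unfolding eq .
qed

context parabolic_form
begin

text \<open>Plateaus on (p, q] as test functions in time: their derivatives tend to point masses at
  p and at q, which turns the distributional derivative into an increment of the continuous
  representative.\<close>

lemma weak_solution_increment:
  assumes v: "v \<in> bochner_L2 T H1 H1_norm" and w: "continuous_on {0..T} w"
    and vw: "AE t in lebesgue_on {0<..<T}. w t = v t"
    and wtd: "is_weak_time_derivative T v u'"
    and eqn: "AE t in lebesgue_on {0<..<T}. \<forall>\<phi>\<in>H1. u' t \<phi> + B (v t) \<phi> = 0"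
    and \<phi>: "\<phi> \<in> H1" and pq: "0 < p" "p \<le> q" "q < T"
  shows "cinner_L2 (w p) \<phi> - cinner_L2 (w q) \<phi> = (\<integral>t. B (v t) \<phi> * indicator {p<..q} t \<partial>lebesgue_on {0<..<T})"
proof -
  let ?I = "lebesgue_on {0<..<T}"
  have S: "{0<..<T} \<in> sets lebesgue" by simp
  have Bi: "integrable ?I (\<lambda>t. B (v t) \<phi>)" by (rule B_integrable[OF v \<phi>])
  \<comment> \<open>Clamping t to [0, T] extends the pairing to a bounded continuous function on the
    line, as the approximate identity requires.\<close>
  define G where "G t = cinner_L2 (w (max 0 (min T t))) \<phi>" for t
  have cw: "continuous_on {0..T} (\<lambda>t. cinner_L2 (w t) \<phi>)"
    using w unfolding continuous_on_def by (auto intro: tendsto_cinner_L2)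
  have T: "0 < T" using pq by linarith
  have cG: "continuous_on UNIV G"
    unfolding G_def by (rule continuous_on_compose2[OF cw]) (use T in \<open>auto intro!: continuous_intros\<close>)
  obtain K where K: "\<And>t. cmod (G t) \<le> K"
  proof -
    have "bounded ((\<lambda>t. cinner_L2 (w t) \<phi>) ` {0..T})"
      by (intro compact_imp_bounded compact_continuous_image cw) simp
    then obtain K where "\<And>t. t \<in> {0..T} \<Longrightarrow> cmod (cinner_L2 (w t) \<phi>) \<le> K" unfolding bounded_iff by blast
    then show ?thesis using T by (intro that[of K]) (simp add: G_def)
  qed
  obtain d where d: "\<And>x. (smooth_step has_real_derivative d x) (at x)" "continuous_on UNIV d"
    "\<And>x. x \<notin> {0..1} \<Longrightarrow> d x = 0" "has_bochner_integral lborel d 1"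
    using smooth_step_derivative by blast
  define \<delta> where "\<delta> p k t = real (Suc k) * d (real (Suc k) * (t - p))" for p k t
  have deriv: "deriv (plateau p q k) t = \<delta> p k t - \<delta> q k t" for k t
  proof -
    have "((\<lambda>t. smooth_step (real (Suc k) * (t - r))) has_real_derivative d (real (Suc k) * (t - r)) * real (Suc k)) (at t)" for r
      by (rule DERIV_chain2[OF d(1)]) (auto intro!: derivative_eq_intros)
    then have "(plateau p q k has_real_derivative d (real (Suc k) * (t - p)) * real (Suc k) - d (real (Suc k) * (t - q)) * real (Suc k)) (at t)"
      unfolding plateau_def[abs_def] by (intro DERIV_diff)
    then show ?thesis by (simp add: DERIV_imp_deriv \<delta>_def mult.commute)
  qed
  have \<delta>i: "integrable lborel (\<lambda>t. G t * of_real (\<delta> r k t))" for r k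
  proof (rule Bochner_Integration.integrable_bound)
    have "integrable lborel d" using d(4) by (simp add: has_bochner_integral_iff)
    then have "integrable lborel (\<lambda>t. d (- real (Suc k) * r + real (Suc k) * t))"
      by (rule lborel_integrable_real_affine) simp
    then show "integrable lborel (\<lambda>t. K * (real (Suc k) * d (- real (Suc k) * r + real (Suc k) * t)))"
      by (intro integrable_mult_right)
    have [measurable]: "G \<in> borel_measurable borel" "d \<in> borel_measurable borel"
      by (intro borel_measurable_continuous_onI cG d)+
    show "(\<lambda>t. G t * of_real (\<delta> r k t)) \<in> borel_measurable lborel" unfolding \<delta>_def by measurable
    show "AE t in lborel. norm (G t * of_real (\<delta> r k t)) \<le> norm (K * (real (Suc k) * d (- real (Suc k) * r + real (Suc k) * t)))"
    proof (rule AE_I2)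
      fix t
      have "- real (Suc k) * r + real (Suc k) * t = real (Suc k) * (t - r)"
        by (simp only: right_diff_distrib)
      then have eq: "real (Suc k) * d (- real (Suc k) * r + real (Suc k) * t) = \<delta> r k t" by (simp only: \<delta>_def)
      have "cmod (G t) \<le> \<bar>K\<bar>" using K[of t] by linarith
      then have "cmod (G t) * \<bar>\<delta> r k t\<bar> \<le> \<bar>K\<bar> * \<bar>\<delta> r k t\<bar>" by (rule mult_right_mono) simp
      then show "norm (G t * of_real (\<delta> r k t)) \<le> norm (K * (real (Suc k) * d (- real (Suc k) * r + real (Suc k) * t)))"
        unfolding eq by (simp only: norm_mult norm_of_real real_norm_def)
    qed
  qed
  have parts: "(\<integral>t. G t * of_real (\<delta> p k t) \<partial>lborel) - (\<integral>t. G t * of_real (\<delta> q k t) \<partial>lborel)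
      = (\<integral>t. B (v t) \<phi> * of_real (plateau p q k t) \<partial>?I)" if k: "q + 1 / real (Suc k) < T" for k
  proof -
    let ?\<psi> = "plateau p q k"
    have test: "test_function {0<..<T} ?\<psi>" by (rule test_function_plateau[OF pq(1,2) k])
    note t = test_function_real[OF test]
    have c1: "continuous_on {0..T} (\<lambda>t. cinner_L2 (w t) \<phi> * of_real (deriv ?\<psi> t))"
      by (intro continuous_intros cw t(2))
    have m1: "(\<lambda>t. cinner_L2 (w t) \<phi> * of_real (deriv ?\<psi> t)) \<in> borel_measurable ?I"
      by (rule borel_measurable_integrable[OF integrable_continuous_lebesgue_on(1)[OF c1]])
    have ae1: "AE t in ?I. cinner_L2 (w t) \<phi> * of_real (deriv ?\<psi> t) = cinner_L2 (v t) \<phi> * of_real (deriv ?\<psi> t)"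
      using vw by eventually_elim simp
    have m\<psi>: "(\<lambda>t. complex_of_real (?\<psi> t)) \<in> borel_measurable ?I"
      by (rule borel_measurable_integrable[OF integrable_continuous_lebesgue_on(1)])
        (intro continuous_intros smooth_continuous[OF smooth_plateau])
    have m2: "(\<lambda>t. - (B (v t) \<phi> * of_real (?\<psi> t))) \<in> borel_measurable ?I"
      using borel_measurable_integrable[OF Bi] m\<psi> by measurable
    have ae2: "AE t in ?I. - (B (v t) \<phi> * of_real (?\<psi> t)) = u' t \<phi> * of_real (?\<psi> t)"
      using eqn
    proof eventually_elim
      case (elim t)
      then have "u' t \<phi> = - B (v t) \<phi>" using \<phi> by (simp add: eq_neg_iff_add_eq_0)
      then show ?case by simp
    qed
    have "(\<integral>t. cinner_L2 (w t) \<phi> * of_real (deriv ?\<psi> t) \<partial>?I) = (\<integral>t. cinner_L2 (v t) \<phi> * of_real (deriv ?\<psi> t) \<partial>?I)"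
      by (rule integral_cong_AE[OF m1 borel_measurable_AE_lebesgue_on[OF m1 S ae1] ae1])
    also have "\<dots> = - (\<integral>t. u' t \<phi> * of_real (?\<psi> t) \<partial>?I)"
      using wtd test \<phi> unfolding is_weak_time_derivative_def by blast
    also have "(\<integral>t. u' t \<phi> * of_real (?\<psi> t) \<partial>?I) = (\<integral>t. - (B (v t) \<phi> * of_real (?\<psi> t)) \<partial>?I)"
      by (rule integral_cong_AE[OF m2 borel_measurable_AE_lebesgue_on[OF m2 S ae2] ae2, symmetric])
    finally have 1: "(\<integral>t. cinner_L2 (w t) \<phi> * of_real (deriv ?\<psi> t) \<partial>?I) = (\<integral>t. B (v t) \<phi> * of_real (?\<psi> t) \<partial>?I)"
      by simp
    have "(\<integral>t. cinner_L2 (w t) \<phi> * of_real (deriv ?\<psi> t) \<partial>?I) = (\<integral>t. indicator {0..T} t *\<^sub>R (cinner_L2 (w t) \<phi> * of_real (deriv ?\<psi> t)) \<partial>lborel)"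
      by (rule integrable_continuous_lebesgue_on(2)[OF c1])
    also have "\<dots> = (\<integral>t. G t * of_real (\<delta> p k t) - G t * of_real (\<delta> q k t) \<partial>lborel)"
    proof (intro Bochner_Integration.integral_cong refl)
      fix t
      show "indicator {0..T} t *\<^sub>R (cinner_L2 (w t) \<phi> * of_real (deriv ?\<psi> t)) = G t * of_real (\<delta> p k t) - G t * of_real (\<delta> q k t)"
      proof (cases "t \<in> {0..T}")
        case True
        then show ?thesis by (simp add: G_def deriv right_diff_distrib)
      next
        case False
        \<comment> \<open>Outside [0, T] the peaks vanish, so the clamped extension contributes
          nothing; this needs the right end r + 1/(k + 1) of the peak to lie before T.\<close>
        have "\<delta> r k t = 0" if "0 < r" "r + 1 / real (Suc k) < T" for r
        proof -
          define n where "n = real (Suc k)"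
          have n: "n > 0" by (simp add: n_def)
          have "n * (t - r) < 0 \<or> 1 < n * (t - r)"
          proof (cases "t < 0")
            case True then show ?thesis using that n by (simp add: mult_pos_neg)
          next
            case F: False
            then have "1 / n < t - r" using False that unfolding n_def by auto
            then show ?thesis using n by (simp add: field_simps)
          qed
          then have "d (n * (t - r)) = 0" by (intro d(3)) auto
          then show ?thesis by (simp add: \<delta>_def n_def)
        qed
        from this[of p] this[of q] show ?thesis using False pq k by simp
      qed
    qed
    also have "\<dots> = (\<integral>t. G t * of_real (\<delta> p k t) \<partial>lborel) - (\<integral>t. G t * of_real (\<delta> q k t) \<partial>lborel)"
      by (rule Bochner_Integration.integral_diff[OF \<delta>i \<delta>i])
    finally show ?thesis using 1 by simp
  qed
  have "(\<lambda>k. (\<integral>t. G t * of_real (\<delta> p k t) \<partial>lborel) - (\<integral>t. G t * of_real (\<delta> q k t) \<partial>lborel)) \<longlonglongrightarrow> G p - G q"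
    unfolding \<delta>_def by (intro tendsto_diff tendsto_approximate_identity[OF cG K d(4)])
  moreover have "\<forall>\<^sub>F k in sequentially. (\<integral>t. G t * of_real (\<delta> p k t) \<partial>lborel) - (\<integral>t. G t * of_real (\<delta> q k t) \<partial>lborel)
      = (\<integral>t. B (v t) \<phi> * of_real (plateau p q k t) \<partial>?I)"
  proof -
    have "(\<lambda>k. 1 / real (Suc k)) \<longlonglongrightarrow> 0"
      using LIMSEQ_inverse_real_of_nat by (simp add: inverse_eq_divide)
    then have "\<forall>\<^sub>F k in sequentially. 1 / real (Suc k) < T - q"
      by (rule order_tendstoD) (use pq in simp)
    then show ?thesis by eventually_elim (use parts in force)
  qed
  ultimately have l1: "(\<lambda>k. \<integral>t. B (v t) \<phi> * of_real (plateau p q k t) \<partial>?I) \<longlonglongrightarrow> G p - G q"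
    by (rule Lim_transform_eventually)
  have l2: "(\<lambda>k. \<integral>t. B (v t) \<phi> * of_real (plateau p q k t) \<partial>?I) \<longlonglongrightarrow> (\<integral>t. B (v t) \<phi> * of_real (indicator {p<..q} t) \<partial>?I)"
  proof (rule integral_dominated_convergence[where w = "\<lambda>t. cmod (B (v t) \<phi>)"])
    have ind: "(\<lambda>t. complex_of_real (indicator {p<..q} t)) \<in> borel_measurable ?I"
    proof (rule measurable_restrict_space1)
      show "(\<lambda>t. complex_of_real (indicator {p<..q} t)) \<in> borel_measurable lebesgue"
        by (rule lebesgue_measurable_of_borel) measurable
    qed
    show "(\<lambda>t. B (v t) \<phi> * of_real (indicator {p<..q} t)) \<in> borel_measurable ?I"
      by (intro borel_measurable_times borel_measurable_integrable[OF Bi] ind)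
    show "(\<lambda>t. B (v t) \<phi> * of_real (plateau p q k t)) \<in> borel_measurable ?I" for k
      by (intro borel_measurable_times borel_measurable_integrable[OF Bi]
          borel_measurable_integrable[OF integrable_continuous_lebesgue_on(1)])
        (intro continuous_intros smooth_continuous[OF smooth_plateau])
    show "AE t in ?I. (\<lambda>k. B (v t) \<phi> * of_real (plateau p q k t)) \<longlonglongrightarrow> B (v t) \<phi> * of_real (indicator {p<..q} t)"
      by (intro AE_I2 tendsto_intros tendsto_plateau pq)
    show "AE t in ?I. norm (B (v t) \<phi> * of_real (plateau p q k t)) \<le> cmod (B (v t) \<phi>)" for k
      using plateau_bounds[OF pq(2)] by (auto simp: norm_mult intro!: mult_left_le)
  qed (use Bi in auto)
  have "G p - G q = (\<integral>t. B (v t) \<phi> * of_real (indicator {p<..q} t) \<partial>?I)"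
    by (rule LIMSEQ_unique[OF l1 l2])
  moreover have "G p = cinner_L2 (w p) \<phi>" "G q = cinner_L2 (w q) \<phi>" using pq by (simp_all add: G_def)
  ultimately show ?thesis by (simp add: of_real_indicator)
qed

text \<open>Test functions vanish near time 0, so the initial value is reached only in the limit p
  \<rightarrow> 0, by continuity of w on one side and integrability of B(v, \<phi>) on the
  other.\<close>

lemma weak_solution_integrated:
  assumes v: "v \<in> bochner_L2 T H1 H1_norm" and w: "continuous_on {0..T} w"
    and vw: "AE t in lebesgue_on {0<..<T}. w t = v t"
    and wtd: "is_weak_time_derivative T v u'"
    and eqn: "AE t in lebesgue_on {0<..<T}. \<forall>\<phi>\<in>H1. u' t \<phi> + B (v t) \<phi> = 0"
    and \<phi>: "\<phi> \<in> H1" and q: "0 < q" "q < T"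
  shows "cinner_L2 (w 0) \<phi> - cinner_L2 (w q) \<phi> = (\<integral>t. B (v t) \<phi> * indicator {0<..q} t \<partial>lebesgue_on {0<..<T})"
proof -
  let ?I = "lebesgue_on {0<..<T}"
  have Bi: "integrable ?I (\<lambda>t. B (v t) \<phi>)" by (rule B_integrable[OF v \<phi>])
  define p where "p k = q * (1 / real (Suc k))" for k
  have p: "0 < p k" "p k \<le> q" for k
  proof -
    show "0 < p k" using q by (simp add: p_def)
    have "q * (1 / real (Suc k)) \<le> q * 1" using q by (intro mult_left_mono) auto
    then show "p k \<le> q" by (simp add: p_def)
  qed
  have "(\<lambda>k. q * (1 / real (Suc k))) \<longlonglongrightarrow> q * 0"
    using LIMSEQ_inverse_real_of_nat by (intro tendsto_intros) (simp add: inverse_eq_divide)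
  then have p0: "p \<longlonglongrightarrow> 0" by (simp add: p_def[abs_def])
  have "(\<lambda>k. w (p k)) \<longlonglongrightarrow> w 0"
    by (rule continuous_on_tendsto_compose[OF w p0]) (use p q in \<open>auto intro!: always_eventually less_imp_le[OF p(1)] order_trans[OF p(2)]\<close>)
  then have l1: "(\<lambda>k. cinner_L2 (w (p k)) \<phi> - cinner_L2 (w q) \<phi>) \<longlonglongrightarrow> cinner_L2 (w 0) \<phi> - cinner_L2 (w q) \<phi>"
    by (intro tendsto_intros tendsto_cinner_L2)
  have ind: "(indicator {r<..q} :: real \<Rightarrow> complex) \<in> borel_measurable ?I" for r
    by (intro measurable_restrict_space1 lebesgue_measurable_of_borel) measurable
  have "(\<lambda>k. \<integral>t. B (v t) \<phi> * indicator {p k<..q} t \<partial>?I) \<longlonglongrightarrow> (\<integral>t. B (v t) \<phi> * indicator {0<..q} t \<partial>?I)"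
  proof (rule integral_dominated_convergence[where w = "\<lambda>t. cmod (B (v t) \<phi>)"])
    show "(\<lambda>t. B (v t) \<phi> * indicator {0<..q} t) \<in> borel_measurable ?I"
      "(\<lambda>t. B (v t) \<phi> * indicator {p k<..q} t) \<in> borel_measurable ?I" for k
      by (intro borel_measurable_times borel_measurable_integrable[OF Bi] ind)+
    show "AE t in ?I. (\<lambda>k. B (v t) \<phi> * indicator {p k<..q} t) \<longlonglongrightarrow> B (v t) \<phi> * indicator {0<..q} t"
    proof (intro AE_I2 tendsto_mult tendsto_const)
      fix t assume "t \<in> space ?I"
      then have "0 < t" by simp
      then have "\<forall>\<^sub>F k in sequentially. p k < t" using p0 by (rule order_tendstoD[rotated])
      then have "\<forall>\<^sub>F k in sequentially. indicator {0<..q} t = (indicator {p k<..q} t :: complex)"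
        by eventually_elim (use \<open>0 < t\<close> in \<open>auto split: split_indicator\<close>)
      then show "(\<lambda>k. indicator {p k<..q} t :: complex) \<longlonglongrightarrow> indicator {0<..q} t"
        by (rule Lim_transform_eventually[OF tendsto_const])
    qed
    show "AE t in ?I. norm (B (v t) \<phi> * indicator {p k<..q} t) \<le> cmod (B (v t) \<phi>)" for k
      by (auto simp: norm_mult split: split_indicator)
  qed (use Bi in auto)
  then have l2: "(\<lambda>k. cinner_L2 (w (p k)) \<phi> - cinner_L2 (w q) \<phi>) \<longlonglongrightarrow> (\<integral>t. B (v t) \<phi> * indicator {0<..q} t \<partial>?I)"
    using weak_solution_increment[OF v w vw wtd eqn \<phi> p q(2)] by simp
  show ?thesis by (rule LIMSEQ_unique[OF l1 l2])
qed

end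

section \<open>Uniqueness\<close>

lemma integral_continuous_halfopen:
  fixes g :: "real \<Rightarrow> real"
  assumes g: "continuous_on {0..T} g" and q: "0 < q" "q < T"
  shows "(\<integral>t. g t * indicator {0<..q} t \<partial>lebesgue_on {0<..<T}) = integral {0..q} g"
proof -
  have "continuous_on {0..q} g" using g q by (auto intro: continuous_on_subset)
  then have "set_integrable lborel {0..q} g" by (rule borel_integrable_atLeastAtMost')
  then have i: "integrable lborel (\<lambda>t. indicator {0..q} t *\<^sub>R g t)" by (simp add: set_integrable_def)
  then have il: "integrable lebesgue (\<lambda>t. indicator {0..q} t *\<^sub>R g t)"
    by (subst integrable_completion) auto
  have ae: "AE t in lebesgue. indicator {0..q} t *\<^sub>R g t = indicator {0<..<T} t *\<^sub>R (g t * indicator {0<..q} t)"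
    using AE_completion[OF AE_lborel_singleton[of 0]] by eventually_elim (use q in \<open>auto split: split_indicator\<close>)
  have m: "(\<lambda>t. indicator {0<..<T} t *\<^sub>R (g t * indicator {0<..q} t)) \<in> borel_measurable lebesgue"
  proof -
    have "(\<lambda>t. indicator {0<..q} t *\<^sub>R (indicator {0..q} t *\<^sub>R g t)) \<in> borel_measurable lebesgue"
      by (intro borel_measurable_scaleR borel_measurable_indicator borel_measurable_integrable[OF il]) simp
    moreover have "(\<lambda>t. indicator {0<..q} t *\<^sub>R (indicator {0..q} t *\<^sub>R g t))
        = (\<lambda>t. indicator {0<..<T} t *\<^sub>R (g t * indicator {0<..q} t))"
      using q by (auto simp: fun_eq_iff split: split_indicator)
    ultimately show ?thesis by (simp only:)
  qed
  have "(\<integral>t. g t * indicator {0<..q} t \<partial>lebesgue_on {0<..<T}) = (\<integral>t. indicator {0<..<T} t *\<^sub>R (g t * indicator {0<..q} t) \<partial>lebesgue)"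
    by (rule integral_restrict_space) simp
  also have "\<dots> = (\<integral>t. indicator {0..q} t *\<^sub>R g t \<partial>lebesgue)"
    by (rule integral_cong_AE[OF m borel_measurable_integrable[OF il]]) (use ae in \<open>auto elim: eventually_mono\<close>)
  also have "\<dots> = (\<integral>t. indicator {0..q} t *\<^sub>R g t \<partial>lborel)"
    by (rule integral_completion) (use borel_measurable_integrable[OF i] in simp)
  also have "\<dots> = integral {0..q} g"
    using set_borel_integral_eq_integral(2)[OF \<open>set_integrable lborel {0..q} g\<close>] by (simp add: set_lebesgue_integral_def)
  finally show ?thesis .
qed

context parabolic_form
begin

text \<open>Solvability of the elliptic problem with right-hand side \<eta> in L2, from bijectivity
  of \<open>A\<close>. In the uniqueness proof it produces elements of H1 where only an integral in
  L2 is at hand.\<close>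

lemma riesz_A: "\<exists>z. \<forall>y. inner (A z) y = inner \<eta> (fun_of y)"
proof -
  obtain r where r: "\<And>y. inner \<eta> (fun_of y) = inner r y"
    using riesz_representation[OF bounded_linear_compose[OF bounded_linear_inner_right bounded_linear_fun_of], of \<eta>] by blast
  interpret E: symmetric_evolution M A "min a0 c0" by (rule evolution)
  have "bij A" using coercive_bij[OF A(1) E.\<alpha>_pos E.A_coercive] .
  then have "A (inv A r) = r" by (simp add: bij_is_surj surj_f_inv_f)
  then show ?thesis using r by metis
qed

text \<open>The difference \<open>D\<close> of two solutions is integrated in time: \<open>Y(t) = \<integral>\<^sub>0\<^sup>t D\<close> lies in \<open>H\<^sup>1\<close> and
  is a \<open>C\<^sup>1\<close> solution with zero initial value, so it may be tested with itself.\<close>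

theorem weak_solution_unique:
  assumes T: "0 < T" and 1: "weak_solution a b c s T u0 v1" and 2: "weak_solution a b c s T u0 v2"
  shows "AE t in lebesgue_on {0<..<T}. v1 t = v2 t"
proof -
  let ?I = "lebesgue_on {0<..<T}"
  obtain w1 u1 where v1: "v1 \<in> bochner_L2 T H1 H1_norm" and w1: "continuous_on {0..T} w1"
    "AE t in ?I. w1 t = v1 t" "w1 0 = u0" and u1: "is_weak_time_derivative T v1 u1"
    "AE t in ?I. \<forall>\<phi>\<in>H1. u1 t \<phi> + B (v1 t) \<phi> = 0"
    using 1 unfolding weak_solution_def by blast
  obtain w2 u2 where v2: "v2 \<in> bochner_L2 T H1 H1_norm" and w2: "continuous_on {0..T} w2"
    "AE t in ?I. w2 t = v2 t" "w2 0 = u0" and u2: "is_weak_time_derivative T v2 u2"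
    "AE t in ?I. \<forall>\<phi>\<in>H1. u2 t \<phi> + B (v2 t) \<phi> = 0"
    using 2 unfolding weak_solution_def by blast
  have H: "AE t in ?I. v1 t \<in> H1" "AE t in ?I. v2 t \<in> H1"
    using v1 v2 by (simp_all add: bochner_L2_def strongly_measurable_def)
  define D where "D t = w1 t - w2 t" for t
  have cD: "continuous_on {0..T} D" unfolding D_def by (intro continuous_intros w1 w2)
  define Y where "Y t = integral {0..t} D" for t
  have Y_deriv: "(Y has_vector_derivative D t) (at t within {0..T})" if "t \<in> {0..T}" for t
    unfolding Y_def by (rule integral_has_vector_derivative[OF cD that])
  have inc: "inner (D q) \<phi> = - (\<integral>t. Re ((B (v1 t) \<phi> - B (v2 t) \<phi>) * indicator {0<..q} t) \<partial>?I)"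
    and inc_int: "integrable ?I (\<lambda>t. (B (v1 t) \<phi> - B (v2 t) \<phi>) * indicator {0<..q} t)"
    if \<phi>: "\<phi> \<in> H1" and q: "0 < q" "q < T" for \<phi> q
  proof -
    have i: "integrable ?I (\<lambda>t. B (v t) \<phi> * indicator {0<..q} t)" if v: "v \<in> bochner_L2 T H1 H1_norm" for v
    proof (rule Bochner_Integration.integrable_bound[OF B_integrable[OF v \<phi>]])
      have "(indicator {0<..q} :: real \<Rightarrow> complex) \<in> borel_measurable ?I"
        by (intro measurable_restrict_space1 lebesgue_measurable_of_borel) measurable
      then show "(\<lambda>t. B (v t) \<phi> * indicator {0<..q} t) \<in> borel_measurable ?I"
        by (intro borel_measurable_times borel_measurable_integrable[OF B_integrable[OF v \<phi>]])
    qed (auto simp: norm_mult split: split_indicator)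
    have lin: "p1 - p2 = - k" if "p - p1 = i1" "p - p2 = i2" "k = i1 - i2" for p p1 p2 i1 i2 k :: complex
      using that by (auto simp: algebra_simps)
    have "cinner_L2 (w1 0) \<phi> - cinner_L2 (w1 q) \<phi> = (\<integral>t. B (v1 t) \<phi> * indicator {0<..q} t \<partial>?I)"
      "cinner_L2 (w2 0) \<phi> - cinner_L2 (w2 q) \<phi> = (\<integral>t. B (v2 t) \<phi> * indicator {0<..q} t \<partial>?I)"
      by (rule weak_solution_integrated[OF v1 w1(1,2) u1 \<phi> q] weak_solution_integrated[OF v2 w2(1,2) u2 \<phi> q])+
    moreover show int: "integrable ?I (\<lambda>t. (B (v1 t) \<phi> - B (v2 t) \<phi>) * indicator {0<..q} t)"
      using Bochner_Integration.integrable_diff[OF i[OF v1] i[OF v2]] by (simp add: left_diff_distrib)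
    moreover have "(\<integral>t. (B (v1 t) \<phi> - B (v2 t) \<phi>) * indicator {0<..q} t \<partial>?I)
        = (\<integral>t. B (v1 t) \<phi> * indicator {0<..q} t \<partial>?I) - (\<integral>t. B (v2 t) \<phi> * indicator {0<..q} t \<partial>?I)"
      unfolding left_diff_distrib by (rule Bochner_Integration.integral_diff[OF i[OF v1] i[OF v2]])
    ultimately have "cinner_L2 (D q) \<phi> = - (\<integral>t. (B (v1 t) \<phi> - B (v2 t) \<phi>) * indicator {0<..q} t \<partial>?I)"
      unfolding D_def cinner_L2_diff_left w1(3) w2(3) using lin by metis
    then have "Re (cinner_L2 (D q) \<phi>) = - Re (\<integral>t. (B (v1 t) \<phi> - B (v2 t) \<phi>) * indicator {0<..q} t \<partial>?I)" by simp
    then show "inner (D q) \<phi> = - (\<integral>t. Re ((B (v1 t) \<phi> - B (v2 t) \<phi>) * indicator {0<..q} t) \<partial>?I)"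
      by (simp only: Re_cinner_L2 integral_Re[OF int])
  qed
  \<comment> \<open>\<open>Y q\<close> is defined as an integral in L2, and its membership in H1 has
    to be earned: it is identified with the solution of the elliptic problem with right-hand side -
    \<open>D q\<close>.\<close>
  have key: "\<exists>z. fun_of z = Y q \<and> inner (D q) (Y q) = - inner (A z) z" if q: "0 < q" "q < T" for q
  proof -
    obtain z' where z': "\<And>y. inner (A z') y = inner (- D q) (fun_of y)" using riesz_A[of "- D q"] by blast
    have "inner \<eta> (fun_of z') = inner \<eta> (Y q)" for \<eta>
    proof -
      \<comment> \<open>Duality: with \<open>k\<close> solving the elliptic problem for \<eta>, the
        pairing of \<eta> with z' is - (D q, k) by symmetry. The integrated equation turns this into
        the time integral of B(v1, k) - B(v2, k), and so of (\<eta>, D), which is (\<eta>, Y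
        q).\<close>
      obtain k where k: "\<And>y. inner (A k) y = inner \<eta> (fun_of y)" using riesz_A[of \<eta>] by blast
      interpret E: symmetric_evolution M A "min a0 c0" by (rule evolution)
      have "inner \<eta> (fun_of z') = inner (A z') k"
        by (metis k E.A_sym inner_commute)
      also have "\<dots> = - inner (D q) (fun_of k)" using z' by simp
      also have "\<dots> = (\<integral>t. Re ((B (v1 t) (fun_of k) - B (v2 t) (fun_of k)) * indicator {0<..q} t) \<partial>?I)"
        using inc[OF fun_of_H1 q, of k] by simp
      also have "\<dots> = (\<integral>t. inner \<eta> (D t) * indicator {0<..q} t \<partial>?I)"
      proof -
        have ae: "AE t in ?I. Re ((B (v1 t) (fun_of k) - B (v2 t) (fun_of k)) * indicator {0<..q} t) = inner \<eta> (D t) * indicator {0<..q} t"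
          using H w1(2) w2(2)
        proof eventually_elim
          case (elim t)
          have r: "Re (B v (fun_of k)) = inner \<eta> v" if "v \<in> H1" for v
            using k[of "sobolev_of v"] A(2)[of "sobolev_of v" k] E.A_sym[of "sobolev_of v" k] that
            by (simp add: inner_commute[of k "A (sobolev_of v)"] inner_commute[of "A k" "sobolev_of v"])
          have "Re ((B (v1 t) (fun_of k) - B (v2 t) (fun_of k)) * indicator {0<..q} t) = (inner \<eta> (v1 t) - inner \<eta> (v2 t)) * indicator {0<..q} t"
            using r[OF elim(1)] r[OF elim(2)] by (auto split: split_indicator)
          then show ?case using elim by (simp add: D_def inner_diff_right)
        qed
        have m: "(\<lambda>t. Re ((B (v1 t) (fun_of k) - B (v2 t) (fun_of k)) * indicator {0<..q} t)) \<in> borel_measurable ?I"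
          by (rule borel_measurable_integrable[OF integrable_Re[OF inc_int[OF fun_of_H1 q]]])
        show ?thesis
          by (rule integral_cong_AE[OF m borel_measurable_AE_lebesgue_on[OF m _ ae] ae]) simp
      qed
      also have "\<dots> = integral {0..q} (\<lambda>t. inner \<eta> (D t))"
        by (intro integral_continuous_halfopen q continuous_intros cD)
      also have "\<dots> = inner \<eta> (Y q)"
      proof -
        have "D integrable_on {0..q}"
          using cD q by (intro integrable_continuous_real) (auto intro: continuous_on_subset)
        from integral_linear[OF this bounded_linear_inner_right[of \<eta>]] show ?thesis by (simp add: Y_def comp_def)
      qed
      finally show ?thesis .
    qed
    then have "fun_of z' = Y q" by (metis inner_commute inner_left_eqI)
    moreover have "inner (D q) (fun_of z') = - inner (A z') z'" using z' by simp
    ultimately show ?thesis by metis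
  qed
  have Y0: "Y q = 0" if q: "0 < q" "q < T" for q
  proof -
    have cont: "continuous_on {0..q} (\<lambda>t. inner (Y t) (Y t))"
    proof -
      have "continuous_on {0..T} Y"
        using Y_deriv has_vector_derivative_continuous continuous_on_eq_continuous_within by blast
      then show ?thesis using q by (intro continuous_intros) (auto intro: continuous_on_subset)
    qed
    \<comment> \<open>The derivative of the squared norm is 2 (D, Y), which \<open>key\<close>
      identifies as - 2 times an energy; so the norm cannot grow from its initial value 0.\<close>
    have "inner (Y q) (Y q) \<le> inner (Y 0) (Y 0)"
    proof (rule DERIV_nonpos_imp_decreasing_open[OF _ _ cont])
      fix t assume t: "0 < t" "t < q"
      have "(Y has_vector_derivative D t) (at t)"
        using Y_deriv[of t] t q by (simp add: at_within_Icc_at)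
      from bounded_bilinear.has_vector_derivative[OF bounded_bilinear_inner this this]
      have "((\<lambda>t. inner (Y t) (Y t)) has_real_derivative 2 * inner (D t) (Y t)) (at t)"
        by (simp add: has_real_derivative_iff_has_vector_derivative inner_commute)
      moreover have "inner (D t) (Y t) \<le> 0"
      proof -
        interpret E: symmetric_evolution M A "min a0 c0" by (rule evolution)
        obtain z where "inner (D t) (Y t) = - inner (A z) z" using key[of t] t q by auto
        then show ?thesis using E.e_nonneg[of z] by (simp add: E.e_def)
      qed
      ultimately show "\<exists>y. ((\<lambda>t. inner (Y t) (Y t)) has_real_derivative y) (at t) \<and> y \<le> 0"
        by (intro exI[of _ "2 * inner (D t) (Y t)"]) simp
    qed (use q in simp)
    moreover have "Y 0 = 0" by (simp add: Y_def)
    ultimately show ?thesis by (metis inner_eq_zero_iff inner_ge_zero order_antisym inner_zero_left)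
  qed
  \<comment> \<open>\<open>D\<close> is the derivative of a function that vanishes on (0,
    T).\<close>
  have "D t = 0" if t: "0 < t" "t < T" for t
  proof -
    have "(Y has_vector_derivative D t) (at t)"
      using Y_deriv[of t] t by (simp add: at_within_Icc_at)
    then have "((\<lambda>_. 0) has_vector_derivative D t) (at t)"
      by (rule has_vector_derivative_transform_within_open[of _ _ _ "{0<..<T}"]) (use t Y0 in auto)
    then show ?thesis using vector_derivative_unique_at[OF _ has_vector_derivative_const] by blast
  qed
  then have "AE t in ?I. w1 t = w2 t" by (intro AE_I2) (simp add: D_def)
  then show ?thesis using w1(2) w2(2) by eventually_elim simp
qed

end

section \<open>Well-posedness and the estimate with its explicit constant\<close>

theorem lemma3p1:
  fixes a b c :: "real^'n \<Rightarrow> real" and a0 b0 c0 s T :: real and u0 :: "'n::finite L2"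
  assumes "T > 0" and "0 < s" and "s < 1"
    and "a \<in> Linfty" and "b \<in> Linfty" and "c \<in> Linfty"
    and "a0 > 0" and "AE x in lebesgue. a x \<ge> a0"
    and "b0 > 0" and "AE x in lebesgue. b x \<ge> b0"
    and "c0 > 0" and "AE x in lebesgue. c x \<ge> c0"
    and "u0 \<in> H1"
  defines "C \<equiv> 2 * (1 + 1 / a0 + 1 / b0) * (1 + Linfty_norm a + Linfty_norm b + Linfty_norm c)"
  shows "\<exists>u. weak_solution a b c s T u0 u \<and>
    (\<forall>v. weak_solution a b c s T u0 v \<longrightarrow> (AE t in lebesgue_on {0<..<T}. v t = u t)) \<and>
    u \<in> bochner_Linfty T H1 H1_norm \<and>
    continuous_on {0..T} u \<and>
    (\<exists>u' \<in> bochner_L2 T H1_dual H1_dual_norm. is_weak_time_derivative T u u') \<and>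
    (AE t in lebesgue_on {0..T}.
       (norm (u t))\<^sup>2 + (norm (weak_gradient (u t)))\<^sup>2 + (norm (frac_laplacian (s / 2) (u t)))\<^sup>2
         \<le> C * (H1_norm u0)\<^sup>2)"
proof -
  interpret parabolic_form a b c a0 b0 c0 s
    by unfold_locales (use assms in auto)
  obtain U where U: "weak_solution a b c s T u0 (\<lambda>t. fun_of (U t))"
    "\<exists>u'\<in>bochner_L2 T H1_dual H1_dual_norm. is_weak_time_derivative T (\<lambda>t. fun_of (U t)) u'"
    "(\<lambda>t. fun_of (U t)) \<in> bochner_Linfty T H1 H1_norm" "continuous_on {0..T} (\<lambda>t. fun_of (U t))"
    and energy: "\<And>t. t \<in> {0..T} \<Longrightarrow> inner (A (U t)) (U t) \<le> inner (A (sobolev_of u0)) (sobolev_of u0)"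
    and mass: "\<And>t. t \<in> {0..T} \<Longrightarrow> norm (fun_of (U t)) \<le> norm u0"
    using weak_solution_exists[OF assms(1,13)] by blast
  define S where "S = Linfty_norm a + Linfty_norm b + Linfty_norm c"
  have S: "0 \<le> S" unfolding S_def using Linfty_norm_nonneg assms(4,5,6) by (intro add_nonneg_nonneg) auto
  define H where "H = (H1_norm u0)\<^sup>2"
  have H: "0 \<le> H" "(norm u0)\<^sup>2 \<le> H" by (simp_all add: H_def H1_norm_def)
  have bound: "(norm (fun_of (U t)))\<^sup>2 + (norm (weak_gradient (fun_of (U t))))\<^sup>2
      + (norm (frac_laplacian (s / 2) (fun_of (U t))))\<^sup>2 \<le> C * (H1_norm u0)\<^sup>2" if t: "t \<in> {0..T}" for t
  proof -
    let ?v = "fun_of (U t)"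
    have "inner (A (sobolev_of u0)) (sobolev_of u0) \<le> S * H"
      using A_upper[of "sobolev_of u0"] assms(13) by (simp add: S_def H_def flip: H1_norm_fun_of)
    then have E: "a0 * (norm (weak_gradient ?v))\<^sup>2 + b0 * (norm (frac_laplacian (s / 2) ?v))\<^sup>2 + c0 * (norm ?v)\<^sup>2 \<le> S * H"
      using A_lower[of "U t"] energy[OF t] by linarith
    have nn: "0 \<le> a0 * (norm (weak_gradient ?v))\<^sup>2" "0 \<le> b0 * (norm (frac_laplacian (s / 2) ?v))\<^sup>2" "0 \<le> c0 * (norm ?v)\<^sup>2"
      using assms(7,9,11) by auto
    have "(norm (weak_gradient ?v))\<^sup>2 \<le> (1 / a0) * (S * H)"
      using E nn assms(7) by (simp add: field_simps)
    moreover have "(norm (frac_laplacian (s / 2) ?v))\<^sup>2 \<le> (1 / b0) * (S * H)"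
      using E nn assms(9) by (simp add: field_simps)
    \<comment> \<open>The L2 norm is bounded by its own decay and not by the c0 term of the energy,
      so no 1/c0 enters \<open>C\<close>.\<close>
    moreover have "(norm ?v)\<^sup>2 \<le> H"
      by (rule order_trans[OF power_mono[OF mass[OF t] norm_ge_zero] H(2)])
    ultimately have "(norm ?v)\<^sup>2 + (norm (weak_gradient ?v))\<^sup>2 + (norm (frac_laplacian (s / 2) ?v))\<^sup>2
        \<le> H + (1 / a0) * (S * H) + (1 / b0) * (S * H)" by linarith
    \<comment> \<open>Expanded, the right-hand side contains each summand of the left with
      coefficient 2 and otherwise only nonnegative terms.\<close>
    also have "\<dots> \<le> 2 * (1 + 1 / a0 + 1 / b0) * (1 + S) * H"
    proof -
      have p: "0 \<le> S * H" "0 \<le> (1 / a0) * (S * H)" "0 \<le> (1 / b0) * (S * H)" "0 \<le> (1 / a0) * H" "0 \<le> (1 / b0) * H"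
        using S H(1) assms(7,9) by simp_all
      have "2 * (1 + x + y) * (1 + S) * H = 2 * H + 2 * (S * H) + 2 * (x * H) + 2 * (x * (S * H)) + 2 * (y * H) + 2 * (y * (S * H))"
        for x y by (simp add: algebra_simps)
      from this[of "1 / a0" "1 / b0"] show ?thesis using p H(1) by linarith
    qed
    also have "\<dots> = C * (H1_norm u0)\<^sup>2" by (simp add: C_def S_def H_def add.assoc)
    finally show ?thesis .
  qed
  show ?thesis
  proof (intro exI[of _ "\<lambda>t. fun_of (U t)"] conjI allI impI U)
    fix v assume "weak_solution a b c s T u0 v"
    then show "AE t in lebesgue_on {0<..<T}. v t = fun_of (U t)"
      by (rule weak_solution_unique[OF assms(1) _ U(1)])
  next
    show "AE t in lebesgue_on {0..T}. (norm (fun_of (U t)))\<^sup>2 + (norm (weak_gradient (fun_of (U t))))\<^sup>2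
        + (norm (frac_laplacian (s / 2) (fun_of (U t))))\<^sup>2 \<le> C * (H1_norm u0)\<^sup>2"
      using bound by (intro AE_I2) simp
  qed
qed

end
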